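(* Let $M=\mathbb{R}^n/\mathbb{Z}^n$, let $\kappa,\nu,\varepsilon\ge 0$ be constants, let $\mathcal{U}$ be a given smooth real function of density, and let $(\mu_t,\rho_t)$ be a pair consisting of a stochastic time-dependent vector field $\mu$ on $M$ and a stochastic time-dependent function $\rho$ on $M$. Write $\bar\mu=E[\mu]$, $\bar\rho=E[\rho]$ and $u=\bar\mu/\bar\rho$. Suppose that $(\mu,\rho)$ satisfies the mean field (McKean–Vlasov) Stratonovich system $$ \begin{aligned} \delta_t\mu &= \Big(-\nabla_{u+\nu\nabla\log\bar\rho}\,\mu-\operatorname{div}(u+\nu\nabla\log\bar\rho)\,\mu-(\nabla^{\top}u)\mu-\nu(\nabla^{\top}\nabla\log\bar\rho)\mu\\ &\qquad+\rho(\nabla^{\top}u)u-\rho\bar\rho^{-1}\nabla\big(\bar\rho^2\,\mathcal{U}'(\bar\rho)\big)+\kappa\rho\nabla\Delta\bar\rho\\ &\qquad-\nu\rho\bar\rho^{-2}\operatorname{div}(\bar\mu)\nabla\bar\rho+\nu\rho\bar\rho^{-1}\nabla\operatorname{div}(\bar\mu)\Big)\,\delta_t t\;-\;\varepsilon\sum_r \operatorname{ad}(\xi_r)^{\top}\mu\;\delta_t W^r,\\ \delta_t\rho &= -\operatorname{div}\big(\rho u+\nu\rho\nabla\log\bar\rho\big)\,\delta_t t\;-\;\varepsilon\sum_r\operatorname{div}(\rho\,\xi_r)\;\delta_t W^r, \end{aligned} $$ where $(W^r)_r$ are independent real Brownian motions. Assume that $\xi_r=\zeta_r$, where $(\zeta_r)_r$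 is the system of divergence-free vector fields defined in the context, and that $c^s\varepsilon^2/2=\nu$, where $c^s=1+\frac{n-1}{n}\sum_{k\in\mathbb{Z}_n^+}|k|^{-2s}$. Then the (deterministic) fields $u=\bar\mu/\bar\rho$ and $\bar\rho$ satisfy the compressible Navier–Stokes equations $$ \begin{aligned} \dot u&=-\nabla_u u-\bar\rho^{-1}\nabla p+\bar\rho^{-1}\big(\operatorname{div}S+\operatorname{div}C\big),\\ \dot{\bar\rho}&=-\operatorname{div}(\bar\rho u), \end{aligned} $$ where $p=\bar\rho^2\,\mathcal{U}'(\bar\rho)$, the stress tensor $S$ is $S_{ij}=\nu\bar\rho\,(\partial_i u^j+\partial_j u^i)$, and the capillary tensor $C$ is $$ C=\kappa\Big(\big(\bar\rho\Delta\bar\rho+\tfrac12\langle\nabla\bar\rho,\nabla\bar\rho\rangle\big)\mathbb{I}-\nabla\bar\rho\otimes\nabla\bar\rho\Big). $$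
   Context: Vector calculus on $M=\mathbb{R}^n/\mathbb{Z}^n$: $e_1,\dots,e_n$ is the standard basis and $\langle\cdot,\cdot\rangle$ the Euclidean inner product. For vector fields $X,Y$: $\nabla_XY=\sum_{i,j}X^i(\partial_iY^j)e_j$ and $(\nabla^{\top}X)Y=\sum_{i,j}(\partial_iX^j)Y^je_i$. The Lie derivative is $L_XY=\nabla_XY-\nabla_YX$, $\operatorname{ad}(X)Y=-L_XY$, and $\top$ denotes the adjoint with respect to the $L^2$ inner product $\int_M\langle X,Y\rangle\,dx$; explicitly $$\operatorname{ad}(X)^{\top}Y=-L_X^{\top}Y=\nabla_XY+\operatorname{div}(X)Y+(\nabla^{\top}X)Y.$$ For a tensor $T=(T_{ij})$, $\operatorname{div}T=\sum_{i,j}\partial_iT_{ij}\,e_j$. $\Delta$ is the (componentwise) Laplacian, and $\mathbb{I}$ is the identity matrix. A dot denotes the time derivative. Stochastic notation: all processes live on a filtered probability space satisfying the usual conditions and are adapted; $\delta_t$ denotes the Stratonovich differential in time, and $\delta_t t$ is ordinary $dt$. The $\xi_r$ are fixed (deterministic, time-independent) divergence-free vector fields on $M$. $E$ denotes expectation; $\bar\mu$, $\bar\rho$ and $u$ are deterministic time-dependent fields. The vector fields $\zeta_r$: fix a Sobolev index $s>1+n/2$. Let $\mathbb{Z}_n^+$ be the set of $k\in\mathbb{Z}^n$ such that $k_1>0$ or, for some $i\in\{2,\dots,n\}$, $k_1=\dots=k_{i-1}=0$ and $k_i>0$. For each $k\in\mathbb{Z}_n^+$ choose pairwise orthogonal vectors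 $k_1^{\bot},\dots,k_{n-1}^{\bot}\in\mathbb{R}^n$ with $|k_i^{\bot}|=|k|$ and $\langle k_i^{\bot},k\rangle=0$. Define $$A_{(k,i)}=\frac{1}{|k|^{s+1}}\cos(2\pi\langle k,x\rangle)\,k_i^{\bot},\qquad B_{(k,i)}=\frac{1}{|k|^{s+1}}\sin(2\pi\langle k,x\rangle)\,k_i^{\bot},\qquad A_{(0,j)}=e_j,$$ for $k\in\mathbb{Z}_n^+$, $i=1,\dots,n-1$, $j=1,\dots,n$. The family $(\zeta_r)_r$ consists of all the $A_{(0,j)}$, $A_{(k,i)}$ and $B_{(k,i)}$, with $r$ a multi-index running over this (countable) collection; sums over $r$ are over all these multi-indices. Conventions on solutions: $\bar\rho>0$; $\mu,\rho$ are assumed regular enough in space, and integrable enough in probability, that every term of the equations makes sense, that expectation commutes with the spatial derivatives and with the sums over $r$ appearing, and that the Itô integrals obtained by converting the Stratonovich system to Itô form have zero expectation. *)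

theory Defs
  imports "HOL-Probability.Probability"
begin

section \<open>Vector calculus on the flat torus\<close>

text \<open>Functions on the torus are functions on Euclidean space that are invariant under integer
  translations. The index type need not be numeric; its linear order is used only to
  define the half-lattice \<open>half_lattice\<close> below.\<close>

definition int_vec :: "int ^ 'n \<Rightarrow> real ^ 'n" where
  "int_vec k = (\<chi> i. real_of_int (k $ i))"

definition torus_fun :: "(real ^ 'n \<Rightarrow> 'b) \<Rightarrow> bool" where
  "torus_fun f \<longleftrightarrow> (\<forall>x k. f (x + int_vec k) = f x)"

definition pd :: "'n \<Rightarrow> (real ^ 'n \<Rightarrow> real) \<Rightarrow> real ^ 'n \<Rightarrow> real" where
  "pd i f x = frechet_derivative f (at x) (axis i 1)"

primrec pds :: "'n list \<Rightarrow> (real ^ 'n \<Rightarrow> real) \<Rightarrow> real ^ 'n \<Rightarrow> real" where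
  "pds [] f = f"
| "pds (i # is) f = pd i (pds is f)"

definition Ck :: "nat \<Rightarrow> (real ^ 'n \<Rightarrow> real) \<Rightarrow> bool" where
  "Ck k f \<longleftrightarrow>
     (\<forall>is x. length is < k \<longrightarrow> pds is f differentiable (at x)) \<and>
     (\<forall>is. length is \<le> k \<longrightarrow> continuous_on UNIV (pds is f))"

definition grad :: "(real ^ 'n \<Rightarrow> real) \<Rightarrow> real ^ 'n \<Rightarrow> real ^ 'n" where
  "grad f x = (\<chi> i. pd i f x)"

definition lap :: "(real ^ 'n \<Rightarrow> real) \<Rightarrow> real ^ 'n \<Rightarrow> real" where
  "lap f x = (\<Sum>i\<in>UNIV. pd i (pd i f) x)"

definition dvg :: "(real ^ 'n \<Rightarrow> real ^ 'n) \<Rightarrow> real ^ 'n \<Rightarrow> real" where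
  "dvg X x = (\<Sum>i\<in>UNIV. pd i (\<lambda>y. X y $ i) x)"

definition dvg_tensor :: "(real ^ 'n \<Rightarrow> real ^ 'n ^ 'n) \<Rightarrow> real ^ 'n \<Rightarrow> real ^ 'n" where
  "dvg_tensor T x = (\<chi> j. \<Sum>i\<in>UNIV. pd i (\<lambda>y. T y $ i $ j) x)"

definition nabla :: "(real ^ 'n \<Rightarrow> real ^ 'n) \<Rightarrow> (real ^ 'n \<Rightarrow> real ^ 'n) \<Rightarrow> real ^ 'n \<Rightarrow> real ^ 'n" where
  "nabla X Y x = (\<chi> j. \<Sum>i\<in>UNIV. X x $ i * pd i (\<lambda>y. Y y $ j) x)"

definition nablaT :: "(real ^ 'n \<Rightarrow> real ^ 'n) \<Rightarrow> (real ^ 'n \<Rightarrow> real ^ 'n) \<Rightarrow> real ^ 'n \<Rightarrow> real ^ 'n" where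
  "nablaT X Y x = (\<chi> i. \<Sum>j\<in>UNIV. pd i (\<lambda>y. X y $ j) x * Y x $ j)"

text \<open>The L2-adjoint of \<open>ad(X) Y = - L\<^sub>X Y = nabla Y X - nabla X Y\<close>, in its explicit form.\<close>

definition adT :: "(real ^ 'n \<Rightarrow> real ^ 'n) \<Rightarrow> (real ^ 'n \<Rightarrow> real ^ 'n) \<Rightarrow> real ^ 'n \<Rightarrow> real ^ 'n" where
  "adT X Y x = nabla X Y x + dvg X x *\<^sub>R Y x + nablaT X Y x"


section \<open>The noise vector fields\<close>

definition half_lattice :: "(int, 'n::{finite,linorder}) vec set" where
  "half_lattice = {k. \<exists>i. (\<forall>j<i. k $ j = 0) \<and> k $ i > 0}"

datatype 'n noise_index =
  Const_mode 'n
| Cos_mode "int ^ 'n" nat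
| Sin_mode "int ^ 'n" nat

definition noise_indices :: "('n::{finite,linorder}) noise_index set" where
  "noise_indices =
     range Const_mode \<union>
     {Cos_mode k i | k i. k \<in> half_lattice \<and> 1 \<le> i \<and> i \<le> CARD('n) - 1} \<union>
     {Sin_mode k i | k i. k \<in> half_lattice \<and> 1 \<le> i \<and> i \<le> CARD('n) - 1}"

definition orthogonal_choice :: "((int, 'n::{finite,linorder}) vec \<Rightarrow> nat \<Rightarrow> (real, 'n) vec) \<Rightarrow> bool" where
  "orthogonal_choice kp \<longleftrightarrow>
     (\<forall>k\<in>half_lattice. \<forall>i\<in>{1..CARD('n) - 1}.
        norm (kp k i) = norm (int_vec k) \<and> kp k i \<bullet> int_vec k = 0 \<and>
        (\<forall>j\<in>{1..CARD('n) - 1}. j \<noteq> i \<longrightarrow> kp k i \<bullet> kp k j = 0))"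

fun zeta :: "real \<Rightarrow> (int ^ 'n \<Rightarrow> nat \<Rightarrow> real ^ 'n) \<Rightarrow> 'n noise_index \<Rightarrow> real ^ 'n \<Rightarrow> real ^ 'n" where
  "zeta s kp (Const_mode j) x = axis j 1"
| "zeta s kp (Cos_mode k i) x =
     (cos (2 * pi * (int_vec k \<bullet> x)) / norm (int_vec k) powr (s + 1)) *\<^sub>R kp k i"
| "zeta s kp (Sin_mode k i) x =
     (sin (2 * pi * (int_vec k \<bullet> x)) / norm (int_vec k) powr (s + 1)) *\<^sub>R kp k i"

definition noise_const :: "'n::{finite,linorder} itself \<Rightarrow> real \<Rightarrow> real" where
  "noise_const _ s = 1 + (real CARD('n) - 1) / real CARD('n) *
     (\<Sum>\<^sub>\<infinity>k\<in>(half_lattice :: (int, 'n) vec set). norm (int_vec k) powr (- 2 * s))"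


section \<open>Stochastic calculus\<close>

text \<open>Time is restricted to nonnegative reals in all uses of a filtration below.\<close>

definition usual_conditions :: "'a measure \<Rightarrow> (real \<Rightarrow> 'a measure) \<Rightarrow> bool" where
  "usual_conditions M F \<longleftrightarrow>
     filtration (space M) F \<and> (\<forall>t. sets (F t) \<subseteq> sets M) \<and>
     complete_measure M \<and> null_sets M \<subseteq> sets (F 0) \<and>
     (\<forall>t\<ge>0. sets (F t) = (\<Inter>u\<in>{t<..}. sets (F u)))"

text \<open>Independent Brownian motions relative to the filtration: the increments over \<open>[s, t]\<close> are
  jointly independent of the past and of each other. Together with adaptedness this makes the
  processes \<open>W r\<close> independent.\<close>

definition brownian_family ::
  "'a measure \<Rightarrow> (real \<Rightarrow> 'a measure) \<Rightarrow> 'i set \<Rightarrow> ('i \<Rightarrow> real \<Rightarrow> 'a \<Rightarrow> real) \<Rightarrow> bool" where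
  "brownian_family M F I W \<longleftrightarrow>
     (\<forall>r\<in>I. \<forall>\<omega>\<in>space M. W r 0 \<omega> = 0 \<and> continuous_on {0..} (\<lambda>t. W r t \<omega>)) \<and>
     (\<forall>r\<in>I. \<forall>t\<ge>0. W r t \<in> borel_measurable (F t)) \<and>
     (\<forall>r\<in>I. \<forall>s t. 0 \<le> s \<longrightarrow> s < t \<longrightarrow>
        distributed M lborel (\<lambda>\<omega>. W r t \<omega> - W r s \<omega>)
          (\<lambda>x. ennreal (normal_density 0 (sqrt (t - s)) x))) \<and>
     (\<forall>s t. 0 \<le> s \<longrightarrow> s < t \<longrightarrow>
        prob_space.indep_sets M
          (\<lambda>q. case q of
                 None \<Rightarrow> sets (F s)
               | Some r \<Rightarrow> {(\<lambda>\<omega>. W r t \<omega> - W r s \<omega>) -` B \<inter> space M | B. B \<in> sets borel})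
          (insert None (Some ` I)))"

definition partition_of :: "real \<Rightarrow> nat \<Rightarrow> (nat \<Rightarrow> real) \<Rightarrow> bool" where
  "partition_of t m p \<longleftrightarrow> p 0 = 0 \<and> p m = t \<and> (\<forall>i<m. p i \<le> p (Suc i))"

definition finite_variation :: "real \<Rightarrow> (real \<Rightarrow> real) \<Rightarrow> bool" where
  "finite_variation T A \<longleftrightarrow>
     (\<exists>B. \<forall>m p. partition_of T m p \<longrightarrow> (\<Sum>i<m. \<bar>A (p (Suc i)) - A (p i)\<bar>) \<le> B)"

definition adapted_continuous ::
  "'a measure \<Rightarrow> (real \<Rightarrow> 'a measure) \<Rightarrow> real \<Rightarrow> (real \<Rightarrow> 'a \<Rightarrow> real) \<Rightarrow> bool" where
  "adapted_continuous M F T Y \<longleftrightarrow>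
     (\<forall>t\<in>{0..T}. Y t \<in> borel_measurable (F t)) \<and>
     (\<forall>\<omega>\<in>space M. continuous_on {0..T} (\<lambda>t. Y t \<omega>))"

text \<open>Convergence in probability of partition sums \<open>\<Phi> m p\<close> over \<open>[0, t]\<close> as the mesh tends to 0.\<close>

definition mesh_limit_in_prob ::
  "'a measure \<Rightarrow> real \<Rightarrow> (nat \<Rightarrow> (nat \<Rightarrow> real) \<Rightarrow> 'a \<Rightarrow> real) \<Rightarrow> ('a \<Rightarrow> real) \<Rightarrow> bool" where
  "mesh_limit_in_prob M t \<Phi> L \<longleftrightarrow>
     (\<forall>e>0. \<forall>d>0. \<exists>h>0. \<forall>m p. partition_of t m p \<longrightarrow> (\<forall>i<m. p (Suc i) - p i < h) \<longrightarrow>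
        measure M {\<omega>\<in>space M. \<bar>\<Phi> m p \<omega> - L \<omega>\<bar> > e} < d)"

text \<open>For continuous adapted integrands the Ito integral is the limit in probability of the
  left-endpoint sums.\<close>

definition has_ito_integral ::
  "'a measure \<Rightarrow> (real \<Rightarrow> 'a measure) \<Rightarrow> real \<Rightarrow> (real \<Rightarrow> 'a \<Rightarrow> real) \<Rightarrow> (real \<Rightarrow> 'a \<Rightarrow> real) \<Rightarrow>
   (real \<Rightarrow> 'a \<Rightarrow> real) \<Rightarrow> bool" where
  "has_ito_integral M F T Y W J \<longleftrightarrow>
     adapted_continuous M F T Y \<and> adapted_continuous M F T J \<and>
     (\<forall>t\<in>{0..T}. mesh_limit_in_prob M t
        (\<lambda>m p \<omega>. \<Sum>i<m. Y (p i) \<omega> * (W (p (Suc i)) \<omega> - W (p i) \<omega>)) (J t))"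

definition has_covariation ::
  "'a measure \<Rightarrow> (real \<Rightarrow> 'a measure) \<Rightarrow> real \<Rightarrow> (real \<Rightarrow> 'a \<Rightarrow> real) \<Rightarrow> (real \<Rightarrow> 'a \<Rightarrow> real) \<Rightarrow>
   (real \<Rightarrow> 'a \<Rightarrow> real) \<Rightarrow> bool" where
  "has_covariation M F T Y W V \<longleftrightarrow>
     adapted_continuous M F T Y \<and> adapted_continuous M F T V \<and>
     (\<forall>\<omega>\<in>space M. finite_variation T (\<lambda>t. V t \<omega>)) \<and>
     (\<forall>t\<in>{0..T}. mesh_limit_in_prob M t
        (\<lambda>m p \<omega>. \<Sum>i<m. (Y (p (Suc i)) \<omega> - Y (p i) \<omega>) * (W (p (Suc i)) \<omega> - W (p i) \<omega>)) (V t))"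

text \<open>Ito integral plus half the covariation; equivalently the limit of the trapezoidal sums.\<close>

definition has_stratonovich_integral ::
  "'a measure \<Rightarrow> (real \<Rightarrow> 'a measure) \<Rightarrow> real \<Rightarrow> (real \<Rightarrow> 'a \<Rightarrow> real) \<Rightarrow> (real \<Rightarrow> 'a \<Rightarrow> real) \<Rightarrow>
   (real \<Rightarrow> 'a \<Rightarrow> real) \<Rightarrow> bool" where
  "has_stratonovich_integral M F T Y W S \<longleftrightarrow>
     (\<exists>J V. has_ito_integral M F T Y W J \<and> has_covariation M F T Y W V \<and>
        (\<forall>t\<in>{0..T}. \<forall>\<omega>\<in>space M. S t \<omega> = J t \<omega> + V t \<omega> / 2))"

definition sums_in_prob ::
  "'a measure \<Rightarrow> 'i set \<Rightarrow> ('i \<Rightarrow> 'a \<Rightarrow> real) \<Rightarrow> ('a \<Rightarrow> real) \<Rightarrow> bool" where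
  "sums_in_prob M I S Z \<longleftrightarrow> Z \<in> borel_measurable M \<and>
     (\<forall>e>0. ((\<lambda>R. measure M {\<omega>\<in>space M. \<bar>(\<Sum>r\<in>R. S r \<omega>) - Z \<omega>\<bar> > e}) \<longlongrightarrow> 0)
        (finite_subsets_at_top I))"

text \<open>\<open>S\<close> is the sum over \<open>r\<close> of the Stratonovich integrals of \<open>Y r\<close> against \<open>W r\<close>, as a
  semimartingale: the Ito parts and the halved covariations are both summable in probability,
  and the latter sum to a continuous process of finite variation.\<close>

definition has_stratonovich_series ::
  "'a measure \<Rightarrow> (real \<Rightarrow> 'a measure) \<Rightarrow> real \<Rightarrow> 'i set \<Rightarrow> ('i \<Rightarrow> real \<Rightarrow> 'a \<Rightarrow> real) \<Rightarrow>
   ('i \<Rightarrow> real \<Rightarrow> 'a \<Rightarrow> real) \<Rightarrow> (real \<Rightarrow> 'a \<Rightarrow> real) \<Rightarrow> bool" where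
  "has_stratonovich_series M F T I Y W S \<longleftrightarrow>
     (\<exists>J V Z A.
        (\<forall>r\<in>I. has_ito_integral M F T (Y r) (W r) (J r) \<and>
               has_covariation M F T (Y r) (W r) (V r)) \<and>
        (\<forall>t\<in>{0..T}. sums_in_prob M I (\<lambda>r. J r t) (Z t) \<and> sums_in_prob M I (\<lambda>r. V r t) (A t)) \<and>
        adapted_continuous M F T Z \<and> adapted_continuous M F T A \<and>
        (\<forall>\<omega>\<in>space M. finite_variation T (\<lambda>t. A t \<omega>)) \<and>
        (\<forall>t\<in>{0..T}. \<forall>\<omega>\<in>space M. S t \<omega> = Z t \<omega> + A t \<omega> / 2))"

text \<open>The scalar equation \<open>dX = b dt + a \<Sum>\<^sub>r G r o dW r\<close> in integrated form.\<close>

definition stratonovich_equation ::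
  "'a measure \<Rightarrow> (real \<Rightarrow> 'a measure) \<Rightarrow> real \<Rightarrow> 'i set \<Rightarrow> ('i \<Rightarrow> real \<Rightarrow> 'a \<Rightarrow> real) \<Rightarrow>
   (real \<Rightarrow> 'a \<Rightarrow> real) \<Rightarrow> (real \<Rightarrow> 'a \<Rightarrow> real) \<Rightarrow> real \<Rightarrow> ('i \<Rightarrow> real \<Rightarrow> 'a \<Rightarrow> real) \<Rightarrow> bool" where
  "stratonovich_equation M F T I W X b a G \<longleftrightarrow>
     (\<exists>S. has_stratonovich_series M F T I G W S \<and>
        (\<forall>t\<in>{0..T}. AE \<omega> in M.
           (\<lambda>\<tau>. b \<tau> \<omega>) integrable_on {0..t} \<and>
           X t \<omega> = X 0 \<omega> + integral {0..t} (\<lambda>\<tau>. b \<tau> \<omega>) + a * S t \<omega>))"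


section \<open>Regularity conventions\<close>

definition ck_field :: "real \<Rightarrow> nat \<Rightarrow> (real \<Rightarrow> real ^ 'n \<Rightarrow> real) \<Rightarrow> bool" where
  "ck_field T k f \<longleftrightarrow>
     (\<forall>t\<in>{0..T}. torus_fun (f t) \<and> Ck k (f t)) \<and>
     (\<forall>is. length is \<le> k \<longrightarrow> continuous_on ({0..T} \<times> UNIV) (\<lambda>(t, x). pds is (f t) x))"

definition mean :: "'a measure \<Rightarrow> (real \<Rightarrow> 'a \<Rightarrow> real ^ 'n \<Rightarrow> 'b::{banach,second_countable_topology}) \<Rightarrow>
   real \<Rightarrow> real ^ 'n \<Rightarrow> 'b" where
  "mean M X t x = (\<integral>\<omega>. X t \<omega> x \<partial>M)"

text \<open>Adapted scalar random fields with twice continuously differentiable realisations, whose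
  spatial derivatives are integrable and commute with the expectation.\<close>

definition regular_field ::
  "'a measure \<Rightarrow> (real \<Rightarrow> 'a measure) \<Rightarrow> real \<Rightarrow> (real \<Rightarrow> 'a \<Rightarrow> real ^ 'n \<Rightarrow> real) \<Rightarrow> bool" where
  "regular_field M F T X \<longleftrightarrow>
     (\<forall>t\<in>{0..T}. \<forall>x. (\<lambda>\<omega>. X t \<omega> x) \<in> borel_measurable (F t)) \<and>
     (\<forall>\<omega>\<in>space M. ck_field T 2 (\<lambda>t. X t \<omega>)) \<and>
     (\<forall>is x. length is \<le> 2 \<longrightarrow>
        (\<forall>t\<in>{0..T}. integrable M (\<lambda>\<omega>. pds is (X t \<omega>) x) \<and>
           pds is (mean M X t) x = (\<integral>\<omega>. pds is (X t \<omega>) x \<partial>M)) \<and>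
        integrable (restrict_space lborel {0..T} \<Otimes>\<^sub>M M) (\<lambda>(t, \<omega>). pds is (X t \<omega>) x))"

text \<open>The covariation of the random field \<open>X\<close> with \<open>W\<close> is continuously differentiable in space,
  and its spatial derivatives are the covariations of the spatial derivatives of \<open>X\<close>.\<close>

definition covariation_commutes_pd ::
  "'a measure \<Rightarrow> (real \<Rightarrow> 'a measure) \<Rightarrow> real \<Rightarrow> (real \<Rightarrow> 'a \<Rightarrow> real ^ 'n \<Rightarrow> real) \<Rightarrow>
   (real \<Rightarrow> 'a \<Rightarrow> real) \<Rightarrow> bool" where
  "covariation_commutes_pd M F T X W \<longleftrightarrow>
     (\<exists>C. (\<forall>t\<in>{0..T}. \<forall>\<omega>\<in>space M. Ck 1 (C t \<omega>)) \<and>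
        (\<forall>x. has_covariation M F T (\<lambda>t \<omega>. X t \<omega> x) W (\<lambda>t \<omega>. C t \<omega> x) \<and>
           (\<forall>i. has_covariation M F T (\<lambda>t \<omega>. pd i (X t \<omega>) x) W (\<lambda>t \<omega>. pd i (C t \<omega>) x))))"

definition ito_integrals_centred ::
  "'a measure \<Rightarrow> (real \<Rightarrow> 'a measure) \<Rightarrow> real \<Rightarrow> 'i set \<Rightarrow> ('i \<Rightarrow> real \<Rightarrow> 'a \<Rightarrow> real) \<Rightarrow>
   ('i \<Rightarrow> real \<Rightarrow> 'a \<Rightarrow> real) \<Rightarrow> bool" where
  "ito_integrals_centred M F T I Y W \<longleftrightarrow>
     (\<forall>r\<in>I. \<forall>J. has_ito_integral M F T (Y r) (W r) J \<longrightarrow>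
        (\<forall>t\<in>{0..T}. integrable M (J t) \<and> (\<integral>\<omega>. J t \<omega> \<partial>M) = 0))"

definition expectation_commutes_series ::
  "'a measure \<Rightarrow> (real \<Rightarrow> 'a measure) \<Rightarrow> real \<Rightarrow> 'i set \<Rightarrow> ('i \<Rightarrow> real \<Rightarrow> 'a \<Rightarrow> real) \<Rightarrow>
   ('i \<Rightarrow> real \<Rightarrow> 'a \<Rightarrow> real) \<Rightarrow> bool" where
  "expectation_commutes_series M F T I Y W \<longleftrightarrow>
     (\<forall>S t Z. (\<forall>r\<in>I. has_stratonovich_integral M F T (Y r) (W r) (S r)) \<longrightarrow> t \<in> {0..T} \<longrightarrow>
        sums_in_prob M I (\<lambda>r. S r t) Z \<longrightarrow>
        ((\<lambda>r. \<integral>\<omega>. S r t \<omega> \<partial>M) has_sum (\<integral>\<omega>. Z \<omega> \<partial>M)) I)"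


section \<open>The mean field system and the compressible Navier-Stokes equations\<close>

definition velocity :: "(real ^ 'n \<Rightarrow> real ^ 'n) \<Rightarrow> (real ^ 'n \<Rightarrow> real) \<Rightarrow> real ^ 'n \<Rightarrow> real ^ 'n" where
  "velocity mb rb x = (1 / rb x) *\<^sub>R mb x"

definition pressure :: "(real \<Rightarrow> real) \<Rightarrow> (real ^ 'n \<Rightarrow> real) \<Rightarrow> real ^ 'n \<Rightarrow> real" where
  "pressure U rb x = (rb x)\<^sup>2 * deriv U (rb x)"

text \<open>In both drifts \<open>mb\<close>, \<open>rb\<close> are the mean fields and \<open>m\<close>, \<open>r\<close> the realisations, all at one
  instant.\<close>

definition momentum_drift ::
  "real \<Rightarrow> real \<Rightarrow> (real \<Rightarrow> real) \<Rightarrow> (real ^ 'n \<Rightarrow> real ^ 'n) \<Rightarrow> (real ^ 'n \<Rightarrow> real) \<Rightarrow>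
   (real ^ 'n \<Rightarrow> real ^ 'n) \<Rightarrow> (real ^ 'n \<Rightarrow> real) \<Rightarrow> real ^ 'n \<Rightarrow> real ^ 'n" where
  "momentum_drift \<kappa> \<nu> U mb rb m r x =
     (let u = velocity mb rb;
          g = grad (\<lambda>y. ln (rb y));
          v = (\<lambda>y. u y + \<nu> *\<^sub>R g y)
      in - nabla v m x - dvg v x *\<^sub>R m x - nablaT u m x - \<nu> *\<^sub>R nablaT g m x
         + r x *\<^sub>R nablaT u u x
         - (r x / rb x) *\<^sub>R grad (pressure U rb) x
         + (\<kappa> * r x) *\<^sub>R grad (lap rb) x
         - (\<nu> * r x / (rb x)\<^sup>2 * dvg mb x) *\<^sub>R grad rb x
         + (\<nu> * r x / rb x) *\<^sub>R grad (dvg mb) x)"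

definition density_drift ::
  "real \<Rightarrow> (real ^ 'n \<Rightarrow> real ^ 'n) \<Rightarrow> (real ^ 'n \<Rightarrow> real) \<Rightarrow>
   (real ^ 'n \<Rightarrow> real) \<Rightarrow> real ^ 'n \<Rightarrow> real" where
  "density_drift \<nu> mb rb r x =
     - dvg (\<lambda>y. r y *\<^sub>R velocity mb rb y + (\<nu> * r y) *\<^sub>R grad (\<lambda>z. ln (rb z)) y) x"

definition stress :: "real \<Rightarrow> (real ^ 'n \<Rightarrow> real) \<Rightarrow> (real ^ 'n \<Rightarrow> real ^ 'n) \<Rightarrow> real ^ 'n \<Rightarrow> real ^ 'n ^ 'n" where
  "stress \<nu> rb u x =
     (\<chi> i j. \<nu> * rb x * (pd i (\<lambda>y. u y $ j) x + pd j (\<lambda>y. u y $ i) x))"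

definition capillary :: "real \<Rightarrow> (real ^ 'n \<Rightarrow> real) \<Rightarrow> real ^ 'n \<Rightarrow> real ^ 'n ^ 'n" where
  "capillary \<kappa> rb x =
     \<kappa> *\<^sub>R ((rb x * lap rb x + 1 / 2 * (grad rb x \<bullet> grad rb x)) *\<^sub>R mat 1
          - (\<chi> i j. grad rb x $ i * grad rb x $ j))"

definition compressible_navier_stokes ::
  "real \<Rightarrow> real \<Rightarrow> real \<Rightarrow> (real \<Rightarrow> real) \<Rightarrow> (real \<Rightarrow> real ^ 'n \<Rightarrow> real ^ 'n) \<Rightarrow>
   (real \<Rightarrow> real ^ 'n \<Rightarrow> real) \<Rightarrow> bool" where
  "compressible_navier_stokes T \<kappa> \<nu> U u rb \<longleftrightarrow>
     (\<forall>t\<in>{0..T}. \<forall>x.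
        ((\<lambda>\<tau>. u \<tau> x) has_vector_derivative
           (- nabla (u t) (u t) x - (1 / rb t x) *\<^sub>R grad (pressure U (rb t)) x
            + (1 / rb t x) *\<^sub>R (dvg_tensor (stress \<nu> (rb t) (u t)) x
                               + dvg_tensor (capillary \<kappa> (rb t)) x)))
          (at t within {0..T}) \<and>
        ((\<lambda>\<tau>. rb \<tau> x) has_real_derivative (- dvg (\<lambda>y. rb t y *\<^sub>R u t y) x))
          (at t within {0..T}))"

end

theory Submission
  imports Defs
begin

text \<open>Conversion to Ito form: the noise terms are first order operators \<open>P\<^sub>r X = A\<^sub>r \<cdot> \<nabla>X + B\<^sub>r X\<close> applied to the
  unknown fields, with \<open>A\<^sub>r = \<zeta>\<^sub>r\<close> and \<open>B\<^sub>r = 0\<close> for the density, \<open>B\<^sub>r = \<nabla>\<^sup>\<top>\<zeta>\<^sub>r\<close> for the momentum. Since the \<open>W\<^sub>r\<close> are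
  independent, the covariation of \<open>X = \<dots> + a \<Sum>\<^sub>q \<integral> P\<^sub>q X \<circ> dW\<^sub>q\<close> with \<open>W\<^sub>r\<close> is \<open>a \<integral> P\<^sub>r X dt\<close>, and differentiating it
  in space gives the covariation \<open>a \<integral> P\<^sub>r P\<^sub>r X dt\<close> of \<open>P\<^sub>r X\<close> with \<open>W\<^sub>r\<close>. Taking expectations, the means satisfy
  a deterministic equation with the additional term \<open>a\<^sup>2/2 \<Sum>\<^sub>r P\<^sub>r P\<^sub>r\<close>.

  All noise fields are plane waves orthogonal to their frequency. Hence the lower order parts of
  \<open>P\<^sub>r P\<^sub>r\<close> vanish individually, the mixed terms \<open>\<zeta>\<^sub>r\<^sup>i B\<^sub>r\<close> cancel between sines and cosines, and the
  symmetry of the lattice makes \<open>\<Sum>\<^sub>r \<zeta>\<^sub>r\<^sup>i \<zeta>\<^sub>r\<^sup>j\<close> the multiple \<open>c\<^sup>s\<close> of the identity. So the noise adds \<open>\<nu> \<Delta>\<close> to both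
  mean equations; the \<open>\<nu>\<close>-terms of the drifts combine with it to the stress tensor and cancel in
  the continuity equation.\<close>

section \<open>Increments of Brownian families\<close>

text \<open>The covariations with \<open>W r\<close> are given only as limits in probability of
  partition sums, and so are the Ito integrals of the infinitely many noise terms, whose integrands
  are continuous and adapted without assumed second moments. Identifying a covariation therefore
  takes two scales: a coarse partition carries the covariation sum, a finer one inside each of its
  blocks carries the Ito sums. All errors are bounded uniformly in the fine mesh and in the finite
  set of modes. This is possible because at a fixed point the noise terms are combinations of
  finitely many processes, with coefficients that are square summable over the modes. For the
  momentum these coefficients include gradients of the noise fields, whose squares are of order
  \<open>|k|^(2 - 2 s)\<close>; their summability over an n-dimensional lattice is what
  \<open>s > 1 + n / 2\<close> provides.

  No equation is derived for the spatial derivatives of the fields. The covariation is identified as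
  a function of the point and differentiated afterwards, so that second derivatives of the fields
  occur only under a time integral.\<close>

locale brownian_setting = prob_space M
  for M :: "'a measure" and F :: "real \<Rightarrow> 'a measure" and I :: "'i set"
    and W :: "'i \<Rightarrow> real \<Rightarrow> 'a \<Rightarrow> real" +
  assumes usual: "usual_conditions M F" and bm: "brownian_family M F I W"
begin

lemma space_F [simp]: "space (F t) = space M"
  using usual by (auto simp: usual_conditions_def filtration_def)

lemma sets_F_subset: "sets (F t) \<subseteq> sets M"
  using usual by (auto simp: usual_conditions_def)

lemma sets_F_mono: "s \<le> t \<Longrightarrow> sets (F s) \<subseteq> sets (F t)"
  using usual by (auto simp: usual_conditions_def filtration_def)

lemma measurable_F_mono: "X \<in> borel_measurable (F s) \<Longrightarrow> s \<le> t \<Longrightarrow> X \<in> borel_measurable (F t)"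
  using measurable_mono[of borel borel "F s" "F t"] sets_F_mono[of s t] by auto

lemma measurable_F_M: "X \<in> borel_measurable (F s) \<Longrightarrow> X \<in> borel_measurable M"
  using measurable_mono[of borel borel "F s" M] sets_F_subset[of s] by auto

lemma W_measurable_F: "q \<in> I \<Longrightarrow> 0 \<le> t \<Longrightarrow> W q t \<in> borel_measurable (F t)"
  using bm by (auto simp: brownian_family_def)

lemma W_measurable [measurable (raw)]: "q \<in> I \<Longrightarrow> 0 \<le> t \<Longrightarrow> W q t \<in> borel_measurable M"
  using W_measurable_F measurable_F_M by blast

abbreviation incr :: "'i \<Rightarrow> real \<Rightarrow> real \<Rightarrow> 'a \<Rightarrow> real" where
  "incr q s t \<omega> \<equiv> W q t \<omega> - W q s \<omega>"

definition incr_events :: "real \<Rightarrow> real \<Rightarrow> 'i \<Rightarrow> 'a set set" where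
  "incr_events s t q = {incr q s t -` B \<inter> space M | B. B \<in> sets borel}"

text \<open>The information available just before the increments of the remaining indices over
  \<open>[s, t]\<close> are revealed. With it, different Brownian motions over one interval can be
  treated like successive increments of a single one.\<close>

definition past :: "real \<Rightarrow> real \<Rightarrow> 'i set \<Rightarrow> 'a measure" where
  "past s t Q = sigma (space M) (sets (F s) \<union> (\<Union>q\<in>Q. incr_events s t q))"

lemma past_generators: "sets (F s) \<union> (\<Union>q\<in>Q. incr_events s t q) \<subseteq> Pow (space M)"
  using sets.space_closed[of "F s"] by (auto simp: incr_events_def)

lemma space_past [simp]: "space (past s t Q) = space M"
  by (simp add: past_def space_measure_of_conv)

lemma sets_past: "sets (past s t Q) = sigma_sets (space M) (sets (F s) \<union> (\<Union>q\<in>Q. incr_events s t q))"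
  unfolding past_def using past_generators[of s t Q] by (simp add: sets_measure_of_conv)

lemma measurable_past_F: "X \<in> borel_measurable (F s) \<Longrightarrow> X \<in> borel_measurable (past s t Q)"
  using measurable_mono[of borel borel "F s" "past s t Q"] by (auto simp: sets_past)

lemma measurable_past_incr: "q \<in> Q \<Longrightarrow> incr q s t \<in> borel_measurable (past s t Q)"
  by (rule measurableI) (auto simp: sets_past incr_events_def)

lemma incr_events_subset_F:
  assumes "q \<in> I" "0 \<le> s" "s \<le> t" shows "incr_events s t q \<subseteq> sets (F t)"
proof -
  have "incr q s t \<in> borel_measurable (F t)"
    using W_measurable_F[of q t] measurable_F_mono[OF W_measurable_F[of q s], of t] assms by auto
  from measurable_sets[OF this] show ?thesis by (auto simp: incr_events_def)
qed

lemma sets_past_subset_F: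
  assumes "Q \<subseteq> I" "0 \<le> s" "s \<le> t" shows "sets (past s t Q) \<subseteq> sets (F t)"
proof -
  have "sets (F s) \<union> (\<Union>q\<in>Q. incr_events s t q) \<subseteq> sets (F t)"
    using incr_events_subset_F[of _ s t] sets_F_mono[of s t] assms by blast
  then show ?thesis
    using sets.sigma_sets_subset[of _ "F t"] by (auto simp: sets_past)
qed

lemma measurable_past_imp_F:
  "X \<in> borel_measurable (past s t Q) \<Longrightarrow> Q \<subseteq> I \<Longrightarrow> 0 \<le> s \<Longrightarrow> s \<le> t \<Longrightarrow> X \<in> borel_measurable (F t)"
  using measurable_mono[of borel borel "past s t Q" "F t"] sets_past_subset_F[of Q s t] by auto

lemma measurable_past_mono:
  "X \<in> borel_measurable (past s t Q) \<Longrightarrow> Q \<subseteq> Q' \<Longrightarrow> X \<in> borel_measurable (past s t Q')"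
proof -
  assume X: "X \<in> borel_measurable (past s t Q)" and Q: "Q \<subseteq> Q'"
  have "sets (past s t Q) \<subseteq> sets (past s t Q')"
    unfolding sets_past using Q by (intro sigma_sets_mono') auto
  then show ?thesis using X measurable_mono[of borel borel "past s t Q" "past s t Q'"] by auto
qed

text \<open>An independent family stays independent after grouping: one group consists of
  \<open>F s\<close> and the increments of \<open>Q\<close>, the other of the increment of
  \<open>p\<close>. Passing to the generated sigma-algebras needs stability under intersection,
  which the increment events have as preimages of Borel sets.\<close>

lemma indep_past_incr:
  assumes p: "p \<in> I" "Q \<subseteq> I - {p}" and st: "0 \<le> s" "s < t"
    and X: "X \<in> borel_measurable (past s t Q)"
  shows "indep_var borel X borel (incr p s t)"
proof -
  define E where "E = (\<lambda>o'. case o' of None \<Rightarrow> sets (F s) | Some r \<Rightarrow> incr_events s t r)"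
  have ind: "indep_sets E (insert None (Some ` I))"
    using bm st unfolding brownian_family_def E_def incr_events_def by blast
  \<comment> \<open>The two groups, indexed by the booleans because \<open>indep_set\<close> is
    independence of a family over \<open>bool\<close>.\<close>
  define K where "K = (\<lambda>b. if b then insert None (Some ` Q) else {Some p})"
  have "indep_sets (\<lambda>b. sigma_sets (space M) (\<Union>i\<in>K b. E i)) UNIV"
  proof (rule indep_sets_collect_sigma)
    show "indep_sets E (\<Union>j\<in>UNIV. K j)"
      by (rule indep_sets_mono_index[OF _ ind]) (use p in \<open>auto simp: K_def\<close>)
    show "disjoint_family_on K UNIV" using p by (auto simp: disjoint_family_on_def K_def)
    have vs: "Int_stable (incr_events s t r)" for r
      unfolding incr_events_def Int_stable_def
    proof clarify
      fix A B :: "real set" assume "A \<in> sets borel" "B \<in> sets borel"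
      then show "\<exists>C. incr r s t -` A \<inter> space M \<inter> (incr r s t -` B \<inter> space M) = incr r s t -` C \<inter> space M \<and> C \<in> sets borel"
        by (intro exI[of _ "A \<inter> B"]) auto
    qed
    show "Int_stable (E i)" for i
      using vs by (auto simp: E_def sets.Int_stable split: option.splits)
  qed
  moreover have "(\<Union>i\<in>K True. E i) = sets (F s) \<union> (\<Union>q\<in>Q. incr_events s t q)"
    by (auto simp: K_def E_def)
  moreover have "(\<Union>i\<in>K False. E i) = incr_events s t p"
    by (auto simp: K_def E_def)
  ultimately have ind2: "indep_set (sets (past s t Q)) (sigma_sets (space M) (incr_events s t p))"
    unfolding indep_set_def sets_past
    by (subst indep_sets_cong[where J=UNIV]) (auto split: bool.splits)
  have XM: "X \<in> borel_measurable M" using measurable_past_imp_F[OF X] p st measurable_F_M by auto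
  have WM: "incr p s t \<in> borel_measurable M" using W_measurable[of p s] W_measurable[of p t] p st by auto
  have sub: "sigma_sets (space M) {X -` A \<inter> space M |A. A \<in> sets borel} \<subseteq> sets (past s t Q)"
  proof -
    have "{X -` A \<inter> space M |A. A \<in> sets borel} \<subseteq> sets (past s t Q)"
      using measurable_sets[OF X] by auto
    from sets.sigma_sets_subset[OF this] show ?thesis by simp
  qed
  show ?thesis
    unfolding indep_var_eq using XM WM ind2 sub
    unfolding indep_sets2_eq incr_events_def by blast
qed

lemma past_incr_expectation:
  fixes g :: "real \<Rightarrow> real"
  assumes p: "p \<in> I" "Q \<subseteq> I - {p}" and st: "0 \<le> s" "s < t"
    and X: "X \<in> borel_measurable (past s t Q)" "integrable M X"
    and g: "g \<in> borel_measurable borel" "integrable M (\<lambda>\<omega>. g (incr p s t \<omega>))"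
  shows "integrable M (\<lambda>\<omega>. X \<omega> * g (incr p s t \<omega>))"
    "expectation (\<lambda>\<omega>. X \<omega> * g (incr p s t \<omega>)) = expectation X * expectation (\<lambda>\<omega>. g (incr p s t \<omega>))"
proof -
  have "indep_var borel (id \<circ> X) borel (g \<circ> incr p s t)"
    by (rule indep_var_compose[OF indep_past_incr[OF p st X(1)]]) (use g in auto)
  then have i: "indep_var borel X borel (\<lambda>\<omega>. g (incr p s t \<omega>))" by (simp add: comp_def)
  show "integrable M (\<lambda>\<omega>. X \<omega> * g (incr p s t \<omega>))"
    using indep_var_integrable[OF i X(2) g(2)] .
  show "expectation (\<lambda>\<omega>. X \<omega> * g (incr p s t \<omega>)) = expectation X * expectation (\<lambda>\<omega>. g (incr p s t \<omega>))"
    using indep_var_lebesgue_integral[OF i X(2) g(2)] .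
qed

lemma incr_distributed:
  "p \<in> I \<Longrightarrow> 0 \<le> s \<Longrightarrow> s < t \<Longrightarrow>
    distributed M lborel (incr p s t) (\<lambda>x. ennreal (normal_density 0 (sqrt (t - s)) x))"
  using bm unfolding brownian_family_def by blast

lemma incr_moment:
  fixes g :: "real \<Rightarrow> real"
  assumes p: "p \<in> I" and st: "0 \<le> s" "s < t" and g: "g \<in> borel_measurable borel"
    and hb: "has_bochner_integral lborel (\<lambda>x. normal_density 0 (sqrt (t - s)) x * g x) c"
  shows "integrable M (\<lambda>\<omega>. g (incr p s t \<omega>))" "expectation (\<lambda>\<omega>. g (incr p s t \<omega>)) = c"
proof -
  have g': "g \<in> borel_measurable lborel" using g by simp
  show "integrable M (\<lambda>\<omega>. g (incr p s t \<omega>))"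
    using distributed_integrable[OF incr_distributed[OF p st] g'] hb
    by (simp add: has_bochner_integral_iff)
  show "expectation (\<lambda>\<omega>. g (incr p s t \<omega>)) = c"
    using distributed_integral[OF incr_distributed[OF p st] g'] hb
    by (simp add: has_bochner_integral_iff)
qed

text \<open>Moments of a normal variable of variance \<open>t - s\<close>. The fourth yields the
  variance \<open>2 * (t - s)\<^sup>2\<close> of a squared increment, which controls the quadratic
  variation.\<close>

lemma incr_power_moment:
  assumes p: "p \<in> I" and st: "0 \<le> s" "s < t"
  shows incr_integrable: "integrable M (incr p s t)"
    and incr_mean: "expectation (incr p s t) = 0"
    and incr_integrable2: "integrable M (\<lambda>\<omega>. (incr p s t \<omega>)\<^sup>2)"
    and incr_variance: "expectation (\<lambda>\<omega>. (incr p s t \<omega>)\<^sup>2) = t - s"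
    and incr_integrable4: "integrable M (\<lambda>\<omega>. (incr p s t \<omega>) ^ 4)"
    and incr_fourth: "expectation (\<lambda>\<omega>. (incr p s t \<omega>) ^ 4) = 3 * (t - s)\<^sup>2"
proof -
  have pos: "0 < sqrt (t - s)" and sq: "(sqrt (t - s))\<^sup>2 = t - s" using st by auto
  show "integrable M (incr p s t)" "expectation (incr p s t) = 0"
    using incr_moment[OF p st, of "\<lambda>x. x"] normal_moment_odd[OF pos, of 0 0] by auto
  show "integrable M (\<lambda>\<omega>. (incr p s t \<omega>)\<^sup>2)" "expectation (\<lambda>\<omega>. (incr p s t \<omega>)\<^sup>2) = t - s"
    using incr_moment[OF p st, of "\<lambda>x. x\<^sup>2"] normal_moment_even[OF pos, of 0 1] st
    by (auto simp: sq)
  show "integrable M (\<lambda>\<omega>. (incr p s t \<omega>) ^ 4)" "expectation (\<lambda>\<omega>. (incr p s t \<omega>) ^ 4) = 3 * (t - s)\<^sup>2"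
    using incr_moment[OF p st, of "\<lambda>x. x ^ 4"] normal_moment_even[OF pos, of 0 2] st
    by (auto simp: sq fact_numeral field_simps power2_eq_square)
qed

end

lemma (in prob_space) orthogonal_sum_second_moment:
  fixes \<xi> :: "'b \<Rightarrow> 'a \<Rightarrow> real"
  assumes "finite A" and "\<And>a b. a \<in> A \<Longrightarrow> b \<in> A \<Longrightarrow> integrable M (\<lambda>\<omega>. \<xi> a \<omega> * \<xi> b \<omega>)"
    and "\<And>a b. a \<in> A \<Longrightarrow> b \<in> A \<Longrightarrow> a \<noteq> b \<Longrightarrow> expectation (\<lambda>\<omega>. \<xi> a \<omega> * \<xi> b \<omega>) = 0"
  shows "integrable M (\<lambda>\<omega>. (\<Sum>a\<in>A. \<xi> a \<omega>)\<^sup>2)"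
    "expectation (\<lambda>\<omega>. (\<Sum>a\<in>A. \<xi> a \<omega>)\<^sup>2) = (\<Sum>a\<in>A. expectation (\<lambda>\<omega>. (\<xi> a \<omega>)\<^sup>2))"
proof -
  have eq: "(\<Sum>a\<in>A. \<xi> a \<omega>)\<^sup>2 = (\<Sum>a\<in>A. \<Sum>b\<in>A. \<xi> a \<omega> * \<xi> b \<omega>)" for \<omega>
    by (simp add: power2_eq_square sum_product)
  show "integrable M (\<lambda>\<omega>. (\<Sum>a\<in>A. \<xi> a \<omega>)\<^sup>2)" unfolding eq using assms by auto
  have "expectation (\<lambda>\<omega>. (\<Sum>a\<in>A. \<xi> a \<omega>)\<^sup>2) = (\<Sum>a\<in>A. \<Sum>b\<in>A. expectation (\<lambda>\<omega>. \<xi> a \<omega> * \<xi> b \<omega>))"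
    unfolding eq using assms(2) by (subst Bochner_Integration.integral_sum, auto)+
  also have "\<dots> = (\<Sum>a\<in>A. \<Sum>b\<in>A. if b = a then expectation (\<lambda>\<omega>. (\<xi> a \<omega>)\<^sup>2) else 0)"
    using assms(3) by (intro sum.cong refl) (auto simp: power2_eq_square)
  also have "\<dots> = (\<Sum>a\<in>A. expectation (\<lambda>\<omega>. (\<xi> a \<omega>)\<^sup>2))" using assms(1) by simp
  finally show "expectation (\<lambda>\<omega>. (\<Sum>a\<in>A. \<xi> a \<omega>)\<^sup>2) = (\<Sum>a\<in>A. expectation (\<lambda>\<omega>. (\<xi> a \<omega>)\<^sup>2))" .
qed

section \<open>Convergence in probability\<close>

context prob_space
begin

text \<open>Measurability is part of the notion because \<open>measure\<close> is 0 on nonmeasurable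
  sets, which would make the limit condition void. The filter is arbitrary: limits are taken along
  sequences of partitions and along finite sets of modes.\<close>

definition tends_in_prob :: "('x \<Rightarrow> 'a \<Rightarrow> real) \<Rightarrow> ('a \<Rightarrow> real) \<Rightarrow> 'x filter \<Rightarrow> bool" where
  "tends_in_prob f L X \<longleftrightarrow> L \<in> borel_measurable M \<and> (\<forall>\<^sub>F x in X. f x \<in> borel_measurable M) \<and>
     (\<forall>e>0. ((\<lambda>x. prob {\<omega>\<in>space M. \<bar>f x \<omega> - L \<omega>\<bar> > e}) \<longlongrightarrow> 0) X)"

lemma tends_in_probD: "tends_in_prob f L X \<Longrightarrow> e > 0 \<Longrightarrow>
    ((\<lambda>x. prob {\<omega>\<in>space M. \<bar>f x \<omega> - L \<omega>\<bar> > e}) \<longlongrightarrow> 0) X"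
  by (simp add: tends_in_prob_def)

lemma tends_in_prob_ev: "tends_in_prob f L X \<Longrightarrow> e > 0 \<Longrightarrow> d > 0 \<Longrightarrow>
    \<forall>\<^sub>F x in X. f x \<in> borel_measurable M \<and> prob {\<omega>\<in>space M. \<bar>f x \<omega> - L \<omega>\<bar> > e} < d"
  unfolding tends_in_prob_def by (intro eventually_conj order_tendstoD(2)) auto

lemma tends_in_probI:
  assumes "L \<in> borel_measurable M" "\<forall>\<^sub>F x in X. f x \<in> borel_measurable M"
    and "\<And>e d. e > 0 \<Longrightarrow> d > 0 \<Longrightarrow> \<forall>\<^sub>F x in X. prob {\<omega>\<in>space M. \<bar>f x \<omega> - L \<omega>\<bar> > e} < d"
  shows "tends_in_prob f L X"
  unfolding tends_in_prob_def
proof (intro conjI allI impI)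
  fix e :: real assume "e > 0"
  show "((\<lambda>x. prob {\<omega>\<in>space M. \<bar>f x \<omega> - L \<omega>\<bar> > e}) \<longlongrightarrow> 0) X"
  proof (rule order_tendstoI)
    fix a :: real assume "a < 0"
    then show "\<forall>\<^sub>F x in X. a < prob {\<omega>\<in>space M. \<bar>f x \<omega> - L \<omega>\<bar> > e}"
      by (intro always_eventually allI) (simp add: order_less_le_trans)
  qed (use assms(3)[OF \<open>e > 0\<close>] in auto)
qed (use assms in auto)

lemma prob_abs_add_le:
  fixes f g h :: "'a \<Rightarrow> real"
  assumes [measurable]: "f \<in> borel_measurable M" "g \<in> borel_measurable M"
    and le: "\<And>\<omega>. \<omega> \<in> space M \<Longrightarrow> \<bar>h \<omega>\<bar> \<le> \<bar>f \<omega>\<bar> + \<bar>g \<omega>\<bar>"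
  shows "prob {\<omega>\<in>space M. \<bar>h \<omega>\<bar> > a + b} \<le>
    prob {\<omega>\<in>space M. \<bar>f \<omega>\<bar> > a} + prob {\<omega>\<in>space M. \<bar>g \<omega>\<bar> > b}"
proof -
  have "prob {\<omega>\<in>space M. \<bar>h \<omega>\<bar> > a + b} \<le>
      prob ({\<omega>\<in>space M. \<bar>f \<omega>\<bar> > a} \<union> {\<omega>\<in>space M. \<bar>g \<omega>\<bar> > b})"
  proof (rule finite_measure_mono)
    show "{\<omega>\<in>space M. \<bar>h \<omega>\<bar> > a + b} \<subseteq> {\<omega>\<in>space M. \<bar>f \<omega>\<bar> > a} \<union> {\<omega>\<in>space M. \<bar>g \<omega>\<bar> > b}"
    proof safe
      fix \<omega> assume "\<omega> \<in> space M" "a + b < \<bar>h \<omega>\<bar>" "\<not> b < \<bar>g \<omega>\<bar>"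
      then show "a < \<bar>f \<omega>\<bar>" using le[of \<omega>] by linarith
    qed
  qed measurable
  also have "\<dots> \<le> prob {\<omega>\<in>space M. \<bar>f \<omega>\<bar> > a} + prob {\<omega>\<in>space M. \<bar>g \<omega>\<bar> > b}"
    by (rule measure_Un_le) measurable
  finally show ?thesis .
qed

lemma tends_in_prob_add:
  assumes f: "tends_in_prob f L X" and g: "tends_in_prob g K X"
  shows "tends_in_prob (\<lambda>x \<omega>. f x \<omega> + g x \<omega>) (\<lambda>\<omega>. L \<omega> + K \<omega>) X"
proof (rule tends_in_probI)
  have [measurable]: "L \<in> borel_measurable M" "K \<in> borel_measurable M"
    using f g by (auto simp: tends_in_prob_def)
  show "(\<lambda>\<omega>. L \<omega> + K \<omega>) \<in> borel_measurable M" by measurable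
  show "\<forall>\<^sub>F x in X. (\<lambda>\<omega>. f x \<omega> + g x \<omega>) \<in> borel_measurable M"
    using f g unfolding tends_in_prob_def by (auto elim: eventually_elim2)
  fix e d :: real assume "e > 0" "d > 0"
  then have "0 < e / 2" "0 < d / 2" by auto
  from tends_in_prob_ev[OF f this] tends_in_prob_ev[OF g this]
  show "\<forall>\<^sub>F x in X. prob {\<omega>\<in>space M. \<bar>f x \<omega> + g x \<omega> - (L \<omega> + K \<omega>)\<bar> > e} < d"
  proof eventually_elim
    case 1: (elim x)
    then have [measurable]: "f x \<in> borel_measurable M" "g x \<in> borel_measurable M" by auto
    have "prob {\<omega>\<in>space M. \<bar>f x \<omega> + g x \<omega> - (L \<omega> + K \<omega>)\<bar> > e / 2 + e / 2} \<le>
       prob {\<omega>\<in>space M. e / 2 < \<bar>f x \<omega> - L \<omega>\<bar>} + prob {\<omega>\<in>space M. e / 2 < \<bar>g x \<omega> - K \<omega>\<bar>}"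
      by (rule prob_abs_add_le) auto
    with 1 \<open>e > 0\<close> show "prob {\<omega>\<in>space M. e < \<bar>f x \<omega> + g x \<omega> - (L \<omega> + K \<omega>)\<bar>} < d" by auto
  qed
qed

lemma tends_in_prob_const:
  "L \<in> borel_measurable M \<Longrightarrow> tends_in_prob (\<lambda>x. L) L X"
  by (rule tends_in_probI) auto

lemma tends_in_prob_sum:
  assumes "\<And>a. a \<in> A \<Longrightarrow> tends_in_prob (f a) (L a) X"
  shows "tends_in_prob (\<lambda>x \<omega>. \<Sum>a\<in>A. f a x \<omega>) (\<lambda>\<omega>. \<Sum>a\<in>A. L a \<omega>) X"
  using assms
  by (induction A rule: infinite_finite_induct)
    (simp_all add: tends_in_prob_const tends_in_prob_add)

lemma prob_abs_gt_small:
  fixes D :: "'a \<Rightarrow> real"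
  assumes [measurable]: "D \<in> borel_measurable M" and "d > 0"
  shows "\<exists>K>0. prob {\<omega>\<in>space M. \<bar>D \<omega>\<bar> > K} < (d::real)"
proof -
  have "(\<lambda>n. prob {\<omega>\<in>space M. \<bar>D \<omega>\<bar> > real n}) \<longlonglongrightarrow> prob (\<Inter>n. {\<omega>\<in>space M. \<bar>D \<omega>\<bar> > real n})"
    by (rule finite_Lim_measure_decseq) (auto simp: decseq_def)
  moreover have "(\<Inter>n. {\<omega>\<in>space M. \<bar>D \<omega>\<bar> > real n}) = {}"
  proof safe
    fix \<omega> assume *: "\<omega> \<in> (\<Inter>n. {\<omega>\<in>space M. \<bar>D \<omega>\<bar> > real n})"
    obtain n where "\<bar>D \<omega>\<bar> < real n" using reals_Archimedean2 by blast
    moreover have "real n < \<bar>D \<omega>\<bar>" using * by blast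
    ultimately have False by simp
    then show "\<omega> \<in> {}" ..
  qed
  ultimately have "(\<lambda>n. prob {\<omega>\<in>space M. \<bar>D \<omega>\<bar> > real n}) \<longlonglongrightarrow> 0" by simp
  then have "\<forall>\<^sub>F n in sequentially. prob {\<omega>\<in>space M. \<bar>D \<omega>\<bar> > real n} < d"
    using \<open>d > 0\<close> by (rule order_tendstoD)
  then obtain n where n: "\<And>k. k \<ge> n \<Longrightarrow> prob {\<omega>\<in>space M. \<bar>D \<omega>\<bar> > real k} < d"
    by (auto simp: eventually_sequentially)
  then show ?thesis by (intro exI[of _ "real (Suc n)"]) (use n[of "Suc n"] in auto)
qed

text \<open>A single random variable is bounded by a constant off an event of small probability, so
  \<open>D\<close> needs neither bounds nor moments.\<close>

lemma tends_in_prob_mult_rv: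
  assumes f: "tends_in_prob f L X" and [measurable]: "D \<in> borel_measurable M"
  shows "tends_in_prob (\<lambda>x \<omega>. f x \<omega> * D \<omega>) (\<lambda>\<omega>. L \<omega> * D \<omega>) X"
proof (rule tends_in_probI)
  have [measurable]: "L \<in> borel_measurable M" using f by (auto simp: tends_in_prob_def)
  show "(\<lambda>\<omega>. L \<omega> * D \<omega>) \<in> borel_measurable M" by measurable
  show "\<forall>\<^sub>F x in X. (\<lambda>\<omega>. f x \<omega> * D \<omega>) \<in> borel_measurable M"
    using f unfolding tends_in_prob_def by (auto elim: eventually_mono)
  fix e d :: real assume "e > 0" "d > 0"
  obtain K where K: "K > 0" "prob {\<omega>\<in>space M. \<bar>D \<omega>\<bar> > K} < d / 2"
    using prob_abs_gt_small[of D "d / 2"] \<open>d > 0\<close> by auto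
  have "\<forall>\<^sub>F x in X. f x \<in> borel_measurable M \<and> prob {\<omega>\<in>space M. \<bar>f x \<omega> - L \<omega>\<bar> > e / K} < d / 2"
    using \<open>e > 0\<close> \<open>d > 0\<close> K by (intro tends_in_prob_ev[OF f]) auto
  then show "\<forall>\<^sub>F x in X. prob {\<omega>\<in>space M. \<bar>f x \<omega> * D \<omega> - L \<omega> * D \<omega>\<bar> > e} < d"
  proof (elim eventually_mono)
    fix x assume 1: "f x \<in> borel_measurable M \<and> prob {\<omega>\<in>space M. \<bar>f x \<omega> - L \<omega>\<bar> > e / K} < d / 2"
    then have [measurable]: "f x \<in> borel_measurable M" by auto
    have "prob {\<omega>\<in>space M. \<bar>f x \<omega> * D \<omega> - L \<omega> * D \<omega>\<bar> > e} \<le>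
      prob ({\<omega>\<in>space M. \<bar>f x \<omega> - L \<omega>\<bar> > e / K} \<union> {\<omega>\<in>space M. \<bar>D \<omega>\<bar> > K})"
    proof (rule finite_measure_mono)
      show "{\<omega>\<in>space M. \<bar>f x \<omega> * D \<omega> - L \<omega> * D \<omega>\<bar> > e} \<subseteq>
        {\<omega>\<in>space M. \<bar>f x \<omega> - L \<omega>\<bar> > e / K} \<union> {\<omega>\<in>space M. \<bar>D \<omega>\<bar> > K}"
      proof safe
        fix \<omega> assume "e < \<bar>f x \<omega> * D \<omega> - L \<omega> * D \<omega>\<bar>" "\<not> K < \<bar>D \<omega>\<bar>"
        then have "e < \<bar>f x \<omega> - L \<omega>\<bar> * \<bar>D \<omega>\<bar>" by (simp add: abs_mult[symmetric] left_diff_distrib)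
        also have "\<dots> \<le> \<bar>f x \<omega> - L \<omega>\<bar> * K"
          using \<open>\<not> K < \<bar>D \<omega>\<bar>\<close> by (intro mult_left_mono) auto
        finally show "e / K < \<bar>f x \<omega> - L \<omega>\<bar>" using K by (simp add: field_simps)
      qed
    qed measurable
    also have "\<dots> \<le> prob {\<omega>\<in>space M. \<bar>f x \<omega> - L \<omega>\<bar> > e / K} + prob {\<omega>\<in>space M. \<bar>D \<omega>\<bar> > K}"
      by (rule measure_Un_le) measurable
    finally show "prob {\<omega>\<in>space M. \<bar>f x \<omega> * D \<omega> - L \<omega> * D \<omega>\<bar> > e} < d" using 1 K by linarith
  qed
qed

lemma tends_in_prob_cmult:
  "tends_in_prob f L X \<Longrightarrow> tends_in_prob (\<lambda>x \<omega>. a * f x \<omega>) (\<lambda>\<omega>. a * L \<omega>) X"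
  using tends_in_prob_mult_rv[of f L X "\<lambda>_. a"] by (simp add: mult.commute)

lemma tends_in_prob_diff:
  "tends_in_prob f L X \<Longrightarrow> tends_in_prob g K X \<Longrightarrow>
    tends_in_prob (\<lambda>x \<omega>. f x \<omega> - g x \<omega>) (\<lambda>\<omega>. L \<omega> - K \<omega>) X"
  using tends_in_prob_add[of f L X "\<lambda>x \<omega>. - 1 * g x \<omega>" "\<lambda>\<omega>. - 1 * K \<omega>"] tends_in_prob_cmult[of g K X "-1"]
  by simp

lemma tends_in_prob_unique:
  assumes f: "tends_in_prob f L X" and g: "tends_in_prob f K X" and X: "X \<noteq> bot"
  shows "AE \<omega> in M. L \<omega> = K \<omega>"
proof -
  have [measurable]: "L \<in> borel_measurable M" "K \<in> borel_measurable M"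
    using f g by (auto simp: tends_in_prob_def)
  have "prob {\<omega>\<in>space M. \<bar>L \<omega> - K \<omega>\<bar> > e} = 0" if "e > 0" for e
  proof (rule ccontr)
    assume "prob {\<omega>\<in>space M. \<bar>L \<omega> - K \<omega>\<bar> > e} \<noteq> 0"
    then have d: "prob {\<omega>\<in>space M. \<bar>L \<omega> - K \<omega>\<bar> > e} > 0" (is "?p > 0") by (simp add: zero_less_measure_iff)
    have "\<forall>\<^sub>F x in X. (f x \<in> borel_measurable M \<and> prob {\<omega>\<in>space M. \<bar>f x \<omega> - L \<omega>\<bar> > e / 2} < ?p / 2)
      \<and> (f x \<in> borel_measurable M \<and> prob {\<omega>\<in>space M. \<bar>f x \<omega> - K \<omega>\<bar> > e / 2} < ?p / 2)"
      using d \<open>e > 0\<close>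
      by (intro eventually_conj[OF tends_in_prob_ev[OF f] tends_in_prob_ev[OF g]]) auto
    from eventually_happens[OF this] X obtain x where
      [measurable]: "f x \<in> borel_measurable M" and p: "prob {\<omega>\<in>space M. \<bar>f x \<omega> - L \<omega>\<bar> > e / 2} < ?p / 2"
        "prob {\<omega>\<in>space M. \<bar>f x \<omega> - K \<omega>\<bar> > e / 2} < ?p / 2" by blast
    have "prob {\<omega>\<in>space M. \<bar>L \<omega> - K \<omega>\<bar> > e / 2 + e / 2} \<le>
       prob {\<omega>\<in>space M. \<bar>f x \<omega> - L \<omega>\<bar> > e / 2} + prob {\<omega>\<in>space M. \<bar>f x \<omega> - K \<omega>\<bar> > e / 2}"
      by (rule prob_abs_add_le) auto
    with p show False by auto
  qed
  then have "AE \<omega> in M. \<not> \<bar>L \<omega> - K \<omega>\<bar> > e" if "e > 0" for e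
    using that by (subst AE_iff_measurable[OF _ refl]) (auto simp: emeasure_eq_measure)
  then have "AE \<omega> in M. \<forall>n. \<not> \<bar>L \<omega> - K \<omega>\<bar> > 1 / real (Suc n)"
    by (subst AE_all_countable) auto
  then show ?thesis
  proof eventually_elim
    case (elim \<omega>)
    show "L \<omega> = K \<omega>"
    proof (rule ccontr)
      assume "L \<omega> \<noteq> K \<omega>"
      then have "\<bar>L \<omega> - K \<omega>\<bar> > 0" by simp
      then obtain n where "1 / real (Suc n) < \<bar>L \<omega> - K \<omega>\<bar>" using nat_approx_posE by blast
      then show False using elim by blast
    qed
  qed
qed

text \<open>Carries a probability bound through a limit at the price of doubling the threshold. This
  is how estimates uniform in an approximation reach the limit object.\<close>

lemma tends_in_prob_le:
  assumes f: "tends_in_prob f L X" and X: "X \<noteq> bot" and [measurable]: "A \<in> borel_measurable M"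
    and e: "e > 0" "\<forall>\<^sub>F x in X. prob {\<omega>\<in>space M. \<bar>f x \<omega> - A \<omega>\<bar> > e} \<le> d"
  shows "prob {\<omega>\<in>space M. \<bar>L \<omega> - A \<omega>\<bar> > 2 * e} \<le> d"
proof -
  have [measurable]: "L \<in> borel_measurable M" using f by (auto simp: tends_in_prob_def)
  have lim: "((\<lambda>x. prob {\<omega>\<in>space M. \<bar>f x \<omega> - L \<omega>\<bar> > e} + d) \<longlongrightarrow> 0 + d) X"
    by (intro tendsto_intros tends_in_probD[OF f e(1)])
  have mf: "\<forall>\<^sub>F x in X. f x \<in> borel_measurable M" using f by (auto simp: tends_in_prob_def)
  have "\<forall>\<^sub>F x in X. prob {\<omega>\<in>space M. \<bar>L \<omega> - A \<omega>\<bar> > 2 * e} \<le> prob {\<omega>\<in>space M. \<bar>f x \<omega> - L \<omega>\<bar> > e} + d"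
    using e(2) mf
  proof eventually_elim
    case 1: (elim x)
    then have [measurable]: "f x \<in> borel_measurable M" by simp
    have "prob {\<omega>\<in>space M. \<bar>L \<omega> - A \<omega>\<bar> > e + e} \<le>
       prob {\<omega>\<in>space M. \<bar>f x \<omega> - L \<omega>\<bar> > e} + prob {\<omega>\<in>space M. \<bar>f x \<omega> - A \<omega>\<bar> > e}"
      by (rule prob_abs_add_le) auto
    with 1 show "prob {\<omega>\<in>space M. \<bar>L \<omega> - A \<omega>\<bar> > 2 * e} \<le> prob {\<omega>\<in>space M. \<bar>f x \<omega> - L \<omega>\<bar> > e} + d"
      by simp
  qed
  from tendsto_lowerbound[OF lim this X] show ?thesis by simp
qed

text \<open>Dominated convergence for the indicators of the exceptional events.\<close>

lemma tends_in_prob_pointwise: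
  fixes f :: "nat \<Rightarrow> 'a \<Rightarrow> real"
  assumes [measurable]: "\<And>n. f n \<in> borel_measurable M" and "L \<in> borel_measurable M"
    and lim: "AE \<omega> in M. (\<lambda>n. f n \<omega>) \<longlonglongrightarrow> L \<omega>"
  shows "tends_in_prob f L sequentially"
  unfolding tends_in_prob_def
proof (intro conjI allI impI)
  fix e :: real assume e: "e > 0"
  note [measurable] = \<open>L \<in> borel_measurable M\<close>
  let ?S = "\<lambda>n. {\<omega>\<in>space M. \<bar>f n \<omega> - L \<omega>\<bar> > e}"
  have "(\<lambda>n. \<integral>\<omega>. indicator (?S n) \<omega> \<partial>M) \<longlonglongrightarrow> (\<integral>\<omega>. (0::real) \<partial>M)"
  proof (rule integral_dominated_convergence[where w="\<lambda>_. 1"])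
    show "AE \<omega> in M. (\<lambda>n. indicator (?S n) \<omega> :: real) \<longlonglongrightarrow> 0"
      using lim
    proof eventually_elim
      case (elim \<omega>)
      then have "(\<lambda>n. \<bar>f n \<omega> - L \<omega>\<bar>) \<longlonglongrightarrow> 0" by (simp add: LIM_zero tendsto_rabs_zero)
      then have "\<forall>\<^sub>F n in sequentially. \<bar>f n \<omega> - L \<omega>\<bar> < e" using e by (rule order_tendstoD)
      then have "\<forall>\<^sub>F n in sequentially. indicator (?S n) \<omega> = (0::real)"
        by (elim eventually_mono) (auto simp: indicator_def)
      then show ?case by (rule tendsto_eventually)
    qed
  qed (auto simp: indicator_def)
  then show "(\<lambda>n. prob (?S n)) \<longlonglongrightarrow> 0" by simp
qed (use assms in auto)

lemma prob_abs_gt_le_expectation: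
  assumes "integrable M (\<lambda>\<omega>. \<bar>X \<omega>\<bar>)" "e > 0"
  shows "prob {\<omega>\<in>space M. \<bar>X \<omega>\<bar> > e} \<le> expectation (\<lambda>\<omega>. \<bar>X \<omega>\<bar>) / (e::real)"
proof -
  have [measurable]: "(\<lambda>\<omega>. \<bar>X \<omega>\<bar>) \<in> borel_measurable M" using assms(1) by auto
  have "prob {\<omega>\<in>space M. \<bar>X \<omega>\<bar> > e} \<le> prob {\<omega>\<in>space M. \<bar>X \<omega>\<bar> \<ge> e}"
    by (rule finite_measure_mono) (auto simp del: borel_measurable_abs)
  also have "\<dots> \<le> expectation (\<lambda>\<omega>. \<bar>X \<omega>\<bar>) / e"
    using integral_Markov_inequality_measure[OF assms(1), of "{}" e] assms(2) by auto
  finally show ?thesis .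
qed

lemma prob_abs_gt_le_second_moment:
  assumes "integrable M (\<lambda>\<omega>. (X \<omega>)\<^sup>2)" "e > 0"
  shows "prob {\<omega>\<in>space M. \<bar>X \<omega>\<bar> > e} \<le> expectation (\<lambda>\<omega>. (X \<omega>)\<^sup>2) / (e::real)\<^sup>2"
proof -
  have "{\<omega>\<in>space M. \<bar>X \<omega>\<bar> > e} = {\<omega>\<in>space M. \<bar>(X \<omega>)\<^sup>2\<bar> > e\<^sup>2}"
    using assms(2) abs_le_square_iff[of _ e] by (auto simp: not_le[symmetric])
  then show ?thesis using prob_abs_gt_le_expectation[of "\<lambda>\<omega>. (X \<omega>)\<^sup>2" "e\<^sup>2"] assms by auto
qed

end

lemma integrable_mult_of_squares:
  fixes f g :: "'a \<Rightarrow> real"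
  assumes "f \<in> borel_measurable M" "g \<in> borel_measurable M"
    "integrable M (\<lambda>x. (f x)\<^sup>2)" "integrable M (\<lambda>x. (g x)\<^sup>2)"
  shows "integrable M (\<lambda>x. f x * g x)"
proof (rule Bochner_Integration.integrable_bound)
  show "integrable M (\<lambda>x. (f x)\<^sup>2 + (g x)\<^sup>2)" using assms by auto
  show "AE x in M. norm (f x * g x) \<le> norm ((f x)\<^sup>2 + (g x)\<^sup>2)"
  proof (intro always_eventually allI)
    fix x
    have "2 * (\<bar>f x\<bar> * \<bar>g x\<bar>) \<le> (f x)\<^sup>2 + (g x)\<^sup>2"
      using sum_squares_bound[of "\<bar>f x\<bar>" "\<bar>g x\<bar>"] by (simp add: mult.assoc)
    moreover have "0 \<le> \<bar>f x\<bar> * \<bar>g x\<bar>" by simp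
    ultimately show "norm (f x * g x) \<le> norm ((f x)\<^sup>2 + (g x)\<^sup>2)"
      unfolding real_norm_def abs_mult by linarith
  qed
  show "(\<lambda>x. f x * g x) \<in> borel_measurable M" using assms by auto
qed

context brownian_setting
begin

text \<open>Increments carrying a predictable factor are orthogonal, also for different indices over the
  same interval: a product of two of them is centred in its last increment.\<close>

lemma incr_sum_second_moment:
  fixes g :: "real \<Rightarrow> real" and \<eta> :: "'i \<Rightarrow> nat \<Rightarrow> 'a \<Rightarrow> real"
  assumes t0: "0 \<le> t 0" and tm: "\<And>i. i < m \<Longrightarrow> t i < t (Suc i)"
    and R: "finite R" "R \<subseteq> I" and g[measurable]: "g \<in> borel_measurable borel"
    and gm: "\<And>i q. i < m \<Longrightarrow> q \<in> R \<Longrightarrow> integrable M (\<lambda>\<omega>. g (incr q (t i) (t (Suc i)) \<omega>)) \<and>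
        expectation (\<lambda>\<omega>. g (incr q (t i) (t (Suc i)) \<omega>)) = 0 \<and>
        integrable M (\<lambda>\<omega>. (g (incr q (t i) (t (Suc i)) \<omega>))\<^sup>2) \<and>
        expectation (\<lambda>\<omega>. (g (incr q (t i) (t (Suc i)) \<omega>))\<^sup>2) = v i"
    and \<eta>: "\<And>i q. i < m \<Longrightarrow> q \<in> R \<Longrightarrow> \<eta> q i \<in> borel_measurable (past (t i) (t (Suc i)) (I - R)) \<and>
        integrable M (\<lambda>\<omega>. (\<eta> q i \<omega>)\<^sup>2)"
  shows "integrable M (\<lambda>\<omega>. (\<Sum>i<m. \<Sum>q\<in>R. \<eta> q i \<omega> * g (incr q (t i) (t (Suc i)) \<omega>))\<^sup>2)" (is ?int)
    "expectation (\<lambda>\<omega>. (\<Sum>i<m. \<Sum>q\<in>R. \<eta> q i \<omega> * g (incr q (t i) (t (Suc i)) \<omega>))\<^sup>2) =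
       (\<Sum>i<m. \<Sum>q\<in>R. expectation (\<lambda>\<omega>. (\<eta> q i \<omega>)\<^sup>2) * v i)" (is ?eq)
proof -
  define G where "G = (\<lambda>i q \<omega>. g (incr q (t i) (t (Suc i)) \<omega>))"
  define \<xi> where "\<xi> = (\<lambda>(i, q) \<omega>. \<eta> q i \<omega> * G i q \<omega>)"
  define A where "A = {..<m} \<times> R"
  have tpos: "0 \<le> t i" if "i \<le> m" for i
    using that
  proof (induction i)
    case (Suc i) then show ?case using tm[of i] by auto
  qed (use t0 in simp)
  have tmono: "t i \<le> t j" if "i \<le> j" "j \<le> m" for i j
    using that
  proof (induction j)
    case (Suc j) then show ?case using tm[of j] by (cases "i = Suc j") auto
  qed simp
  have G_past: "G i q \<in> borel_measurable (past (t i) (t (Suc i)) Q)" if "q \<in> Q" for i q Q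
    unfolding G_def using measurable_compose[OF measurable_past_incr[OF that] g] by simp
  \<comment> \<open>The factors may contain increments over the current interval of indices outside
    \<open>R\<close>; the off-diagonal estimate below uses this for the increment of
    \<open>W r\<close>.\<close>
  have \<eta>_past: "\<eta> q i \<in> borel_measurable (past (t i) (t (Suc i)) Q)" if "i < m" "q \<in> R" "I - R \<subseteq> Q" for i q Q
    using \<eta>[OF that(1,2)] measurable_past_mono that(3) by blast
  have \<xi>_F: "\<xi> (i, q) \<in> borel_measurable (F (t (Suc i)))" if "i < m" "q \<in> R" for i q
  proof -
    have "(\<lambda>\<omega>. \<eta> q i \<omega> * G i q \<omega>) \<in> borel_measurable (past (t i) (t (Suc i)) I)"
      by (rule borel_measurable_times[OF \<eta>_past G_past]) (use that R in auto)
    then have "\<xi> (i, q) \<in> borel_measurable (past (t i) (t (Suc i)) I)" by (simp add: \<xi>_def)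
    from measurable_past_imp_F[OF this] show ?thesis
      using tpos[of i] tm[of i] that by auto
  qed
  have \<xi>_M: "\<xi> a \<in> borel_measurable M" if "a \<in> A" for a
    using \<xi>_F that measurable_F_M by (cases a) (auto simp: A_def)
  have sq: "integrable M (\<lambda>\<omega>. (\<xi> (i, q) \<omega>)\<^sup>2)"
    "expectation (\<lambda>\<omega>. (\<xi> (i, q) \<omega>)\<^sup>2) = expectation (\<lambda>\<omega>. (\<eta> q i \<omega>)\<^sup>2) * v i"
    if iq: "i < m" "q \<in> R" for i q
  proof -
    have *: "(\<lambda>\<omega>. (\<eta> q i \<omega>)\<^sup>2) \<in> borel_measurable (past (t i) (t (Suc i)) (I - R))"
      using \<eta>[OF iq] by (intro borel_measurable_power) auto
    note ** = past_incr_expectation[of q "I - R" "t i" "t (Suc i)", OF _ _ _ _ *, where g="\<lambda>x. (g x)\<^sup>2"]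
    show "integrable M (\<lambda>\<omega>. (\<xi> (i, q) \<omega>)\<^sup>2)"
      "expectation (\<lambda>\<omega>. (\<xi> (i, q) \<omega>)\<^sup>2) = expectation (\<lambda>\<omega>. (\<eta> q i \<omega>)\<^sup>2) * v i"
      unfolding \<xi>_def G_def power_mult_distrib prod.case
      using **[OF _ _ _ _ ] \<eta>[OF iq] gm[OF iq] iq R tpos[of i] tm[of i] by (auto simp: subset_iff)
  qed
  have int: "integrable M (\<lambda>\<omega>. \<xi> a \<omega> * \<xi> b \<omega>)" if "a \<in> A" "b \<in> A" for a b
    using that sq(1) \<xi>_M by (intro integrable_mult_of_squares) (auto simp: A_def)
  have orth: "expectation (\<lambda>\<omega>. \<xi> (i, q) \<omega> * \<xi> (j, p) \<omega>) = 0"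
    if ij: "i \<le> j" "j < m" "q \<in> R" "p \<in> R" "(i, q) \<noteq> (j, p)" for i q j p
  proof -
    define X where "X = (\<lambda>\<omega>. \<xi> (i, q) \<omega> * \<eta> p j \<omega>)"
    have \<xi>p: "\<xi> (i, q) \<in> borel_measurable (past (t j) (t (Suc j)) (I - {p}))"
    \<comment> \<open>Over the same interval the indices differ, and the increment of
      \<open>q\<close> belongs to the past without \<open>p\<close>; over an earlier interval the
      whole product is already known at time \<open>t j\<close>.\<close>
    proof (cases "i = j")
      case True
      have "(\<lambda>\<omega>. \<eta> q i \<omega> * G i q \<omega>) \<in> borel_measurable (past (t i) (t (Suc i)) (I - {p}))"
        by (rule borel_measurable_times[OF \<eta>_past G_past]) (use True ij R in auto)
      then show ?thesis using True by (simp add: \<xi>_def)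
    next
      case False
      then have "\<xi> (i, q) \<in> borel_measurable (F (t j))"
        using measurable_F_mono[OF \<xi>_F[of i q] tmono[of "Suc i" j]] ij by auto
      then show ?thesis by (rule measurable_past_F)
    qed
    have \<eta>p: "\<eta> p j \<in> borel_measurable (past (t j) (t (Suc j)) (I - {p}))"
      using \<eta>_past[of j p "I - {p}"] ij by auto
    have Xm: "X \<in> borel_measurable (past (t j) (t (Suc j)) (I - {p}))"
      unfolding X_def using \<xi>p \<eta>p by auto
    have \<eta>M: "\<eta> p j \<in> borel_measurable M"
      using measurable_F_M[OF measurable_past_imp_F[OF \<eta>p]] tpos[of j] tm[of j] ij by auto
    have Xi: "integrable M X"
      unfolding X_def using \<eta>[of j p] ij sq(1)[of i q] \<xi>_M[of "(i, q)"] \<eta>M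
      by (intro integrable_mult_of_squares) (auto simp: A_def)
    have "expectation (\<lambda>\<omega>. X \<omega> * g (incr p (t j) (t (Suc j)) \<omega>)) =
        expectation X * expectation (\<lambda>\<omega>. g (incr p (t j) (t (Suc j)) \<omega>))"
      using past_incr_expectation(2)[OF _ _ _ _ Xm Xi g, of p] gm[of j p] ij R tpos[of j] tm[of j]
      by auto
    then show ?thesis using gm[of j p] ij by (simp add: X_def \<xi>_def G_def mult.assoc)
  qed
  have orth': "expectation (\<lambda>\<omega>. \<xi> a \<omega> * \<xi> b \<omega>) = 0" if ab: "a \<in> A" "b \<in> A" "a \<noteq> b" for a b
  proof (cases "fst a \<le> fst b")
    case True
    then show ?thesis using orth[of "fst a" "fst b" "snd a" "snd b"] ab by (auto simp: A_def)
  next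
    case False
    then show ?thesis using orth[of "fst b" "fst a" "snd b" "snd a"] ab
      by (auto simp: A_def mult.commute)
  qed
  have eq: "(\<Sum>i<m. \<Sum>q\<in>R. \<eta> q i \<omega> * g (incr q (t i) (t (Suc i)) \<omega>)) = (\<Sum>a\<in>A. \<xi> a \<omega>)" for \<omega>
    unfolding A_def \<xi>_def G_def sum.cartesian_product by (rule sum.cong) auto
  have fin: "finite A" unfolding A_def using R by auto
  show ?int unfolding eq using orthogonal_sum_second_moment(1)[OF fin int orth'] .
  have "expectation (\<lambda>\<omega>. (\<Sum>a\<in>A. \<xi> a \<omega>)\<^sup>2) = (\<Sum>a\<in>A. expectation (\<lambda>\<omega>. (\<xi> a \<omega>)\<^sup>2))"
    using orthogonal_sum_second_moment(2)[OF fin int orth'] .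
  also have "\<dots> = (\<Sum>(i, q)\<in>A. expectation (\<lambda>\<omega>. (\<eta> q i \<omega>)\<^sup>2) * v i)"
    using sq(2) by (intro sum.cong) (auto simp: A_def)
  finally show ?eq unfolding eq by (simp add: A_def sum.cartesian_product)
qed

end

section \<open>Covariation with a series of Ito integrals\<close>

text \<open>Truncation supplies the second moments that continuity and adaptedness alone do not
  give.\<close>

definition clip :: "real \<Rightarrow> real \<Rightarrow> real" where
  "clip N x = max (- N) (min N x)"

lemma abs_clip_le: "0 \<le> N \<Longrightarrow> \<bar>clip N x\<bar> \<le> N"
  by (auto simp: clip_def)

lemma clip_id: "\<bar>x\<bar> \<le> N \<Longrightarrow> clip N x = x"
  by (auto simp: clip_def)

lemma measurable_clip [measurable]: "clip N \<in> borel_measurable borel"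
  unfolding clip_def by measurable

lemma (in prob_space) bounded_second_moment:
  fixes X :: "'a \<Rightarrow> real"
  assumes [measurable]: "X \<in> borel_measurable M" and b: "\<And>\<omega>. \<omega> \<in> space M \<Longrightarrow> \<bar>X \<omega>\<bar> \<le> b"
  shows "integrable M (\<lambda>\<omega>. (X \<omega>)\<^sup>2)" "expectation (\<lambda>\<omega>. (X \<omega>)\<^sup>2) \<le> b\<^sup>2"
proof -
  have le: "(X \<omega>)\<^sup>2 \<le> b\<^sup>2" if "\<omega> \<in> space M" for \<omega>
    using power_mono[OF b[OF that], of 2] by simp
  show i: "integrable M (\<lambda>\<omega>. (X \<omega>)\<^sup>2)"
    by (rule integrable_const_bound[where B="b\<^sup>2"]) (use le in auto)
  show "expectation (\<lambda>\<omega>. (X \<omega>)\<^sup>2) \<le> b\<^sup>2"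
    using integral_mono[OF i _ le] by (auto simp: prob_space)
qed

lemma sum_lessThan_add: "(\<Sum>k<a + n. f k) = (\<Sum>k<a. f k) + (\<Sum>j<n. f (a + j))"
  for f :: "nat \<Rightarrow> 'b::comm_monoid_add"
  by (induction n) (auto simp: add.assoc)

text \<open>The noise terms at a fixed point: \<open>G\<close> collects the values and first
  derivatives of the unknown fields there, \<open>c\<close> the values of the noise fields and their
  gradients. Since only finitely many processes are involved, one bound and one modulus of
  continuity serve all modes, and \<open>c_sq\<close> sums the errors over the modes.\<close>

locale linear_integrands = brownian_setting M F I W
  for M :: "'a measure" and F :: "real \<Rightarrow> 'a measure" and I :: "'i set"
    and W :: "'i \<Rightarrow> real \<Rightarrow> 'a \<Rightarrow> real" +
  fixes T :: real and L :: "'l set" and c :: "'i \<Rightarrow> 'l \<Rightarrow> real" and G :: "'l \<Rightarrow> real \<Rightarrow> 'a \<Rightarrow> real"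
  assumes finite_L: "finite L" and G_ac: "\<And>l. l \<in> L \<Longrightarrow> adapted_continuous M F T (G l)"
    and c_sq: "(\<lambda>q. (\<Sum>l\<in>L. \<bar>c q l\<bar>)\<^sup>2) summable_on I"
begin

definition Y :: "'i \<Rightarrow> real \<Rightarrow> 'a \<Rightarrow> real" where
  "Y q t \<omega> = (\<Sum>l\<in>L. c q l * G l t \<omega>)"

definition k :: "'i \<Rightarrow> real" where "k q = (\<Sum>l\<in>L. \<bar>c q l\<bar>)"

definition k_sq_sum :: real where "k_sq_sum = (\<Sum>\<^sub>\<infinity>q\<in>I. (k q)\<^sup>2)"

lemma sum_k_le: "finite R \<Longrightarrow> R \<subseteq> I \<Longrightarrow> (\<Sum>q\<in>R. (k q)\<^sup>2) \<le> k_sq_sum"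
  unfolding k_sq_sum_def using c_sq by (intro finite_sum_le_infsum) (auto simp: k_def)

lemma k_sq_sum_nonneg: "0 \<le> k_sq_sum" using sum_k_le[of "{}"] by simp

lemma G_measurable_F: "l \<in> L \<Longrightarrow> 0 \<le> t \<Longrightarrow> t \<le> T \<Longrightarrow> G l t \<in> borel_measurable (F t)"
  using G_ac by (auto simp: adapted_continuous_def)

lemma G_measurable: "l \<in> L \<Longrightarrow> 0 \<le> t \<Longrightarrow> t \<le> T \<Longrightarrow> G l t \<in> borel_measurable M"
  using G_measurable_F measurable_F_M by blast

lemma Y_measurable: "0 \<le> t \<Longrightarrow> t \<le> T \<Longrightarrow> Y q t \<in> borel_measurable M"
  unfolding Y_def using G_measurable by (intro borel_measurable_sum borel_measurable_times) auto

lemma abs_weighted_sum_le: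
  assumes "\<And>l. l \<in> L \<Longrightarrow> \<bar>x l\<bar> \<le> b" shows "\<bar>\<Sum>l\<in>L. c q l * x l\<bar> \<le> k q * b"
proof -
  have "\<bar>\<Sum>l\<in>L. c q l * x l\<bar> \<le> (\<Sum>l\<in>L. \<bar>c q l\<bar> * \<bar>x l\<bar>)"
    using sum_abs[of "\<lambda>l. c q l * x l" L] by (simp add: abs_mult)
  also have "\<dots> \<le> (\<Sum>l\<in>L. \<bar>c q l\<bar> * b)" by (intro sum_mono mult_left_mono assms) auto
  finally show ?thesis by (simp add: k_def sum_distrib_right)
qed

text \<open>Sampling at rational multiples of \<open>t\<close> makes the exceptional events
  countable unions, hence measurable. It suffices because only points of uniform partitions of
  \<open>[0, t]\<close> are ever evaluated.\<close>

definition large_values :: "real \<Rightarrow> real \<Rightarrow> 'a set" where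
  "large_values t N = (\<Union>l\<in>L. \<Union>x\<in>\<rat> \<inter> {0..1}. {\<omega>\<in>space M. \<bar>G l (t * x) \<omega>\<bar> > N})"

definition large_oscillation :: "real \<Rightarrow> real \<Rightarrow> real \<Rightarrow> 'a set" where
  "large_oscillation t \<delta> h = (\<Union>l\<in>L. \<Union>x\<in>\<rat> \<inter> {0..1}. \<Union>y\<in>\<rat> \<inter> {0..1} \<inter> {y. \<bar>x - y\<bar> \<le> h}.
     {\<omega>\<in>space M. \<bar>G l (t * x) \<omega> - G l (t * y) \<omega>\<bar> > \<delta>})"

lemma countable_rat_unit: "countable (\<rat> \<inter> {0..1::real} \<inter> A)" "countable (\<rat> \<inter> {0..1::real})"
  using countable_rat by (auto intro: countable_subset)

lemma scaled_unit: "0 \<le> t \<Longrightarrow> t \<le> T \<Longrightarrow> x \<in> {0..1} \<Longrightarrow> 0 \<le> t * x \<and> t * x \<le> T"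
  using mult_mono[of t T x 1] by auto

lemma large_values_measurable:
  assumes t: "0 \<le> t" "t \<le> T" shows "large_values t N \<in> sets M"
  unfolding large_values_def
proof (intro sets.countable_UN'' sets.finite_UN countable_rat_unit finite_L)
  fix l x :: _ and y :: real assume "x \<in> L" "y \<in> \<rat> \<inter> {0..1}"
  then have [measurable]: "G x (t * y) \<in> borel_measurable M"
    using scaled_unit[OF t, of y] G_measurable by auto
  show "{\<omega>\<in>space M. \<bar>G x (t * y) \<omega>\<bar> > N} \<in> sets M" by measurable
qed (use finite_L countable_finite in auto)

lemma large_oscillation_measurable:
  assumes t: "0 \<le> t" "t \<le> T" shows "large_oscillation t \<delta> h \<in> sets M"
  unfolding large_oscillation_def
proof (intro sets.countable_UN'' sets.finite_UN countable_rat_unit finite_L)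
  fix l x y assume "l \<in> L" "x \<in> \<rat> \<inter> {0..1}" "y \<in> \<rat> \<inter> {0..1} \<inter> {y. \<bar>x - y\<bar> \<le> h}"
  then have [measurable]: "G l (t * x) \<in> borel_measurable M" "G l (t * y) \<in> borel_measurable M"
    using scaled_unit[OF t, of x] scaled_unit[OF t, of y] G_measurable by auto
  show "{\<omega>\<in>space M. \<bar>G l (t * x) \<omega> - G l (t * y) \<omega>\<bar> > \<delta>} \<in> sets M" by measurable
qed (use finite_L countable_finite in auto)

lemma G_continuous: "l \<in> L \<Longrightarrow> \<omega> \<in> space M \<Longrightarrow> continuous_on {0..T} (\<lambda>t. G l t \<omega>)"
  using G_ac by (auto simp: adapted_continuous_def)

text \<open>Continuous paths are bounded on \<open>[0, T]\<close>, so the events decrease to the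
  empty set and their probabilities to 0; no rate is obtained or needed.\<close>

lemma large_values_small:
  assumes t: "0 \<le> t" "t \<le> T" and \<theta>: "\<theta> > 0"
  shows "\<exists>N>0. prob (large_values t N) < \<theta>"
proof -
  have "(\<lambda>n. prob (large_values t (real n))) \<longlonglongrightarrow> prob (\<Inter>n. large_values t (real n))"
  proof (rule finite_Lim_measure_decseq)
    show "decseq (\<lambda>n. large_values t (real n))"
      unfolding decseq_def large_values_def by (intro allI impI UN_mono) auto
  qed (use large_values_measurable[OF t] in auto)
  moreover have "(\<Inter>n. large_values t (real n)) = {}"
  proof (rule equals0I)
    fix \<omega> assume *: "\<omega> \<in> (\<Inter>n. large_values t (real n))"
    then have \<omega>: "\<omega> \<in> space M" by (auto simp: large_values_def)
    have "bounded ((\<lambda>t. G l t \<omega>) ` {0..T})" if "l \<in> L" for l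
      using compact_continuous_image[OF G_continuous[OF that \<omega>]] compact_imp_bounded by blast
    then have "\<forall>l\<in>L. \<exists>b. \<forall>s\<in>{0..T}. \<bar>G l s \<omega>\<bar> \<le> b"
      by (force simp: bounded_iff)
    then obtain b where b: "\<And>l s. l \<in> L \<Longrightarrow> s \<in> {0..T} \<Longrightarrow> \<bar>G l s \<omega>\<bar> \<le> b l" by metis
    obtain n where n: "real n > (\<Sum>l\<in>L. \<bar>b l\<bar>)" using reals_Archimedean2 by blast
    from * have "\<omega> \<in> large_values t (real n)" by blast
    then obtain l x where l: "l \<in> L" "x \<in> {0..1}" "\<bar>G l (t * x) \<omega>\<bar> > real n"
      by (auto simp: large_values_def)
    have "\<bar>G l (t * x) \<omega>\<bar> \<le> \<bar>b l\<bar>" using b[OF l(1), of "t * x"] scaled_unit[OF t l(2)] by auto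
    also have "\<dots> \<le> (\<Sum>l\<in>L. \<bar>b l\<bar>)" using l finite_L by (intro member_le_sum) auto
    finally show False using n l by auto
  qed
  ultimately have "(\<lambda>n. prob (large_values t (real n))) \<longlonglongrightarrow> 0" by simp
  from order_tendstoD(2)[OF this \<theta>] obtain n where "\<And>k. k \<ge> n \<Longrightarrow> prob (large_values t (real k)) < \<theta>"
    by (auto simp: eventually_sequentially)
  from this[of "Suc n"] show ?thesis by (intro exI[of _ "real (Suc n)"]) auto
qed

lemma large_oscillation_small:
  assumes t: "0 \<le> t" "t \<le> T" and \<theta>: "\<theta> > 0" and \<delta>: "\<delta> > 0"
  shows "\<exists>m0. \<forall>m\<ge>m0. prob (large_oscillation t \<delta> (1 / real (Suc m))) < \<theta>"
proof -
  have "(\<lambda>n. prob (large_oscillation t \<delta> (1 / real (Suc n)))) \<longlonglongrightarrow> prob (\<Inter>n. large_oscillation t \<delta> (1 / real (Suc n)))"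
  proof (rule finite_Lim_measure_decseq)
    show "range (\<lambda>n. large_oscillation t \<delta> (1 / real (Suc n))) \<subseteq> events"
      using large_oscillation_measurable[OF t] by auto
    have mono: "large_oscillation t \<delta> h \<subseteq> large_oscillation t \<delta> h'" if "h \<le> h'" for h h'
      using that unfolding large_oscillation_def by (intro UN_mono) auto
    show "decseq (\<lambda>n. large_oscillation t \<delta> (1 / real (Suc n)))"
      unfolding decseq_def by (intro allI impI mono) (simp add: frac_le)
  qed
  moreover have "(\<Inter>n. large_oscillation t \<delta> (1 / real (Suc n))) = {}"
  proof (rule equals0I)
    fix \<omega> assume *: "\<omega> \<in> (\<Inter>n. large_oscillation t \<delta> (1 / real (Suc n)))"
    then have \<omega>: "\<omega> \<in> space M" by (auto simp: large_oscillation_def)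
    have "uniformly_continuous_on {0..T} (\<lambda>t. G l t \<omega>)" if "l \<in> L" for l
      using compact_uniformly_continuous[OF G_continuous[OF that \<omega>]] by simp
    then have "\<forall>l\<in>L. \<exists>d>0. \<forall>x\<in>{0..T}. \<forall>y\<in>{0..T}. \<bar>x - y\<bar> < d \<longrightarrow> \<bar>G l x \<omega> - G l y \<omega>\<bar> < \<delta>"
      unfolding uniformly_continuous_on_def dist_real_def using \<delta> by (metis abs_minus_commute)
    then obtain d where d: "\<And>l. l \<in> L \<Longrightarrow> d l > 0"
      "\<And>l x y. l \<in> L \<Longrightarrow> x \<in> {0..T} \<Longrightarrow> y \<in> {0..T} \<Longrightarrow> \<bar>x - y\<bar> < d l \<Longrightarrow> \<bar>G l x \<omega> - G l y \<omega>\<bar> < \<delta>"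
      by metis
    \<comment> \<open>The inserted 1 keeps the minimum meaningful when \<open>L\<close> is
      empty.\<close>
    define d0 where "d0 = Min (insert 1 (d ` L))"
    have d0: "d0 > 0" "\<And>l. l \<in> L \<Longrightarrow> d0 \<le> d l" unfolding d0_def using finite_L d(1) by auto
    \<comment> \<open>Dividing by \<open>T + 1\<close> instead of \<open>T\<close> covers
      \<open>T = 0\<close>.\<close>
    have T1: "T + 1 > 0" using t by auto
    obtain n where n: "1 / real (Suc n) < d0 / (T + 1)" using nat_approx_posE[of "d0 / (T + 1)"] d0 T1 by auto
    from * have "\<omega> \<in> large_oscillation t \<delta> (1 / real (Suc n))" by blast
    then obtain l x y where l: "l \<in> L" "x \<in> {0..1}" "y \<in> {0..1}" "\<bar>x - y\<bar> \<le> 1 / real (Suc n)"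
        "\<bar>G l (t * x) \<omega> - G l (t * y) \<omega>\<bar> > \<delta>"
      unfolding large_oscillation_def by blast
    have "\<bar>t * x - t * y\<bar> = t * \<bar>x - y\<bar>" using t by (simp add: abs_mult right_diff_distrib[symmetric])
    also have "\<dots> \<le> (T + 1) * (1 / real (Suc n))" using l t by (intro mult_mono) auto
    also have "\<dots> < (T + 1) * (d0 / (T + 1))" using n T1 by (intro mult_strict_left_mono) auto
    also have "\<dots> \<le> d l" using T1 d0(2)[OF l(1)] by simp
    finally have "\<bar>G l (t * x) \<omega> - G l (t * y) \<omega>\<bar> < \<delta>"
      using d(2)[OF l(1), of "t * x" "t * y"] scaled_unit[OF t l(2)] scaled_unit[OF t l(3)] by auto
    then show False using l by auto
  qed
  ultimately have "(\<lambda>n. prob (large_oscillation t \<delta> (1 / real (Suc n)))) \<longlonglongrightarrow> 0" by simp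
  from order_tendstoD(2)[OF this \<theta>] show ?thesis by (auto simp: eventually_sequentially)
qed


text \<open>The three error terms, with clipped integrands: the oscillation of the integrands over the
  coarse blocks, the off-diagonal products of increments, and the fluctuation of the quadratic
  variation of \<open>W r\<close>.\<close>

lemma oscillation_block_second_moment:
  assumes R: "finite R" "R \<subseteq> I" and \<delta>: "0 \<le> \<delta>" and \<tau>: "0 < \<tau>" and a: "real (a + n) * \<tau> \<le> T"
    and s: "s = (\<lambda>j. real j * \<tau>)"
    and e: "e = (\<lambda>\<omega>. \<Sum>j<n. \<Sum>q\<in>R. (\<Sum>l\<in>L. c q l * clip \<delta> (G l (s (a + j)) \<omega> - G l (s a) \<omega>)) *
      incr q (s (a + j)) (s (Suc (a + j))) \<omega>)"
  shows "integrable M (\<lambda>\<omega>. (e \<omega>)\<^sup>2)" "expectation (\<lambda>\<omega>. (e \<omega>)\<^sup>2) \<le> k_sq_sum * \<delta>\<^sup>2 * (real n * \<tau>)"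
    "e \<in> borel_measurable M"
proof -
  have s0: "0 \<le> s j" and smono: "i \<le> j \<Longrightarrow> s i \<le> s j" and sS: "s j < s (Suc j)" "s (Suc j) - s j = \<tau>" for i j
    unfolding s using \<tau> by (auto intro!: mult_right_mono simp: algebra_simps)
  have sT: "s (a + j) \<le> T" if "j \<le> n" for j
    using smono[of "a + j" "a + n"] that a by (auto simp: s)
  define \<eta> where "\<eta> = (\<lambda>q j \<omega>. \<Sum>l\<in>L. c q l * clip \<delta> (G l (s (a + j)) \<omega> - G l (s a) \<omega>))"
  have \<eta>F: "\<eta> q j \<in> borel_measurable (F (s (a + j)))" if "j < n" for q j
    unfolding \<eta>_def
  proof (intro borel_measurable_sum borel_measurable_times borel_measurable_const)
    fix l assume l: "l \<in> L"
    have "(\<lambda>\<omega>. G l (s (a + j)) \<omega> - G l (s a) \<omega>) \<in> borel_measurable (F (s (a + j)))"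
      using G_measurable_F[OF l s0 sT[of j]] that
        measurable_F_mono[OF G_measurable_F[OF l s0[of a]], of "s (a + j)"] sT[of 0] smono[of a "a + j"]
      by (intro borel_measurable_diff) auto
    from measurable_compose[OF this measurable_clip[of \<delta>]]
    show "(\<lambda>\<omega>. clip \<delta> (G l (s (a + j)) \<omega> - G l (s a) \<omega>)) \<in> borel_measurable (F (s (a + j)))" .
  qed
  have \<eta>b: "\<bar>\<eta> q j \<omega>\<bar> \<le> k q * \<delta>" for q j \<omega>
    unfolding \<eta>_def by (rule abs_weighted_sum_le) (rule abs_clip_le[OF \<delta>])
  have \<eta>2: "integrable M (\<lambda>\<omega>. (\<eta> q j \<omega>)\<^sup>2)" "expectation (\<lambda>\<omega>. (\<eta> q j \<omega>)\<^sup>2) \<le> (k q * \<delta>)\<^sup>2"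
    if "j < n" for q j
    using bounded_second_moment[OF measurable_F_M[OF \<eta>F[OF that]] \<eta>b] by auto
  have gm: "integrable M (incr q (s (a + j)) (s (a + Suc j))) \<and>
      expectation (incr q (s (a + j)) (s (a + Suc j))) = 0 \<and>
      integrable M (\<lambda>\<omega>. (incr q (s (a + j)) (s (a + Suc j)) \<omega>)\<^sup>2) \<and>
      expectation (\<lambda>\<omega>. (incr q (s (a + j)) (s (a + Suc j)) \<omega>)\<^sup>2) = \<tau>" if "q \<in> R" for q j
    using incr_power_moment[of q "s (a + j)" "s (a + Suc j)"] that R s0 sS[of "a + j"] by auto
  note core = incr_sum_second_moment[where t="\<lambda>j. s (a + j)" and g="\<lambda>x. x" and v="\<lambda>_. \<tau>" and \<eta>=\<eta> and m=n,
      OF _ _ R _ _ conjI[OF measurable_past_F[OF \<eta>F] \<eta>2(1)]]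
  have e': "e \<omega> = (\<Sum>j<n. \<Sum>q\<in>R. \<eta> q j \<omega> * incr q (s (a + j)) (s (a + Suc j)) \<omega>)" for \<omega>
    by (simp add: e \<eta>_def)
  show "integrable M (\<lambda>\<omega>. (e \<omega>)\<^sup>2)"
    unfolding e' by (rule core) (use gm s0 sS in auto)
  have "expectation (\<lambda>\<omega>. (e \<omega>)\<^sup>2) = (\<Sum>j<n. \<Sum>q\<in>R. expectation (\<lambda>\<omega>. (\<eta> q j \<omega>)\<^sup>2) * \<tau>)"
    unfolding e' by (rule core) (use gm s0 sS in auto)
  also have "\<dots> \<le> (\<Sum>j<n. \<Sum>q\<in>R. (k q * \<delta>)\<^sup>2 * \<tau>)"
    using \<eta>2(2) \<tau> by (intro sum_mono mult_right_mono) auto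
  also have "\<dots> = (\<Sum>q\<in>R. (k q)\<^sup>2) * (\<delta>\<^sup>2 * (real n * \<tau>))"
    by (simp add: power_mult_distrib sum_distrib_right sum_distrib_left mult_ac)
  also have "\<dots> \<le> k_sq_sum * (\<delta>\<^sup>2 * (real n * \<tau>))"
    using sum_k_le[OF R] \<tau> by (intro mult_right_mono) auto
  finally show "expectation (\<lambda>\<omega>. (e \<omega>)\<^sup>2) \<le> k_sq_sum * \<delta>\<^sup>2 * (real n * \<tau>)" by (simp add: mult.assoc)
  have "(\<lambda>\<omega>. \<eta> q j \<omega> * incr q (s (a + j)) (s (a + Suc j)) \<omega>) \<in> borel_measurable M" if "j < n" "q \<in> R" for q j
    using measurable_F_M[OF \<eta>F[OF that(1)]] gm[OF that(2)] by (intro borel_measurable_times) auto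
  then show "e \<in> borel_measurable M"
    unfolding e'[abs_def] by (intro borel_measurable_sum) auto
qed

text \<open>\<open>R\<close> may contain \<open>r\<close>, so the block error and the increment of
  \<open>W r\<close> are not independent, and orthogonality is available only inside a block. Across
  blocks Young's inequality with weight \<open>\<delta>\<close> is used: the error has second moment
  of order \<open>\<delta>\<^sup>2\<close> times the block length, the increment that of the block
  length, so both parts sum to order \<open>\<delta> * T\<close>, whatever the partitions and
  \<open>R\<close>.\<close>

lemma oscillation_term_small:
  assumes R: "finite R" "R \<subseteq> I" and r: "r \<in> I" and \<delta>: "0 < \<delta>" and \<tau>: "0 < \<tau>"
    and n: "0 < n" and T: "real (m * n) * \<tau> \<le> T" and s: "s = (\<lambda>j. real j * \<tau>)" and \<eta>: "\<eta> > 0"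
    and E: "E = (\<lambda>\<omega>. \<Sum>i<m. (\<Sum>j<n. \<Sum>q\<in>R. (\<Sum>l\<in>L. c q l * clip \<delta> (G l (s (i * n + j)) \<omega> - G l (s (i * n)) \<omega>)) *
      incr q (s (i * n + j)) (s (Suc (i * n + j))) \<omega>) * incr r (s (i * n)) (s (i * n + n)) \<omega>)"
  shows "E \<in> borel_measurable M" "prob {\<omega>\<in>space M. \<bar>E \<omega>\<bar> > \<eta>} \<le> \<delta> * T * (k_sq_sum + 1) / (2 * \<eta>)"
proof -
  define e where "e = (\<lambda>i \<omega>. \<Sum>j<n. \<Sum>q\<in>R. (\<Sum>l\<in>L. c q l * clip \<delta> (G l (s (i * n + j)) \<omega> - G l (s (i * n)) \<omega>)) *
      incr q (s (i * n + j)) (s (Suc (i * n + j))) \<omega>)"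
  define D where "D = (\<lambda>i. incr r (s (i * n)) (s (i * n + n)))"
  have s0: "0 \<le> s j" and ss: "s j < s (j + n)" "s (j + n) - s j = real n * \<tau>" for j
    unfolding s using \<tau> n by (auto simp: algebra_simps)
  have iT: "real (i * n + n) * \<tau> \<le> T" if "i < m" for i
  proof -
    have "i * n + n \<le> m * n" using that by (metis Suc_leI add.commute mult_Suc mult_le_mono1)
    then have "real (i * n + n) * \<tau> \<le> real (m * n) * \<tau>" using \<tau>
      by (intro mult_right_mono) (simp_all only: of_nat_le_iff less_imp_le)
    then show ?thesis using T by linarith
  qed
  have eb: "integrable M (\<lambda>\<omega>. (e i \<omega>)\<^sup>2)" "expectation (\<lambda>\<omega>. (e i \<omega>)\<^sup>2) \<le> k_sq_sum * \<delta>\<^sup>2 * (real n * \<tau>)"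
    "e i \<in> borel_measurable M" if "i < m" for i
    using oscillation_block_second_moment[OF R less_imp_le[OF \<delta>] \<tau> iT[OF that] s, of "e i"]
    by (auto simp: e_def)
  have Db: "integrable M (\<lambda>\<omega>. (D i \<omega>)\<^sup>2)" "expectation (\<lambda>\<omega>. (D i \<omega>)\<^sup>2) = real n * \<tau>" "D i \<in> borel_measurable M" for i
    using incr_power_moment[OF r s0 ss(1)] ss(2) by (auto simp: D_def)
  have E': "E \<omega> = (\<Sum>i<m. e i \<omega> * D i \<omega>)" for \<omega> by (simp add: E e_def D_def)
  show EM: "E \<in> borel_measurable M"
    unfolding E'[abs_def] using eb(3) Db(3) by (intro borel_measurable_sum borel_measurable_times) auto
  define B where "B = (\<lambda>\<omega>. \<Sum>i<m. ((e i \<omega>)\<^sup>2 / \<delta> + \<delta> * (D i \<omega>)\<^sup>2) / 2)"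
  have EB: "\<bar>E \<omega>\<bar> \<le> B \<omega>" for \<omega>
  proof -
    have "\<bar>e i \<omega> * D i \<omega>\<bar> \<le> ((e i \<omega>)\<^sup>2 / \<delta> + \<delta> * (D i \<omega>)\<^sup>2) / 2" for i
    proof -
      have "0 \<le> (\<bar>e i \<omega>\<bar> - \<delta> * \<bar>D i \<omega>\<bar>)\<^sup>2 / \<delta>" using \<delta> by auto
      also have "\<dots> = (e i \<omega>)\<^sup>2 / \<delta> + \<delta> * (D i \<omega>)\<^sup>2 - 2 * \<bar>e i \<omega> * D i \<omega>\<bar>"
        using \<delta> by (simp add: power2_diff field_simps power_mult_distrib abs_mult) (simp add: power2_eq_square)
      finally show ?thesis by simp
    qed
    then show ?thesis unfolding E' B_def by (intro order_trans[OF sum_abs] sum_mono)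
  qed
  have Bi: "integrable M B" unfolding B_def using eb(1) Db(1) by auto
  have Ei: "integrable M (\<lambda>\<omega>. \<bar>E \<omega>\<bar>)"
    by (rule Bochner_Integration.integrable_bound[OF Bi]) (use EM EB in \<open>auto intro: order_trans[OF _ abs_ge_self]\<close>)
  have "expectation (\<lambda>\<omega>. \<bar>E \<omega>\<bar>) \<le> expectation B" by (rule integral_mono[OF Ei Bi EB])
  also have "\<dots> = (\<Sum>i<m. (expectation (\<lambda>\<omega>. (e i \<omega>)\<^sup>2) / \<delta> + \<delta> * expectation (\<lambda>\<omega>. (D i \<omega>)\<^sup>2)) / 2)"
    unfolding B_def using eb(1) Db(1) by (subst Bochner_Integration.integral_sum) auto
  also have "\<dots> \<le> (\<Sum>i<m. (k_sq_sum * \<delta>\<^sup>2 * (real n * \<tau>) / \<delta> + \<delta> * (real n * \<tau>)) / 2)"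
    using eb(2) Db(2) \<delta> by (intro sum_mono divide_right_mono add_mono) auto
  also have "\<dots> = \<delta> * (real (m * n) * \<tau>) * (k_sq_sum + 1) / 2"
    using \<delta> by (simp add: power2_eq_square field_simps)
  also have "\<dots> \<le> \<delta> * T * (k_sq_sum + 1) / 2"
    using T \<delta> k_sq_sum_nonneg by (intro divide_right_mono mult_right_mono mult_left_mono) auto
  finally have ex: "expectation (\<lambda>\<omega>. \<bar>E \<omega>\<bar>) \<le> \<delta> * T * (k_sq_sum + 1) / 2" .
  have "prob {\<omega>\<in>space M. \<bar>E \<omega>\<bar> > \<eta>} \<le> expectation (\<lambda>\<omega>. \<bar>E \<omega>\<bar>) / \<eta>"
    by (rule prob_abs_gt_le_expectation[OF Ei \<eta>])
  also have "\<dots> \<le> (\<delta> * T * (k_sq_sum + 1) / 2) / \<eta>" using ex \<eta> by (intro divide_right_mono) auto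
  finally show "prob {\<omega>\<in>space M. \<bar>E \<omega>\<bar> > \<eta>} \<le> \<delta> * T * (k_sq_sum + 1) / (2 * \<eta>)" by simp
qed

lemma clipped_coefficient:
  assumes t: "0 \<le> t" "t \<le> T" and N: "0 \<le> N"
  shows "(\<lambda>\<omega>. \<Sum>l\<in>L. c q l * clip N (G l t \<omega>)) \<in> borel_measurable (F t)"
    "\<bar>\<Sum>l\<in>L. c q l * clip N (G l t \<omega>)\<bar> \<le> k q * N"
proof -
  show "(\<lambda>\<omega>. \<Sum>l\<in>L. c q l * clip N (G l t \<omega>)) \<in> borel_measurable (F t)"
    using measurable_compose[OF G_measurable_F[OF _ t] measurable_clip[of N]]
    by (intro borel_measurable_sum borel_measurable_times) auto
  show "\<bar>\<Sum>l\<in>L. c q l * clip N (G l t \<omega>)\<bar> \<le> k q * N"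
    by (rule abs_weighted_sum_le) (rule abs_clip_le[OF N])
qed

text \<open>As \<open>r\<close> is not in \<open>R\<close>, the increment of \<open>W r\<close> may
  be absorbed into the predictable factor, and the summands are orthogonal. Each step has variance
  of order \<open>h\<^sup>2\<close>, so the total is of order \<open>T * h\<close>.\<close>

lemma off_diagonal_term_small:
  assumes R: "finite R" "R \<subseteq> I" "r \<notin> R" and r: "r \<in> I" and N: "0 \<le> N" and h: "0 < h"
    and T: "real m * h \<le> T" and p: "p = (\<lambda>i. real i * h)" and \<eta>: "\<eta> > 0"
    and E: "E = (\<lambda>\<omega>. \<Sum>i<m. \<Sum>q\<in>R. (\<Sum>l\<in>L. c q l * clip N (G l (p i) \<omega>)) * incr r (p i) (p (Suc i)) \<omega> *
      incr q (p i) (p (Suc i)) \<omega>)"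
  shows "E \<in> borel_measurable M" "prob {\<omega>\<in>space M. \<bar>E \<omega>\<bar> > \<eta>} \<le> k_sq_sum * N\<^sup>2 * T * h / \<eta>\<^sup>2"
proof -
  have p0: "0 \<le> p i" and pS: "p i < p (Suc i)" "p (Suc i) - p i = h" for i
    unfolding p using h by (auto simp: algebra_simps)
  have pT: "p i \<le> T" if "i \<le> m" for i
  proof -
    have "real i * h \<le> real m * h" using that h by (intro mult_right_mono) auto
    then show ?thesis using T by (simp add: p)
  qed
  have T0: "0 \<le> T" using T mult_nonneg_nonneg[of "real m" h] h by linarith
  define K where "K = (\<lambda>q i \<omega>. \<Sum>l\<in>L. c q l * clip N (G l (p i) \<omega>))"
  define D where "D = (\<lambda>i. incr r (p i) (p (Suc i)))"
  have KF: "K q i \<in> borel_measurable (F (p i))" and Kb: "\<bar>K q i \<omega>\<bar> \<le> k q * N" if "i < m" for q i \<omega>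
    using clipped_coefficient[OF p0 pT N] that by (auto simp: K_def)
  have K2: "integrable M (\<lambda>\<omega>. (K q i \<omega>)\<^sup>2)" "expectation (\<lambda>\<omega>. (K q i \<omega>)\<^sup>2) \<le> (k q * N)\<^sup>2" if "i < m" for q i
    using bounded_second_moment[OF measurable_F_M[OF KF] Kb] that by auto
  have inc: "integrable M (incr q (p i) (p (Suc i))) \<and> expectation (incr q (p i) (p (Suc i))) = 0 \<and>
      integrable M (\<lambda>\<omega>. (incr q (p i) (p (Suc i)) \<omega>)\<^sup>2) \<and>
      expectation (\<lambda>\<omega>. (incr q (p i) (p (Suc i)) \<omega>)\<^sup>2) = h" if "q \<in> I" for q i
    using incr_power_moment[OF that p0 pS(1)] pS(2) by auto
  have KD: "integrable M (\<lambda>\<omega>. (K q i \<omega> * D i \<omega>)\<^sup>2)"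
    "expectation (\<lambda>\<omega>. (K q i \<omega> * D i \<omega>)\<^sup>2) = expectation (\<lambda>\<omega>. (K q i \<omega>)\<^sup>2) * h" if "i < m" for q i
  proof -
    have *: "(\<lambda>\<omega>. (K q i \<omega>)\<^sup>2) \<in> borel_measurable (past (p i) (p (Suc i)) {})"
      using measurable_past_F[OF KF[OF that]] by (intro borel_measurable_power)
    from past_incr_expectation[OF r _ p0 pS(1) * K2(1)[OF that], of "\<lambda>x. x\<^sup>2"] inc[OF r, of i]
    show "integrable M (\<lambda>\<omega>. (K q i \<omega> * D i \<omega>)\<^sup>2)"
      "expectation (\<lambda>\<omega>. (K q i \<omega> * D i \<omega>)\<^sup>2) = expectation (\<lambda>\<omega>. (K q i \<omega>)\<^sup>2) * h"
      by (auto simp: power_mult_distrib D_def)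
  qed
  have KDp: "(\<lambda>\<omega>. K q i \<omega> * D i \<omega>) \<in> borel_measurable (past (p i) (p (Suc i)) (I - R))" if "i < m" for q i
    unfolding D_def using measurable_past_F[OF KF[OF that]] measurable_past_incr[of r "I - R"] r R
    by (intro borel_measurable_times) auto
  note core = incr_sum_second_moment[where t=p and g="\<lambda>x. x" and v="\<lambda>_. h" and
      \<eta>="\<lambda>q i \<omega>. K q i \<omega> * D i \<omega>" and m=m, OF _ _ R(1,2) _ _ conjI[OF KDp KD(1)]]
  have E': "E \<omega> = (\<Sum>i<m. \<Sum>q\<in>R. K q i \<omega> * D i \<omega> * incr q (p i) (p (Suc i)) \<omega>)" for \<omega>
    by (simp add: E K_def D_def)
  have i: "integrable M (\<lambda>\<omega>. (E \<omega>)\<^sup>2)"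
    unfolding E' by (rule core) (use p0 pS inc R in auto)
  have "expectation (\<lambda>\<omega>. (E \<omega>)\<^sup>2) = (\<Sum>i<m. \<Sum>q\<in>R. expectation (\<lambda>\<omega>. (K q i \<omega> * D i \<omega>)\<^sup>2) * h)"
    unfolding E' by (rule core) (use p0 pS inc R in auto)
  also have "\<dots> \<le> (\<Sum>i<m. \<Sum>q\<in>R. ((k q * N)\<^sup>2 * h) * h)"
    using KD(2) K2(2) h by (intro sum_mono mult_right_mono) auto
  also have "\<dots> = (\<Sum>q\<in>R. (k q)\<^sup>2) * (N\<^sup>2 * (real m * h) * h)"
    by (simp add: power_mult_distrib sum_distrib_right sum_distrib_left mult_ac)
  also have "\<dots> \<le> k_sq_sum * (N\<^sup>2 * T * h)"
    using sum_k_le[OF R(1,2)] h T T0 k_sq_sum_nonneg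
    by (intro mult_mono mult_right_mono mult_left_mono mult_nonneg_nonneg) auto
  finally have ex: "expectation (\<lambda>\<omega>. (E \<omega>)\<^sup>2) \<le> k_sq_sum * N\<^sup>2 * T * h" by (simp add: mult.assoc)
  have "prob {\<omega>\<in>space M. \<bar>E \<omega>\<bar> > \<eta>} \<le> expectation (\<lambda>\<omega>. (E \<omega>)\<^sup>2) / \<eta>\<^sup>2"
    by (rule prob_abs_gt_le_second_moment[OF i \<eta>])
  also have "\<dots> \<le> k_sq_sum * N\<^sup>2 * T * h / \<eta>\<^sup>2" using ex by (intro divide_right_mono) auto
  finally show "prob {\<omega>\<in>space M. \<bar>E \<omega>\<bar> > \<eta>} \<le> k_sq_sum * N\<^sup>2 * T * h / \<eta>\<^sup>2" .
  have "(\<lambda>\<omega>. K q i \<omega> * D i \<omega> * incr q (p i) (p (Suc i)) \<omega>) \<in> borel_measurable M" if "i < m" "q \<in> R" for q i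
    using measurable_F_M[OF KF[OF that(1)]] inc[of q i] inc[OF r, of i] that R unfolding D_def
    by (intro borel_measurable_times) auto
  then show "E \<in> borel_measurable M"
    unfolding E'[abs_def] by (intro borel_measurable_sum) auto
qed

text \<open>Squared increments minus \<open>h\<close> are centred with variance
  \<open>2 * h\<^sup>2\<close> and orthogonal over disjoint intervals, so the weighted sum has
  variance of order \<open>T * h\<close>.\<close>

lemma diagonal_term_small:
  assumes r: "r \<in> I" and N: "0 \<le> N" and h: "0 < h"
    and T: "real m * h \<le> T" and p: "p = (\<lambda>i. real i * h)" and \<eta>: "\<eta> > 0"
    and E: "E = (\<lambda>\<omega>. \<Sum>i<m. (\<Sum>l\<in>L. c r l * clip N (G l (p i) \<omega>)) * ((incr r (p i) (p (Suc i)) \<omega>)\<^sup>2 - h))"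
  shows "E \<in> borel_measurable M" "prob {\<omega>\<in>space M. \<bar>E \<omega>\<bar> > \<eta>} \<le> 2 * k_sq_sum * N\<^sup>2 * T * h / \<eta>\<^sup>2"
proof -
  have p0: "0 \<le> p i" and pS: "p i < p (Suc i)" "p (Suc i) - p i = h" for i
    unfolding p using h by (auto simp: algebra_simps)
  have pT: "p i \<le> T" if "i \<le> m" for i
  proof -
    have "real i * h \<le> real m * h" using that h by (intro mult_right_mono) auto
    then show ?thesis using T by (simp add: p)
  qed
  have T0: "0 \<le> T" using T mult_nonneg_nonneg[of "real m" h] h by linarith
  define K where "K = (\<lambda>(q::'i) i \<omega>. \<Sum>l\<in>L. c r l * clip N (G l (p i) \<omega>))"
  have KF: "K q i \<in> borel_measurable (F (p i))" and Kb: "\<bar>K q i \<omega>\<bar> \<le> k r * N" if "i < m" for q i \<omega>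
    using clipped_coefficient[OF p0 pT N] that by (auto simp: K_def)
  have K2: "integrable M (\<lambda>\<omega>. (K q i \<omega>)\<^sup>2)" "expectation (\<lambda>\<omega>. (K q i \<omega>)\<^sup>2) \<le> (k r * N)\<^sup>2" if "i < m" for q i
    using bounded_second_moment[OF measurable_F_M[OF KF] Kb] that by auto
  let ?D = "\<lambda>i. incr r (p i) (p (Suc i))"
  have D: "integrable M (?D i)" "integrable M (\<lambda>\<omega>. (?D i \<omega>)\<^sup>2)" "expectation (\<lambda>\<omega>. (?D i \<omega>)\<^sup>2) = h"
    "integrable M (\<lambda>\<omega>. (?D i \<omega>) ^ 4)" "expectation (\<lambda>\<omega>. (?D i \<omega>) ^ 4) = 3 * h\<^sup>2" for i
    using incr_power_moment[OF r p0 pS(1)] pS(2) by auto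
  have sq: "(x\<^sup>2 - h)\<^sup>2 = x ^ 4 + (- 2 * h) * x\<^sup>2 + h\<^sup>2" for x :: real
    by (simp add: power2_eq_square algebra_simps numeral_eq_Suc)
  have gm: "integrable M (\<lambda>\<omega>. (?D i \<omega>)\<^sup>2 - h) \<and> expectation (\<lambda>\<omega>. (?D i \<omega>)\<^sup>2 - h) = 0 \<and>
      integrable M (\<lambda>\<omega>. ((?D i \<omega>)\<^sup>2 - h)\<^sup>2) \<and> expectation (\<lambda>\<omega>. ((?D i \<omega>)\<^sup>2 - h)\<^sup>2) = 2 * h\<^sup>2" for i
  proof (intro conjI)
    show "integrable M (\<lambda>\<omega>. (?D i \<omega>)\<^sup>2 - h)" "integrable M (\<lambda>\<omega>. ((?D i \<omega>)\<^sup>2 - h)\<^sup>2)"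
      unfolding sq using D(2,4)[of i] by auto
    show "expectation (\<lambda>\<omega>. (?D i \<omega>)\<^sup>2 - h) = 0"
      using D(2,3)[of i] by (subst Bochner_Integration.integral_diff) (auto simp: prob_space)
    have "expectation (\<lambda>\<omega>. (?D i \<omega>) ^ 4 + (- 2 * h) * (?D i \<omega>)\<^sup>2 + h\<^sup>2) =
        expectation (\<lambda>\<omega>. (?D i \<omega>) ^ 4) + (- 2 * h) * expectation (\<lambda>\<omega>. (?D i \<omega>)\<^sup>2) + h\<^sup>2"
      using D(2,4)[of i] by (subst Bochner_Integration.integral_add, auto simp: prob_space)+
    also have "\<dots> = 2 * h\<^sup>2" by (simp only: D) (simp add: power2_eq_square)
    finally show "expectation (\<lambda>\<omega>. ((?D i \<omega>)\<^sup>2 - h)\<^sup>2) = 2 * h\<^sup>2" unfolding sq .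
  qed
  note core = incr_sum_second_moment[where t=p and g="\<lambda>x. x\<^sup>2 - h" and v="\<lambda>_. 2 * h\<^sup>2" and
      \<eta>=K and m=m and R="{r}", OF _ _ _ _ _ _ conjI[OF measurable_past_F[OF KF] K2(1)]]
  have E': "E \<omega> = (\<Sum>i<m. \<Sum>q\<in>{r}. K q i \<omega> * ((incr q (p i) (p (Suc i)) \<omega>)\<^sup>2 - h))" for \<omega>
    by (simp add: E K_def)
  have i: "integrable M (\<lambda>\<omega>. (E \<omega>)\<^sup>2)"
    unfolding E' by (rule core) (use p0 pS gm r in auto)
  have "expectation (\<lambda>\<omega>. (E \<omega>)\<^sup>2) = (\<Sum>i<m. \<Sum>q\<in>{r}. expectation (\<lambda>\<omega>. (K q i \<omega>)\<^sup>2) * (2 * h\<^sup>2))"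
    unfolding E' by (rule core) (use p0 pS gm r in auto)
  also have "\<dots> \<le> (\<Sum>i<m. \<Sum>q\<in>{r}. (k r * N)\<^sup>2 * (2 * h\<^sup>2))"
    using K2(2) by (intro sum_mono mult_right_mono) auto
  also have "\<dots> = (k r)\<^sup>2 * (2 * N\<^sup>2 * (real m * h) * h)"
    by (simp add: power_mult_distrib power2_eq_square mult_ac)
  also have "\<dots> \<le> k_sq_sum * (2 * N\<^sup>2 * T * h)"
    using sum_k_le[of "{r}"] r h T T0 k_sq_sum_nonneg
    by (intro mult_mono mult_right_mono mult_left_mono mult_nonneg_nonneg) auto
  finally have ex: "expectation (\<lambda>\<omega>. (E \<omega>)\<^sup>2) \<le> 2 * k_sq_sum * N\<^sup>2 * T * h" by (simp add: mult_ac)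
  have "prob {\<omega>\<in>space M. \<bar>E \<omega>\<bar> > \<eta>} \<le> expectation (\<lambda>\<omega>. (E \<omega>)\<^sup>2) / \<eta>\<^sup>2"
    by (rule prob_abs_gt_le_second_moment[OF i \<eta>])
  also have "\<dots> \<le> 2 * k_sq_sum * N\<^sup>2 * T * h / \<eta>\<^sup>2" using ex by (intro divide_right_mono) auto
  finally show "prob {\<omega>\<in>space M. \<bar>E \<omega>\<bar> > \<eta>} \<le> 2 * k_sq_sum * N\<^sup>2 * T * h / \<eta>\<^sup>2" .
  have "(\<lambda>\<omega>. K r i \<omega> * ((?D i \<omega>)\<^sup>2 - h)) \<in> borel_measurable M" if "i < m" for i
    using measurable_F_M[OF KF[OF that]] gm[of i] by (intro borel_measurable_times) auto
  then show "E \<in> borel_measurable M"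
    unfolding E'[abs_def] by (intro borel_measurable_sum) auto
qed

end

section \<open>Partition sums on two scales\<close>

context linear_integrands
begin

definition fine_sum :: "(nat \<Rightarrow> real) \<Rightarrow> 'i \<Rightarrow> nat \<Rightarrow> 'a \<Rightarrow> real" where
  "fine_sum s q N \<omega> = (\<Sum>k<N. Y q (s k) \<omega> * incr q (s k) (s (Suc k)) \<omega>)"

lemma incr_telescope: "(\<Sum>j<n. incr q (s (a + j)) (s (Suc (a + j))) \<omega>) = incr q (s a) (s (a + n)) \<omega>"
  by (induction n) auto

lemma fine_sum_measurable:
  assumes q: "q \<in> I" and s: "\<And>k. 0 \<le> s k" "\<And>k. k < N \<Longrightarrow> s k \<le> T"
  shows "fine_sum s q N \<in> borel_measurable M"
  unfolding fine_sum_def[abs_def]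
  using Y_measurable W_measurable[OF q] s
  by (intro borel_measurable_sum borel_measurable_times borel_measurable_diff) auto

text \<open>The decomposition holds off the small exceptional event on which clipping changes
  something.\<close>

lemma discrete_covariation_estimate:
  assumes t: "0 < t" "t \<le> T" and r: "r \<in> I" and \<eta>: "\<eta> > 0" and \<theta>: "\<theta> > 0"
  shows "\<exists>m0>0. \<forall>m\<ge>m0. \<forall>n>0. \<forall>R. finite R \<longrightarrow> R \<subseteq> I \<longrightarrow> r \<in> R \<longrightarrow>
    (\<forall>s p. s = (\<lambda>j. real j * (t / (real m * real n))) \<longrightarrow> p = (\<lambda>i. real i * (t / real m)) \<longrightarrow>
      prob {\<omega>\<in>space M. \<bar>(\<Sum>i<m. (\<Sum>q\<in>R. fine_sum s q (Suc i * n) \<omega> - fine_sum s q (i * n) \<omega>) *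
          incr r (p i) (p (Suc i)) \<omega>) - (\<Sum>i<m. Y r (p i) \<omega> * (t / real m))\<bar> > \<eta>} < \<theta>)"
proof -
  have t0: "0 \<le> t" using t by simp
  have T0: "0 < T" using t by simp
  \<comment> \<open>Five events share the failure probability \<open>\<theta>\<close>: the two
    exceptional ones and one for each error term, at threshold \<open>\<eta> / 3\<close>.
    \<open>C1\<close> and \<open>C2\<close> are the constants in the bounds of the oscillation and
    the diagonal term; the latter also dominates the off-diagonal term.\<close>
  obtain N where N: "N > 0" "prob (large_values t N) < \<theta> / 5"
    using large_values_small[OF t0 t(2), of "\<theta> / 5"] \<theta> by auto
  define C1 where "C1 = T * (k_sq_sum + 1) / (2 * (\<eta> / 3))"
  have C1: "C1 > 0" unfolding C1_def using T0 k_sq_sum_nonneg \<eta> by (auto intro!: divide_pos_pos mult_pos_pos)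
  define \<delta> where "\<delta> = \<theta> / 5 / C1"
  have \<delta>: "\<delta> > 0" "\<delta> * C1 = \<theta> / 5" unfolding \<delta>_def using C1 \<theta> by auto
  obtain m1 where m1: "\<And>m. m \<ge> m1 \<Longrightarrow> prob (large_oscillation t \<delta> (1 / real (Suc m))) < \<theta> / 5"
    using large_oscillation_small[OF t0 t(2), of "\<theta> / 5" \<delta>] \<theta> \<delta> by auto
  define C2 where "C2 = 2 * k_sq_sum * N\<^sup>2 * T / (\<eta> / 3)\<^sup>2"
  have C2: "C2 \<ge> 0" unfolding C2_def using T0 k_sq_sum_nonneg by auto
  have "(\<lambda>m. C2 * (t / real m)) \<longlonglongrightarrow> C2 * 0"
    by (intro tendsto_intros tendsto_divide_0[OF tendsto_const] filterlim_at_top_imp_at_infinity filterlim_real_sequentially)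
  then have "\<forall>\<^sub>F m in sequentially. C2 * (t / real m) < \<theta> / 5"
    by (rule order_tendstoD(2)) (use \<theta> in auto)
  then obtain m2 where m2: "\<And>m. m \<ge> m2 \<Longrightarrow> C2 * (t / real m) < \<theta> / 5"
    by (auto simp: eventually_sequentially)
  show ?thesis
  \<comment> \<open>\<open>Suc m1\<close> because the oscillation bound is indexed by
    \<open>1 / real (Suc m)\<close> and is used at \<open>m - 1\<close>; it also makes
    \<open>m\<close> positive.\<close>
  proof (intro exI[of _ "max (Suc m1) m2"] conjI allI impI)
    fix m n :: nat and R s p
    assume m: "max (Suc m1) m2 \<le> m" and n: "0 < n" and R: "finite R" "R \<subseteq> I" "r \<in> R"
      and s: "s = (\<lambda>j. real j * (t / (real m * real n)))" and p: "p = (\<lambda>i. real i * (t / real m))"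
    define \<tau> where "\<tau> = t / (real m * real n)"
    define h where "h = t / real m"
    have m0: "0 < m" using m by simp
    have \<tau>: "0 < \<tau>" "s = (\<lambda>j. real j * \<tau>)" "real (m * n) * \<tau> = t" unfolding \<tau>_def s using t m0 n by auto
    have h: "0 < h" "p = (\<lambda>i. real i * h)" "real m * h = t" unfolding h_def p using t m0 by auto
    have sp: "s (i * n) = p i" for i unfolding s p using n by (simp add: field_simps)
    have sp': "s (i * n + n) = p (Suc i)" for i using sp[of "Suc i"] by (simp add: add.commute)
    define E1 where "E1 = (\<lambda>\<omega>. \<Sum>i<m. (\<Sum>j<n. \<Sum>q\<in>R. (\<Sum>l\<in>L. c q l * clip \<delta> (G l (s (i * n + j)) \<omega> - G l (s (i * n)) \<omega>)) *
      incr q (s (i * n + j)) (s (Suc (i * n + j))) \<omega>) * incr r (s (i * n)) (s (i * n + n)) \<omega>)"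
    define E2 where "E2 = (\<lambda>\<omega>. \<Sum>i<m. \<Sum>q\<in>R - {r}. (\<Sum>l\<in>L. c q l * clip N (G l (p i) \<omega>)) * incr r (p i) (p (Suc i)) \<omega> *
      incr q (p i) (p (Suc i)) \<omega>)"
    define E3 where "E3 = (\<lambda>\<omega>. \<Sum>i<m. (\<Sum>l\<in>L. c r l * clip N (G l (p i) \<omega>)) * ((incr r (p i) (p (Suc i)) \<omega>)\<^sup>2 - h))"
    have \<eta>3: "\<eta> / 3 > 0" using \<eta> by simp
    have e1: "E1 \<in> borel_measurable M" "prob {\<omega>\<in>space M. \<bar>E1 \<omega>\<bar> > \<eta> / 3} \<le> \<delta> * T * (k_sq_sum + 1) / (2 * (\<eta> / 3))"
      by (rule oscillation_term_small[OF R(1,2) r \<delta>(1) \<tau>(1) n _ \<tau>(2) \<eta>3 E1_def], use \<tau>(3) t in simp)+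
    have "\<delta> * T * (k_sq_sum + 1) / (2 * (\<eta> / 3)) = \<theta> / 5" using \<delta>(2) by (simp add: C1_def mult.assoc)
    with e1 have e1': "prob {\<omega>\<in>space M. \<bar>E1 \<omega>\<bar> > \<eta> / 3} \<le> \<theta> / 5" by simp
    have Rr: "finite (R - {r})" "R - {r} \<subseteq> I" "r \<notin> R - {r}" using R by auto
    have e2: "E2 \<in> borel_measurable M" "prob {\<omega>\<in>space M. \<bar>E2 \<omega>\<bar> > \<eta> / 3} \<le> k_sq_sum * N\<^sup>2 * T * h / (\<eta> / 3)\<^sup>2"
      by (rule off_diagonal_term_small[OF Rr r less_imp_le[OF N(1)] h(1) _ h(2) \<eta>3 E2_def], use h(3) t in simp)+
    have e3: "E3 \<in> borel_measurable M" "prob {\<omega>\<in>space M. \<bar>E3 \<omega>\<bar> > \<eta> / 3} \<le> 2 * k_sq_sum * N\<^sup>2 * T * h / (\<eta> / 3)\<^sup>2"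
      by (rule diagonal_term_small[OF r less_imp_le[OF N(1)] h(1) _ h(2) \<eta>3 E3_def], use h(3) t in simp)+
    have c2: "2 * k_sq_sum * N\<^sup>2 * T * h / (\<eta> / 3)\<^sup>2 < \<theta> / 5"
      using m2[of m] m unfolding C2_def h_def[symmetric] by (simp add: mult_ac)
    have "k_sq_sum * N\<^sup>2 * T * h / (\<eta> / 3)\<^sup>2 \<le> 2 * k_sq_sum * N\<^sup>2 * T * h / (\<eta> / 3)\<^sup>2"
      using k_sq_sum_nonneg T0 h by (intro divide_right_mono mult_right_mono) auto
    with c2 have c1: "k_sq_sum * N\<^sup>2 * T * h / (\<eta> / 3)\<^sup>2 < \<theta> / 5" by linarith
    have mm: "m - 1 \<ge> m1" "Suc (m - 1) = m" using m by auto
    have osc: "prob (large_oscillation t \<delta> (1 / real m)) < \<theta> / 5" using m1[OF mm(1)] mm(2) by simp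
    let ?P = "\<lambda>\<omega>. (\<Sum>i<m. (\<Sum>q\<in>R. fine_sum s q (Suc i * n) \<omega> - fine_sum s q (i * n) \<omega>) *
          incr r (p i) (p (Suc i)) \<omega>) - (\<Sum>i<m. Y r (p i) \<omega> * (t / real m))"
    have decomp: "?P \<omega> = E1 \<omega> + E2 \<omega> + E3 \<omega>"
      if \<omega>: "\<omega> \<in> space M" "\<omega> \<notin> large_values t N" "\<omega> \<notin> large_oscillation t \<delta> (1 / real m)" for \<omega>
    proof -
      \<comment> \<open>All grid points are rational multiples of \<open>t\<close>, hence seen by
        the exceptional events.\<close>
      have unit: "s (i * n + j) = t * (real (i * n + j) / real (m * n))"
        "real (i * n + j) / real (m * n) \<in> \<rat> \<inter> {0..1}" if "i < m" "j \<le> n" for i j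
      proof -
        show "s (i * n + j) = t * (real (i * n + j) / real (m * n))" by (simp add: s)
        have "i * n + j \<le> m * n" using that
          by (metis Suc_leI add.commute add_le_mono1 le_trans mult_Suc mult_le_mono1)
        then have "real (i * n + j) \<le> real (m * n)" using of_nat_mono by blast
        then show "real (i * n + j) / real (m * n) \<in> \<rat> \<inter> {0..1}"
          by (auto simp: divide_le_eq_1 simp del: of_nat_mult of_nat_add)
      qed
      have osc: "\<bar>G l (s (i * n + j)) \<omega> - G l (s (i * n)) \<omega>\<bar> \<le> \<delta>" if ij: "i < m" "j \<le> n" "l \<in> L" for i j l
      proof (rule ccontr)
        assume c: "\<not> \<bar>G l (s (i * n + j)) \<omega> - G l (s (i * n)) \<omega>\<bar> \<le> \<delta>"
        let ?x = "real (i * n + j) / real (m * n)" and ?y = "real (i * n) / real (m * n)"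
        have "?x - ?y = real j / real (m * n)"
          unfolding diff_divide_distrib[symmetric] of_nat_add by simp
        then have "\<bar>?x - ?y\<bar> = real j / real (m * n)" by (simp del: of_nat_mult of_nat_add)
        also have "\<dots> \<le> real n / real (m * n)" using ij by (intro divide_right_mono) auto
        also have "\<dots> = 1 / real m" using n by simp
        finally have d: "\<bar>?x - ?y\<bar> \<le> 1 / real m" .
        have x: "?x \<in> \<rat> \<inter> {0..1}" and y: "?y \<in> \<rat> \<inter> {0..1}"
          using unit(2)[OF ij(1,2)] unit(2)[OF ij(1), of 0] by auto
        have sx: "s (i * n + j) = t * ?x" and sy: "s (i * n) = t * ?y"
          using unit(1)[OF ij(1,2)] unit(1)[OF ij(1), of 0] by auto
        have "\<omega> \<in> large_oscillation t \<delta> (1 / real m)"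
          if "x \<in> \<rat> \<inter> {0..1}" "y \<in> \<rat> \<inter> {0..1}" "\<bar>x - y\<bar> \<le> 1 / real m"
            "\<not> \<bar>G l (t * x) \<omega> - G l (t * y) \<omega>\<bar> \<le> \<delta>" for x y
          unfolding large_oscillation_def
          by (rule UN_I[OF ij(3) UN_I[OF that(1) UN_I[of y]]]) (use that \<omega>(1) in auto)
        from this[OF x y d] have "\<omega> \<in> large_oscillation t \<delta> (1 / real m)"
          using c unfolding sx sy by blast
        then show False using \<omega> by simp
      qed
      have val: "\<bar>G l (p i) \<omega>\<bar> \<le> N" if il: "i < m" "l \<in> L" for i l
      proof (rule ccontr)
        assume c: "\<not> \<bar>G l (p i) \<omega>\<bar> \<le> N"
        let ?y = "real (i * n) / real (m * n)"
        have y: "?y \<in> \<rat> \<inter> {0..1}" and sy: "p i = t * ?y"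
          using unit[OF il(1), of 0] by (auto simp: sp)
        have "\<omega> \<in> large_values t N"
          unfolding large_values_def using il(2) y c \<omega>(1) unfolding sy
          by (intro UN_I[of l] UN_I[of ?y]) auto
        then show False using \<omega> by simp
      qed
      have Yd: "(\<Sum>l\<in>L. c q l * clip \<delta> (G l (s (i * n + j)) \<omega> - G l (s (i * n)) \<omega>)) =
          Y q (s (i * n + j)) \<omega> - Y q (p i) \<omega>" if "i < m" "j < n" for q i j
        using clip_id[OF osc[OF that(1)]] that
        by (simp add: Y_def sp sum_subtractf[symmetric] right_diff_distrib)
      have Yv: "(\<Sum>l\<in>L. c q l * clip N (G l (p i) \<omega>)) = Y q (p i) \<omega>" if "i < m" for q i
        using clip_id[OF val[OF that]] by (simp add: Y_def)
      have block: "fine_sum s q (Suc i * n) \<omega> - fine_sum s q (i * n) \<omega> =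
          (\<Sum>j<n. (Y q (s (i * n + j)) \<omega> - Y q (p i) \<omega>) * incr q (s (i * n + j)) (s (Suc (i * n + j))) \<omega>)
          + Y q (p i) \<omega> * incr q (p i) (p (Suc i)) \<omega>" for q i
      proof -
        have "fine_sum s q (Suc i * n) \<omega> - fine_sum s q (i * n) \<omega> =
            (\<Sum>j<n. Y q (s (i * n + j)) \<omega> * incr q (s (i * n + j)) (s (Suc (i * n + j))) \<omega>)"
          using sum_lessThan_add[of "\<lambda>k. Y q (s k) \<omega> * incr q (s k) (s (Suc k)) \<omega>" "i * n" n]
          by (simp add: fine_sum_def add.commute)
        also have "\<dots> = (\<Sum>j<n. (Y q (s (i * n + j)) \<omega> - Y q (p i) \<omega>) * incr q (s (i * n + j)) (s (Suc (i * n + j))) \<omega>)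
            + (\<Sum>j<n. Y q (p i) \<omega> * incr q (s (i * n + j)) (s (Suc (i * n + j))) \<omega>)"
          by (simp add: sum.distrib[symmetric] left_diff_distrib)
        also have "(\<Sum>j<n. Y q (p i) \<omega> * incr q (s (i * n + j)) (s (Suc (i * n + j))) \<omega>) =
            Y q (p i) \<omega> * incr q (p i) (p (Suc i)) \<omega>"
          using incr_telescope[where s=s and q=q and a="i * n" and n=n and \<omega>=\<omega>] by (simp add: sum_distrib_left[symmetric] sp sp')
        finally show ?thesis .
      qed
      let ?D = "\<lambda>i. incr r (p i) (p (Suc i)) \<omega>"
      let ?e = "\<lambda>i. \<Sum>j<n. \<Sum>q\<in>R. (Y q (s (i * n + j)) \<omega> - Y q (p i) \<omega>) * incr q (s (i * n + j)) (s (Suc (i * n + j))) \<omega>"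
      have blocks: "(\<Sum>q\<in>R. fine_sum s q (Suc i * n) \<omega> - fine_sum s q (i * n) \<omega>) =
          ?e i + (\<Sum>q\<in>R - {r}. Y q (p i) \<omega> * incr q (p i) (p (Suc i)) \<omega>) + Y r (p i) \<omega> * ?D i" for i
        unfolding block sum.distrib
        by (subst sum.swap, subst (2) sum.remove[OF R(1,3)]) simp
      have "(\<Sum>i<m. (\<Sum>q\<in>R. fine_sum s q (Suc i * n) \<omega> - fine_sum s q (i * n) \<omega>) * ?D i) =
          (\<Sum>i<m. ?e i * ?D i) + (\<Sum>i<m. \<Sum>q\<in>R - {r}. Y q (p i) \<omega> * ?D i * incr q (p i) (p (Suc i)) \<omega>)
          + (\<Sum>i<m. Y r (p i) \<omega> * (?D i)\<^sup>2)"
      proof -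
        have "(\<Sum>q\<in>R - {r}. Y q (p i) \<omega> * incr q (p i) (p (Suc i)) \<omega>) * ?D i =
            (\<Sum>q\<in>R - {r}. Y q (p i) \<omega> * ?D i * incr q (p i) (p (Suc i)) \<omega>)" for i
          unfolding sum_distrib_right by (intro sum.cong refl) (simp only: mult_ac)
        then show ?thesis
          unfolding blocks sum.distrib[symmetric]
          by (intro sum.cong refl) (simp only: distrib_right power2_eq_square mult.assoc)
      qed
      moreover have "E1 \<omega> = (\<Sum>i<m. ?e i * ?D i)"
        unfolding E1_def by (intro sum.cong refl arg_cong2[where f="(*)"]) (auto simp: Yd[unfolded sp] sp sp')
      moreover have "E2 \<omega> = (\<Sum>i<m. \<Sum>q\<in>R - {r}. Y q (p i) \<omega> * ?D i * incr q (p i) (p (Suc i)) \<omega>)"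
        unfolding E2_def by (intro sum.cong refl) (auto simp: Yv)
      moreover have "E3 \<omega> = (\<Sum>i<m. Y r (p i) \<omega> * (?D i)\<^sup>2) - (\<Sum>i<m. Y r (p i) \<omega> * (t / real m))"
        unfolding E3_def h_def by (simp add: Yv right_diff_distrib sum_subtractf)
      ultimately show ?thesis by simp
    qed
    note [measurable] = e1(1) e2(1) e3(1) large_values_measurable[OF t0 t(2)] large_oscillation_measurable[OF t0 t(2)]
    let ?A = "large_values t N" and ?B = "large_oscillation t \<delta> (1 / real m)"
    let ?S1 = "{\<omega>\<in>space M. \<bar>E1 \<omega>\<bar> > \<eta> / 3}" and ?S2 = "{\<omega>\<in>space M. \<bar>E2 \<omega>\<bar> > \<eta> / 3}" and ?S3 = "{\<omega>\<in>space M. \<bar>E3 \<omega>\<bar> > \<eta> / 3}"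
    have "prob {\<omega>\<in>space M. \<bar>?P \<omega>\<bar> > \<eta>} \<le> prob (?A \<union> (?B \<union> (?S1 \<union> (?S2 \<union> ?S3))))"
    proof (rule finite_measure_mono)
      show "{\<omega>\<in>space M. \<bar>?P \<omega>\<bar> > \<eta>} \<subseteq> ?A \<union> (?B \<union> (?S1 \<union> (?S2 \<union> ?S3)))"
      proof (rule subsetI, rule ccontr)
        fix \<omega> assume 1: "\<omega> \<in> {\<omega>\<in>space M. \<bar>?P \<omega>\<bar> > \<eta>}" and 2: "\<omega> \<notin> ?A \<union> (?B \<union> (?S1 \<union> (?S2 \<union> ?S3)))"
        then have "?P \<omega> = E1 \<omega> + E2 \<omega> + E3 \<omega>" by (intro decomp) auto
        moreover have "\<bar>?P \<omega>\<bar> > \<eta>" using 1 by blast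
        moreover have "\<bar>E1 \<omega>\<bar> \<le> \<eta> / 3" "\<bar>E2 \<omega>\<bar> \<le> \<eta> / 3" "\<bar>E3 \<omega>\<bar> \<le> \<eta> / 3" using 1 2 by auto
        ultimately show False by linarith
      qed
    qed measurable
    also have "\<dots> \<le> prob ?A + (prob ?B + (prob ?S1 + (prob ?S2 + prob ?S3)))"
      by (intro order_trans[OF measure_Un_le] add_mono order_refl) measurable
    also have "\<dots> < \<theta>" using N osc e1' e2(2) e3(2) c1 c2 by linarith
    finally show "prob {\<omega>\<in>space M. \<bar>?P \<omega>\<bar> > \<eta>} < \<theta>" .
  qed auto
qed


text \<open>Three limits in a fixed order. For fixed \<open>m\<close> and finite \<open>R\<close>,
  refining the fine grid turns the fine sums into Ito integrals; then \<open>R\<close> exhausts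
  \<open>I\<close> and their sum becomes \<open>Z\<close>; only then does \<open>m\<close> tend to
  infinity. The first two limits preserve the estimate because it is uniform in \<open>n\<close> and
  \<open>R\<close>.\<close>

lemma covariation_sums_limit:
  assumes t: "0 < t" "t \<le> T" and r: "r \<in> I"
    and J: "\<And>q. q \<in> I \<Longrightarrow> has_ito_integral M F T (Y q) (W q) (J q)"
    and Z: "\<And>t. t \<in> {0..T} \<Longrightarrow> sums_in_prob M I (\<lambda>q. J q t) (Z t)"
  shows "tends_in_prob (\<lambda>m \<omega>. (\<Sum>i<m. (Z (real (Suc i) * (t / real m)) \<omega> - Z (real i * (t / real m)) \<omega>) *
      incr r (real i * (t / real m)) (real (Suc i) * (t / real m)) \<omega>) -
      (\<Sum>i<m. Y r (real i * (t / real m)) \<omega> * (t / real m))) (\<lambda>_. 0) sequentially"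
proof -
  have JM: "J q x \<in> borel_measurable M" if "q \<in> I" "x \<in> {0..T}" for q x
  proof -
    have "J q x \<in> borel_measurable (F x)"
      using J[OF that(1)] that(2) by (auto simp: has_ito_integral_def adapted_continuous_def)
    then show ?thesis by (rule measurable_F_M)
  qed
  have ZM: "Z x \<in> borel_measurable M" if "x \<in> {0..T}" for x
    using Z[OF that] by (simp add: sums_in_prob_def)
  have pT: "real i * (t / real m) \<in> {0..T}" if "i \<le> m" for i m
  proof (cases "m = 0")
    case False
    then have "real i * (t / real m) \<le> real m * (t / real m)"
      using that t by (intro mult_right_mono) auto
    then show ?thesis using False t by auto
  qed (use t in auto)
  define p where "p = (\<lambda>m i. real i * (t / real m))"
  define A where "A = (\<lambda>m \<omega>. \<Sum>i<m. Y r (p m i) \<omega> * (t / real m))"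
  define \<Phi> where "\<Phi> = (\<lambda>m \<omega>. \<Sum>i<m. (Z (p m (Suc i)) \<omega> - Z (p m i) \<omega>) * incr r (p m i) (p m (Suc i)) \<omega>)"
  have D: "incr r (p m i) (p m (Suc i)) \<in> borel_measurable M" if "i < m" for m i
    using W_measurable[OF r] pT[of i m] pT[of "Suc i" m] that unfolding p_def
    by (intro borel_measurable_diff) auto
  have AM: "A m \<in> borel_measurable M" for m
    unfolding A_def p_def using pT[of _ m]
    by (intro borel_measurable_sum borel_measurable_times Y_measurable) auto
  have \<Phi>M: "\<Phi> m \<in> borel_measurable M" for m
    unfolding \<Phi>_def
    by (intro borel_measurable_sum borel_measurable_times[OF borel_measurable_diff D] ZM)
      (use pT[of _ m] in \<open>auto simp: p_def simp del: of_nat_Suc\<close>)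
  \<comment> \<open>The first \<open>i * n\<close> cells of the fine grid partition the interval up
    to the coarse point \<open>p m i\<close>, so one grid serves the integrals at all coarse
    points.\<close>
  have ito: "tends_in_prob (\<lambda>n. fine_sum (\<lambda>j. real j * (t / (real m * real n))) q (i * n)) (J q (p m i)) sequentially"
    if q: "q \<in> I" and i: "i \<le> m" and m: "0 < m" for q i m
  proof (rule tends_in_probI)
    show "J q (p m i) \<in> borel_measurable M" using JM[OF q] pT[OF i] by (simp add: p_def)
    have sT: "real k * (t / (real m * real n)) \<in> {0..T}" if "k \<le> i * n" for k n
    proof -
      have "k \<le> m * n" using that i by (meson le_trans mult_le_mono1)
      then show ?thesis using pT[of k "m * n"] by simp
    qed
    show "\<forall>\<^sub>F n in sequentially. fine_sum (\<lambda>j. real j * (t / (real m * real n))) q (i * n) \<in> borel_measurable M"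
      using sT t q by (intro always_eventually allI fine_sum_measurable) (auto intro: order_trans)
    fix e d :: real assume "e > 0" "d > 0"
    moreover have "mesh_limit_in_prob M (p m i)
        (\<lambda>m p \<omega>. \<Sum>i<m. Y q (p i) \<omega> * (W q (p (Suc i)) \<omega> - W q (p i) \<omega>)) (J q (p m i))"
      using J[OF q] pT[OF i] by (auto simp: has_ito_integral_def p_def)
    ultimately obtain h where h: "h > 0" "\<And>m' p'. partition_of (p m i) m' p' \<Longrightarrow> (\<forall>i<m'. p' (Suc i) - p' i < h) \<Longrightarrow>
        prob {\<omega>\<in>space M. \<bar>(\<Sum>i<m'. Y q (p' i) \<omega> * (W q (p' (Suc i)) \<omega> - W q (p' i) \<omega>)) - J q (p m i) \<omega>\<bar> > e} < d"
      unfolding mesh_limit_in_prob_def by blast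
    have "(\<lambda>n. t / real m * inverse (real n)) \<longlonglongrightarrow> t / real m * 0"
      by (intro tendsto_intros lim_inverse_n)
    then have "\<forall>\<^sub>F n in sequentially. t / real m * inverse (real n) < h"
      by (rule order_tendstoD(2)) (use h in auto)
    then show "\<forall>\<^sub>F n in sequentially. prob {\<omega>\<in>space M.
        \<bar>fine_sum (\<lambda>j. real j * (t / (real m * real n))) q (i * n) \<omega> - J q (p m i) \<omega>\<bar> > e} < d"
      using eventually_gt_at_top[of 0]
    proof eventually_elim
      case (elim n)
      have "partition_of (p m i) (i * n) (\<lambda>j. real j * (t / (real m * real n)))"
        unfolding partition_of_def p_def using elim t
        by (intro conjI allI impI mult_right_mono) (auto simp: field_simps)
      moreover have "\<forall>k<i * n. real (Suc k) * (t / (real m * real n)) - real k * (t / (real m * real n)) < h"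
      proof (intro allI impI)
        fix k
        have "real (Suc k) * x - real k * x = x" for x by (simp add: algebra_simps)
        then show "real (Suc k) * (t / (real m * real n)) - real k * (t / (real m * real n)) < h"
          using elim(1) by (simp only:) (simp add: field_simps)
      qed
      ultimately show ?case unfolding fine_sum_def by (rule h(2))
    qed
  qed
  have sum: "tends_in_prob (\<lambda>R \<omega>. \<Sum>q\<in>R. J q x \<omega>) (Z x) (finite_subsets_at_top I)" if "x \<in> {0..T}" for x
  proof -
    have "\<forall>\<^sub>F R in finite_subsets_at_top I. (\<lambda>\<omega>. \<Sum>q\<in>R. J q x \<omega>) \<in> borel_measurable M"
      using eventually_finite_subsets_at_top_weakI[of I] JM[OF _ that]
      by (intro eventually_finite_subsets_at_top_weakI borel_measurable_sum) auto
    then show ?thesis using Z[OF that] by (simp add: sums_in_prob_def tends_in_prob_def)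
  qed
  have "tends_in_prob (\<lambda>m \<omega>. \<Phi> m \<omega> - A m \<omega>) (\<lambda>_. 0) sequentially"
  proof (rule tends_in_probI)
    fix e d :: real assume ed: "e > 0" "d > 0"
    \<comment> \<open>Each of the two inner limits doubles the threshold, hence
      \<open>e / 4\<close>; they preserve only non-strict bounds, hence
      \<open>d / 2\<close>.\<close>
    then have e4: "e / 4 > 0" "d / 2 > 0" by auto
    define Bad where "Bad = (\<lambda>m n R. {\<omega>\<in>space M. \<bar>(\<Sum>i<m. (\<Sum>q\<in>R. fine_sum (\<lambda>j. real j * (t / (real m * real n))) q (Suc i * n) \<omega> -
          fine_sum (\<lambda>j. real j * (t / (real m * real n))) q (i * n) \<omega>) *
          incr r (p m i) (p m (Suc i)) \<omega>) - A m \<omega>\<bar> > e / 4})"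
    have "\<exists>m0>0. \<forall>m\<ge>m0. \<forall>n>0. \<forall>R. finite R \<longrightarrow> R \<subseteq> I \<longrightarrow> r \<in> R \<longrightarrow> prob (Bad m n R) < d / 2"
      using discrete_covariation_estimate[OF t r e4] unfolding Bad_def p_def A_def
      by (elim ex_forward conj_forward all_forward imp_forward) (assumption | (drule spec, drule spec, drule mp, rule refl, drule mp, rule refl))+
    then obtain m0 where m0: "m0 > 0"
      and raw: "\<forall>m\<ge>m0. \<forall>n>0. \<forall>R. finite R \<longrightarrow> R \<subseteq> I \<longrightarrow> r \<in> R \<longrightarrow> prob (Bad m n R) < d / 2"
      by (elim exE conjE)
    have est: "prob (Bad m n R) < d / 2" if "m \<ge> m0" "0 < n" "finite R" "R \<subseteq> I" "r \<in> R" for m n R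
      using raw that by simp
    note est = est[unfolded Bad_def]
    have "prob {\<omega>\<in>space M. \<bar>\<Phi> m \<omega> - A m \<omega>\<bar> > e} < d" if m: "m \<ge> m0" for m
    proof -
      have mpos: "0 < m" using m m0 by simp
      define \<Phi>R where "\<Phi>R = (\<lambda>R \<omega>. \<Sum>i<m. (\<Sum>q\<in>R. J q (p m (Suc i)) \<omega> - J q (p m i) \<omega>) * incr r (p m i) (p m (Suc i)) \<omega>)"
      have R: "prob {\<omega>\<in>space M. \<bar>\<Phi>R R \<omega> - A m \<omega>\<bar> > 2 * (e / 4)} \<le> d / 2"
        if R: "finite R" "R \<subseteq> I" "r \<in> R" for R
      proof (rule tends_in_prob_le)
        show "tends_in_prob (\<lambda>n \<omega>. \<Sum>i<m. (\<Sum>q\<in>R. fine_sum (\<lambda>j. real j * (t / (real m * real n))) q (Suc i * n) \<omega> -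
          fine_sum (\<lambda>j. real j * (t / (real m * real n))) q (i * n) \<omega>) * incr r (p m i) (p m (Suc i)) \<omega>) (\<Phi>R R) sequentially"
          unfolding \<Phi>R_def
          by (intro tends_in_prob_sum tends_in_prob_mult_rv tends_in_prob_diff ito D) (use R mpos in auto)
        show "\<forall>\<^sub>F n in sequentially. prob {\<omega>\<in>space M. \<bar>(\<Sum>i<m. (\<Sum>q\<in>R. fine_sum (\<lambda>j. real j * (t / (real m * real n))) q (Suc i * n) \<omega> -
          fine_sum (\<lambda>j. real j * (t / (real m * real n))) q (i * n) \<omega>) *
          incr r (p m i) (p m (Suc i)) \<omega>) - A m \<omega>\<bar> > e / 4} \<le> d / 2"
          using eventually_gt_at_top[of 0] by (rule eventually_mono) (intro less_imp_le est[OF m _ R])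
      qed (use AM e4 in auto)
      have "prob {\<omega>\<in>space M. \<bar>\<Phi> m \<omega> - A m \<omega>\<bar> > 2 * (2 * (e / 4))} \<le> d / 2"
      proof (rule tends_in_prob_le)
        show "tends_in_prob \<Phi>R (\<Phi> m) (finite_subsets_at_top I)"
          unfolding \<Phi>R_def \<Phi>_def sum_subtractf
          by (intro tends_in_prob_sum tends_in_prob_mult_rv tends_in_prob_diff sum D)
            (use pT[of _ m] in \<open>auto simp: p_def simp del: of_nat_Suc\<close>)
        have "\<forall>\<^sub>F R in finite_subsets_at_top I. finite R \<and> {r} \<subseteq> R \<and> R \<subseteq> I"
          unfolding eventually_finite_subsets_at_top using r by (intro exI[of _ "{r}"]) auto
        then show "\<forall>\<^sub>F R in finite_subsets_at_top I. prob {\<omega>\<in>space M. \<bar>\<Phi>R R \<omega> - A m \<omega>\<bar> > 2 * (e / 4)} \<le> d / 2"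
          by eventually_elim (intro R, auto)
      qed (use AM e4 in auto)
      then show ?thesis using ed by simp
    qed
    then show "\<forall>\<^sub>F m in sequentially. prob {\<omega>\<in>space M. \<bar>\<Phi> m \<omega> - A m \<omega> - 0\<bar> > e} < d"
      by (auto simp: eventually_sequentially)
  qed (use AM \<Phi>M in auto)
  then show ?thesis by (simp add: \<Phi>_def A_def p_def)
qed

end

section \<open>Finite variation and Riemann sums along uniform partitions\<close>

lemma uniform_partition_points:
  assumes "0 \<le> t" "t \<le> (T::real)" "i \<le> m"
  shows "real i * (t / real m) \<in> {0..T}"
proof (cases "m = 0")
  case False
  then have "real i * (t / real m) \<le> real m * (t / real m)"
    using assms by (intro mult_right_mono) auto
  then show ?thesis using False assms by auto
qed (use assms in auto)

lemma uniform_partition_small: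
  assumes "h > 0"
  shows "\<forall>\<^sub>F m in sequentially. \<forall>i. real (Suc i) * (t / real m) - real i * (t / real m) < h"
proof -
  have "(\<lambda>m. t * inverse (real m)) \<longlonglongrightarrow> t * 0" by (intro tendsto_intros lim_inverse_n)
  then have "\<forall>\<^sub>F m in sequentially. t * inverse (real m) < h" by (rule order_tendstoD(2)) (use assms in auto)
  then show ?thesis
  proof eventually_elim
    case (elim m)
    have "real (Suc i) * x - real i * x = x" for x i by (simp add: algebra_simps)
    then show ?case using elim by (simp only: divide_inverse simp_thms)
  qed
qed

lemma partition_of_uniform: "0 \<le> t \<Longrightarrow> 0 < m \<Longrightarrow> partition_of t m (\<lambda>i. real i * (t / real m))"
  unfolding partition_of_def by (intro conjI allI impI mult_right_mono) auto

text \<open>Appending \<open>T\<close> turns a partition of \<open>[0, t]\<close> into one of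
  \<open>[0, T]\<close> and adds one nonnegative term.\<close>

lemma finite_variation_sum_le:
  assumes B: "\<And>m p. partition_of T m p \<Longrightarrow> (\<Sum>i<m. \<bar>f (p (Suc i)) - f (p i)\<bar>) \<le> B"
    and p: "partition_of t m p" and t: "t \<le> T"
  shows "(\<Sum>i<m. \<bar>f (p (Suc i)) - f (p i)\<bar>) \<le> (B::real)"
proof -
  define q where "q = p(Suc m := T)"
  have "partition_of T (Suc m) q"
    unfolding partition_of_def
  proof (intro conjI allI impI)
    fix i assume "i < Suc m"
    then consider "i < m" | "i = m" by linarith
    then show "q i \<le> q (Suc i)" using p t by cases (auto simp: partition_of_def q_def)
  qed (use p in \<open>auto simp: partition_of_def q_def\<close>)
  from B[OF this] have "(\<Sum>i<m. \<bar>f (q (Suc i)) - f (q i)\<bar>) + \<bar>f (q (Suc m)) - f (q m)\<bar> \<le> B" by simp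
  moreover have "(\<Sum>i<m. \<bar>f (p (Suc i)) - f (p i)\<bar>) = (\<Sum>i<m. \<bar>f (q (Suc i)) - f (q i)\<bar>)"
    by (intro sum.cong) (auto simp: q_def)
  ultimately show ?thesis by linarith
qed

lemma finite_variation_add:
  assumes "finite_variation T f" "finite_variation T g"
  shows "finite_variation T (\<lambda>t. f t + a * g t)"
proof -
  obtain B C where B: "\<And>m p. partition_of T m p \<Longrightarrow> (\<Sum>i<m. \<bar>f (p (Suc i)) - f (p i)\<bar>) \<le> B"
    and C: "\<And>m p. partition_of T m p \<Longrightarrow> (\<Sum>i<m. \<bar>g (p (Suc i)) - g (p i)\<bar>) \<le> C"
    using assms unfolding finite_variation_def by blast
  have "(\<Sum>i<m. \<bar>f (p (Suc i)) + a * g (p (Suc i)) - (f (p i) + a * g (p i))\<bar>) \<le> B + \<bar>a\<bar> * C"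
    if p: "partition_of T m p" for m p
  proof -
    have "(\<Sum>i<m. \<bar>f (p (Suc i)) + a * g (p (Suc i)) - (f (p i) + a * g (p i))\<bar>) \<le>
       (\<Sum>i<m. \<bar>f (p (Suc i)) - f (p i)\<bar> + \<bar>a\<bar> * \<bar>g (p (Suc i)) - g (p i)\<bar>)"
    proof (rule sum_mono)
      fix i
      have "f (p (Suc i)) + a * g (p (Suc i)) - (f (p i) + a * g (p i)) =
          (f (p (Suc i)) - f (p i)) + a * (g (p (Suc i)) - g (p i))" by (simp add: algebra_simps)
      then show "\<bar>f (p (Suc i)) + a * g (p (Suc i)) - (f (p i) + a * g (p i))\<bar> \<le>
          \<bar>f (p (Suc i)) - f (p i)\<bar> + \<bar>a\<bar> * \<bar>g (p (Suc i)) - g (p i)\<bar>"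
        using abs_triangle_ineq[of "f (p (Suc i)) - f (p i)" "a * (g (p (Suc i)) - g (p i))"]
        by (simp add: abs_mult)
    qed
    also have "\<dots> \<le> B + \<bar>a\<bar> * C"
      using B[OF p] C[OF p] by (auto simp: sum.distrib sum_distrib_left[symmetric] intro!: add_mono mult_left_mono)
    finally show ?thesis .
  qed
  then show ?thesis unfolding finite_variation_def by blast
qed

lemma integral_diff_le:
  fixes f :: "real \<Rightarrow> real"
  assumes f: "continuous_on {0..T} f" and C: "\<And>x. x \<in> {0..T} \<Longrightarrow> \<bar>f x\<bar> \<le> C"
    and xy: "0 \<le> x" "x \<le> y" "y \<le> T"
  shows "\<bar>integral {0..y} f - integral {0..x} f\<bar> \<le> C * (y - x)"
proof -
  have i: "f integrable_on {u..v}" if "0 \<le> u" "v \<le> T" for u v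
    using that by (intro integrable_continuous_interval continuous_on_subset[OF f]) auto
  have "integral {0..x} f + integral {x..y} f = integral {0..y} f"
    using xy i by (intro Henstock_Kurzweil_Integration.integral_combine) auto
  then have "\<bar>integral {0..y} f - integral {0..x} f\<bar> = norm (integral {x..y} f)" by simp
  also have "\<dots> \<le> C * (y - x)"
    using integral_bound[of x y f C] continuous_on_subset[OF f, of "{x..y}"] C xy by auto
  finally show ?thesis .
qed

lemma finite_variation_integral:
  fixes f :: "real \<Rightarrow> real"
  assumes f: "continuous_on {0..T} f"
  shows "finite_variation T (\<lambda>t. integral {0..t} f)"
proof -
  have "bounded (f ` {0..T})" using compact_continuous_image[OF f] compact_imp_bounded by blast
  then obtain C where C: "\<And>x. x \<in> {0..T} \<Longrightarrow> \<bar>f x\<bar> \<le> C" by (force simp: bounded_iff)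
  have "(\<Sum>i<m. \<bar>integral {0..p (Suc i)} f - integral {0..p i} f\<bar>) \<le> C * T" if p: "partition_of T m p" for m p
  proof -
    have mono: "p i \<le> p j" if "i \<le> j" "j \<le> m" for i j
      using that
    proof (induction j)
      case (Suc j) then show ?case using p by (cases "i = Suc j") (auto simp: partition_of_def intro: order_trans)
    qed simp
    have "(\<Sum>i<m. \<bar>integral {0..p (Suc i)} f - integral {0..p i} f\<bar>) \<le> (\<Sum>i<m. C * (p (Suc i) - p i))"
    proof (rule sum_mono)
      fix i assume "i \<in> {..<m}"
      then show "\<bar>integral {0..p (Suc i)} f - integral {0..p i} f\<bar> \<le> C * (p (Suc i) - p i)"
        using integral_diff_le[OF f C, of "p i" "p (Suc i)"] mono[of 0 i] mono[of i "Suc i"] mono[of "Suc i" m] p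
        by (auto simp: partition_of_def)
    qed
    also have "\<dots> = C * T" using p by (simp add: sum_distrib_left[symmetric] sum_lessThan_telescope partition_of_def)
    finally show ?thesis .
  qed
  then show ?thesis unfolding finite_variation_def by blast
qed

text \<open>The sum is at most the largest increment of \<open>g\<close> times the variation of
  \<open>f\<close>, and the former tends to 0 by uniform continuity.\<close>

lemma covariation_finite_variation_zero:
  assumes f: "finite_variation T f" and g: "continuous_on {0..T} g" and t: "0 \<le> t" "t \<le> T"
  shows "(\<lambda>m. \<Sum>i<m. (f (real (Suc i) * (t / real m)) - f (real i * (t / real m))) *
      (g (real (Suc i) * (t / real m)) - g (real i * (t / real m)))) \<longlonglongrightarrow> (0::real)"
proof (rule LIMSEQ_I)
  fix e :: real assume e: "e > 0"
  obtain B where B: "\<And>m p. partition_of T m p \<Longrightarrow> (\<Sum>i<m. \<bar>f (p (Suc i)) - f (p i)\<bar>) \<le> B"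
    using f unfolding finite_variation_def by blast
  define d where "d = e / (\<bar>B\<bar> + 1)"
  have d: "d > 0" using e by (simp add: d_def)
  have "uniformly_continuous_on {0..T} g" using compact_uniformly_continuous[OF g] by simp
  then obtain h where h: "h > 0" "\<And>x y. x \<in> {0..T} \<Longrightarrow> y \<in> {0..T} \<Longrightarrow> \<bar>x - y\<bar> < h \<Longrightarrow> \<bar>g x - g y\<bar> < d"
    using d unfolding uniformly_continuous_on_def dist_real_def by (metis abs_minus_commute)
  have "\<forall>\<^sub>F m in sequentially. \<bar>\<Sum>i<m. (f (real (Suc i) * (t / real m)) - f (real i * (t / real m))) *
      (g (real (Suc i) * (t / real m)) - g (real i * (t / real m)))\<bar> < e"
    using uniform_partition_small[OF h(1), of t] eventually_gt_at_top[of 0]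
  proof eventually_elim
    case (elim m)
    let ?p = "\<lambda>i. real i * (t / real m)"
    have "\<bar>\<Sum>i<m. (f (?p (Suc i)) - f (?p i)) * (g (?p (Suc i)) - g (?p i))\<bar> \<le>
        (\<Sum>i<m. \<bar>f (?p (Suc i)) - f (?p i)\<bar> * d)"
    proof (intro order_trans[OF sum_abs] sum_mono)
      fix i assume i: "i \<in> {..<m}"
      have "?p i \<le> ?p (Suc i)" using t by (intro mult_right_mono) auto
      then have "\<bar>?p (Suc i) - ?p i\<bar> < h" using elim(1) by (simp only: abs_of_nonneg diff_ge_0_iff_ge)
      moreover have "?p i \<in> {0..T}" "?p (Suc i) \<in> {0..T}"
        using uniform_partition_points[OF t, of i m] uniform_partition_points[OF t, of "Suc i" m] i
        by (auto simp del: of_nat_Suc)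
      ultimately have "\<bar>g (?p (Suc i)) - g (?p i)\<bar> \<le> d" using h(2) less_imp_le by blast
      then show "\<bar>(f (?p (Suc i)) - f (?p i)) * (g (?p (Suc i)) - g (?p i))\<bar> \<le> \<bar>f (?p (Suc i)) - f (?p i)\<bar> * d"
        unfolding abs_mult by (intro mult_left_mono) auto
    qed
    also have "\<dots> \<le> B * d"
      unfolding sum_distrib_right[symmetric]
      using finite_variation_sum_le[of T f B, OF _ partition_of_uniform[OF t(1) elim(2)] t(2)] B d
      by (intro mult_right_mono) auto
    also have "\<dots> \<le> \<bar>B\<bar> * d" using d by (intro mult_right_mono) auto
    also have "\<dots> < e" unfolding d_def using e by (simp add: field_simps)
    finally show ?case .
  qed
  then show "\<exists>no. \<forall>m\<ge>no. norm ((\<Sum>i<m. (f (real (Suc i) * (t / real m)) - f (real i * (t / real m))) *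
      (g (real (Suc i) * (t / real m)) - g (real i * (t / real m)))) - 0) < e"
    by (simp add: eventually_sequentially)
qed

lemma uniform_riemann_sum_tendsto:
  fixes f :: "real \<Rightarrow> real"
  assumes f: "continuous_on {0..T} f" and t: "0 \<le> t" "t \<le> T"
  shows "(\<lambda>m. \<Sum>i<m. f (real i * (t / real m)) * (t / real m)) \<longlonglongrightarrow> integral {0..t} f"
proof (rule LIMSEQ_I)
  fix e :: real assume e: "e > 0"
  define d where "d = e / (t + 1)"
  have d: "d > 0" using e t by (simp add: d_def)
  have "uniformly_continuous_on {0..T} f" using compact_uniformly_continuous[OF f] by simp
  then obtain h where h: "h > 0" "\<And>x y. x \<in> {0..T} \<Longrightarrow> y \<in> {0..T} \<Longrightarrow> \<bar>x - y\<bar> < h \<Longrightarrow> \<bar>f x - f y\<bar> < d"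
    using d unfolding uniformly_continuous_on_def dist_real_def by (metis abs_minus_commute)
  have "\<forall>\<^sub>F m in sequentially. \<bar>(\<Sum>i<m. f (real i * (t / real m)) * (t / real m)) - integral {0..t} f\<bar> < e"
    using uniform_partition_small[OF h(1), of t] eventually_gt_at_top[of 0]
  proof eventually_elim
    case (elim m)
    let ?p = "\<lambda>i. real i * (t / real m)"
    have pT: "?p i \<in> {0..T}" if "i \<le> m" for i using uniform_partition_points[OF t that] .
    have mono: "?p i \<le> ?p j" if "i \<le> j" for i j using t that by (intro mult_right_mono) auto
    have "real (Suc i) * x - real i * x = x" for i x by (simp add: algebra_simps)
    then have step: "?p (Suc i) - ?p i = t / real m" for i by (simp only:)
    have i: "f integrable_on {u..v}" if "0 \<le> u" "v \<le> T" for u v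
      using that by (intro integrable_continuous_interval continuous_on_subset[OF f]) auto
    have split: "integral {0..?p k} f = (\<Sum>i<k. integral {?p i..?p (Suc i)} f)" if "k \<le> m" for k
      using that
    proof (induction k)
      case (Suc k)
      have "integral {0..?p k} f + integral {?p k..?p (Suc k)} f = integral {0..?p (Suc k)} f"
        using pT[of k] pT[of "Suc k"] Suc.prems mono[of k "Suc k"]
        by (intro Henstock_Kurzweil_Integration.integral_combine i) (auto simp del: of_nat_Suc)
      then show ?case using Suc by (simp del: of_nat_Suc)
    qed simp
    have pm: "?p m = t" using elim by simp
    have blk: "\<bar>f (?p i) * (t / real m) - integral {?p i..?p (Suc i)} f\<bar> \<le> d * (t / real m)" if "i < m" for i
    proof -
      have "((\<lambda>x. f (?p i)) has_integral (f (?p i) * (t / real m))) {?p i..?p (Suc i)}"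
        using has_integral_const_real[of "f (?p i)" "?p i" "?p (Suc i)"] mono[of i "Suc i"] step[of i]
        by (simp add: mult.commute)
      then have "f (?p i) * (t / real m) - integral {?p i..?p (Suc i)} f =
          integral {?p i..?p (Suc i)} (\<lambda>x. f (?p i) - f x)"
        using i[of "?p i" "?p (Suc i)"] pT[of i] pT[of "Suc i"] that
        by (subst Henstock_Kurzweil_Integration.integral_diff) (auto simp del: of_nat_Suc simp: has_integral_iff)
      moreover have "norm (integral {?p i..?p (Suc i)} (\<lambda>x. f (?p i) - f x)) \<le> d * (?p (Suc i) - ?p i)"
      proof (rule integral_bound[OF mono])
        show "continuous_on {?p i..?p (Suc i)} (\<lambda>x. f (?p i) - f x)"
          using pT[of i] pT[of "Suc i"] that
          by (intro continuous_intros continuous_on_subset[OF f]) (auto simp del: of_nat_Suc)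
        fix x assume x: "x \<in> {?p i..?p (Suc i)}"
        then have "\<bar>?p i - x\<bar> < h" using elim(1)[rule_format, of i] by auto
        moreover have "x \<in> {0..T}" using x pT[of i] pT[of "Suc i"] that by (auto simp del: of_nat_Suc)
        ultimately show "norm (f (?p i) - f x) \<le> d" using h(2)[of "?p i" x] pT[of i] that by auto
      qed simp
      ultimately show ?thesis by (simp only: step real_norm_def)
    qed
    have "(\<Sum>i<m. f (?p i) * (t / real m)) - integral {0..t} f =
        (\<Sum>i<m. f (?p i) * (t / real m) - integral {?p i..?p (Suc i)} f)"
      using split[of m] elim(2) by (simp add: sum_subtractf del: of_nat_Suc)
    also have "\<bar>\<dots>\<bar> \<le> (\<Sum>i<m. d * (t / real m))"
      by (intro order_trans[OF sum_abs] sum_mono blk) auto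
    also have "\<dots> = d * t" using elim by simp
    also have "\<dots> < e" unfolding d_def using e t by (simp add: field_simps)
    finally show ?case .
  qed
  then show "\<exists>no. \<forall>m\<ge>no. norm ((\<Sum>i<m. f (real i * (t / real m)) * (t / real m)) - integral {0..t} f) < e"
    by (simp add: eventually_sequentially)
qed

lemma (in brownian_setting) covariation_tends_in_prob:
  assumes V: "has_covariation M F T X (W r) V" and r: "r \<in> I" and t: "0 \<le> t" "t \<le> T"
  shows "tends_in_prob (\<lambda>m \<omega>. \<Sum>i<m. (X (real (Suc i) * (t / real m)) \<omega> - X (real i * (t / real m)) \<omega>) *
      incr r (real i * (t / real m)) (real (Suc i) * (t / real m)) \<omega>) (V t) sequentially"
proof (rule tends_in_probI)
  have XF: "X x \<in> borel_measurable (F x)" and VF: "V x \<in> borel_measurable (F x)" if "x \<in> {0..T}" for x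
    using V that by (auto simp: has_covariation_def adapted_continuous_def)
  note XM = measurable_F_M[OF XF]
  show "V t \<in> borel_measurable M" using measurable_F_M[OF VF] t by auto
  show "\<forall>\<^sub>F m in sequentially. (\<lambda>\<omega>. \<Sum>i<m. (X (real (Suc i) * (t / real m)) \<omega> - X (real i * (t / real m)) \<omega>) *
      incr r (real i * (t / real m)) (real (Suc i) * (t / real m)) \<omega>) \<in> borel_measurable M"
  proof (intro always_eventually allI borel_measurable_sum)
    fix m i :: nat assume i: "i \<in> {..<m}"
    then have "real i * (t / real m) \<in> {0..T}" "real (Suc i) * (t / real m) \<in> {0..T}"
      using uniform_partition_points[OF t, of i m] uniform_partition_points[OF t, of "Suc i" m] by auto
    then show "(\<lambda>\<omega>. (X (real (Suc i) * (t / real m)) \<omega> - X (real i * (t / real m)) \<omega>) *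
      incr r (real i * (t / real m)) (real (Suc i) * (t / real m)) \<omega>) \<in> borel_measurable M"
      by (intro borel_measurable_times borel_measurable_diff XM W_measurable[OF r]) auto
  qed
  fix e d :: real assume "e > 0" "d > 0"
  moreover have "mesh_limit_in_prob M t
      (\<lambda>m p \<omega>. \<Sum>i<m. (X (p (Suc i)) \<omega> - X (p i) \<omega>) * (W r (p (Suc i)) \<omega> - W r (p i) \<omega>)) (V t)"
    using V t by (auto simp: has_covariation_def)
  ultimately obtain h where h: "h > 0" "\<And>m p. partition_of t m p \<Longrightarrow> (\<forall>i<m. p (Suc i) - p i < h) \<Longrightarrow>
     prob {\<omega>\<in>space M. \<bar>(\<Sum>i<m. (X (p (Suc i)) \<omega> - X (p i) \<omega>) * (W r (p (Suc i)) \<omega> - W r (p i) \<omega>)) - V t \<omega>\<bar> > e} < d"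
    unfolding mesh_limit_in_prob_def by blast
  show "\<forall>\<^sub>F m in sequentially. prob {\<omega>\<in>space M. \<bar>(\<Sum>i<m. (X (real (Suc i) * (t / real m)) \<omega> - X (real i * (t / real m)) \<omega>) *
      incr r (real i * (t / real m)) (real (Suc i) * (t / real m)) \<omega>) - V t \<omega>\<bar> > e} < d"
    using uniform_partition_small[OF h(1), of t] eventually_gt_at_top[of 0]
  proof eventually_elim
    case (elim m)
    show ?case
      by (rule h(2)[OF partition_of_uniform[OF t(1) elim(2)]]) (use elim(1) in blast)
  qed
qed

text \<open>Linearity is exact for the partition sums. Uniqueness of limits in probability carries
  it to the covariations, which are determined only almost everywhere.\<close>

lemma (in brownian_setting) covariation_linear_combination:
  fixes c :: "'l \<Rightarrow> real"
  assumes V: "\<And>l. l \<in> L \<Longrightarrow> has_covariation M F T (X l) (W r) (V l)"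
    and U: "has_covariation M F T (\<lambda>t \<omega>. \<Sum>l\<in>L. c l * X l t \<omega>) (W r) U"
    and r: "r \<in> I" and t: "0 \<le> t" "t \<le> T"
  shows "AE \<omega> in M. U t \<omega> = (\<Sum>l\<in>L. c l * V l t \<omega>)"
proof -
  have "tends_in_prob (\<lambda>m \<omega>. \<Sum>l\<in>L. c l * (\<Sum>i<m. (X l (real (Suc i) * (t / real m)) \<omega> - X l (real i * (t / real m)) \<omega>) *
      incr r (real i * (t / real m)) (real (Suc i) * (t / real m)) \<omega>)) (\<lambda>\<omega>. \<Sum>l\<in>L. c l * V l t \<omega>) sequentially"
    by (intro tends_in_prob_sum tends_in_prob_cmult covariation_tends_in_prob[OF V r t])
  moreover have "(\<lambda>m \<omega>. \<Sum>l\<in>L. c l * (\<Sum>i<m. (X l (real (Suc i) * (t / real m)) \<omega> - X l (real i * (t / real m)) \<omega>) *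
      incr r (real i * (t / real m)) (real (Suc i) * (t / real m)) \<omega>)) =
    (\<lambda>m \<omega>. \<Sum>i<m. ((\<Sum>l\<in>L. c l * X l (real (Suc i) * (t / real m)) \<omega>) - (\<Sum>l\<in>L. c l * X l (real i * (t / real m)) \<omega>)) *
      incr r (real i * (t / real m)) (real (Suc i) * (t / real m)) \<omega>)"
    unfolding sum_distrib_left sum_subtractf[symmetric] sum_distrib_right
    by (subst sum.swap) (simp only: right_diff_distrib left_diff_distrib mult.assoc)
  ultimately show ?thesis
    using tends_in_prob_unique[OF covariation_tends_in_prob[OF U r t]] by simp
qed

text \<open>Against \<open>W r\<close> the drift and the summed covariations have finite variation, so that only the
  Ito integral driven by \<open>W r\<close> itself contributes.\<close>

theorem (in linear_integrands) covariation_identity: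
  assumes r: "r \<in> I" and t: "0 \<le> t" "t \<le> T"
    and V: "has_covariation M F T X (W r) V"
    and S: "has_stratonovich_series M F T I Y W S"
    and b: "\<And>\<omega>. \<omega> \<in> space M \<Longrightarrow> continuous_on {0..T} (\<lambda>\<tau>. b \<tau> \<omega>)"
    and X: "\<And>t. t \<in> {0..T} \<Longrightarrow> AE \<omega> in M. X t \<omega> = X 0 \<omega> + integral {0..t} (\<lambda>\<tau>. b \<tau> \<omega>) + a * S t \<omega>"
  shows "AE \<omega> in M. V t \<omega> = a * integral {0..t} (\<lambda>\<tau>. Y r \<tau> \<omega>)"
proof -
  obtain J VV Z A where J: "\<And>q. q \<in> I \<Longrightarrow> has_ito_integral M F T (Y q) (W q) (J q)"
    and Z: "\<And>t. t \<in> {0..T} \<Longrightarrow> sums_in_prob M I (\<lambda>q. J q t) (Z t)"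
    and Zac: "adapted_continuous M F T Z"
    and A: "\<And>\<omega>. \<omega> \<in> space M \<Longrightarrow> finite_variation T (\<lambda>t. A t \<omega>)"
    and SZ: "\<And>t \<omega>. t \<in> {0..T} \<Longrightarrow> \<omega> \<in> space M \<Longrightarrow> S t \<omega> = Z t \<omega> + A t \<omega> / 2"
    using S unfolding has_stratonovich_series_def by blast
  define p where "p = (\<lambda>m i. real i * (t / real m))"
  have pT: "p m i \<in> {0..T}" if "i \<le> m" for m i
    using uniform_partition_points[OF t that] by (simp add: p_def)
  define D where "D = (\<lambda>m i. incr r (p m i) (p m (Suc i)))"
  define VS where "VS = (\<lambda>m \<omega>. \<Sum>i<m. (X (p m (Suc i)) \<omega> - X (p m i) \<omega>) * D m i \<omega>)"
  define ZS where "ZS = (\<lambda>m \<omega>. \<Sum>i<m. (Z (p m (Suc i)) \<omega> - Z (p m i) \<omega>) * D m i \<omega>)"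
  define RS where "RS = (\<lambda>m \<omega>. \<Sum>i<m. Y r (p m i) \<omega> * (t / real m))"
  have VS: "tends_in_prob VS (V t) sequentially"
    using covariation_tends_in_prob[OF V r t] by (simp add: VS_def D_def p_def)
  have XM: "X x \<in> borel_measurable M" if "x \<in> {0..T}" for x
    using V that measurable_F_M[of "X x" x] by (auto simp: has_covariation_def adapted_continuous_def)
  have ZM: "Z x \<in> borel_measurable M" if "x \<in> {0..T}" for x
    using Z[OF that] by (simp add: sums_in_prob_def)
  have DM: "D m i \<in> borel_measurable M" if "i < m" for m i
    using W_measurable[OF r] pT[of i m] pT[of "Suc i" m] that unfolding D_def
    by (intro borel_measurable_diff) auto
  have VSM: "VS m \<in> borel_measurable M" and ZSM: "ZS m \<in> borel_measurable M" for m
    unfolding VS_def ZS_def using XM ZM DM pT[of _ m]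
    by (intro borel_measurable_sum borel_measurable_times borel_measurable_diff; force)+
  have RSM: "RS m \<in> borel_measurable M" for m
    unfolding RS_def using pT[of _ m]
    by (intro borel_measurable_sum borel_measurable_times Y_measurable) auto
  have Yc: "continuous_on {0..T} (\<lambda>\<tau>. Y r \<tau> \<omega>)" if "\<omega> \<in> space M" for \<omega>
    unfolding Y_def using G_continuous that by (intro continuous_intros) auto
  have RSlim: "(\<lambda>m. RS m \<omega>) \<longlonglongrightarrow> integral {0..t} (\<lambda>\<tau>. Y r \<tau> \<omega>)" if "\<omega> \<in> space M" for \<omega>
    unfolding RS_def p_def by (rule uniform_riemann_sum_tendsto[OF Yc[OF that] t])
  have RS: "tends_in_prob RS (\<lambda>\<omega>. integral {0..t} (\<lambda>\<tau>. Y r \<tau> \<omega>)) sequentially"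
    using RSM RSlim
    by (intro tends_in_prob_pointwise borel_measurable_LIMSEQ_metric[OF RSM]) auto
  have ZR: "tends_in_prob (\<lambda>m \<omega>. ZS m \<omega> - RS m \<omega>) (\<lambda>_. 0) sequentially"
  proof (cases "t = 0")
    case True
    then show ?thesis by (simp add: ZS_def RS_def p_def tends_in_prob_const)
  next
    case False
    then show ?thesis
      using covariation_sums_limit[OF _ t(2) r J Z] t by (simp add: ZS_def RS_def D_def p_def)
  qed
  have FV: "tends_in_prob (\<lambda>m \<omega>. VS m \<omega> - a * ZS m \<omega>) (\<lambda>_. 0) sequentially"
  proof (rule tends_in_prob_pointwise)
    show "(\<lambda>\<omega>. VS m \<omega> - a * ZS m \<omega>) \<in> borel_measurable M" for m
      using VSM ZSM by (intro borel_measurable_diff borel_measurable_times) auto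
    \<comment> \<open>The equation holds almost everywhere at each fixed time. Only countably many
      partition points occur, so a single null set suffices.\<close>
    have "AE \<omega> in M. i \<le> m \<longrightarrow> X (p m i) \<omega> = X 0 \<omega> + integral {0..p m i} (\<lambda>\<tau>. b \<tau> \<omega>) + a * S (p m i) \<omega>" for m i
      using X[OF pT[of i m]] by (cases "i \<le> m") simp_all
    then have "AE \<omega> in M. \<forall>m i. i \<le> m \<longrightarrow> X (p m i) \<omega> = X 0 \<omega> + integral {0..p m i} (\<lambda>\<tau>. b \<tau> \<omega>) + a * S (p m i) \<omega>"
      unfolding AE_all_countable by blast
    then show "AE \<omega> in M. (\<lambda>m. VS m \<omega> - a * ZS m \<omega>) \<longlonglongrightarrow> 0"
    proof (rule AE_mp, intro AE_I2 impI)
      fix \<omega> assume \<omega>: "\<omega> \<in> space M"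
        and eq: "\<forall>m i. i \<le> m \<longrightarrow> X (p m i) \<omega> = X 0 \<omega> + integral {0..p m i} (\<lambda>\<tau>. b \<tau> \<omega>) + a * S (p m i) \<omega>"
      define f where "f = (\<lambda>t. integral {0..t} (\<lambda>\<tau>. b \<tau> \<omega>) + a / 2 * A t \<omega>)"
      have f: "finite_variation T f"
        unfolding f_def by (intro finite_variation_add finite_variation_integral b A \<omega>)
      have W: "continuous_on {0..T} (\<lambda>t. W r t \<omega>)"
      proof -
        have "\<forall>r\<in>I. \<forall>\<omega>\<in>space M. W r 0 \<omega> = 0 \<and> continuous_on {0..} (\<lambda>t. W r t \<omega>)"
          using bm unfolding brownian_family_def by (rule conjunct1)
        then have "continuous_on {0..} (\<lambda>t. W r t \<omega>)" using r \<omega> by simp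
        then show ?thesis by (rule continuous_on_subset) auto
      qed
      have Xf: "X (p m i) \<omega> = X 0 \<omega> + f (p m i) + a * Z (p m i) \<omega>" if "i \<le> m" for m i
        using eq[rule_format, OF that] SZ[OF pT[OF that] \<omega>] by (simp add: f_def algebra_simps)
      have "VS m \<omega> - a * ZS m \<omega> = (\<Sum>i<m. (f (p m (Suc i)) - f (p m i)) * D m i \<omega>)" for m
        unfolding VS_def ZS_def sum_distrib_left sum_subtractf[symmetric]
        by (intro sum.cong refl) (simp add: Xf algebra_simps)
      then show "(\<lambda>m. VS m \<omega> - a * ZS m \<omega>) \<longlonglongrightarrow> 0"
        using covariation_finite_variation_zero[OF f W t] by (simp add: p_def D_def)
    qed
  qed simp
  have "tends_in_prob (\<lambda>m \<omega>. (VS m \<omega> - a * ZS m \<omega>) + (a * (ZS m \<omega> - RS m \<omega>) + a * RS m \<omega>))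
      (\<lambda>\<omega>. 0 + (a * 0 + a * integral {0..t} (\<lambda>\<tau>. Y r \<tau> \<omega>))) sequentially"
    by (intro tends_in_prob_add tends_in_prob_cmult FV ZR RS)
  then have "tends_in_prob VS (\<lambda>\<omega>. a * integral {0..t} (\<lambda>\<tau>. Y r \<tau> \<omega>)) sequentially"
    by (simp add: right_diff_distrib)
  from tends_in_prob_unique[OF VS this] show ?thesis by simp
qed

section \<open>Expectation of a linear Stratonovich equation\<close>

lemma interval_lebesgue_eq_integral:
  fixes g :: "real \<Rightarrow> real"
  assumes t: "0 \<le> t" "t \<le> T" and g: "continuous_on {0..T} g"
  shows "(\<integral>\<tau>. indicator {0..t} \<tau> * g \<tau> \<partial>(restrict_space lborel {0..T})) = integral {0..t} g"
proof -
  have "(\<integral>\<tau>. indicator {0..t} \<tau> * g \<tau> \<partial>(restrict_space lborel {0..T})) =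
      (\<integral>\<tau>. indicator {0..T} \<tau> *\<^sub>R (indicator {0..t} \<tau> * g \<tau>) \<partial>lborel)"
    by (rule integral_restrict_space) auto
  also have "\<dots> = (LINT \<tau>:{0..t}|lborel. g \<tau>)"
    unfolding set_lebesgue_integral_def using t
    by (intro Bochner_Integration.integral_cong) (auto simp: indicator_def)
  also have "\<dots> = integral {0..t} g"
    using continuous_on_subset[OF g, of "{0..t}"] t
    by (intro set_borel_integral_eq_integral(2) borel_integrable_atLeastAtMost'[unfolded set_integrable_def[symmetric]]) auto
  finally show ?thesis .
qed

text \<open>Fubini. The path integrals are gauge integrals, which agree with Lebesgue integrals for
  continuous paths.\<close>

lemma (in prob_space) expectation_time_integral:
  fixes b :: "real \<Rightarrow> 'a \<Rightarrow> real"
  assumes t: "0 \<le> t" "t \<le> T"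
    and b: "\<And>\<omega>. \<omega> \<in> space M \<Longrightarrow> continuous_on {0..T} (\<lambda>\<tau>. b \<tau> \<omega>)"
    and i: "integrable (restrict_space lborel {0..T} \<Otimes>\<^sub>M M) (\<lambda>(\<tau>, \<omega>). b \<tau> \<omega>)"
    and Eb: "continuous_on {0..T} Eb" "\<And>\<tau>. \<tau> \<in> {0..T} \<Longrightarrow> expectation (b \<tau>) = Eb \<tau>"
  shows "integrable M (\<lambda>\<omega>. integral {0..t} (\<lambda>\<tau>. b \<tau> \<omega>))"
    "expectation (\<lambda>\<omega>. integral {0..t} (\<lambda>\<tau>. b \<tau> \<omega>)) = integral {0..t} Eb"
proof -
  let ?R = "restrict_space lborel {0..T} :: real measure"
  interpret R: sigma_finite_measure ?R
    by (rule sigma_finite_measure_restrict_space) (auto intro: sigma_finite_lborel)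
  interpret P: pair_sigma_finite ?R M ..
  let ?f = "\<lambda>(\<tau>, \<omega>). indicator {0..t} \<tau> * b \<tau> \<omega>"
  have [measurable]: "(\<lambda>(\<tau>, \<omega>). b \<tau> \<omega>) \<in> borel_measurable (?R \<Otimes>\<^sub>M M)" using i by auto
  have ind: "(\<lambda>\<tau>. indicator {0..t} \<tau> :: real) \<in> borel_measurable ?R"
    by (intro measurable_restrict_space1) simp
  have f: "integrable (?R \<Otimes>\<^sub>M M) ?f"
  proof (rule Bochner_Integration.integrable_bound[OF i])
    have "(\<lambda>x. indicator {0..t} (fst x) * (case x of (\<tau>, \<omega>) \<Rightarrow> b \<tau> \<omega>)) \<in> borel_measurable (?R \<Otimes>\<^sub>M M)"
      using measurable_compose[OF measurable_fst ind] by (intro borel_measurable_times) auto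
    then show "?f \<in> borel_measurable (?R \<Otimes>\<^sub>M M)" by (simp add: case_prod_beta')
  qed (auto simp: indicator_def)
  have eq: "(\<integral>\<tau>. indicator {0..t} \<tau> * b \<tau> \<omega> \<partial>?R) = integral {0..t} (\<lambda>\<tau>. b \<tau> \<omega>)" if "\<omega> \<in> space M" for \<omega>
    by (rule interval_lebesgue_eq_integral[OF t b[OF that]])
  have "integrable M (\<lambda>\<omega>. \<integral>\<tau>. indicator {0..t} \<tau> * b \<tau> \<omega> \<partial>?R)"
    using P.integrable_snd[OF f] by simp
  then show "integrable M (\<lambda>\<omega>. integral {0..t} (\<lambda>\<tau>. b \<tau> \<omega>))"
    using eq by (simp cong: Bochner_Integration.integrable_cong)
  have "expectation (\<lambda>\<omega>. integral {0..t} (\<lambda>\<tau>. b \<tau> \<omega>)) = expectation (\<lambda>\<omega>. \<integral>\<tau>. indicator {0..t} \<tau> * b \<tau> \<omega> \<partial>?R)"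
    using eq by (intro Bochner_Integration.integral_cong) auto
  also have "\<dots> = (\<integral>\<tau>. expectation (\<lambda>\<omega>. indicator {0..t} \<tau> * b \<tau> \<omega>) \<partial>?R)"
    using P.Fubini_integral[OF f] by simp
  also have "\<dots> = (\<integral>\<tau>. indicator {0..t} \<tau> * Eb \<tau> \<partial>?R)"
    using Eb(2) by (intro Bochner_Integration.integral_cong) (auto simp: space_restrict_space)
  also have "\<dots> = integral {0..t} Eb"
    by (rule interval_lebesgue_eq_integral[OF t Eb(1)])
  finally show "expectation (\<lambda>\<omega>. integral {0..t} (\<lambda>\<tau>. b \<tau> \<omega>)) = integral {0..t} Eb" .
qed

text \<open>The Ito parts are centred, so the series contributes half the summed mean covariations.
  The covariations contained in the series are arbitrary ones; by uniqueness they are the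
  combinations of the given \<open>GV\<close>, whose sum of means is
  \<open>\<sigma>\<close>.\<close>

theorem (in linear_integrands) mean_equation:
  assumes t: "0 \<le> t" "t \<le> T"
    and S: "has_stratonovich_series M F T I Y W S"
    and b: "\<And>\<omega>. \<omega> \<in> space M \<Longrightarrow> continuous_on {0..T} (\<lambda>\<tau>. b \<tau> \<omega>)"
    and bi: "integrable (restrict_space lborel {0..T} \<Otimes>\<^sub>M M) (\<lambda>(\<tau>, \<omega>). b \<tau> \<omega>)"
    and Eb: "continuous_on {0..T} Eb" "\<And>\<tau>. \<tau> \<in> {0..T} \<Longrightarrow> expectation (b \<tau>) = Eb \<tau>"
    and X: "AE \<omega> in M. X t \<omega> = X 0 \<omega> + integral {0..t} (\<lambda>\<tau>. b \<tau> \<omega>) + a * S t \<omega>"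
    and Xi: "integrable M (X 0)" "integrable M (X t)"
    and ito: "ito_integrals_centred M F T I Y W"
    and comm: "expectation_commutes_series M F T I Y W"
    and GV: "\<And>l r. l \<in> L \<Longrightarrow> r \<in> I \<Longrightarrow> has_covariation M F T (G l) (W r) (GV l r)"
    and \<sigma>: "((\<lambda>r. expectation (\<lambda>\<omega>. \<Sum>l\<in>L. c r l * GV l r t \<omega>)) has_sum \<sigma>) I"
  shows "expectation (X t) = expectation (X 0) + integral {0..t} Eb + a / 2 * \<sigma>"
proof -
  obtain J V Z A where J: "\<And>q. q \<in> I \<Longrightarrow> has_ito_integral M F T (Y q) (W q) (J q)"
    and V: "\<And>q. q \<in> I \<Longrightarrow> has_covariation M F T (Y q) (W q) (V q)"
    and Z: "\<And>t. t \<in> {0..T} \<Longrightarrow> sums_in_prob M I (\<lambda>q. J q t) (Z t)"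
    and A: "\<And>t. t \<in> {0..T} \<Longrightarrow> sums_in_prob M I (\<lambda>q. V q t) (A t)"
    and SZ: "\<And>t \<omega>. t \<in> {0..T} \<Longrightarrow> \<omega> \<in> space M \<Longrightarrow> S t \<omega> = Z t \<omega> + A t \<omega> / 2"
    using S unfolding has_stratonovich_series_def by blast
  have tT: "t \<in> {0..T}" using t by simp
  have JM: "J q t \<in> borel_measurable M" and VM: "V q t \<in> borel_measurable M" if "q \<in> I" for q
  proof -
    have "J q t \<in> borel_measurable (F t)" "V q t \<in> borel_measurable (F t)"
      using J[OF that] V[OF that] tT
      by (auto simp: has_ito_integral_def has_covariation_def adapted_continuous_def)
    then show "J q t \<in> borel_measurable M" "V q t \<in> borel_measurable M" using measurable_F_M by auto
  qed
  have tip: "tends_in_prob (\<lambda>R \<omega>. \<Sum>q\<in>R. f q \<omega>) K (finite_subsets_at_top I)"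
    if "sums_in_prob M I f K" "\<And>q. q \<in> I \<Longrightarrow> f q \<in> borel_measurable M" for f K
  proof -
    have "\<forall>\<^sub>F R in finite_subsets_at_top I. (\<lambda>\<omega>. \<Sum>q\<in>R. f q \<omega>) \<in> borel_measurable M"
      using that(2) by (intro eventually_finite_subsets_at_top_weakI borel_measurable_sum) auto
    then show ?thesis using that(1) by (simp add: sums_in_prob_def tends_in_prob_def)
  qed
  have "tends_in_prob (\<lambda>R \<omega>. (\<Sum>q\<in>R. J q t \<omega>) + 1 / 2 * (\<Sum>q\<in>R. V q t \<omega>)) (\<lambda>\<omega>. Z t \<omega> + 1 / 2 * A t \<omega>) (finite_subsets_at_top I)"
    by (intro tends_in_prob_add tends_in_prob_cmult tip Z A tT JM VM)
  then have "sums_in_prob M I (\<lambda>q \<omega>. J q t \<omega> + V q t \<omega> / 2) (\<lambda>\<omega>. Z t \<omega> + A t \<omega> / 2)"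
    unfolding sums_in_prob_def tends_in_prob_def
    by (simp add: sum.distrib sum_divide_distrib)
  moreover have "has_stratonovich_integral M F T (Y q) (W q) (\<lambda>t \<omega>. J q t \<omega> + V q t \<omega> / 2)" if "q \<in> I" for q
    unfolding has_stratonovich_integral_def using J[OF that] V[OF that] by blast
  ultimately have "((\<lambda>q. expectation (\<lambda>\<omega>. J q t \<omega> + V q t \<omega> / 2)) has_sum expectation (\<lambda>\<omega>. Z t \<omega> + A t \<omega> / 2)) I"
    using comm tT unfolding expectation_commutes_series_def
    by (elim allE[of _ "\<lambda>q t \<omega>. J q t \<omega> + V q t \<omega> / 2"] allE[of _ t] allE[of _ "\<lambda>\<omega>. Z t \<omega> + A t \<omega> / 2"]) auto
  also have "expectation (\<lambda>\<omega>. Z t \<omega> + A t \<omega> / 2) = expectation (S t)"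
    using SZ[OF tT] by (intro Bochner_Integration.integral_cong) auto
  finally have sum1: "((\<lambda>q. expectation (\<lambda>\<omega>. J q t \<omega> + V q t \<omega> / 2)) has_sum expectation (S t)) I" .
  have "expectation (\<lambda>\<omega>. J q t \<omega> + V q t \<omega> / 2) = 1 / 2 * expectation (\<lambda>\<omega>. \<Sum>l\<in>L. c q l * GV l q t \<omega>)" if q: "q \<in> I" for q
  proof -
    have Ji: "integrable M (J q t)" "expectation (J q t) = 0"
      using ito J[OF q] q tT unfolding ito_integrals_centred_def by auto
    have "expectation (\<lambda>\<omega>. J q t \<omega> + V q t \<omega> / 2) = expectation (V q t) / 2"
    proof (cases "integrable M (V q t)")
      case True
      then show ?thesis using Ji by simp
    next
      \<comment> \<open>Since \<open>J q t\<close> is integrable, the sum is then not integrable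
        either, and both expectations are 0 by convention.\<close>
      case False
      have "\<not> integrable M (\<lambda>\<omega>. J q t \<omega> + V q t \<omega> / 2)"
      proof
        assume "integrable M (\<lambda>\<omega>. J q t \<omega> + V q t \<omega> / 2)"
        from Bochner_Integration.integrable_diff[OF this Ji(1)]
        have "integrable M (\<lambda>\<omega>. 2 * (V q t \<omega> / 2))" by (intro integrable_mult_right) simp
        with False show False by simp
      qed
      with False show ?thesis by (simp add: not_integrable_integral_eq)
    qed
    moreover have "AE \<omega> in M. V q t \<omega> = (\<Sum>l\<in>L. c q l * GV l q t \<omega>)"
      using covariation_linear_combination[OF GV[OF _ q] V[OF q, unfolded Y_def[abs_def]] q t] by simp
    then have "expectation (V q t) = expectation (\<lambda>\<omega>. \<Sum>l\<in>L. c q l * GV l q t \<omega>)"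
    proof (rule integral_cong_AE[rotated 2])
      have "GV l q t \<in> borel_measurable M" if "l \<in> L" for l
      proof -
        have "GV l q t \<in> borel_measurable (F t)"
          using GV[OF that q] tT by (auto simp: has_covariation_def adapted_continuous_def)
        then show ?thesis by (rule measurable_F_M)
      qed
      then show "(\<lambda>\<omega>. \<Sum>l\<in>L. c q l * GV l q t \<omega>) \<in> borel_measurable M"
        by (intro borel_measurable_sum borel_measurable_times) auto
    qed (use VM[OF q] in auto)
    ultimately show ?thesis by simp
  qed
  with sum1 have "((\<lambda>q. 1 / 2 * expectation (\<lambda>\<omega>. \<Sum>l\<in>L. c q l * GV l q t \<omega>)) has_sum expectation (S t)) I"
    by (subst has_sum_cong[where g="\<lambda>q. expectation (\<lambda>\<omega>. J q t \<omega> + V q t \<omega> / 2)"]) auto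
  moreover have "((\<lambda>q. 1 / 2 * expectation (\<lambda>\<omega>. \<Sum>l\<in>L. c q l * GV l q t \<omega>)) has_sum (1 / 2 * \<sigma>)) I"
    by (rule has_sum_cmult_right[OF \<sigma>])
  ultimately have ES: "expectation (S t) = 1 / 2 * \<sigma>" by (rule has_sum_unique)
  note bint = expectation_time_integral[OF t b bi Eb]
  have SM: "S t \<in> borel_measurable M"
  proof -
    have "(\<lambda>\<omega>. Z t \<omega> + A t \<omega> / 2) \<in> borel_measurable M"
      using Z[OF tT] A[OF tT] by (auto simp: sums_in_prob_def)
    then show ?thesis using SZ[OF tT] by (subst measurable_cong) auto
  qed
  \<comment> \<open>Integrability of the noise contribution is read off the equation, whose other
    terms are integrable. It concerns \<open>a * S t\<close> and not \<open>S t\<close>, as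
    \<open>a\<close> may be 0.\<close>
  have aS: "integrable M (\<lambda>\<omega>. a * S t \<omega>)"
  proof (rule integrable_cong_AE_imp)
    show "integrable M (\<lambda>\<omega>. X t \<omega> - X 0 \<omega> - integral {0..t} (\<lambda>\<tau>. b \<tau> \<omega>))"
      using Xi bint by auto
    show "AE \<omega> in M. X t \<omega> - X 0 \<omega> - integral {0..t} (\<lambda>\<tau>. b \<tau> \<omega>) = a * S t \<omega>"
      using X by eventually_elim simp
  qed (use SM in auto)
  have "expectation (X t) = expectation (\<lambda>\<omega>. X 0 \<omega> + integral {0..t} (\<lambda>\<tau>. b \<tau> \<omega>) + a * S t \<omega>)"
    using X Xi bint aS by (intro integral_cong_AE) auto
  also have "\<dots> = expectation (X 0) + integral {0..t} Eb + a * expectation (S t)"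
    using Xi bint aS by simp
  finally show ?thesis by (simp add: ES)
qed

section \<open>Partial derivatives and first order operators\<close>

lemma pd_eqI: "(f has_derivative f') (at x) \<Longrightarrow> pd i f x = f' (axis i 1)"
  unfolding pd_def using frechet_derivative_at by metis

lemma has_derivative_frechet:
  "f differentiable (at x) \<Longrightarrow> (f has_derivative frechet_derivative f (at x)) (at x)"
  by (simp add: frechet_derivative_works)

lemma pd_const [simp]: "pd i (\<lambda>_. c) x = 0"
  by (rule pd_eqI[OF has_derivative_const])

lemma pd_add:
  "f differentiable (at x) \<Longrightarrow> g differentiable (at x) \<Longrightarrow> pd i (\<lambda>y. f y + g y) x = pd i f x + pd i g x"
  by (rule trans[OF pd_eqI[OF has_derivative_add[OF has_derivative_frechet has_derivative_frechet]]])
    (auto simp: pd_def)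

lemma pd_diff:
  "f differentiable (at x) \<Longrightarrow> g differentiable (at x) \<Longrightarrow> pd i (\<lambda>y. f y - g y) x = pd i f x - pd i g x"
  by (rule trans[OF pd_eqI[OF has_derivative_diff[OF has_derivative_frechet has_derivative_frechet]]])
    (auto simp: pd_def)

lemma pd_mult:
  "f differentiable (at x) \<Longrightarrow> g differentiable (at x) \<Longrightarrow>
    pd i (\<lambda>y. f y * g y) x = f x * pd i g x + pd i f x * g x"
  by (rule trans[OF pd_eqI[OF has_derivative_mult[OF has_derivative_frechet has_derivative_frechet]]])
    (auto simp: pd_def)

lemma pd_cmult: "f differentiable (at x) \<Longrightarrow> pd i (\<lambda>y. c * f y) x = c * pd i f x"
  using pd_mult[of "\<lambda>_. c" x f i] by simp

lemma differentiable_sum':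
  "(\<And>a. a \<in> A \<Longrightarrow> f a differentiable (at x)) \<Longrightarrow> (\<lambda>y. \<Sum>a\<in>A. f a y) differentiable (at x)"
  by (induction A rule: infinite_finite_induct) auto

lemma pd_sum:
  "(\<And>a. a \<in> A \<Longrightarrow> f a differentiable (at x)) \<Longrightarrow> pd i (\<lambda>y. \<Sum>a\<in>A. f a y) x = (\<Sum>a\<in>A. pd i (f a) x)"
  by (induction A rule: infinite_finite_induct) (auto simp: pd_add differentiable_sum')

lemma pd_compose:
  assumes f: "f differentiable (at x)" and h: "(h has_real_derivative h') (at (f x))"
  shows "pd i (\<lambda>y. h (f y)) x = h' * pd i f x" "(\<lambda>y. h (f y)) differentiable (at x)"
proof -
  have "((\<lambda>y. h (f y)) has_derivative (\<lambda>v. h' * frechet_derivative f (at x) v)) (at x)"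
    using has_derivative_compose[OF has_derivative_frechet[OF f], of h "(*) h'"] h
    by (simp add: has_field_derivative_def)
  then show "pd i (\<lambda>y. h (f y)) x = h' * pd i f x" "(\<lambda>y. h (f y)) differentiable (at x)"
    by (auto simp: pd_def differentiable_def dest: pd_eqI)
qed

lemma pd_divide:
  assumes "f differentiable (at x)" "g differentiable (at x)" "g x \<noteq> 0"
  shows "pd i (\<lambda>y. f y / g y) x = pd i f x / g x - f x * pd i g x / (g x)\<^sup>2"
    "(\<lambda>y. f y / g y) differentiable (at x)"
proof -
  have inv: "(inverse has_real_derivative - (inverse (g x) ^ Suc (Suc 0))) (at (g x))"
    by (rule DERIV_inverse[OF assms(3)])
  note c = pd_compose[OF assms(2) inv]
  show "(\<lambda>y. f y / g y) differentiable (at x)"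
    unfolding divide_inverse using assms(1) c(2) by (rule differentiable_mult)
  have "pd i (\<lambda>y. f y * inverse (g y)) x = f x * (- (inverse (g x) ^ Suc (Suc 0)) * pd i g x) + pd i f x * inverse (g x)"
    using pd_mult[OF assms(1) c(2), of i] c(1)[of i] by simp
  then show "pd i (\<lambda>y. f y / g y) x = pd i f x / g x - f x * pd i g x / (g x)\<^sup>2"
    by (simp add: divide_inverse power2_eq_square mult_ac)
qed

lemma has_derivative_line:
  "((\<lambda>s. x + s *\<^sub>R axis i (1::real)) has_derivative (\<lambda>v. v *\<^sub>R axis i 1)) (at s)"
  by (auto intro!: derivative_eq_intros)

lemma pd_line:
  assumes "f differentiable (at (x + s *\<^sub>R axis i 1))"
  shows "((\<lambda>s. f (x + s *\<^sub>R axis i 1)) has_real_derivative pd i f (x + s *\<^sub>R axis i 1)) (at s)"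
proof -
  let ?D = "frechet_derivative f (at (x + s *\<^sub>R axis i 1))"
  have "((\<lambda>s. f (x + s *\<^sub>R axis i 1)) has_derivative (\<lambda>v. ?D (v *\<^sub>R axis i 1))) (at s)"
    using has_derivative_compose[OF has_derivative_line has_derivative_frechet[OF assms]] .
  moreover have "(\<lambda>v. ?D (v *\<^sub>R axis i 1)) = (*) (?D (axis i 1))"
    using linear_frechet_derivative[OF assms] by (auto simp: linear_cmul)
  ultimately show ?thesis by (simp add: has_field_derivative_def pd_def)
qed

lemma pds_append: "pds (is @ js) f = pds is (pds js f)"
  by (induction "is") auto

lemma Ck_pd: "Ck (Suc k) f \<Longrightarrow> Ck k (pd i f)"
proof -
  assume f: "Ck (Suc k) f"
  have "pds js (pd i f) = pds (js @ [i]) f" for js by (simp add: pds_append)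
  then show ?thesis using f unfolding Ck_def by auto
qed

lemma Ck_mono: "Ck k f \<Longrightarrow> j \<le> k \<Longrightarrow> Ck j f"
  unfolding Ck_def by auto

lemma Ck_zero: "Ck k (\<lambda>_ :: real ^ 'n. 0)"
proof -
  have "pds is (\<lambda>_. 0) = (\<lambda>_. 0)" for "is" :: "'n list"
    by (induction "is") auto
  then show ?thesis by (simp add: Ck_def)
qed

lemma Ck_continuous: "Ck k f \<Longrightarrow> continuous_on UNIV f"
  unfolding Ck_def by (auto dest: spec[of _ "[]"])

lemma Ck_differentiable: "Ck (Suc k) f \<Longrightarrow> f differentiable (at x)"
  unfolding Ck_def by (auto dest!: spec[of _ "[]"])

text \<open>The mean value theorem, first in direction \<open>i\<close> for the difference in
  direction \<open>j\<close>, then in direction \<open>j\<close>. The second difference is symmetric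
  in \<open>i\<close> and \<open>j\<close>, so its limit identifies the two mixed
  derivatives.\<close>

lemma second_difference:
  assumes f: "\<And>x. f differentiable (at x)" and fi: "\<And>x. pd i f differentiable (at x)" and h: "h > 0"
  shows "\<exists>s t. 0 < s \<and> s < h \<and> 0 < t \<and> t < h \<and>
    f (x + h *\<^sub>R axis i 1 + h *\<^sub>R axis j 1) - f (x + h *\<^sub>R axis i 1) - f (x + h *\<^sub>R axis j 1) + f x =
      h * h * pd j (pd i f) (x + s *\<^sub>R axis i 1 + t *\<^sub>R axis j 1)"
proof -
  define g where "g = (\<lambda>s. f ((x + h *\<^sub>R axis j 1) + s *\<^sub>R axis i 1) - f (x + s *\<^sub>R axis i 1))"
  have g': "(g has_real_derivative pd i f ((x + h *\<^sub>R axis j 1) + s *\<^sub>R axis i 1) - pd i f (x + s *\<^sub>R axis i 1)) (at s)" for s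
    unfolding g_def by (intro DERIV_diff pd_line f)
  obtain s where s: "0 < s" "s < h"
    "g h - g 0 = (h - 0) * (pd i f ((x + h *\<^sub>R axis j 1) + s *\<^sub>R axis i 1) - pd i f (x + s *\<^sub>R axis i 1))"
    using MVT2[OF h, of g "\<lambda>s. pd i f ((x + h *\<^sub>R axis j 1) + s *\<^sub>R axis i 1) - pd i f (x + s *\<^sub>R axis i 1)"] g' by blast
  define k where "k = (\<lambda>t. pd i f ((x + s *\<^sub>R axis i 1) + t *\<^sub>R axis j 1))"
  have k': "(k has_real_derivative pd j (pd i f) ((x + s *\<^sub>R axis i 1) + t *\<^sub>R axis j 1)) (at t)" for t
    unfolding k_def by (intro pd_line fi)
  obtain t where t: "0 < t" "t < h" "k h - k 0 = (h - 0) * pd j (pd i f) ((x + s *\<^sub>R axis i 1) + t *\<^sub>R axis j 1)"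
    using MVT2[OF h, of k "\<lambda>t. pd j (pd i f) ((x + s *\<^sub>R axis i 1) + t *\<^sub>R axis j 1)"] k' by blast
  have "g h - g 0 = h * (k h - k 0)" using s(3) by (simp add: k_def add_ac)
  then have "g h - g 0 = h * h * pd j (pd i f) (x + s *\<^sub>R axis i 1 + t *\<^sub>R axis j 1)" using t(3) by simp
  then show ?thesis using s t
    by - (rule exI[of _ s], rule exI[of _ t], simp add: g_def algebra_simps)
qed

lemma pd_commute:
  fixes f :: "real ^ 'n \<Rightarrow> real"
  assumes f: "Ck 2 f"
  shows "pd i (pd j f) x = pd j (pd i f) x"
proof -
  have f1: "f differentiable (at y)" "pd k f differentiable (at y)" for y k
    using Ck_differentiable[of 1 f] Ck_differentiable[of 0 "pd k f"] Ck_pd[of 1 f k] f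
    by (auto simp: numeral_2_eq_2)
  have cont: "continuous_on UNIV (pd k (pd l f))" for k l
    using f unfolding Ck_def by (auto dest!: spec[of _ "[k, l]"])
  define h where "h = (\<lambda>n. 1 / real (Suc n))"
  have h: "h n > 0" for n by (simp add: h_def)
  have h0: "h \<longlonglongrightarrow> 0" unfolding h_def by (rule LIMSEQ_Suc[OF lim_1_over_n])
  define \<Delta> where "\<Delta> = (\<lambda>h. f (x + h *\<^sub>R axis i 1 + h *\<^sub>R axis j 1) - f (x + h *\<^sub>R axis i 1) - f (x + h *\<^sub>R axis j 1) + f x)"
  have lim: "(\<lambda>n. \<Delta> (h n) / (h n * h n)) \<longlonglongrightarrow> pd l (pd k f) x"
    if kl: "\<And>h. h > 0 \<Longrightarrow> \<exists>s t. 0 < s \<and> s < h \<and> 0 < t \<and> t < h \<and>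
        \<Delta> h = h * h * pd l (pd k f) (x + s *\<^sub>R axis k 1 + t *\<^sub>R axis l 1)" for k l
  proof -
    obtain s t where st: "\<And>n. 0 < s n \<and> s n < h n \<and> 0 < t n \<and> t n < h n \<and>
        \<Delta> (h n) = h n * h n * pd l (pd k f) (x + s n *\<^sub>R axis k 1 + t n *\<^sub>R axis l 1)"
      using kl[OF h] by metis
    have "s \<longlonglongrightarrow> 0" "t \<longlonglongrightarrow> 0"
      using st by (auto intro!: tendsto_sandwich[OF _ _ tendsto_const h0] always_eventually less_imp_le)
    then have "(\<lambda>n. x + s n *\<^sub>R axis k 1 + t n *\<^sub>R axis l 1) \<longlonglongrightarrow> x + 0 *\<^sub>R axis k 1 + 0 *\<^sub>R axis l 1"
      by (intro tendsto_intros)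
    then have "(\<lambda>n. pd l (pd k f) (x + s n *\<^sub>R axis k 1 + t n *\<^sub>R axis l 1)) \<longlonglongrightarrow> pd l (pd k f) x"
      using cont[of l k] by (intro continuous_on_tendsto_compose[of UNIV "pd l (pd k f)"]) auto
    moreover have "\<Delta> (h n) / (h n * h n) = pd l (pd k f) (x + s n *\<^sub>R axis k 1 + t n *\<^sub>R axis l 1)" for n
      using st[of n] h[of n] by simp
    ultimately show ?thesis by simp
  qed
  have "(\<lambda>n. \<Delta> (h n) / (h n * h n)) \<longlonglongrightarrow> pd j (pd i f) x"
    by (rule lim) (use second_difference[OF f1, of _ x i j] in \<open>simp add: \<Delta>_def\<close>)
  moreover have "(\<lambda>n. \<Delta> (h n) / (h n * h n)) \<longlonglongrightarrow> pd i (pd j f) x"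
    by (rule lim) (use second_difference[OF f1, of _ x j i] in \<open>simp add: \<Delta>_def algebra_simps\<close>)
  ultimately show ?thesis using LIMSEQ_unique by blast
qed

text \<open>The operators \<open>P\<^sub>r\<close> of the overview. They act on families of scalar
  fields, so that they can be composed; the transport part \<open>A\<close> is common to all
  components and \<open>B\<close> couples them.\<close>

definition first_order :: "('n \<Rightarrow> real ^ 'n \<Rightarrow> real) \<Rightarrow> ('c \<Rightarrow> 'c \<Rightarrow> real ^ 'n \<Rightarrow> real) \<Rightarrow>
    ('c::finite \<Rightarrow> real ^ 'n \<Rightarrow> real) \<Rightarrow> 'c \<Rightarrow> real ^ 'n \<Rightarrow> real" where
  "first_order A B f c x = (\<Sum>i\<in>UNIV. A i x * pd i (f c) x) + (\<Sum>d\<in>UNIV. B c d x * f d x)"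

lemma pd_first_order:
  assumes A: "\<And>i. A i differentiable (at x)" and B: "\<And>d. B c d differentiable (at x)"
    and f: "\<And>d. f d differentiable (at x)" "\<And>i. pd i (f c) differentiable (at x)"
  shows "first_order A B f c differentiable (at x)"
    "pd i (first_order A B f c) x =
      (\<Sum>j\<in>UNIV. A j x * pd i (pd j (f c)) x + pd i (A j) x * pd j (f c) x) +
      (\<Sum>d\<in>UNIV. B c d x * pd i (f d) x + pd i (B c d) x * f d x)"
proof -
  have d: "(\<lambda>x. \<Sum>i\<in>UNIV. A i x * pd i (f c) x) differentiable (at x)"
    "(\<lambda>x. \<Sum>d\<in>UNIV. B c d x * f d x) differentiable (at x)"
    by (intro differentiable_sum' differentiable_mult assms)+
  show "first_order A B f c differentiable (at x)"
    unfolding first_order_def[abs_def] by (intro differentiable_add d)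
  have "pd i (first_order A B f c) x = pd i (\<lambda>x. \<Sum>i\<in>UNIV. A i x * pd i (f c) x) x
      + pd i (\<lambda>x. \<Sum>d\<in>UNIV. B c d x * f d x) x"
    unfolding first_order_def[abs_def] by (rule pd_add[OF d])
  also have "pd i (\<lambda>x. \<Sum>i\<in>UNIV. A i x * pd i (f c) x) x =
      (\<Sum>j\<in>UNIV. A j x * pd i (pd j (f c)) x + pd i (A j) x * pd j (f c) x)"
    by (subst pd_sum) (simp_all add: assms pd_mult differentiable_mult)
  also have "pd i (\<lambda>x. \<Sum>d\<in>UNIV. B c d x * f d x) x =
      (\<Sum>d\<in>UNIV. B c d x * pd i (f d) x + pd i (B c d) x * f d x)"
    by (subst pd_sum) (simp_all add: assms pd_mult differentiable_mult)
  finally show "pd i (first_order A B f c) x =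
      (\<Sum>j\<in>UNIV. A j x * pd i (pd j (f c)) x + pd i (A j) x * pd j (f c) x) +
      (\<Sum>d\<in>UNIV. B c d x * pd i (f d) x + pd i (B c d) x * f d x)" .
qed

lemma ck_field_Ck: "ck_field T k g \<Longrightarrow> t \<in> {0..T} \<Longrightarrow> Ck k (g t)"
  by (simp add: ck_field_def)

lemma ck_field_joint:
  assumes "ck_field T k g" "length is \<le> k"
  shows "continuous_on (UNIV \<times> {0..T}) (\<lambda>(x, t). pds is (g t) x)"
proof -
  have "continuous_on ({0..T} \<times> UNIV) (\<lambda>(t, x). pds is (g t) x)"
    using assms by (simp add: ck_field_def)
  then have "continuous_on (UNIV \<times> {0..T}) (\<lambda>z. case (snd z, fst z) of (t, x) \<Rightarrow> pds is (g t) x)"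
    by (rule continuous_on_compose2) (auto intro!: continuous_intros)
  then show ?thesis by (simp add: case_prod_unfold)
qed

lemma ck_field_time:
  assumes "ck_field T k g" "length is \<le> k"
  shows "continuous_on {0..T} (\<lambda>t. pds is (g t) x)"
proof -
  have "continuous_on {0..T} (\<lambda>t. case (x, t) of (x, t) \<Rightarrow> pds is (g t) x)"
    by (rule continuous_on_compose2[OF ck_field_joint[OF assms]]) (auto intro!: continuous_intros)
  then show ?thesis by simp
qed

lemma ck_field_2_joint:
  assumes "ck_field T 2 g"
  shows "continuous_on (UNIV \<times> {0..T}) (\<lambda>z. g (snd z) (fst z))"
    "continuous_on (UNIV \<times> {0..T}) (\<lambda>z. pd i (g (snd z)) (fst z))"
    "continuous_on (UNIV \<times> {0..T}) (\<lambda>z. pd i (pd j (g (snd z))) (fst z))"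
  using ck_field_joint[OF assms, of "[]"] ck_field_joint[OF assms, of "[i]"] ck_field_joint[OF assms, of "[i, j]"]
  by (auto simp: case_prod_unfold)

lemma ck_field_2_time:
  assumes "ck_field T 2 g"
  shows "continuous_on {0..T} (\<lambda>t. g t x)" "continuous_on {0..T} (\<lambda>t. pd i (g t) x)"
    "continuous_on {0..T} (\<lambda>t. pd i (pd j (g t)) x)"
  using ck_field_time[OF assms, of "[]" x] ck_field_time[OF assms, of "[i]" x] ck_field_time[OF assms, of "[i, j]" x]
  by auto

lemma ck_field_2_differentiable:
  assumes "ck_field T 2 g" "t \<in> {0..T}"
  shows "g t differentiable (at x)" "pd i (g t) differentiable (at x)"
  using ck_field_Ck[OF assms] Ck_differentiable[of 1 "g t"] Ck_differentiable[of 0 "pd i (g t)"] Ck_pd[of 1 "g t" i]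
  by (auto simp: numeral_2_eq_2)

lemma Ck_1_continuous_pd: "Ck 1 f \<Longrightarrow> continuous_on UNIV (pd i f)"
  unfolding Ck_def by (auto dest!: spec[of _ "[i]"])

text \<open>The Leibniz rule along a coordinate line. One order of smoothness of \<open>A\<close>
  and \<open>B\<close> and two of the fields make the differentiated integrand jointly continuous in
  point and time.\<close>

lemma time_integral_first_order:
  fixes g :: "'c::finite \<Rightarrow> real \<Rightarrow> real ^ 'n \<Rightarrow> real"
  assumes g: "\<And>c. ck_field T 2 (g c)" and A: "\<And>i. Ck 1 (A i)" and B: "\<And>c d. Ck 1 (B c d)"
    and t: "0 \<le> t" "t \<le> T"
  shows "continuous_on UNIV (\<lambda>x. integral {0..t} (\<lambda>\<tau>. first_order A B (\<lambda>d. g d \<tau>) c x))"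
    "((\<lambda>s. integral {0..t} (\<lambda>\<tau>. first_order A B (\<lambda>d. g d \<tau>) c (x + s *\<^sub>R axis i 1))) has_real_derivative
        integral {0..t} (\<lambda>\<tau>. pd i (first_order A B (\<lambda>d. g d \<tau>) c) x)) (at 0)"
proof -
  have sub: "UNIV \<times> {0..t} \<subseteq> UNIV \<times> {0..T}" for x using t by auto
  note j = ck_field_2_joint[OF g, THEN continuous_on_subset, OF sub]
  have f: "continuous_on (UNIV \<times> {0..t}) (\<lambda>z. a (fst z))" if "continuous_on UNIV a" for a :: "real ^ 'n \<Rightarrow> real"
    by (rule continuous_on_compose2[OF that]) (auto intro!: continuous_intros)
  note fA = f[OF Ck_continuous[OF A]] f[OF Ck_continuous[OF B]]
    f[OF Ck_1_continuous_pd[OF A]] f[OF Ck_1_continuous_pd[OF B]]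
  have c0: "continuous_on (UNIV \<times> {0..t}) (\<lambda>(x, \<tau>). first_order A B (\<lambda>d. g d \<tau>) c x)"
    unfolding first_order_def case_prod_unfold by (intro continuous_on_add continuous_on_sum continuous_on_mult j fA)
  have dA: "A i differentiable (at x)" and dB: "B c d differentiable (at x)" for i c d x
    using Ck_differentiable[of 0 "A i"] Ck_differentiable[of 0 "B c d"] A B by simp_all
  have pdF: "first_order A B (\<lambda>d. g d \<tau>) c differentiable (at x)"
    "pd i (first_order A B (\<lambda>d. g d \<tau>) c) x =
      (\<Sum>j\<in>UNIV. A j x * pd i (pd j (g c \<tau>)) x + pd i (A j) x * pd j (g c \<tau>) x) +
      (\<Sum>d\<in>UNIV. B c d x * pd i (g d \<tau>) x + pd i (B c d) x * g d \<tau> x)" if "\<tau> \<in> {0..t}" for x \<tau>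
  proof -
    have \<tau>: "\<tau> \<in> {0..T}" using that t by auto
    show "first_order A B (\<lambda>d. g d \<tau>) c differentiable (at x)"
      by (rule pd_first_order(1)) (intro dA dB ck_field_2_differentiable[OF g \<tau>])+
    show "pd i (first_order A B (\<lambda>d. g d \<tau>) c) x =
      (\<Sum>j\<in>UNIV. A j x * pd i (pd j (g c \<tau>)) x + pd i (A j) x * pd j (g c \<tau>) x) +
      (\<Sum>d\<in>UNIV. B c d x * pd i (g d \<tau>) x + pd i (B c d) x * g d \<tau> x)"
      by (rule pd_first_order(2)) (intro dA dB ck_field_2_differentiable[OF g \<tau>])+
  qed
  have "continuous_on (UNIV \<times> {0..t}) (\<lambda>(x, \<tau>). (\<Sum>j\<in>UNIV. A j x * pd i (pd j (g c \<tau>)) x + pd i (A j) x * pd j (g c \<tau>) x) +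
      (\<Sum>d\<in>UNIV. B c d x * pd i (g d \<tau>) x + pd i (B c d) x * g d \<tau> x))"
    unfolding case_prod_unfold by (intro continuous_on_add continuous_on_sum continuous_on_mult j fA)
  then have c1: "continuous_on (UNIV \<times> {0..t}) (\<lambda>(x, \<tau>). pd i (first_order A B (\<lambda>d. g d \<tau>) c) x)"
    by (rule continuous_on_eq) (auto simp: pdF(2))
  show "continuous_on UNIV (\<lambda>x. integral {0..t} (\<lambda>\<tau>. first_order A B (\<lambda>d. g d \<tau>) c x))"
    using integral_continuous_on_param[of UNIV 0 t "\<lambda>x \<tau>. first_order A B (\<lambda>d. g d \<tau>) c x"] c0 by simp
  have line: "continuous_on (UNIV \<times> {0..t}) (\<lambda>(s, \<tau>). h (x + s *\<^sub>R axis i 1) \<tau>)"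
    if "continuous_on (UNIV \<times> {0..t}) (\<lambda>(x, \<tau>). h x \<tau>)" for h :: "real ^ 'n \<Rightarrow> real \<Rightarrow> real"
  proof -
    have "continuous_on (UNIV \<times> {0..t}) (\<lambda>z. (\<lambda>(x, \<tau>). h x \<tau>) (x + fst z *\<^sub>R axis i 1, snd z))"
      by (rule continuous_on_compose2[OF that]) (auto intro!: continuous_intros)
    then show ?thesis by (simp add: case_prod_unfold)
  qed
  have "((\<lambda>s. integral (cbox 0 t) (\<lambda>\<tau>. first_order A B (\<lambda>d. g d \<tau>) c (x + s *\<^sub>R axis i 1))) has_real_derivative
        integral (cbox 0 t) (\<lambda>\<tau>. pd i (first_order A B (\<lambda>d. g d \<tau>) c) (x + 0 *\<^sub>R axis i 1))) (at 0 within UNIV)"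
  proof (rule leibniz_rule_field_derivative)
    fix s \<tau> :: real assume "\<tau> \<in> cbox 0 t"
    then show "((\<lambda>s. first_order A B (\<lambda>d. g d \<tau>) c (x + s *\<^sub>R axis i 1)) has_real_derivative
        pd i (first_order A B (\<lambda>d. g d \<tau>) c) (x + s *\<^sub>R axis i 1)) (at s within UNIV)"
      using pd_line[OF pdF(1)] by simp
  next
    fix s :: real
    have "continuous_on {0..t} (\<lambda>\<tau>. case (s, \<tau>) of (s, \<tau>) \<Rightarrow> first_order A B (\<lambda>d. g d \<tau>) c (x + s *\<^sub>R axis i 1))"
      by (rule continuous_on_compose2[OF line[OF c0]]) (auto intro!: continuous_intros)
    then show "(\<lambda>\<tau>. first_order A B (\<lambda>d. g d \<tau>) c (x + s *\<^sub>R axis i 1)) integrable_on cbox 0 t"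
      by (auto intro: integrable_continuous_interval)
  qed (use line[OF c1] in auto)
  then show "((\<lambda>s. integral {0..t} (\<lambda>\<tau>. first_order A B (\<lambda>d. g d \<tau>) c (x + s *\<^sub>R axis i 1))) has_real_derivative
        integral {0..t} (\<lambda>\<tau>. pd i (first_order A B (\<lambda>d. g d \<tau>) c) x)) (at 0)"
    by simp
qed

text \<open>Turns identities that hold almost surely at each point into an almost sure identity of
  functions: a countable set of points costs only one null set.\<close>

lemma continuous_eq_on_countable_dense:
  obtains D :: "(real ^ 'n) set" where "countable D"
    "\<And>f g :: real ^ 'n \<Rightarrow> real. continuous_on UNIV f \<Longrightarrow> continuous_on UNIV g \<Longrightarrow>
      (\<And>x. x \<in> D \<Longrightarrow> f x = g x) \<Longrightarrow> f = g"
proof -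
  obtain D :: "(real ^ 'n) set" where D: "countable D" "\<And>X. open X \<Longrightarrow> X \<noteq> {} \<Longrightarrow> \<exists>d\<in>D. d \<in> X"
    using countable_dense_setE by blast
  show ?thesis
  proof (rule that[OF D(1)])
    fix f g :: "real ^ 'n \<Rightarrow> real"
    assume fg: "continuous_on UNIV f" "continuous_on UNIV g" "\<And>x. x \<in> D \<Longrightarrow> f x = g x"
    then have "open (- {x. f x = g x})" using closed_Collect_eq[of f g] by (simp add: open_Compl)
    then show "f = g" using D(2)[of "- {x. f x = g x}"] fg(3) by fastforce
  qed
qed

section \<open>The mean field equation\<close>

lemma sum_UNIV_Plus:
  fixes f :: "'a::finite + 'b::finite \<Rightarrow> 'c::comm_monoid_add"
  shows "(\<Sum>l\<in>UNIV. f l) = (\<Sum>i\<in>UNIV. f (Inl i)) + (\<Sum>d\<in>UNIV. f (Inr d))"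
  using sum.Plus[of UNIV UNIV f] by (simp add: UNIV_Plus_UNIV comp_def)

lemma square_sum_abs_le:
  "finite L \<Longrightarrow> (\<Sum>l\<in>L. \<bar>c l\<bar>)\<^sup>2 \<le> real (card L) * (\<Sum>l\<in>L. (c l)\<^sup>2)"
  using Cauchy_Schwarz_ineq_sum[of "\<lambda>_. 1" "\<lambda>l. \<bar>c l\<bar>" L] by simp

lemma summable_on_finite_sum:
  fixes f :: "'l \<Rightarrow> 'i \<Rightarrow> real"
  shows "(\<And>l. l \<in> L \<Longrightarrow> f l summable_on I) \<Longrightarrow> (\<lambda>r. \<Sum>l\<in>L. f l r) summable_on I"
  by (induction L rule: infinite_finite_induct) (auto intro!: summable_on_add)

lemma square_sum_abs_summable:
  fixes c :: "'i \<Rightarrow> 'l \<Rightarrow> real"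
  assumes L: "finite L" and c: "\<And>l. l \<in> L \<Longrightarrow> (\<lambda>r. (c r l)\<^sup>2) summable_on I"
  shows "(\<lambda>r. (\<Sum>l\<in>L. \<bar>c r l\<bar>)\<^sup>2) summable_on I"
proof (rule summable_on_comparison_test)
  show "(\<lambda>r. real (card L) * (\<Sum>l\<in>L. (c r l)\<^sup>2)) summable_on I"
    by (intro summable_on_cmult_right summable_on_finite_sum c)
qed (use square_sum_abs_le[OF L] in auto)

text \<open>\<open>f\<close> is differentiable in the full sense, \<open>g\<close> only along the
  axis; equality of the functions transfers the value.\<close>

lemma has_real_derivative_line_unique:
  assumes f: "f differentiable (at x)" and g: "((\<lambda>s. g (x + s *\<^sub>R axis i 1)) has_real_derivative D) (at 0)"
    and eq: "f = (\<lambda>x. a * g x)"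
  shows "pd i f x = a * D"
proof -
  have "((\<lambda>s. f (x + s *\<^sub>R axis i 1)) has_real_derivative pd i f (x + 0 *\<^sub>R axis i 1)) (at 0)"
    using f by (intro pd_line) simp
  moreover have "((\<lambda>s. f (x + s *\<^sub>R axis i 1)) has_real_derivative a * D) (at 0)"
    unfolding eq by (rule DERIV_cmult[OF g])
  ultimately show ?thesis using DERIV_unique by fastforce
qed

text \<open>One factor \<open>a\<close> comes from the covariation of the field with
  \<open>W r\<close>, the other stands in front of the noise series; the factor 1/2 is the
  Stratonovich correction.\<close>

theorem (in brownian_setting) mean_field_equation:
  fixes X :: "'c::finite \<Rightarrow> real \<Rightarrow> 'a \<Rightarrow> real ^ 'n \<Rightarrow> real"
    and A :: "'i \<Rightarrow> 'n \<Rightarrow> real ^ 'n \<Rightarrow> real" and B :: "'i \<Rightarrow> 'c \<Rightarrow> 'c \<Rightarrow> real ^ 'n \<Rightarrow> real"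
  assumes ne: "I \<noteq> {}" and t: "0 \<le> t" "t \<le> T"
    and reg: "\<And>c. regular_field M F T (X c)" and mreg: "\<And>c. ck_field T 2 (mean M (X c))"
    and cov: "\<And>c r. r \<in> I \<Longrightarrow> covariation_commutes_pd M F T (X c) (W r)"
    and A: "\<And>r i. r \<in> I \<Longrightarrow> Ck 1 (A r i)" and B: "\<And>r c d. r \<in> I \<Longrightarrow> Ck 1 (B r c d)"
    and A2: "\<And>i x. (\<lambda>r. (A r i x)\<^sup>2) summable_on I" and B2: "\<And>c d x. (\<lambda>r. (B r c d x)\<^sup>2) summable_on I"
    and ito: "ito_integrals_centred M F T I (\<lambda>r t \<omega>. first_order (A r) (B r) (\<lambda>d. X d t \<omega>) c x) W"
    and comm: "expectation_commutes_series M F T I (\<lambda>r t \<omega>. first_order (A r) (B r) (\<lambda>d. X d t \<omega>) c x) W"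
    and eq: "\<And>x c. stratonovich_equation M F T I W (\<lambda>t \<omega>. X c t \<omega> x) (b c x) a
        (\<lambda>r t \<omega>. first_order (A r) (B r) (\<lambda>d. X d t \<omega>) c x)"
    and b: "\<And>c x \<omega>. \<omega> \<in> space M \<Longrightarrow> continuous_on {0..T} (\<lambda>\<tau>. b c x \<tau> \<omega>)"
    and bi: "integrable (restrict_space lborel {0..T} \<Otimes>\<^sub>M M) (\<lambda>(\<tau>, \<omega>). b c x \<tau> \<omega>)"
    and Eb: "continuous_on {0..T} Eb" "\<And>\<tau>. \<tau> \<in> {0..T} \<Longrightarrow> expectation (b c x \<tau>) = Eb \<tau>"
    and \<sigma>: "((\<lambda>r. integral {0..t} (\<lambda>\<tau>. first_order (A r) (B r) (first_order (A r) (B r) (\<lambda>e. mean M (X e) \<tau>)) c x)) has_sum \<sigma>) I"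
  shows "mean M (X c) t x = mean M (X c) 0 x + integral {0..t} Eb + a\<^sup>2 / 2 * \<sigma>"
proof -
  have Xck: "ck_field T 2 (\<lambda>t. X c t \<omega>)" if "\<omega> \<in> space M" for c \<omega>
    using reg[of c] that by (simp add: regular_field_def)
  have Xmean: "integrable M (\<lambda>\<omega>. pds is (X c \<tau> \<omega>) x)" "expectation (\<lambda>\<omega>. pds is (X c \<tau> \<omega>) x) = pds is (mean M (X c) \<tau>) x"
    if "\<tau> \<in> {0..T}" "length is \<le> 2" for c \<tau> "is" x
    using reg[of c] that by (auto simp: regular_field_def)
  have Xjoint: "integrable (restrict_space lborel {0..T} \<Otimes>\<^sub>M M) (\<lambda>(\<tau>, \<omega>). pds is (X c \<tau> \<omega>) x)"
    if "length is \<le> 2" for c "is" x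
    using reg[of c] that by (simp add: regular_field_def)
  have "\<forall>r\<in>I. \<forall>d. \<exists>C. (\<forall>t\<in>{0..T}. \<forall>\<omega>\<in>space M. Ck 1 (C t \<omega>)) \<and>
        (\<forall>x. has_covariation M F T (\<lambda>t \<omega>. X d t \<omega> x) (W r) (\<lambda>t \<omega>. C t \<omega> x) \<and>
           (\<forall>i. has_covariation M F T (\<lambda>t \<omega>. pd i (X d t \<omega>) x) (W r) (\<lambda>t \<omega>. pd i (C t \<omega>) x)))"
    using cov unfolding covariation_commutes_pd_def by blast
  then obtain C where C1: "\<And>r d t \<omega>. r \<in> I \<Longrightarrow> t \<in> {0..T} \<Longrightarrow> \<omega> \<in> space M \<Longrightarrow> Ck 1 (C r d t \<omega>)"
    and C0: "\<And>r d x. r \<in> I \<Longrightarrow> has_covariation M F T (\<lambda>t \<omega>. X d t \<omega> x) (W r) (\<lambda>t \<omega>. C r d t \<omega> x)"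
    and Ci: "\<And>r d x i. r \<in> I \<Longrightarrow> has_covariation M F T (\<lambda>t \<omega>. pd i (X d t \<omega>) x) (W r) (\<lambda>t \<omega>. pd i (C r d t \<omega>) x)"
    by metis
  \<comment> \<open>Adaptedness and continuity of the processes \<open>G\<close> are obtained from
    their having a covariation with some \<open>W r\<close>, hence one index is needed.\<close>
  obtain r0 where r0: "r0 \<in> I" using ne by blast
  \<comment> \<open>At a fixed point the operator is a finite combination: \<open>Inl i\<close>
    labels the derivative of component \<open>c\<close> in direction \<open>i\<close>,
    \<open>Inr d\<close> the value of component \<open>d\<close>.\<close>
  define cf where "cf = (\<lambda>c x r l. case l of Inl i \<Rightarrow> A r i x | Inr d \<Rightarrow> B r c d x)"
  define G where "G = (\<lambda>c x l t \<omega>. case l of Inl i \<Rightarrow> pd i (X c t \<omega>) x | Inr d \<Rightarrow> X d t \<omega> x)"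
  define GV where "GV = (\<lambda>c x l r t \<omega>. case l of Inl i \<Rightarrow> pd i (C r c t \<omega>) x | Inr d \<Rightarrow> C r d t \<omega> x)"
  have GV: "has_covariation M F T (G c x l) (W r) (GV c x l r)" if "r \<in> I" for c x l r
    using C0[OF that] Ci[OF that] unfolding G_def GV_def by (cases l) auto
  have li: "linear_integrands M F I W T UNIV (cf c x) (G c x)" for c x
  proof
    show "adapted_continuous M F T (G c x l)" for l
      using GV[OF r0, of c x l] by (simp add: has_covariation_def)
    have "(\<lambda>r. (cf c x r l)\<^sup>2) summable_on I" for l
      using A2 B2 by (cases l) (auto simp: cf_def)
    then show "(\<lambda>q. (\<Sum>l\<in>UNIV. \<bar>cf c x q l\<bar>)\<^sup>2) summable_on I"
      by (intro square_sum_abs_summable) auto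
  qed auto
  have Yeq: "linear_integrands.Y UNIV (cf c x) (G c x) = (\<lambda>r t \<omega>. first_order (A r) (B r) (\<lambda>d. X d t \<omega>) c x)" for c x
    by (intro ext) (simp add: linear_integrands.Y_def[OF li] first_order_def sum_UNIV_Plus, simp add: cf_def G_def)
  have ex: "\<exists>S. has_stratonovich_series M F T I (linear_integrands.Y UNIV (cf c x) (G c x)) W S \<and>
      (\<forall>t\<in>{0..T}. AE \<omega> in M. X c t \<omega> x = X c 0 \<omega> x + integral {0..t} (\<lambda>\<tau>. b c x \<tau> \<omega>) + a * S t \<omega>)" for c x
  proof -
    from eq[of c x] obtain S where S: "has_stratonovich_series M F T I (\<lambda>r t \<omega>. first_order (A r) (B r) (\<lambda>d. X d t \<omega>) c x) W S"
      "\<And>t. t \<in> {0..T} \<Longrightarrow> AE \<omega> in M. (\<lambda>\<tau>. b c x \<tau> \<omega>) integrable_on {0..t} \<and>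
         X c t \<omega> x = X c 0 \<omega> x + integral {0..t} (\<lambda>\<tau>. b c x \<tau> \<omega>) + a * S t \<omega>"
      unfolding stratonovich_equation_def by blast
    have "AE \<omega> in M. X c t \<omega> x = X c 0 \<omega> x + integral {0..t} (\<lambda>\<tau>. b c x \<tau> \<omega>) + a * S t \<omega>"
      if "t \<in> {0..T}" for t
      using S(2)[OF that] by eventually_elim simp
    then show ?thesis using S(1) unfolding Yeq by blast
  qed
  define K where "K = (\<lambda>r d \<omega> x. integral {0..t} (\<lambda>\<tau>. first_order (A r) (B r) (\<lambda>e. X e \<tau> \<omega>) d x))"
  have CK: "AE \<omega> in M. C r d t \<omega> x = a * K r d \<omega> x" if r: "r \<in> I" for r d x
  proof -
    obtain S where S: "has_stratonovich_series M F T I (linear_integrands.Y UNIV (cf d x) (G d x)) W S"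
      "\<And>t. t \<in> {0..T} \<Longrightarrow> AE \<omega> in M. X d t \<omega> x = X d 0 \<omega> x + integral {0..t} (\<lambda>\<tau>. b d x \<tau> \<omega>) + a * S t \<omega>"
      using ex[of d x] by blast
    show ?thesis
      using linear_integrands.covariation_identity[OF li r t C0[OF r, of d x] S(1) b S(2)]
      unfolding K_def Yeq by simp
  qed
  obtain D :: "(real ^ 'n) set" where D: "countable D"
    "\<And>f g :: real ^ 'n \<Rightarrow> real. continuous_on UNIV f \<Longrightarrow> continuous_on UNIV g \<Longrightarrow>
      (\<And>x. x \<in> D \<Longrightarrow> f x = g x) \<Longrightarrow> f = g"
    using continuous_eq_on_countable_dense by blast
  \<comment> \<open>The null set must not depend on the point: only an identity of functions can be
    differentiated in space.\<close>
  have CKx: "AE \<omega> in M. \<forall>d. C r d t \<omega> = (\<lambda>x. a * K r d \<omega> x)" if r: "r \<in> I" for r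
  proof -
    have "AE \<omega> in M. \<forall>x\<in>D. C r d t \<omega> x = a * K r d \<omega> x" for d
      using CK[OF r] D(1) by (subst AE_ball_countable) auto
    then have "AE \<omega> in M. \<forall>d\<in>UNIV. \<forall>x\<in>D. C r d t \<omega> x = a * K r d \<omega> x"
      by (rule AE_finite_allI[OF finite])
    then show ?thesis
    proof (rule AE_mp, intro AE_I2 impI allI)
      fix \<omega> d assume \<omega>: "\<omega> \<in> space M" and e: "\<forall>d\<in>UNIV. \<forall>x\<in>D. C r d t \<omega> x = a * K r d \<omega> x"
      show "C r d t \<omega> = (\<lambda>x. a * K r d \<omega> x)"
      proof (rule D(2))
        show "continuous_on UNIV (C r d t \<omega>)" using C1[OF r _ \<omega>] t by (intro Ck_continuous) auto
        show "continuous_on UNIV (\<lambda>x. a * K r d \<omega> x)"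
          unfolding K_def
          by (intro continuous_on_mult continuous_on_const)
            (rule time_integral_first_order(1)[OF _ _ _ t], intro Xck \<omega>, intro A r, intro B r)
      qed (use e in auto)
    qed
  qed
  define H where "H = (\<lambda>r \<tau> \<omega>. first_order (A r) (B r) (first_order (A r) (B r) (\<lambda>e. X e \<tau> \<omega>)) c x)"
  have H_eq: "first_order (A r) (B r) (first_order (A r) (B r) (\<lambda>e. g e \<tau>)) c x =
      (\<Sum>i\<in>UNIV. A r i x * ((\<Sum>j\<in>UNIV. A r j x * pd i (pd j (g c \<tau>)) x + pd i (A r j) x * pd j (g c \<tau>) x) +
        (\<Sum>d\<in>UNIV. B r c d x * pd i (g d \<tau>) x + pd i (B r c d) x * g d \<tau> x))) +
      (\<Sum>d\<in>UNIV. B r c d x * ((\<Sum>i\<in>UNIV. A r i x * pd i (g d \<tau>) x) + (\<Sum>e\<in>UNIV. B r d e x * g e \<tau> x)))"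
    if r: "r \<in> I" and g: "\<And>c. ck_field T 2 (g c)" and \<tau>: "\<tau> \<in> {0..T}" for r \<tau> and g :: "'c \<Rightarrow> real \<Rightarrow> real ^ 'n \<Rightarrow> real"
  proof -
    have dA: "A r i differentiable (at y)" and dB: "B r c d differentiable (at y)" for i c d y
      using Ck_differentiable[of 0 "A r i"] Ck_differentiable[of 0 "B r c d"] A[OF r] B[OF r] by simp_all
    have "pd i (first_order (A r) (B r) (\<lambda>e. g e \<tau>) c) x =
      (\<Sum>j\<in>UNIV. A r j x * pd i (pd j (g c \<tau>)) x + pd i (A r j) x * pd j (g c \<tau>) x) +
        (\<Sum>d\<in>UNIV. B r c d x * pd i (g d \<tau>) x + pd i (B r c d) x * g d \<tau> x)" for i
      by (rule pd_first_order(2)) (intro dA dB ck_field_2_differentiable[OF g \<tau>])+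
    then show ?thesis
      unfolding first_order_def[of "A r" "B r" "first_order (A r) (B r) (\<lambda>e. g e \<tau>)"]
      by (simp add: first_order_def)
  qed
  have sumH: "AE \<omega> in M. (\<Sum>l\<in>UNIV. cf c x r l * GV c x l r t \<omega>) = a * integral {0..t} (\<lambda>\<tau>. H r \<tau> \<omega>)" if r: "r \<in> I" for r
    using CKx[OF r]
  proof (rule AE_mp, intro AE_I2 impI)
    fix \<omega> assume \<omega>: "\<omega> \<in> space M" and e: "\<forall>d. C r d t \<omega> = (\<lambda>x. a * K r d \<omega> x)"
    let ?fo = "\<lambda>\<tau>. first_order (A r) (B r) (\<lambda>e. X e \<tau> \<omega>)"
    have pdC: "pd i (C r c t \<omega>) x = a * integral {0..t} (\<lambda>\<tau>. pd i (?fo \<tau> c) x)" for i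
    proof (rule has_real_derivative_line_unique)
      show "C r c t \<omega> differentiable (at x)" using C1[OF r _ \<omega>, of t c] t Ck_differentiable[of 0] by auto
      show "C r c t \<omega> = (\<lambda>x. a * integral {0..t} (\<lambda>\<tau>. ?fo \<tau> c x))" using e by (simp add: K_def)
      show "((\<lambda>s. integral {0..t} (\<lambda>\<tau>. ?fo \<tau> c (x + s *\<^sub>R axis i 1))) has_real_derivative
          integral {0..t} (\<lambda>\<tau>. pd i (?fo \<tau> c) x)) (at 0)"
        by (rule time_integral_first_order(2)[OF _ _ _ t], intro Xck \<omega>, intro A r, intro B r)
    qed
    have Cv: "C r d t \<omega> x = a * integral {0..t} (\<lambda>\<tau>. ?fo \<tau> d x)" for d
      using e by (simp add: K_def)
    have dA: "A r i differentiable (at y)" and dB: "B r c d differentiable (at y)" for i c d y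
      using Ck_differentiable[of 0 "A r i"] Ck_differentiable[of 0 "B r c d"] A[OF r] B[OF r] by simp_all
    note ct = ck_field_2_time[OF Xck[OF \<omega>], THEN continuous_on_subset, of "{0..t}"]
    have st: "{0..t} \<subseteq> {0..T}" using t by auto
    have i1: "(\<lambda>\<tau>. ?fo \<tau> d x) integrable_on {0..t}" for d
      unfolding first_order_def
      by (intro integrable_continuous_interval continuous_on_add continuous_on_sum continuous_on_mult continuous_on_const ct st)
    have "continuous_on {0..t} (\<lambda>\<tau>. (\<Sum>j\<in>UNIV. A r j x * pd i (pd j (X c \<tau> \<omega>)) x + pd i (A r j) x * pd j (X c \<tau> \<omega>) x) +
        (\<Sum>d\<in>UNIV. B r c d x * pd i (X d \<tau> \<omega>) x + pd i (B r c d) x * X d \<tau> \<omega> x))" for i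
      by (intro continuous_on_add continuous_on_sum continuous_on_mult continuous_on_const ct st)
    then have "continuous_on {0..t} (\<lambda>\<tau>. pd i (?fo \<tau> c) x)" for i
    proof (rule continuous_on_eq)
      fix \<tau> assume "\<tau> \<in> {0..t}"
      then have \<tau>: "\<tau> \<in> {0..T}" using st by auto
      show "(\<Sum>j\<in>UNIV. A r j x * pd i (pd j (X c \<tau> \<omega>)) x + pd i (A r j) x * pd j (X c \<tau> \<omega>) x) +
        (\<Sum>d\<in>UNIV. B r c d x * pd i (X d \<tau> \<omega>) x + pd i (B r c d) x * X d \<tau> \<omega> x) = pd i (?fo \<tau> c) x"
        by (rule pd_first_order(2)[symmetric]) (intro dA dB ck_field_2_differentiable[OF Xck[OF \<omega>] \<tau>])+
    qed
    then have i2: "(\<lambda>\<tau>. pd i (?fo \<tau> c) x) integrable_on {0..t}" for i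
      by (intro integrable_continuous_interval)
    have "integral {0..t} (\<lambda>\<tau>. H r \<tau> \<omega>) = (\<Sum>i\<in>UNIV. A r i x * integral {0..t} (\<lambda>\<tau>. pd i (?fo \<tau> c) x)) +
        (\<Sum>d\<in>UNIV. B r c d x * integral {0..t} (\<lambda>\<tau>. ?fo \<tau> d x))"
      unfolding H_def first_order_def[of "A r" "B r" "first_order (A r) (B r) _"]
      using i1 i2
      by (subst integral_add integral_sum integral_mult_right,
          auto intro!: integrable_add integrable_sum integrable_on_mult_right)+
    then show "(\<Sum>l\<in>UNIV. cf c x r l * GV c x l r t \<omega>) = a * integral {0..t} (\<lambda>\<tau>. H r \<tau> \<omega>)"
      unfolding sum_UNIV_Plus cf_def GV_def
      by (simp add: pdC Cv sum_distrib_left distrib_left mult_ac)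
  qed
  have EH: "expectation (\<lambda>\<omega>. \<Sum>l\<in>UNIV. cf c x r l * GV c x l r t \<omega>) =
      a * integral {0..t} (\<lambda>\<tau>. first_order (A r) (B r) (first_order (A r) (B r) (\<lambda>e. mean M (X e) \<tau>)) c x)"
    if r: "r \<in> I" for r
  proof -
    \<comment> \<open>The expanded form of the doubly applied operator. It is linear in derivatives
      of order at most two, so taking expectations replaces each of them by the derivative of the
      mean.\<close>
    define Q where "Q = (\<lambda>(g :: 'c \<Rightarrow> real \<Rightarrow> real ^ 'n \<Rightarrow> real) \<tau>.
      (\<Sum>i\<in>UNIV. A r i x * ((\<Sum>j\<in>UNIV. A r j x * pd i (pd j (g c \<tau>)) x + pd i (A r j) x * pd j (g c \<tau>) x) +
        (\<Sum>d\<in>UNIV. B r c d x * pd i (g d \<tau>) x + pd i (B r c d) x * g d \<tau> x))) +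
      (\<Sum>d\<in>UNIV. B r c d x * ((\<Sum>i\<in>UNIV. A r i x * pd i (g d \<tau>) x) + (\<Sum>e\<in>UNIV. B r d e x * g e \<tau> x))))"
    have Qc: "continuous_on {0..T} (Q g)" if g: "\<And>c. ck_field T 2 (g c)" for g
      unfolding Q_def
      by (intro continuous_on_add continuous_on_sum continuous_on_mult continuous_on_const ck_field_2_time[OF g])
    have HQ: "H r \<tau> \<omega> = Q (\<lambda>c t. X c t \<omega>) \<tau>" if "\<tau> \<in> {0..T}" "\<omega> \<in> space M" for \<tau> \<omega>
      unfolding H_def Q_def using H_eq[OF r Xck[OF that(2)] that(1)] by simp
    have mQ: "first_order (A r) (B r) (first_order (A r) (B r) (\<lambda>e. mean M (X e) \<tau>)) c x = Q (\<lambda>c. mean M (X c)) \<tau>"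
      if "\<tau> \<in> {0..T}" for \<tau>
      unfolding Q_def using H_eq[OF r mreg that] by simp
    have int: "integrable M (\<lambda>\<omega>. X d \<tau> \<omega> x)" "integrable M (\<lambda>\<omega>. pd i (X d \<tau> \<omega>) x)"
        "integrable M (\<lambda>\<omega>. pd i (pd j (X d \<tau> \<omega>)) x)"
        "expectation (\<lambda>\<omega>. X d \<tau> \<omega> x) = mean M (X d) \<tau> x"
        "expectation (\<lambda>\<omega>. pd i (X d \<tau> \<omega>) x) = pd i (mean M (X d) \<tau>) x"
        "expectation (\<lambda>\<omega>. pd i (pd j (X d \<tau> \<omega>)) x) = pd i (pd j (mean M (X d) \<tau>)) x"
      if "\<tau> \<in> {0..T}" for \<tau> i j d
      using Xmean[OF that, of "[]" d x] Xmean[OF that, of "[i]" d x] Xmean[OF that, of "[i, j]" d x] by auto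
    have jint: "integrable (restrict_space lborel {0..T} \<Otimes>\<^sub>M M) (\<lambda>z. X d (fst z) (snd z) x)"
        "integrable (restrict_space lborel {0..T} \<Otimes>\<^sub>M M) (\<lambda>z. pd i (X d (fst z) (snd z)) x)"
        "integrable (restrict_space lborel {0..T} \<Otimes>\<^sub>M M) (\<lambda>z. pd i (pd j (X d (fst z) (snd z))) x)" for i j d
      using Xjoint[of "[]" d x] Xjoint[of "[i]" d x] Xjoint[of "[i, j]" d x] by (auto simp: case_prod_unfold)
    have "expectation (\<lambda>\<omega>. \<Sum>l\<in>UNIV. cf c x r l * GV c x l r t \<omega>) = expectation (\<lambda>\<omega>. a * integral {0..t} (\<lambda>\<tau>. Q (\<lambda>c t. X c t \<omega>) \<tau>))"
    proof (rule integral_cong_AE)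
      have "GV c x l r t \<in> borel_measurable M" for l
      proof -
        have "GV c x l r t \<in> borel_measurable (F t)"
          using GV[OF r, of c x l] t by (auto simp: has_covariation_def adapted_continuous_def)
        then show ?thesis by (rule measurable_F_M)
      qed
      then show "(\<lambda>\<omega>. \<Sum>l\<in>UNIV. cf c x r l * GV c x l r t \<omega>) \<in> borel_measurable M"
        by (intro borel_measurable_sum borel_measurable_times) auto
      have "integrable M (\<lambda>\<omega>. integral {0..t} (\<lambda>\<tau>. Q (\<lambda>c t. X c t \<omega>) \<tau>))"
        by (rule expectation_time_integral(1)[OF t, where Eb="Q (\<lambda>c. mean M (X c))"])
          (use Qc[OF Xck] Qc[OF mreg] in \<open>auto simp: Q_def case_prod_unfold int jint\<close>)
      then show "(\<lambda>\<omega>. a * integral {0..t} (\<lambda>\<tau>. Q (\<lambda>c t. X c t \<omega>) \<tau>)) \<in> borel_measurable M" by auto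
      show "AE \<omega> in M. (\<Sum>l\<in>UNIV. cf c x r l * GV c x l r t \<omega>) = a * integral {0..t} (\<lambda>\<tau>. Q (\<lambda>c t. X c t \<omega>) \<tau>)"
        using sumH[OF r]
      proof (rule AE_mp, intro AE_I2 impI)
        fix \<omega> assume \<omega>: "\<omega> \<in> space M" and e: "(\<Sum>l\<in>UNIV. cf c x r l * GV c x l r t \<omega>) = a * integral {0..t} (\<lambda>\<tau>. H r \<tau> \<omega>)"
        have "integral {0..t} (\<lambda>\<tau>. H r \<tau> \<omega>) = integral {0..t} (\<lambda>\<tau>. Q (\<lambda>c t. X c t \<omega>) \<tau>)"
          using HQ[OF _ \<omega>] t by (intro Henstock_Kurzweil_Integration.integral_cong) auto
        with e show "(\<Sum>l\<in>UNIV. cf c x r l * GV c x l r t \<omega>) = a * integral {0..t} (\<lambda>\<tau>. Q (\<lambda>c t. X c t \<omega>) \<tau>)" by simp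
      qed
    qed
    also have "\<dots> = a * expectation (\<lambda>\<omega>. integral {0..t} (\<lambda>\<tau>. Q (\<lambda>c t. X c t \<omega>) \<tau>))" by simp
    also have "expectation (\<lambda>\<omega>. integral {0..t} (\<lambda>\<tau>. Q (\<lambda>c t. X c t \<omega>) \<tau>)) = integral {0..t} (Q (\<lambda>c. mean M (X c)))"
      by (rule expectation_time_integral(2)[OF t])
        (use Qc[OF Xck] Qc[OF mreg] in \<open>auto simp: Q_def case_prod_unfold int jint\<close>)
    also have "\<dots> = integral {0..t} (\<lambda>\<tau>. first_order (A r) (B r) (first_order (A r) (B r) (\<lambda>e. mean M (X e) \<tau>)) c x)"
      using mQ t by (intro Henstock_Kurzweil_Integration.integral_cong) auto
    finally show ?thesis .
  qed
  obtain S where S: "has_stratonovich_series M F T I (linear_integrands.Y UNIV (cf c x) (G c x)) W S"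
    "\<And>t. t \<in> {0..T} \<Longrightarrow> AE \<omega> in M. X c t \<omega> x = X c 0 \<omega> x + integral {0..t} (\<lambda>\<tau>. b c x \<tau> \<omega>) + a * S t \<omega>"
    using ex[of c x] by blast
  have "expectation (\<lambda>\<omega>. X c t \<omega> x) = expectation (\<lambda>\<omega>. X c 0 \<omega> x) + integral {0..t} Eb + a / 2 * (a * \<sigma>)"
  proof (rule linear_integrands.mean_equation[OF li t S(1) b bi Eb])
    show "((\<lambda>r. expectation (\<lambda>\<omega>. \<Sum>l\<in>UNIV. cf c x r l * GV c x l r t \<omega>)) has_sum a * \<sigma>) I"
      by (subst has_sum_cong[OF EH]) (auto intro!: has_sum_cmult_right \<sigma>)
    show "has_covariation M F T (G c x l) (W r) (GV c x l r)" if "r \<in> I" for l r using GV[OF that] .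
  qed (use S(2)[of t] t Xmean(1)[of 0 "[]" c x] Xmean(1)[of t "[]" c x] ito comm in \<open>auto simp: Yeq\<close>)
  then show ?thesis by (simp add: mean_def power2_eq_square mult.assoc)
qed

section \<open>Lattice sums and the noise fields\<close>

lemma summable_on_abs_bound:
  fixes f g :: "'b \<Rightarrow> real"
  assumes g: "g summable_on A" and le: "\<And>x. x \<in> A \<Longrightarrow> \<bar>f x\<bar> \<le> g x"
  shows "f summable_on A"
proof (rule Infinite_Sum.abs_summable_summable)
  show "(\<lambda>x. norm (f x)) summable_on A"
    by (rule summable_on_comparison_test[OF g]) (use le in auto)
qed

lemma infsum_finite_sum:
  fixes f :: "'l \<Rightarrow> 'b \<Rightarrow> real"
  assumes "\<And>l. l \<in> L \<Longrightarrow> f l summable_on A"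
  shows "infsum (\<lambda>k. \<Sum>l\<in>L. f l k) A = (\<Sum>l\<in>L. infsum (f l) A)"
proof -
  have "((\<lambda>k. \<Sum>l\<in>L. f l k) has_sum (\<Sum>l\<in>L. infsum (f l) A)) A"
    using assms by (induction L rule: infinite_finite_induct) (auto intro!: has_sum_add has_sum_infsum)
  then show ?thesis by (rule infsumI)
qed

lemma int_vec_nth [simp]: "int_vec k $ i = real_of_int (k $ i)"
  by (simp add: int_vec_def)

lemma norm_int_vec_ge_1:
  assumes "k \<noteq> 0" shows "1 \<le> norm (int_vec k)"
proof -
  obtain i where i: "k $ i \<noteq> 0" using assms by (auto simp: vec_eq_iff)
  then have "1 \<le> \<bar>int_vec k $ i\<bar>" by simp
  also have "\<dots> \<le> norm (int_vec k)" by (rule component_le_norm_cart)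
  finally show ?thesis .
qed

lemma summable_on_int_powr:
  fixes \<beta> :: real
  assumes "\<beta> > 1"
  shows "(\<lambda>m::int. (1 + \<bar>real_of_int m\<bar>) powr (- \<beta>)) summable_on UNIV"
proof -
  let ?g = "\<lambda>m::int. (1 + \<bar>real_of_int m\<bar>) powr (- \<beta>)"
  have "summable (\<lambda>n. real n powr (- \<beta>))" using assms by (simp add: summable_real_powr_iff)
  then have s1: "summable (\<lambda>n. (1 + real n) powr (- \<beta>))"
    by (subst (asm) summable_Suc_iff[symmetric]) simp
  then have s2: "summable (\<lambda>n. (2 + real n) powr (- \<beta>))"
    by (subst (asm) summable_Suc_iff[symmetric]) (simp add: add_ac)
  have "(?g \<circ> int) summable_on UNIV"
    using s1 by (intro norm_summable_imp_summable_on) (simp add: comp_def)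
  then have 1: "?g summable_on (range int)" by (subst summable_on_reindex) auto
  have "(?g \<circ> (\<lambda>n. - 1 - int n)) summable_on UNIV"
    using s2 by (intro norm_summable_imp_summable_on) (simp add: comp_def)
  then have 2: "?g summable_on (range (\<lambda>n. - 1 - int n))" by (subst summable_on_reindex) (auto simp: inj_def)
  have "range int \<inter> range (\<lambda>n. - 1 - int n) = {}" by auto
  from summable_on_Un_disjoint[OF 1 2 this] have "?g summable_on (range int \<union> range (\<lambda>n. - 1 - int n))" .
  moreover have "range int \<union> range (\<lambda>n. - 1 - int n) = UNIV"
  proof (intro set_eqI iffI UNIV_I)
    fix m :: int
    show "m \<in> range int \<union> range (\<lambda>n. - 1 - int n)"
    proof (cases "m \<ge> 0")
      case True then show ?thesis by (auto intro: image_eqI[of _ _ "nat m"])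
    next
      case False then show ?thesis by (intro UnI2 image_eqI[of _ _ "nat (- 1 - m)"]) auto
    qed
  qed
  ultimately show ?thesis by simp
qed

text \<open>For nonzero \<open>k\<close> the norm is at least 1 and at least every entry, so
  \<open>2 * norm (int_vec k)\<close> dominates each \<open>1 + |k $ i|\<close>. Distributing the
  exponent evenly over the coordinates bounds the term by a product of one-dimensional terms with
  exponent \<open>\<alpha> / n > 1\<close>.\<close>

lemma summable_on_lattice_powr:
  fixes \<alpha> :: real
  assumes \<alpha>: "\<alpha> > real CARD('n)"
  shows "(\<lambda>k :: int ^ 'n. norm (int_vec k) powr (- \<alpha>)) summable_on (- {0})"
proof -
  define \<beta> where "\<beta> = \<alpha> / real CARD('n)"
  define g where "g = (\<lambda>m::int. (1 + \<bar>real_of_int m\<bar>) powr (- \<beta>))"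
  have n: "real CARD('n) > 0" by simp
  have \<beta>: "\<beta> > 1" using \<alpha> n by (simp add: \<beta>_def)
  have g0: "g m \<ge> 0" for m by (simp add: g_def)
  have gs: "g summable_on UNIV" unfolding g_def by (rule summable_on_int_powr[OF \<beta>])
  define S where "S = (\<Sum>\<^sub>\<infinity>m. g m)"
  have ptw: "norm (int_vec k) powr (- \<alpha>) \<le> 2 powr \<alpha> * (\<Prod>i\<in>UNIV. g (k $ i))" if "k \<noteq> 0" for k :: "int ^ 'n"
  proof -
    let ?N = "norm (int_vec k)"
    have N: "1 \<le> ?N" by (rule norm_int_vec_ge_1[OF that])
    have "?N powr (- \<alpha>) = 2 powr \<alpha> * (2 * ?N) powr (- \<alpha>)"
      using N by (simp add: powr_mult powr_minus)
    also have "(2 * ?N) powr (- \<alpha>) = (\<Prod>i\<in>(UNIV::'n set). (2 * ?N) powr (- \<beta>))"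
    proof -
      have "((2 * ?N) powr (- \<beta>)) ^ CARD('n) = ((2 * ?N) powr (- \<beta>)) powr real CARD('n)"
        using N by (subst powr_realpow) auto
      also have "\<dots> = (2 * ?N) powr (- \<beta> * real CARD('n))" by (rule powr_powr)
      also have "- \<beta> * real CARD('n) = - \<alpha>" by (simp add: \<beta>_def)
      finally show ?thesis by simp
    qed
    also have "(\<Prod>i\<in>(UNIV::'n set). (2 * ?N) powr (- \<beta>)) \<le> (\<Prod>i\<in>UNIV. g (k $ i))"
    proof (intro prod_mono conjI)
      fix i
      have "\<bar>int_vec k $ i\<bar> \<le> ?N" by (rule component_le_norm_cart)
      then show "(2 * ?N) powr (- \<beta>) \<le> g (k $ i)"
        unfolding g_def using N \<beta> by (intro powr_mono2') auto
    qed simp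
    finally show ?thesis by simp
  qed
  show ?thesis
  proof (rule nonneg_bdd_above_summable_on)
    show "bdd_above (sum (\<lambda>k :: int ^ 'n. norm (int_vec k) powr (- \<alpha>)) ` {F. F \<subseteq> - {0} \<and> finite F})"
    proof (rule bdd_aboveI2)
      fix F :: "(int ^ 'n) set" assume F: "F \<in> {F. F \<subseteq> - {0} \<and> finite F}"
      \<comment> \<open>All entries occurring in \<open>F\<close>. Over the full box of maps into
        \<open>K\<close> the sum of products factorises.\<close>
      define K where "K = (\<Union>k\<in>F. range (($) k))"
      have K: "finite K" using F by (auto simp: K_def)
      have "(\<Sum>k\<in>F. norm (int_vec k) powr (- \<alpha>)) \<le> (\<Sum>k\<in>F. 2 powr \<alpha> * (\<Prod>i\<in>UNIV. g (k $ i)))"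
        using F by (intro sum_mono ptw) auto
      also have "\<dots> = 2 powr \<alpha> * (\<Sum>k\<in>F. \<Prod>i\<in>UNIV. g (k $ i))" by (simp add: sum_distrib_left)
      also have "(\<Sum>k\<in>F. \<Prod>i\<in>UNIV. g (k $ i)) = (\<Sum>h\<in>vec_nth ` F. \<Prod>i\<in>UNIV. g (h i))"
        by (subst sum.reindex) (auto simp: inj_on_def vec_nth_inject)
      also have "\<dots> \<le> (\<Sum>h\<in>PiE (UNIV::'n set) (\<lambda>_. K). \<Prod>i\<in>UNIV. g (h i))"
      proof (rule sum_mono2)
        show "finite (PiE (UNIV::'n set) (\<lambda>_. K))" using K by (intro finite_PiE) auto
        show "vec_nth ` F \<subseteq> PiE UNIV (\<lambda>_. K)" by (auto simp: K_def)
        show "0 \<le> (\<Prod>i\<in>UNIV. g (h i))" for h :: "'n \<Rightarrow> int" by (intro prod_nonneg) (simp add: g0)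
      qed
      also have "\<dots> = (\<Prod>i\<in>(UNIV::'n set). \<Sum>m\<in>K. g m)" by (rule prod_sum_PiE[symmetric]) (use K in auto)
      also have "\<dots> \<le> (\<Prod>i\<in>(UNIV::'n set). S)"
        unfolding S_def using K g0 gs by (intro prod_mono conjI sum_nonneg finite_sum_le_infsum) auto
      finally show "(\<Sum>k\<in>F. norm (int_vec k) powr (- \<alpha>)) \<le> 2 powr \<alpha> * (\<Prod>i\<in>(UNIV::'n set). S)" by simp
    qed
  qed simp
qed

text \<open>Membership depends on the sign of the first nonzero entry, which negation
  reverses.\<close>

lemma half_lattice_split:
  fixes k :: "(int, 'n::{finite,linorder}) vec"
  shows "0 \<notin> (half_lattice :: (int, 'n) vec set)" "k \<noteq> 0 \<Longrightarrow> k \<in> half_lattice \<longleftrightarrow> - k \<notin> half_lattice"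
proof -
  show "0 \<notin> (half_lattice :: (int, 'n) vec set)" by (auto simp: half_lattice_def)
  assume "k \<noteq> 0"
  then have "{i. k $ i \<noteq> 0} \<noteq> {}" by (auto simp: vec_eq_iff)
  define i where "i = Min {i. k $ i \<noteq> 0}"
  have i: "k $ i \<noteq> 0" using Min_in[of "{i. k $ i \<noteq> 0}"] \<open>_ \<noteq> {}\<close> by (simp add: i_def)
  have less: "k $ j = 0" if "j < i" for j
  proof (rule ccontr)
    assume "k $ j \<noteq> 0"
    then have "i \<le> j" unfolding i_def by (intro Min_le) auto
    with that show False by simp
  qed
  have iff: "l \<in> half_lattice \<longleftrightarrow> l $ i > 0" if l: "l $ i \<noteq> 0" "\<And>j. j < i \<Longrightarrow> l $ j = 0" for l :: "(int, 'n) vec"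
  proof
    assume "l \<in> half_lattice"
    then obtain i' where i': "\<And>j. j < i' \<Longrightarrow> l $ j = 0" "l $ i' > 0" by (auto simp: half_lattice_def)
    then have "i' = i" using l by (metis less_irrefl linorder_neqE)
    then show "l $ i > 0" using i' by simp
  qed (use l in \<open>auto simp: half_lattice_def\<close>)
  show "k \<in> half_lattice \<longleftrightarrow> - k \<notin> half_lattice"
    using iff[of k] iff[of "- k"] i less by auto
qed

lemma infsum_even_half_lattice:
  fixes h :: "(int, 'n::{finite,linorder}) vec \<Rightarrow> real"
  assumes h: "h summable_on (- {0})" and even: "\<And>k. h (- k) = h k"
  shows "infsum h (- {0}) = 2 * infsum h half_lattice" "h summable_on half_lattice"
proof -
  let ?H = "half_lattice :: (int, 'n) vec set"
  have sub: "?H \<subseteq> - {0}" using half_lattice_split(1) by auto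
  have un: "- {0} = ?H \<union> uminus ` ?H"
  proof (intro set_eqI iffI)
    fix k :: "(int, 'n) vec" assume "k \<in> - {0}"
    then show "k \<in> ?H \<union> uminus ` ?H"
      using half_lattice_split(2)[of k] by (auto intro: image_eqI[of _ _ "- k"])
  qed (use half_lattice_split(1) in auto)
  have dis: "?H \<inter> uminus ` ?H = {}"
  proof (rule equals0I)
    fix k assume "k \<in> ?H \<inter> uminus ` ?H"
    then have "k \<in> ?H" "- k \<in> ?H" by auto
    then show False using half_lattice_split(1) half_lattice_split(2)[of k] by (cases "k = 0") auto
  qed
  show s: "h summable_on ?H" using h sub by (rule summable_on_subset_banach)
  have s': "h summable_on uminus ` ?H" using h un by (intro summable_on_subset_banach[OF h]) auto
  have "infsum h (uminus ` ?H) = infsum (h \<circ> uminus) ?H" by (rule infsum_reindex) (auto simp: inj_on_def)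
  also have "\<dots> = infsum h ?H" by (simp add: comp_def even)
  finally show "infsum h (- {0}) = 2 * infsum h ?H"
    unfolding un using infsum_Un_disjoint[OF s s' dis] by simp
qed

text \<open>Reflecting one coordinate annihilates the off-diagonal moments, permuting coordinates
  equates the diagonal ones, and their trace is the weighted sum of squared norms. The half lattice
  is not invariant under these symmetries, so the sums are computed over all nonzero frequencies and
  halved by evenness.\<close>

lemma lattice_second_moments:
  fixes w :: "real \<Rightarrow> real" and i j :: "'n::{finite,linorder}"
  assumes w: "(\<lambda>k :: (int, 'n) vec. w (norm (int_vec k)) * (norm (int_vec k))\<^sup>2) summable_on (- {0})"
    and w0: "\<And>r. w r \<ge> 0"
  shows "((\<lambda>k :: (int, 'n) vec. w (norm (int_vec k)) * (int_vec k $ i * int_vec k $ j)) has_sum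
    (if i = j then (\<Sum>\<^sub>\<infinity>k\<in>(half_lattice :: (int, 'n) vec set). w (norm (int_vec k)) * (norm (int_vec k))\<^sup>2) / real CARD('n) else 0))
    half_lattice"
proof -
  define f where "f = (\<lambda>i j (k :: (int, 'n) vec). w (norm (int_vec k)) * (int_vec k $ i * int_vec k $ j))"
  have bound: "\<bar>f i j k\<bar> \<le> w (norm (int_vec k)) * (norm (int_vec k))\<^sup>2" for i j k
  proof -
    have "\<bar>int_vec k $ i\<bar> * \<bar>int_vec k $ j\<bar> \<le> norm (int_vec k) * norm (int_vec k)"
      by (intro mult_mono component_le_norm_cart) auto
    then show ?thesis unfolding f_def abs_mult power2_eq_square using w0 by (simp add: mult_left_mono)
  qed
  have fs: "f i j summable_on (- {0})" for i j
    using w by (rule summable_on_abs_bound) (rule bound)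
  have even: "f i j (- k) = f i j k" for i j k
  proof -
    have "int_vec (- k) = - int_vec k" by (simp add: vec_eq_iff)
    then show ?thesis by (simp add: f_def)
  qed
  have perm: "infsum (f (p i) (p j)) (- {0}) = infsum (f i j) (- {0})" if p: "p permutes UNIV" for p i j
  proof (rule infsum_reindex_bij_witness[of "- {0}" "\<lambda>k. \<chi> i. k $ inv p i" "\<lambda>k. \<chi> i. k $ p i"])
    fix k :: "(int, 'n) vec"
    show "(\<chi> i. (\<chi> i. k $ p i) $ inv p i) = k" "(\<chi> i. (\<chi> i. k $ inv p i) $ p i) = k"
      using permutes_inverses[OF p] by (auto simp: vec_eq_iff)
    assume k: "k \<in> - {0}"
    then obtain a where a: "k $ a \<noteq> 0" by (auto simp: vec_eq_iff)
    have "(\<chi> i. k $ p i) $ inv p a = k $ a" "(\<chi> i. k $ inv p i) $ p a = k $ a"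
      using permutes_inverses[OF p] by auto
    moreover have "l \<in> - {0}" if "l $ b \<noteq> 0" for l :: "(int, 'n) vec" and b using that by auto
    ultimately show "(\<chi> i. k $ p i) \<in> - {0}" "(\<chi> i. k $ inv p i) \<in> - {0}" using a by metis+
    have "norm (int_vec (\<chi> i. k $ p i)) = norm (int_vec k)"
      unfolding norm_vec_def L2_set_def using sum.permute[OF p, of "\<lambda>i. (norm (int_vec k $ i))\<^sup>2"] by (simp add: comp_def)
    then show "f i j (\<chi> i. k $ p i) = f (p i) (p j) k" by (simp add: f_def)
  qed
  have off: "infsum (f i j) (- {0}) = 0" if "i \<noteq> j" for i j
  proof -
    let ?\<sigma> = "\<lambda>k :: (int, 'n) vec. \<chi> l. if l = i then - k $ l else k $ l"
    have "infsum (f i j) (- {0}) = infsum (\<lambda>k. - f i j k) (- {0})"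
    proof (rule infsum_reindex_bij_witness[of "- {0}" ?\<sigma> ?\<sigma>])
      fix k :: "(int, 'n) vec"
      show "?\<sigma> (?\<sigma> k) = k" "?\<sigma> (?\<sigma> k) = k" by (auto simp: vec_eq_iff)
      assume "k \<in> - {0}"
      then obtain a where "k $ a \<noteq> 0" by (auto simp: vec_eq_iff)
      then have "?\<sigma> k $ a \<noteq> 0" by (cases "a = i") auto
      moreover have "l \<in> - {0}" if "l $ b \<noteq> 0" for l :: "(int, 'n) vec" and b using that by auto
      ultimately show "?\<sigma> k \<in> - {0}" "?\<sigma> k \<in> - {0}" by blast+
      have "norm (int_vec (?\<sigma> k)) = norm (int_vec k)"
        unfolding norm_vec_def L2_set_def by (intro arg_cong[where f=sqrt] sum.cong) auto
      then show "- f i j (?\<sigma> k) = f i j k" using that by (simp add: f_def)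
    qed
    then show ?thesis by (simp add: infsum_uminus)
  qed
  define S where "S = (\<Sum>\<^sub>\<infinity>k\<in>(- {0 :: (int, 'n) vec}). w (norm (int_vec k)) * (norm (int_vec k))\<^sup>2)"
  have diag: "infsum (f i i) (- {0}) = S / real CARD('n)" for i
  proof -
    have same: "infsum (f l l) (- {0}) = infsum (f i i) (- {0})" for l
      using perm[OF permutes_swap_id[of i UNIV l], of i i] by simp
    have "S = infsum (\<lambda>k. \<Sum>l\<in>UNIV. f l l k) (- {0})"
      unfolding S_def
    proof (rule infsum_cong)
      fix k :: "(int, 'n) vec"
      have "(norm (int_vec k))\<^sup>2 = (\<Sum>l\<in>UNIV. int_vec k $ l * int_vec k $ l)"
        by (simp add: power2_norm_eq_inner inner_vec_def)
      then show "w (norm (int_vec k)) * (norm (int_vec k))\<^sup>2 = (\<Sum>l\<in>UNIV. f l l k)"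
        by (simp add: f_def sum_distrib_left)
    qed
    also have "\<dots> = (\<Sum>l\<in>UNIV. infsum (f l l) (- {0}))" by (rule infsum_finite_sum[OF fs])
    also have "\<dots> = (\<Sum>l\<in>(UNIV::'n set). infsum (f i i) (- {0}))" by (intro sum.cong refl same)
    also have "\<dots> = real CARD('n) * infsum (f i i) (- {0})" by simp
    finally show ?thesis by simp
  qed
  have Sh: "S = 2 * (\<Sum>\<^sub>\<infinity>k\<in>(half_lattice :: (int, 'n) vec set). w (norm (int_vec k)) * (norm (int_vec k))\<^sup>2)"
  proof -
    have "int_vec (- k) = - int_vec k" for k :: "(int, 'n) vec" by (simp add: vec_eq_iff)
    then show ?thesis unfolding S_def by (intro infsum_even_half_lattice(1)[OF w]) (simp only: norm_minus_cancel)
  qed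
  have hs: "(f i j has_sum infsum (f i j) half_lattice) half_lattice"
    using infsum_even_half_lattice(2)[OF fs even] by (rule has_sum_infsum)
  have e: "infsum (f i j) half_lattice =
      (if i = j then (\<Sum>\<^sub>\<infinity>k\<in>(half_lattice :: (int, 'n) vec set). w (norm (int_vec k)) * (norm (int_vec k))\<^sup>2) / real CARD('n) else 0)"
    using infsum_even_half_lattice(1)[OF fs even, of i j] off[of i j] diag[of i] Sh by (cases "i = j") auto
  show ?thesis using hs[unfolded e] by (simp only: f_def)
qed

section \<open>Plane waves and the noise fields\<close>

definition wave :: "real ^ 'n \<Rightarrow> real \<Rightarrow> real \<Rightarrow> real ^ 'n \<Rightarrow> real" where
  "wave \<theta> a b y = a * cos (\<theta> \<bullet> y) + b * sin (\<theta> \<bullet> y)"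

lemma wave_has_derivative:
  "(wave \<theta> a b has_derivative (\<lambda>v. (b * cos (\<theta> \<bullet> x) - a * sin (\<theta> \<bullet> x)) * (\<theta> \<bullet> v))) (at x)"
  unfolding wave_def[abs_def] by (auto intro!: derivative_eq_intros simp: algebra_simps)

lemma wave_differentiable: "wave \<theta> a b differentiable (at x)"
  using wave_has_derivative differentiable_def by blast

text \<open>Sines and cosines of one frequency form a family closed under differentiation, so a
  single computation covers both kinds of modes and all their derivatives.\<close>

lemma pd_wave: "pd c (wave \<theta> a b) = wave \<theta> (\<theta> $ c * b) (- (\<theta> $ c * a))"
  by (rule ext, subst pd_eqI[OF wave_has_derivative]) (simp add: wave_def inner_axis algebra_simps)

lemma pds_wave: "\<exists>a' b'. pds is (wave \<theta> a b) = wave \<theta> a' b'"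
proof (induction "is")
  case (Cons i "is")
  then obtain a' b' where "pds is (wave \<theta> a b) = wave \<theta> a' b'" by blast
  then have "pds (i # is) (wave \<theta> a b) = wave \<theta> (\<theta> $ i * b') (- (\<theta> $ i * a'))" by (simp add: pd_wave)
  then show ?case by blast
qed auto

lemma Ck_wave: "Ck k (wave \<theta> a b)"
proof -
  have "pds is (wave \<theta> a b) differentiable (at x)" for "is" x
    using pds_wave[of "is" \<theta> a b] wave_differentiable by metis
  then show ?thesis
    unfolding Ck_def
    by (auto intro!: differentiable_imp_continuous_on simp: differentiable_on_def)
qed

lemma abs_wave_le: "\<bar>wave \<theta> a b y\<bar> \<le> \<bar>a\<bar> + \<bar>b\<bar>"
proof -
  have "\<bar>a * cos (\<theta> \<bullet> y)\<bar> \<le> \<bar>a\<bar>"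
    using mult_left_le[of "\<bar>cos (\<theta> \<bullet> y)\<bar>" "\<bar>a\<bar>"] by (simp add: abs_mult)
  moreover have "\<bar>b * sin (\<theta> \<bullet> y)\<bar> \<le> \<bar>b\<bar>"
    using mult_left_le[of "\<bar>sin (\<theta> \<bullet> y)\<bar>" "\<bar>b\<bar>"] by (simp add: abs_mult)
  ultimately show ?thesis unfolding wave_def using abs_triangle_ineq[of "a * cos (\<theta> \<bullet> y)" "b * sin (\<theta> \<bullet> y)"] by linarith
qed

lemma zeta_wave:
  fixes kp :: "(int, 'n::{finite,linorder}) vec \<Rightarrow> nat \<Rightarrow> (real, 'n) vec"
  shows "(\<lambda>y. zeta s kp (Const_mode j) y $ d) = wave 0 (axis j 1 $ d) 0"
    "(\<lambda>y. zeta s kp (Cos_mode k i) y $ d) = wave ((2 * pi) *\<^sub>R int_vec k) (kp k i $ d / norm (int_vec k) powr (s + 1)) 0"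
    "(\<lambda>y. zeta s kp (Sin_mode k i) y $ d) = wave ((2 * pi) *\<^sub>R int_vec k) 0 (kp k i $ d / norm (int_vec k) powr (s + 1))"
  by (auto simp: wave_def)

text \<open>Every noise field is a transversal plane wave; the constant fields have zero frequency.\<close>

lemma zeta_transversal_wave:
  fixes kp :: "(int, 'n::{finite,linorder}) vec \<Rightarrow> nat \<Rightarrow> (real, 'n) vec"
  assumes kp: "orthogonal_choice kp" and r: "r \<in> noise_indices"
  obtains \<theta> v :: "(real, 'n) vec" and a b where "v \<bullet> \<theta> = 0"
    "\<And>d. (\<lambda>y. zeta s kp r y $ d) = wave \<theta> (a * v $ d) (b * v $ d)"
proof -
  have orth: "kp k i \<bullet> ((2 * pi) *\<^sub>R int_vec k) = 0"
    if "k \<in> half_lattice" "1 \<le> i" "i \<le> CARD('n) - 1" for k i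
    using kp that by (auto simp: orthogonal_choice_def)
  show ?thesis
  proof (cases r)
    case (Const_mode j)
    show ?thesis
      by (rule that[of "axis j 1" 0 1 0]) (simp_all only: Const_mode zeta_wave, simp_all)
  next
    case (Cos_mode k i)
    then have ki: "k \<in> half_lattice" "1 \<le> i" "i \<le> CARD('n) - 1" using r by (auto simp: noise_indices_def)
    show ?thesis
      by (rule that[OF orth[OF ki], of "1 / norm (int_vec k) powr (s + 1)" 0])
        (simp only: Cos_mode zeta_wave, simp)
  next
    case (Sin_mode k i)
    then have ki: "k \<in> half_lattice" "1 \<le> i" "i \<le> CARD('n) - 1" using r by (auto simp: noise_indices_def)
    show ?thesis
      by (rule that[OF orth[OF ki], of 0 "1 / norm (int_vec k) powr (s + 1)"])
        (simp only: Sin_mode zeta_wave, simp)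
  qed
qed

text \<open>Every sum contains the factor \<open>v \<bullet> \<theta>\<close>: the field points
  along \<open>v\<close>, and differentiation multiplies by a component of \<open>\<theta>\<close>.
  Besides vanishing divergence, these are the lower order terms of
  \<open>P\<^sub>r P\<^sub>r\<close>: the field transported along itself, its gradient transported
  along it, and the square of the transposed gradient.\<close>

lemma zeta_identities:
  fixes s :: real and kp :: "(int, 'n::{finite,linorder}) vec \<Rightarrow> nat \<Rightarrow> (real, 'n) vec"
  assumes kp: "orthogonal_choice kp" and r: "r \<in> noise_indices"
  defines "Z \<equiv> (\<lambda>d y. zeta s kp r y $ d)"
  shows "Ck k (Z d)" "Ck k (pd c (Z d))"
    "(\<Sum>i\<in>UNIV. pd i (Z i) x) = 0"
    "(\<Sum>i\<in>UNIV. Z i x * pd i (Z d) x) = 0"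
    "(\<Sum>i\<in>UNIV. Z i x * pd i (pd c (Z d)) x) = 0"
    "(\<Sum>e\<in>UNIV. pd c (Z e) x * pd e (Z d) x) = 0"
proof -
  obtain \<theta> v a b where v: "v \<bullet> \<theta> = 0" and Z: "\<And>d. Z d = wave \<theta> (a * v $ d) (b * v $ d)"
    using zeta_transversal_wave[OF kp r, of s] unfolding Z_def by metis
  have v0: "(\<Sum>i\<in>UNIV. v $ i * \<theta> $ i) = 0" using v by (simp add: inner_vec_def)
  have w: "wave \<theta> (a * t) (b * t) y = t * wave \<theta> a b y" "wave \<theta> (u * (b * t)) (- (u * (a * t))) y = t * (u * wave \<theta> b (- a) y)"
    for a b t u y by (simp_all add: wave_def algebra_simps)
  have ww: "wave \<theta> (u' * - (u * (a * t))) (- (u' * (u * (b * t)))) y = t * (u' * (u * wave \<theta> (- a) (- b) y))" for a b t u u' y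
    by (simp add: wave_def algebra_simps)
  show "Ck k (Z d)" "Ck k (pd c (Z d))" by (simp_all add: Z pd_wave Ck_wave)
  have fac: "(\<Sum>i\<in>UNIV. (v $ i * \<theta> $ i) * C) = 0" for C
    using v0 by (simp add: sum_distrib_right[symmetric])
  show "(\<Sum>i\<in>UNIV. pd i (Z i) x) = 0"
    using fac[of "wave \<theta> b (- a) x"] by (simp only: Z pd_wave w) (simp only: mult_ac)
  show "(\<Sum>i\<in>UNIV. Z i x * pd i (Z d) x) = 0"
    using fac[of "wave \<theta> a b x * (v $ d * wave \<theta> b (- a) x)"] by (simp only: Z pd_wave w) (simp only: mult_ac)
  show "(\<Sum>i\<in>UNIV. Z i x * pd i (pd c (Z d)) x) = 0"
    using fac[of "wave \<theta> a b x * (v $ d * (\<theta> $ c * wave \<theta> (- a) (- b) x))"] by (simp only: Z pd_wave w ww) (simp only: mult_ac)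
  show "(\<Sum>e\<in>UNIV. pd c (Z e) x * pd e (Z d) x) = 0"
    using fac[of "\<theta> $ c * wave \<theta> b (- a) x * (v $ d * wave \<theta> b (- a) x)"] by (simp only: Z pd_wave w) (simp only: mult_ac)
qed

text \<open>The normalised frequency and the normalised transversal vectors are an orthonormal
  basis, by their number. Expanding a standard basis vector in it says that the squares of the basis
  vectors sum to the identity; the frequency part is moved to the other side.\<close>

lemma transversal_frame:
  fixes kp :: "(int, 'n::{finite,linorder}) vec \<Rightarrow> nat \<Rightarrow> (real, 'n) vec"
  assumes kp: "orthogonal_choice kp" and k: "k \<in> half_lattice"
  shows "(\<Sum>l\<in>{1..CARD('n) - 1}. kp k l $ i * kp k l $ j) =
    (if i = j then (norm (int_vec k))\<^sup>2 else 0) - int_vec k $ i * int_vec k $ j"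
proof -
  let ?N = "norm (int_vec k)" and ?L = "{1..CARD('n) - 1}"
  have "k \<noteq> 0" using k half_lattice_split(1) by auto
  then have N: "?N > 0" using norm_int_vec_ge_1[of k] by linarith
  \<comment> \<open>Index 0 is free since the transversal vectors are numbered from 1; it takes the
    normalised frequency.\<close>
  define u where "u = (\<lambda>l. if l = 0 then int_vec k /\<^sub>R ?N else kp k l /\<^sub>R ?N)"
  have card: "card (insert 0 ?L) = CARD('n)" by (subst card_insert_disjoint) auto
  have norm1: "norm (u l) = 1" if "l \<in> insert 0 ?L" for l
    using that kp k N by (auto simp: u_def orthogonal_choice_def)
  have orth: "u l \<bullet> u m = 0" if "l \<in> insert 0 ?L" "m \<in> insert 0 ?L" "l \<noteq> m" for l m
    using that kp k by (auto simp: u_def orthogonal_choice_def inner_commute)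
  have inj: "inj_on u (insert 0 ?L)"
  proof (rule inj_onI, rule ccontr)
    fix l m assume lm: "l \<in> insert 0 ?L" "m \<in> insert 0 ?L" "u l = u m" "l \<noteq> m"
    then have "u l \<bullet> u l = 0" using orth[of l m] by simp
    then show False using norm1[OF lm(1)] by simp
  qed
  define B where "B = u ` insert 0 ?L"
  have fB: "finite B" "card B = CARD('n)" using card_image[OF inj] card by (auto simp: B_def)
  have pB: "pairwise orthogonal B"
    unfolding pairwise_def orthogonal_def
  proof (intro ballI impI)
    fix x y assume xy: "x \<in> B" "y \<in> B" "x \<noteq> y"
    obtain l where l: "l \<in> insert 0 ?L" "x = u l" using xy(1) unfolding B_def by (rule imageE)
    obtain m where m: "m \<in> insert 0 ?L" "y = u m" using xy(2) unfolding B_def by (rule imageE)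
    have "l \<noteq> m" using xy(3) l(2) m(2) by metis
    then show "x \<bullet> y = 0" using orth[OF l(1) m(1)] l(2) m(2) by simp
  qed
  have nB: "norm b = 1" if "b \<in> B" for b using that norm1 by (auto simp: B_def)
  have "independent B" using pB nB[of 0] by (intro pairwise_orthogonal_independent) auto
  then have "dim B = DIM((real, 'n) vec)" using fB by (simp add: dim_eq_card_independent)
  then have "span B = UNIV" by (rule dim_eq_full[THEN iffD1])
  then have "(\<Sum>b\<in>B. (axis i 1 \<bullet> b) *\<^sub>R b) = axis i 1"
    by (intro orthonormal_basis_expand pB nB fB) auto
  then have "axis i (1::real) $ j = (\<Sum>b\<in>B. (axis i 1 \<bullet> b) *\<^sub>R b) $ j" by simp
  also have "\<dots> = (\<Sum>b\<in>B. b $ i * b $ j)"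
    by (simp add: sum_component inner_axis')
  also have "\<dots> = (\<Sum>l\<in>insert 0 ?L. u l $ i * u l $ j)"
    unfolding B_def by (subst sum.reindex[OF inj]) simp
  also have "\<dots> = int_vec k $ i * int_vec k $ j / ?N\<^sup>2 + (\<Sum>l\<in>?L. kp k l $ i * kp k l $ j / ?N\<^sup>2)"
    by (subst sum.insert) (auto simp: u_def power2_eq_square divide_inverse mult_ac intro!: sum.cong)
  finally have "int_vec k $ i * int_vec k $ j / ?N\<^sup>2 + (\<Sum>l\<in>?L. kp k l $ i * kp k l $ j) / ?N\<^sup>2 = (if i = j then 1 else 0)"
    by (simp add: axis_def sum_divide_distrib split: if_splits)
  then show ?thesis using N by (simp add: field_simps split: if_splits)
qed

text \<open>Sums over all modes are regrouped so that cosine and sine of the same frequency and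
  direction meet before the lattice sum is taken. The majorant \<open>w\<close> provides the
  absolute convergence that permits this.\<close>

lemma noise_has_sum:
  fixes f :: "'n::{finite,linorder} noise_index \<Rightarrow> real" and w :: "(int, 'n) vec \<Rightarrow> real"
  assumes w: "w summable_on half_lattice"
    and le: "\<And>k i. k \<in> half_lattice \<Longrightarrow> i \<in> {1..CARD('n) - 1} \<Longrightarrow> \<bar>f (Cos_mode k i)\<bar> \<le> w k"
      "\<And>k i. k \<in> half_lattice \<Longrightarrow> i \<in> {1..CARD('n) - 1} \<Longrightarrow> \<bar>f (Sin_mode k i)\<bar> \<le> w k"
    and \<sigma>: "((\<lambda>k. \<Sum>i\<in>{1..CARD('n) - 1}. f (Cos_mode k i) + f (Sin_mode k i)) has_sum \<sigma>) half_lattice"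
  shows "(f has_sum ((\<Sum>j\<in>UNIV. f (Const_mode j)) + \<sigma>)) noise_indices"
proof -
  let ?L = "{1..CARD('n) - 1}" and ?P = "(half_lattice :: (int, 'n) vec set) \<times> {1..CARD('n) - 1}"
  have "(\<lambda>(k, i). w k) summable_on Sigma half_lattice (\<lambda>_. ?L)"
  proof (rule summable_on_SigmaI)
    show "((\<lambda>y. case (k, y) of (k, i) \<Rightarrow> w k) has_sum real (card ?L) * w k) ?L" for k
      by (rule has_sum_finiteI) auto
    show "(\<lambda>k. real (card ?L) * w k) summable_on half_lattice" by (intro summable_on_cmult_right w)
    fix k i assume "k \<in> (half_lattice :: (int, 'n) vec set)" "i \<in> ?L"
    then show "(case (k, i) of (k, i) \<Rightarrow> w k) \<ge> 0" using le(1)[of k i] by (auto intro: order_trans[OF abs_ge_zero])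
  qed
  then have ws: "(\<lambda>(k, i). w k) summable_on ?P" .
  define c where "c = (\<lambda>(k, i). f (Cos_mode k i))"
  define d where "d = (\<lambda>(k, i). f (Sin_mode k i))"
  have cs: "c summable_on ?P" by (rule summable_on_abs_bound[OF ws]) (use le(1) in \<open>auto simp: c_def\<close>)
  have ds: "d summable_on ?P" by (rule summable_on_abs_bound[OF ws]) (use le(2) in \<open>auto simp: d_def\<close>)
  have "((\<lambda>x. c x + d x) has_sum (infsum c ?P + infsum d ?P)) ?P"
    by (intro has_sum_add has_sum_infsum cs ds)
  then have "((\<lambda>k. \<Sum>i\<in>?L. f (Cos_mode k i) + f (Sin_mode k i)) has_sum (infsum c ?P + infsum d ?P)) half_lattice"
    by (rule has_sum_SigmaD) (auto simp: c_def d_def intro!: has_sum_finiteI)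
  then have \<sigma>_eq: "\<sigma> = infsum c ?P + infsum d ?P" using \<sigma> has_sum_unique by blast
  let ?C = "(\<lambda>(k, i). Cos_mode k i) ` ?P" and ?S = "(\<lambda>(k, i). Sin_mode k i) ` ?P"
  have 1: "(f has_sum (\<Sum>j\<in>UNIV. f (Const_mode j))) (range Const_mode)"
    by (rule has_sum_finiteI) (auto simp: sum.reindex inj_def)
  have 2: "(f has_sum infsum c ?P) ?C"
    using has_sum_infsum[OF cs] by (subst has_sum_reindex) (auto simp: inj_on_def comp_def case_prod_unfold c_def)
  have 3: "(f has_sum infsum d ?P) ?S"
    using has_sum_infsum[OF ds] by (subst has_sum_reindex) (auto simp: inj_on_def comp_def case_prod_unfold d_def)
  have "(f has_sum ((\<Sum>j\<in>UNIV. f (Const_mode j)) + infsum c ?P + infsum d ?P)) (range Const_mode \<union> ?C \<union> ?S)"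
    by (intro has_sum_Un_disjoint 1 2 3) auto
  moreover have "range Const_mode \<union> ?C \<union> ?S = noise_indices"
    unfolding noise_indices_def by (intro arg_cong2[where f="(\<union>)"]) force+
  ultimately show ?thesis by (simp add: \<sigma>_eq add.assoc)
qed

lemma noise_summable:
  fixes f :: "'n::{finite,linorder} noise_index \<Rightarrow> real" and w :: "(int, 'n) vec \<Rightarrow> real"
  assumes w: "w summable_on half_lattice"
    and le: "\<And>k i. k \<in> half_lattice \<Longrightarrow> i \<in> {1..CARD('n) - 1} \<Longrightarrow> \<bar>f (Cos_mode k i)\<bar> \<le> w k"
      "\<And>k i. k \<in> half_lattice \<Longrightarrow> i \<in> {1..CARD('n) - 1} \<Longrightarrow> \<bar>f (Sin_mode k i)\<bar> \<le> w k"
  shows "f summable_on noise_indices"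
proof -
  let ?g = "\<lambda>k. \<Sum>i\<in>{1..CARD('n) - 1}. f (Cos_mode k i) + f (Sin_mode k i)"
  have "?g summable_on half_lattice"
  proof (rule summable_on_abs_bound)
    show "(\<lambda>k. real (CARD('n) - 1) * (2 * w k)) summable_on half_lattice" by (intro summable_on_cmult_right w)
    fix k assume k: "k \<in> (half_lattice :: (int, 'n) vec set)"
    have "\<bar>?g k\<bar> \<le> (\<Sum>i\<in>{1..CARD('n) - 1}. 2 * w k)"
    proof (intro order_trans[OF sum_abs] sum_mono)
      fix i assume "i \<in> {1..CARD('n) - 1}"
      then show "\<bar>f (Cos_mode k i) + f (Sin_mode k i)\<bar> \<le> 2 * w k"
        using le[OF k, of i] by linarith
    qed
    then show "\<bar>?g k\<bar> \<le> real (CARD('n) - 1) * (2 * w k)" by simp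
  qed
  then show ?thesis using noise_has_sum[OF w le has_sum_infsum] summable_on_def by blast
qed

lemma has_sum_finite_sum:
  fixes f :: "'l \<Rightarrow> 'b \<Rightarrow> real"
  assumes "\<And>l. l \<in> L \<Longrightarrow> (f l has_sum g l) A"
  shows "((\<lambda>k. \<Sum>l\<in>L. f l k) has_sum (\<Sum>l\<in>L. g l)) A"
  using assms by (induction L rule: infinite_finite_induct) (auto intro!: has_sum_add)

lemma half_lattice_powr_summable:
  "\<alpha> > real CARD('n) \<Longrightarrow> (\<lambda>k. norm (int_vec k) powr (- \<alpha>)) summable_on (half_lattice :: (int, 'n::{finite,linorder}) vec set)"
  by (rule summable_on_subset_banach[OF summable_on_lattice_powr]) (use half_lattice_split(1) in auto)

text \<open>A transversal vector has the length of its frequency, which turns the weight with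
  exponent \<open>s + 1\<close> into one with exponent \<open>s\<close>; a derivative costs another
  factor \<open>2 * pi * norm (int_vec k)\<close>.\<close>

lemma zeta_bounds:
  fixes kp :: "(int, 'n::{finite,linorder}) vec \<Rightarrow> nat \<Rightarrow> (real, 'n) vec"
  assumes kp: "orthogonal_choice kp" and k: "k \<in> half_lattice" and i: "i \<in> {1..CARD('n) - 1}"
    and r: "r = Cos_mode k i \<or> r = Sin_mode k i"
  shows "\<bar>zeta s kp r x $ d\<bar> \<le> norm (int_vec k) powr (- s)"
    "\<bar>pd c (\<lambda>y. zeta s kp r y $ d) x\<bar> \<le> 2 * pi * norm (int_vec k) powr (1 - s)"
proof -
  let ?N = "norm (int_vec k)"
  have "k \<noteq> 0" using k half_lattice_split(1) by auto
  then have N: "?N > 0" using norm_int_vec_ge_1[of k] by linarith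
  define A where "A = kp k i $ d / ?N powr (s + 1)"
  have "\<bar>kp k i $ d\<bar> \<le> ?N"
    using component_le_norm_cart[of "kp k i" d] kp k i by (auto simp: orthogonal_choice_def)
  then have "\<bar>A\<bar> \<le> ?N / ?N powr (s + 1)" by (simp add: A_def divide_right_mono)
  also have "\<dots> = ?N powr 1 / ?N powr (s + 1)" using N by simp
  also have "\<dots> = ?N powr (1 - (s + 1))" by (simp only: powr_diff)
  also have "\<dots> = ?N powr (- s)" by simp
  finally have A: "\<bar>A\<bar> \<le> ?N powr (- s)" .
  have "\<bar>(2 * pi) * int_vec k $ c\<bar> \<le> 2 * pi * ?N"
    unfolding abs_mult using component_le_norm_cart[of "int_vec k" c] by (intro mult_mono) auto
  then have "\<bar>(2 * pi) * int_vec k $ c\<bar> * \<bar>A\<bar> \<le> 2 * pi * ?N * ?N powr (- s)"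
    using A by (intro mult_mono) auto
  also have "\<dots> = 2 * pi * ?N powr (1 - s)"
    using N powr_add[of ?N 1 "- s"] by simp
  finally have B: "\<bar>(2 * pi) * int_vec k $ c * A\<bar> \<le> 2 * pi * ?N powr (1 - s)" by (simp only: abs_mult)
  from r have "(\<lambda>y. zeta s kp r y $ d) = wave ((2 * pi) *\<^sub>R int_vec k) A 0 \<or>
      (\<lambda>y. zeta s kp r y $ d) = wave ((2 * pi) *\<^sub>R int_vec k) 0 A"
    using zeta_wave(2,3)[of s kp k i d] unfolding A_def by metis
  then have "\<bar>zeta s kp r x $ d\<bar> \<le> ?N powr (- s) \<and>
    \<bar>pd c (\<lambda>y. zeta s kp r y $ d) x\<bar> \<le> 2 * pi * ?N powr (1 - s)"
  proof (elim disjE)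
    assume w: "(\<lambda>y. zeta s kp r y $ d) = wave ((2 * pi) *\<^sub>R int_vec k) A 0"
    show "\<bar>zeta s kp r x $ d\<bar> \<le> ?N powr (- s) \<and> \<bar>pd c (\<lambda>y. zeta s kp r y $ d) x\<bar> \<le> 2 * pi * ?N powr (1 - s)"
      using fun_cong[OF w, of x] abs_wave_le[of "(2 * pi) *\<^sub>R int_vec k" A 0 x] A B
        abs_wave_le[of "(2 * pi) *\<^sub>R int_vec k" 0 "- ((2 * pi) * int_vec k $ c * A)" x]
      unfolding w by (simp add: pd_wave)
  next
    assume w: "(\<lambda>y. zeta s kp r y $ d) = wave ((2 * pi) *\<^sub>R int_vec k) 0 A"
    show "\<bar>zeta s kp r x $ d\<bar> \<le> ?N powr (- s) \<and> \<bar>pd c (\<lambda>y. zeta s kp r y $ d) x\<bar> \<le> 2 * pi * ?N powr (1 - s)"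
      using fun_cong[OF w, of x] abs_wave_le[of "(2 * pi) *\<^sub>R int_vec k" 0 A x] A B
        abs_wave_le[of "(2 * pi) *\<^sub>R int_vec k" "(2 * pi) * int_vec k $ c * A" 0 x]
      unfolding w by (simp add: pd_wave)
  qed
  then show "\<bar>zeta s kp r x $ d\<bar> \<le> ?N powr (- s)"
    "\<bar>pd c (\<lambda>y. zeta s kp r y $ d) x\<bar> \<le> 2 * pi * ?N powr (1 - s)" by auto
qed

text \<open>The origin of \<open>c^s\<close>. Squares of sine and cosine add up to 1, which removes
  the dependence on the point. The transversal frame then leaves the identity minus the normalised
  square of the frequency, each with total weight \<open>|k|^(-2 s)\<close>, and averaging over the
  lattice replaces the latter by the identity divided by n. This gives the factor
  \<open>(n - 1) / n\<close>; the constant modes contribute the 1.\<close>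

lemma zeta_product_has_sum:
  fixes kp :: "(int, 'n::{finite,linorder}) vec \<Rightarrow> nat \<Rightarrow> (real, 'n) vec"
  assumes kp: "orthogonal_choice kp" and s: "s > 1 + real CARD('n) / 2"
  shows "((\<lambda>r. zeta s kp r x $ i * zeta s kp r x $ j) has_sum
    (if i = j then noise_const TYPE('n) s else 0)) noise_indices"
proof -
  let ?N = "\<lambda>k :: (int, 'n) vec. norm (int_vec k)"
  let ?H = "half_lattice :: (int, 'n) vec set"
  define S where "S = (\<Sum>\<^sub>\<infinity>k\<in>?H. ?N k powr (- 2 * s))"
  define w where "w = (\<lambda>r::real. 1 / (r powr (s + 1))\<^sup>2)"
  have Npos: "?N k > 0" if "k \<in> - {0}" for k using norm_int_vec_ge_1[of k] that by auto
  have Hpos: "?N k > 0" if "k \<in> ?H" for k using Npos[of k] that half_lattice_split(1) by auto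
  have wN: "w (?N k) * (?N k)\<^sup>2 = ?N k powr (- 2 * s)" if "?N k > 0" for k
  proof -
    have "(?N k)\<^sup>2 = ?N k powr 2" using that by (simp add: powr_numeral)
    moreover have "(?N k powr (s + 1))\<^sup>2 = ?N k powr (2 * (s + 1))"
      using that by (simp add: power2_eq_square powr_add[symmetric])
    ultimately have "w (?N k) * (?N k)\<^sup>2 = ?N k powr 2 / ?N k powr (2 * (s + 1))" by (simp add: w_def)
    also have "\<dots> = ?N k powr (2 - 2 * (s + 1))" by (simp only: powr_diff)
    also have "\<dots> = ?N k powr (- 2 * s)" by simp
    finally show ?thesis .
  qed
  have sum: "(\<lambda>k. ?N k powr (- 2 * s)) summable_on (- {0})"
    using summable_on_lattice_powr[of "2 * s", where 'n='n] s by simp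
  have sumw: "(\<lambda>k. w (?N k) * (?N k)\<^sup>2) summable_on (- {0})"
    using sum by (rule summable_on_cong[THEN iffD1, rotated]) (rule wN[OF Npos, symmetric])
  have Sw: "(\<Sum>\<^sub>\<infinity>k\<in>?H. w (?N k) * (?N k)\<^sup>2) = S"
    unfolding S_def by (rule infsum_cong) (rule wN[OF Hpos])
  have sumH: "(\<lambda>k. ?N k powr (- 2 * s)) summable_on ?H"
    using half_lattice_powr_summable[of "2 * s", where 'n='n] s by simp
  have hs1: "((\<lambda>k. (if i = j then 1 else 0) * ?N k powr (- 2 * s)) has_sum ((if i = j then 1 else 0) * S)) ?H"
    unfolding S_def by (rule has_sum_cmult_right[OF has_sum_infsum[OF sumH]])
  have hs2: "((\<lambda>k. w (?N k) * (int_vec k $ i * int_vec k $ j)) has_sum (if i = j then S / real CARD('n) else 0)) ?H"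
    using lattice_second_moments[OF sumw, of i j] unfolding Sw by (simp add: w_def)
  have "((\<lambda>k. (if i = j then 1 else 0) * ?N k powr (- 2 * s) + - 1 * (w (?N k) * (int_vec k $ i * int_vec k $ j)))
      has_sum ((if i = j then 1 else 0) * S + - 1 * (if i = j then S / real CARD('n) else 0))) ?H"
    by (rule has_sum_add[OF hs1 has_sum_cmult_right[OF hs2]])
  moreover have "(if i = j then 1 else 0) * ?N k powr (- 2 * s) + - 1 * (w (?N k) * (int_vec k $ i * int_vec k $ j)) =
      (\<Sum>l\<in>{1..CARD('n) - 1}. zeta s kp (Cos_mode k l) x $ i * zeta s kp (Cos_mode k l) x $ j +
        zeta s kp (Sin_mode k l) x $ i * zeta s kp (Sin_mode k l) x $ j)" if k: "k \<in> ?H" for k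
  proof -
    have "zeta s kp (Cos_mode k l) x $ i * zeta s kp (Cos_mode k l) x $ j +
        zeta s kp (Sin_mode k l) x $ i * zeta s kp (Sin_mode k l) x $ j = w (?N k) * (kp k l $ i * kp k l $ j)" for l
    proof -
      have "c / W * vi * (c / W * vj) + d / W * vi * (d / W * vj) = (d\<^sup>2 + c\<^sup>2) * (1 / W\<^sup>2 * (vi * vj))"
        for c d W vi vj :: real
        by (cases "W = 0") (simp_all add: power2_eq_square field_simps)
      from this[of "cos (2 * pi * (int_vec k \<bullet> x))" "?N k powr (s + 1)" "kp k l $ i" "kp k l $ j" "sin (2 * pi * (int_vec k \<bullet> x))"]
      show ?thesis by (simp add: w_def)
    qed
    then have "(\<Sum>l\<in>{1..CARD('n) - 1}. zeta s kp (Cos_mode k l) x $ i * zeta s kp (Cos_mode k l) x $ j +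
        zeta s kp (Sin_mode k l) x $ i * zeta s kp (Sin_mode k l) x $ j) =
        w (?N k) * (\<Sum>l\<in>{1..CARD('n) - 1}. kp k l $ i * kp k l $ j)"
      by (simp add: sum_distrib_left del: zeta.simps)
    also have "\<dots> = w (?N k) * ((if i = j then (?N k)\<^sup>2 else 0) - int_vec k $ i * int_vec k $ j)"
      by (simp only: transversal_frame[OF kp k])
    finally show ?thesis using wN[OF Hpos[OF k]] by (simp add: right_diff_distrib del: zeta.simps)
  qed
  ultimately have hs: "((\<lambda>k. \<Sum>l\<in>{1..CARD('n) - 1}. zeta s kp (Cos_mode k l) x $ i * zeta s kp (Cos_mode k l) x $ j +
        zeta s kp (Sin_mode k l) x $ i * zeta s kp (Sin_mode k l) x $ j)
      has_sum ((if i = j then 1 else 0) * S + - 1 * (if i = j then S / real CARD('n) else 0))) ?H"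
    by (subst has_sum_cong[symmetric]) auto
  have bd: "\<bar>zeta s kp r x $ i * zeta s kp r x $ j\<bar> \<le> ?N k powr (- 2 * s)"
    if "k \<in> ?H" "l \<in> {1..CARD('n) - 1}" "r = Cos_mode k l \<or> r = Sin_mode k l" for k l r
  proof -
    have "\<bar>zeta s kp r x $ i * zeta s kp r x $ j\<bar> \<le> ?N k powr (- s) * ?N k powr (- s)"
      unfolding abs_mult by (intro mult_mono zeta_bounds[OF kp that]) auto
    also have "\<dots> = ?N k powr (- 2 * s)" by (simp add: powr_add[symmetric])
    finally show ?thesis .
  qed
  have "((\<lambda>r. zeta s kp r x $ i * zeta s kp r x $ j) has_sum
      ((\<Sum>l\<in>UNIV. zeta s kp (Const_mode l) x $ i * zeta s kp (Const_mode l) x $ j) +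
       ((if i = j then 1 else 0) * S + - 1 * (if i = j then S / real CARD('n) else 0)))) noise_indices"
    by (rule noise_has_sum[OF sumH bd bd hs]) auto
  moreover have "(\<Sum>l\<in>UNIV. zeta s kp (Const_mode l) x $ i * zeta s kp (Const_mode l) x $ j) = (if i = j then 1 else 0)"
  proof -
    have "(\<Sum>l\<in>UNIV. zeta s kp (Const_mode l) x $ i * zeta s kp (Const_mode l) x $ j) =
        (\<Sum>l\<in>(UNIV::'n set). if l = i then (if i = j then 1 else 0) else 0)"
      by (intro sum.cong refl) (auto simp: axis_def)
    then show ?thesis by simp
  qed
  moreover have "noise_const TYPE('n) s = 1 + (S - S / real CARD('n))"
    unfolding noise_const_def S_def by (simp add: field_simps)
  ultimately show ?thesis by (cases "i = j") auto
qed

text \<open>A cosine times its derivative and the corresponding sine times its derivative are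
  opposite multiples of the same product. The bound of order \<open>|k|^(1 - 2 s)\<close> makes the
  pairing legitimate.\<close>

lemma zeta_cross_has_sum:
  fixes kp :: "(int, 'n::{finite,linorder}) vec \<Rightarrow> nat \<Rightarrow> (real, 'n) vec"
  assumes kp: "orthogonal_choice kp" and s: "s > 1 + real CARD('n) / 2"
  shows "((\<lambda>r. zeta s kp r x $ i * pd c (\<lambda>y. zeta s kp r y $ d) x) has_sum 0) noise_indices"
proof -
  let ?N = "\<lambda>k :: (int, 'n) vec. norm (int_vec k)"
  let ?H = "half_lattice :: (int, 'n) vec set"
  let ?f = "\<lambda>r. zeta s kp r x $ i * pd c (\<lambda>y. zeta s kp r y $ d) x"
  have "(\<lambda>k. ?N k powr (- (2 * s - 1))) summable_on ?H"
    using half_lattice_powr_summable[of "2 * s - 1", where 'n='n] s by simp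
  then have w: "(\<lambda>k. 2 * pi * ?N k powr (1 - 2 * s)) summable_on ?H"
    by (intro summable_on_cmult_right) simp
  have bd: "\<bar>?f r\<bar> \<le> 2 * pi * ?N k powr (1 - 2 * s)"
    if "k \<in> ?H" "l \<in> {1..CARD('n) - 1}" "r = Cos_mode k l \<or> r = Sin_mode k l" for k l r
  proof -
    have "\<bar>?f r\<bar> \<le> ?N k powr (- s) * (2 * pi * ?N k powr (1 - s))"
      unfolding abs_mult by (intro mult_mono zeta_bounds[OF kp that]) auto
    also have "\<dots> = 2 * pi * (?N k powr (- s) * ?N k powr (1 - s))" by simp
    also have "?N k powr (- s) * ?N k powr (1 - s) = ?N k powr (1 - 2 * s)" by (simp add: powr_add[symmetric])
    finally show ?thesis .
  qed
  have cancel: "?f (Cos_mode k l) + ?f (Sin_mode k l) = 0" for k l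
    by (simp only: zeta_wave pd_wave) (simp add: wave_def)
  have "(?f has_sum ((\<Sum>l\<in>UNIV. ?f (Const_mode l)) + 0)) noise_indices"
    by (rule noise_has_sum[OF w bd bd]) (simp_all only: cancel, auto)
  moreover have "?f (Const_mode l) = 0" for l
    by (simp only: zeta_wave pd_wave) (simp add: wave_def)
  ultimately show ?thesis by (simp del: zeta.simps)
qed

text \<open>The lattice sum of \<open>|k|^(2 - 2 s)\<close> converges for
  \<open>2 * s - 2 > n\<close>, which is the assumption on \<open>s\<close>. It supplies the square
  summable zeroth order coefficients of the momentum noise.\<close>

lemma zeta_gradient_square_summable:
  fixes kp :: "(int, 'n::{finite,linorder}) vec \<Rightarrow> nat \<Rightarrow> (real, 'n) vec"
  assumes kp: "orthogonal_choice kp" and s: "s > 1 + real CARD('n) / 2"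
  shows "(\<lambda>r. (pd c (\<lambda>y. zeta s kp r y $ d) x)\<^sup>2) summable_on noise_indices"
proof -
  let ?N = "\<lambda>k :: (int, 'n) vec. norm (int_vec k)"
  have "(\<lambda>k. ?N k powr (- (2 * s - 2))) summable_on half_lattice"
    using half_lattice_powr_summable[of "2 * s - 2", where 'n='n] s by simp
  then have w: "(\<lambda>k. (2 * pi)\<^sup>2 * ?N k powr (2 - 2 * s)) summable_on half_lattice"
    by (intro summable_on_cmult_right) simp
  have bd: "\<bar>(pd c (\<lambda>y. zeta s kp r y $ d) x)\<^sup>2\<bar> \<le> (2 * pi)\<^sup>2 * ?N k powr (2 - 2 * s)"
    if "k \<in> half_lattice" "l \<in> {1..CARD('n) - 1}" "r = Cos_mode k l \<or> r = Sin_mode k l" for k l r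
  proof -
    have "\<bar>(pd c (\<lambda>y. zeta s kp r y $ d) x)\<^sup>2\<bar> = \<bar>pd c (\<lambda>y. zeta s kp r y $ d) x\<bar>\<^sup>2" by simp
    also have "\<dots> \<le> (2 * pi * ?N k powr (1 - s))\<^sup>2" by (intro power_mono zeta_bounds[OF kp that]) auto
    also have "\<dots> = (2 * pi)\<^sup>2 * (?N k powr (1 - s) * ?N k powr (1 - s))" by (simp add: power2_eq_square)
    also have "?N k powr (1 - s) * ?N k powr (1 - s) = ?N k powr (2 - 2 * s)" by (simp add: powr_add[symmetric])
    finally show ?thesis .
  qed
  show ?thesis by (rule noise_summable[OF w bd bd]) auto
qed

text \<open>Expanding the composition gives six sums. The hypotheses remove the derivative of
  \<open>A\<close> along itself, the derivative of \<open>B\<close> along \<open>A\<close> and the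
  square of \<open>B\<close>; the two mixed sums coincide, hence the factor 2.\<close>

lemma first_order_square:
  fixes f :: "'c::finite \<Rightarrow> real ^ 'n \<Rightarrow> real"
  assumes A: "\<And>i y. A i differentiable (at y)" and B: "\<And>c d y. B c d differentiable (at y)"
    and f: "\<And>d y. f d differentiable (at y)" "\<And>i d y. pd i (f d) differentiable (at y)"
    and A0: "\<And>j. (\<Sum>i\<in>UNIV. A i x * pd i (A j) x) = 0"
    and B0: "\<And>d. (\<Sum>i\<in>UNIV. A i x * pd i (B c d) x) = 0"
    and BB: "\<And>e. (\<Sum>d\<in>UNIV. B c d x * B d e x) = 0"
  shows "first_order A B (first_order A B f) c x =
    (\<Sum>i\<in>UNIV. \<Sum>j\<in>UNIV. A i x * A j x * pd i (pd j (f c)) x) +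
    2 * (\<Sum>i\<in>UNIV. \<Sum>d\<in>UNIV. A i x * B c d x * pd i (f d) x)"
proof -
  have "first_order A B (first_order A B f) c x =
    (\<Sum>i\<in>UNIV. A i x * ((\<Sum>j\<in>UNIV. A j x * pd i (pd j (f c)) x + pd i (A j) x * pd j (f c) x) +
      (\<Sum>d\<in>UNIV. B c d x * pd i (f d) x + pd i (B c d) x * f d x))) +
    (\<Sum>d\<in>UNIV. B c d x * ((\<Sum>i\<in>UNIV. A i x * pd i (f d) x) + (\<Sum>e\<in>UNIV. B d e x * f e x)))"
    unfolding first_order_def[of A B "first_order A B f"]
    by (subst pd_first_order(2)) (simp_all add: A B f first_order_def)
  also have "\<dots> = (\<Sum>i\<in>UNIV. \<Sum>j\<in>UNIV. A i x * A j x * pd i (pd j (f c)) x) +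
      (\<Sum>i\<in>UNIV. \<Sum>j\<in>UNIV. A i x * pd i (A j) x * pd j (f c) x) +
      (\<Sum>i\<in>UNIV. \<Sum>d\<in>UNIV. A i x * B c d x * pd i (f d) x) +
      (\<Sum>i\<in>UNIV. \<Sum>d\<in>UNIV. A i x * pd i (B c d) x * f d x) +
      ((\<Sum>d\<in>UNIV. \<Sum>i\<in>UNIV. A i x * B c d x * pd i (f d) x) +
      (\<Sum>d\<in>UNIV. \<Sum>e\<in>UNIV. B c d x * B d e x * f e x))"
    by (simp add: sum.distrib sum_distrib_left distrib_left mult_ac)
  also have "(\<Sum>i\<in>UNIV. \<Sum>j\<in>UNIV. A i x * pd i (A j) x * pd j (f c) x) = 0"
    by (subst sum.swap) (simp add: sum_distrib_right[symmetric] A0)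
  also have "(\<Sum>i\<in>UNIV. \<Sum>d\<in>UNIV. A i x * pd i (B c d) x * f d x) = 0"
    by (subst sum.swap) (simp add: sum_distrib_right[symmetric] B0)
  also have "(\<Sum>d\<in>UNIV. \<Sum>e\<in>UNIV. B c d x * B d e x * f e x) = 0"
    by (subst sum.swap) (simp add: sum_distrib_right[symmetric] BB)
  also have "(\<Sum>d\<in>UNIV. \<Sum>i\<in>UNIV. A i x * B c d x * pd i (f d) x) =
      (\<Sum>i\<in>UNIV. \<Sum>d\<in>UNIV. A i x * B c d x * pd i (f d) x)" by (rule sum.swap)
  finally show ?thesis by simp
qed

text \<open>The zeroth order part \<open>B\<close> is zero for the density and the transposed gradient of the noise
  field for the momentum.\<close>

lemma noise_second_order_has_sum:
  fixes kp :: "(int, 'n::{finite,linorder}) vec \<Rightarrow> nat \<Rightarrow> (real, 'n) vec"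
    and g :: "'c::finite \<Rightarrow> real \<Rightarrow> (real, 'n) vec \<Rightarrow> real"
    and B :: "'n noise_index \<Rightarrow> 'c \<Rightarrow> 'c \<Rightarrow> (real, 'n) vec \<Rightarrow> real"
  assumes kp: "orthogonal_choice kp" and s: "s > 1 + real CARD('n) / 2"
    and g: "\<And>c. ck_field T 2 (g c)" and t: "0 \<le> t" "t \<le> T"
    and B: "\<And>r c d. r \<in> noise_indices \<Longrightarrow> Ck 1 (B r c d)"
    and B0: "\<And>r d. r \<in> noise_indices \<Longrightarrow> (\<Sum>i\<in>UNIV. zeta s kp r x $ i * pd i (B r c d) x) = 0"
    and BB: "\<And>r e. r \<in> noise_indices \<Longrightarrow> (\<Sum>d\<in>UNIV. B r c d x * B r d e x) = 0"
    and AB: "\<And>i d. ((\<lambda>r. zeta s kp r x $ i * B r c d x) has_sum 0) noise_indices"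
  shows "((\<lambda>r. integral {0..t} (\<lambda>\<tau>. first_order (\<lambda>i y. zeta s kp r y $ i) (B r)
      (first_order (\<lambda>i y. zeta s kp r y $ i) (B r) (\<lambda>e. g e \<tau>)) c x)) has_sum
      (noise_const TYPE('n) s * integral {0..t} (\<lambda>\<tau>. lap (g c \<tau>) x))) noise_indices"
proof -
  let ?A = "\<lambda>r i y. zeta s kp r y $ i"
  \<comment> \<open>\<open>P\<close> and \<open>Q\<close> are the time integrals that do not depend
    on the mode, so the sum over the modes acts only on their coefficients.\<close>
  define P where "P = (\<lambda>i j. integral {0..t} (\<lambda>\<tau>. pd i (pd j (g c \<tau>)) x))"
  define Q where "Q = (\<lambda>i d. integral {0..t} (\<lambda>\<tau>. pd i (g d \<tau>) x))"
  have st: "{0..t} \<subseteq> {0..T}" using t by auto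
  have i2: "(\<lambda>\<tau>. pd i (pd j (g d \<tau>)) x) integrable_on {0..t}" for i j d
    by (intro integrable_continuous_interval continuous_on_subset[OF ck_field_2_time(3)[OF g] st])
  have i1: "(\<lambda>\<tau>. pd i (g d \<tau>) x) integrable_on {0..t}" for i d
    by (intro integrable_continuous_interval continuous_on_subset[OF ck_field_2_time(2)[OF g] st])
  have eq: "integral {0..t} (\<lambda>\<tau>. first_order (?A r) (B r) (first_order (?A r) (B r) (\<lambda>e. g e \<tau>)) c x) =
      (\<Sum>i\<in>UNIV. \<Sum>j\<in>UNIV. ?A r i x * ?A r j x * P i j) + 2 * (\<Sum>i\<in>UNIV. \<Sum>d\<in>UNIV. ?A r i x * B r c d x * Q i d)"
    if r: "r \<in> noise_indices" for r
  proof -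
    note z = zeta_identities[OF kp r, where s=s]
    have "first_order (?A r) (B r) (first_order (?A r) (B r) (\<lambda>e. g e \<tau>)) c x =
        (\<Sum>i\<in>UNIV. \<Sum>j\<in>UNIV. ?A r i x * ?A r j x * pd i (pd j (g c \<tau>)) x) +
        2 * (\<Sum>i\<in>UNIV. \<Sum>d\<in>UNIV. ?A r i x * B r c d x * pd i (g d \<tau>) x)" if "\<tau> \<in> {0..t}" for \<tau>
    proof (rule first_order_square)
      have \<tau>: "\<tau> \<in> {0..T}" using that st by auto
      show "?A r i differentiable (at y)" for i y using z(1)[of 1 i] Ck_differentiable[of 0 "?A r i"] by simp
      show "B r c d differentiable (at y)" for c d y using B[OF r, of c d] Ck_differentiable[of 0 "B r c d"] by simp
      show "g d \<tau> differentiable (at y)" "pd i (g d \<tau>) differentiable (at y)" for i d y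
        using ck_field_2_differentiable[OF g \<tau>] by auto
    qed (use z(4) B0[OF r] BB[OF r] in auto)
    then have "integral {0..t} (\<lambda>\<tau>. first_order (?A r) (B r) (first_order (?A r) (B r) (\<lambda>e. g e \<tau>)) c x) =
        integral {0..t} (\<lambda>\<tau>. (\<Sum>i\<in>UNIV. \<Sum>j\<in>UNIV. ?A r i x * ?A r j x * pd i (pd j (g c \<tau>)) x) +
        2 * (\<Sum>i\<in>UNIV. \<Sum>d\<in>UNIV. ?A r i x * B r c d x * pd i (g d \<tau>) x))"
      by (intro Henstock_Kurzweil_Integration.integral_cong)
    also have "\<dots> = (\<Sum>i\<in>UNIV. \<Sum>j\<in>UNIV. ?A r i x * ?A r j x * P i j) + 2 * (\<Sum>i\<in>UNIV. \<Sum>d\<in>UNIV. ?A r i x * B r c d x * Q i d)"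
      unfolding P_def Q_def using i1 i2
      by (subst Henstock_Kurzweil_Integration.integral_add Henstock_Kurzweil_Integration.integral_sum integral_mult_right,
          auto intro!: integrable_add integrable_sum integrable_on_mult_right simp del: zeta.simps)+
    finally show ?thesis .
  qed
  have "((\<lambda>r. (\<Sum>i\<in>UNIV. \<Sum>j\<in>UNIV. ?A r i x * ?A r j x * P i j) + 2 * (\<Sum>i\<in>UNIV. \<Sum>d\<in>UNIV. ?A r i x * B r c d x * Q i d))
     has_sum ((\<Sum>i\<in>UNIV. \<Sum>j\<in>UNIV. (if i = j then noise_const TYPE('n) s else 0) * P i j) + 2 * (\<Sum>i\<in>UNIV. \<Sum>d\<in>UNIV. 0 * Q i d))) noise_indices"
    by (rule has_sum_add[OF has_sum_finite_sum[OF has_sum_finite_sum[OF has_sum_cmult_left[OF zeta_product_has_sum[OF kp s]]]]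
        has_sum_cmult_right[OF has_sum_finite_sum[OF has_sum_finite_sum[OF has_sum_cmult_left[OF AB]]]]])
  moreover have "(\<Sum>i\<in>UNIV. \<Sum>j\<in>UNIV. (if i = j then noise_const TYPE('n) s else 0) * P i j) =
      noise_const TYPE('n) s * integral {0..t} (\<lambda>\<tau>. lap (g c \<tau>) x)"
  proof -
    have "(\<Sum>i\<in>UNIV. \<Sum>j\<in>UNIV. (if i = j then noise_const TYPE('n) s else 0) * P i j) =
        (\<Sum>i\<in>UNIV. \<Sum>j\<in>UNIV. if i = j then noise_const TYPE('n) s * P i i else 0)"
      by (intro sum.cong refl) auto
    also have "\<dots> = noise_const TYPE('n) s * (\<Sum>i\<in>UNIV. P i i)" by (simp add: sum_distrib_left)
    also have "(\<Sum>i\<in>UNIV. P i i) = integral {0..t} (\<lambda>\<tau>. lap (g c \<tau>) x)"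
      unfolding P_def lap_def by (rule Henstock_Kurzweil_Integration.integral_sum[symmetric]) (auto simp: i2)
    finally show ?thesis .
  qed
  ultimately have "((\<lambda>r. (\<Sum>i\<in>UNIV. \<Sum>j\<in>UNIV. ?A r i x * ?A r j x * P i j) + 2 * (\<Sum>i\<in>UNIV. \<Sum>d\<in>UNIV. ?A r i x * B r c d x * Q i d))
     has_sum (noise_const TYPE('n) s * integral {0..t} (\<lambda>\<tau>. lap (g c \<tau>) x))) noise_indices"
    by simp
  then show ?thesis by (subst has_sum_cong[OF eq])
qed

section \<open>The drifts and the Navier-Stokes right-hand sides\<close>

lemma Ck_2_facts:
  assumes "Ck 2 f"
  shows "f differentiable (at x)" "pd i f differentiable (at x)"
  using Ck_differentiable[of 1 f] Ck_differentiable[of 0 "pd i f"] Ck_pd[of 1 f i] assms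
  by (auto simp: numeral_2_eq_2)

lemma Ck_3_facts:
  assumes "Ck 3 f"
  shows "f differentiable (at x)" "pd i f differentiable (at x)" "pd i (pd j f) differentiable (at x)"
  using Ck_2_facts[OF Ck_mono[OF assms]] Ck_2_facts(2)[OF Ck_pd[of 2 f j], of i] assms
  by (auto simp: numeral_3_eq_3 numeral_2_eq_2)

text \<open>The mean fields at one instant. The density is one order smoother than the momentum
  because the capillary force contains \<open>grad (lap rb)\<close>.\<close>

locale flow_state =
  fixes mb :: "real ^ 'n \<Rightarrow> real ^ 'n" and rb :: "real ^ 'n \<Rightarrow> real" and U :: "real \<Rightarrow> real"
  assumes mb: "\<And>j. Ck 2 (\<lambda>y. mb y $ j)" and rb: "Ck 3 rb" and pos: "\<And>y. rb y > 0"
    and U: "\<And>r. r > 0 \<Longrightarrow> U field_differentiable (at r)" "\<And>r. r > 0 \<Longrightarrow> deriv U field_differentiable (at r)"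
begin

lemma nz [simp]: "rb y \<noteq> 0" using pos[of y] by simp

lemma mb_diff: "(\<lambda>y. mb y $ j) differentiable (at x)" "pd i (\<lambda>y. mb y $ j) differentiable (at x)"
  using Ck_2_facts[OF mb] by auto

lemma rb_diff: "rb differentiable (at x)" "pd i rb differentiable (at x)" "pd i (pd j rb) differentiable (at x)"
  using Ck_3_facts[OF rb] by auto

lemma pd_commute_mb: "pd i (pd k (\<lambda>y. mb y $ j)) x = pd k (pd i (\<lambda>y. mb y $ j)) x"
  by (rule pd_commute[OF mb])

lemma pd_commute_rb: "pd i (pd k rb) x = pd k (pd i rb) x"
  by (rule pd_commute[OF Ck_mono[OF rb]]) simp

lemma velocity_nth: "velocity mb rb y $ j = mb y $ j / rb y"
  by (simp add: velocity_def)

lemma pd_velocity: "pd i (\<lambda>y. velocity mb rb y $ j) x =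
    pd i (\<lambda>y. mb y $ j) x / rb x - mb x $ j * pd i rb x / (rb x)\<^sup>2"
  unfolding velocity_nth by (rule pd_divide(1)[OF mb_diff(1) rb_diff(1) nz])

lemma velocity_diff: "(\<lambda>y. velocity mb rb y $ j) differentiable (at x)"
  unfolding velocity_nth by (rule pd_divide(2)[OF mb_diff(1) rb_diff(1) nz])

lemma grad_ln: "grad (\<lambda>z. ln (rb z)) y $ i = pd i rb y / rb y"
  using pd_compose(1)[OF rb_diff(1) DERIV_ln_divide[OF pos], of i y] by (simp add: grad_def)

lemma pd_grad_ln: "pd j (\<lambda>y. grad (\<lambda>z. ln (rb z)) y $ i) x =
    pd j (pd i rb) x / rb x - pd i rb x * pd j rb x / (rb x)\<^sup>2"
  unfolding grad_ln by (rule pd_divide(1)[OF rb_diff(2,1) nz])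

lemma grad_ln_diff: "(\<lambda>y. grad (\<lambda>z. ln (rb z)) y $ i) differentiable (at x)"
  unfolding grad_ln by (rule pd_divide(2)[OF rb_diff(2,1) nz])

lemma pd_pressure: "pd j (pressure U rb) x =
    (2 * rb x * deriv U (rb x) + (rb x)\<^sup>2 * deriv (deriv U) (rb x)) * pd j rb x"
proof -
  have "((\<lambda>r. r\<^sup>2 * deriv U r) has_real_derivative
      (2 * rb x * deriv U (rb x) + (rb x)\<^sup>2 * deriv (deriv U) (rb x))) (at (rb x))"
  proof -
    have "((\<lambda>r. r\<^sup>2) has_real_derivative 2 * rb x) (at (rb x))" by (auto intro!: derivative_eq_intros)
    from DERIV_mult[OF this field_differentiable_derivI[OF U(2)[OF pos]]] show ?thesis
      by (simp add: algebra_simps)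
  qed
  from pd_compose(1)[OF rb_diff(1) this, of j] show ?thesis by (simp add: pressure_def[abs_def])
qed

lemma pd_lap_rb: "pd j (lap rb) x = (\<Sum>i\<in>UNIV. pd j (pd i (pd i rb)) x)"
  unfolding lap_def[abs_def] by (rule pd_sum) (rule rb_diff)

lemma pd_dvg_mb: "pd j (dvg mb) x = (\<Sum>i\<in>UNIV. pd j (pd i (\<lambda>y. mb y $ i)) x)"
  unfolding dvg_def[abs_def] by (rule pd_sum) (rule mb_diff)

lemma pd_drift_velocity:
  "pd j (\<lambda>y. (velocity mb rb y + \<nu> *\<^sub>R grad (\<lambda>z. ln (rb z)) y) $ i) x =
    pd j (\<lambda>y. velocity mb rb y $ i) x + \<nu> * pd j (\<lambda>y. grad (\<lambda>z. ln (rb z)) y $ i) x"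
proof -
  have d: "(\<lambda>y. \<nu> * grad (\<lambda>z. ln (rb z)) y $ i) differentiable (at x)"
    by (intro differentiable_mult differentiable_const grad_ln_diff)
  show ?thesis by (simp add: pd_add[OF velocity_diff d] pd_cmult[OF grad_ln_diff])
qed

lemma density_drift_eq:
  assumes r: "r differentiable (at x)"
  shows "density_drift \<nu> mb rb r x = - (\<Sum>i\<in>UNIV.
    r x * ((pd i (\<lambda>y. mb y $ i) x / rb x - mb x $ i * pd i rb x / (rb x)\<^sup>2) +
      \<nu> * (pd i (pd i rb) x / rb x - pd i rb x * pd i rb x / (rb x)\<^sup>2)) +
    pd i r x * (mb x $ i / rb x + \<nu> * (pd i rb x / rb x)))"
proof -
  let ?w = "\<lambda>y. velocity mb rb y + \<nu> *\<^sub>R grad (\<lambda>z. ln (rb z)) y"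
  have w: "(\<lambda>y. ?w y $ i) differentiable (at x)" for i
    using velocity_diff[of i] grad_ln_diff[of i] by (simp add: differentiable_add differentiable_mult)
  have "density_drift \<nu> mb rb r x = - (\<Sum>i\<in>UNIV. pd i (\<lambda>y. r y * ?w y $ i) x)"
    by (simp add: density_drift_def dvg_def algebra_simps)
  also have "(\<Sum>i\<in>UNIV. pd i (\<lambda>y. r y * ?w y $ i) x) =
      (\<Sum>i\<in>UNIV. r x * pd i (\<lambda>y. ?w y $ i) x + pd i r x * ?w x $ i)"
    by (intro sum.cong refl pd_mult r w)
  finally show ?thesis
    unfolding pd_drift_velocity pd_velocity pd_grad_ln by (simp add: velocity_nth grad_ln)
qed

text \<open>Velocity, logarithm and pressure are expanded into derivatives of \<open>mb\<close>,
  \<open>rb\<close> and \<open>U\<close>, leaving identities in these derivatives that can be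
  checked by field arithmetic.\<close>

lemma momentum_drift_eq:
  "momentum_drift \<kappa> \<nu> U mb rb m r x $ j =
    - (\<Sum>i\<in>UNIV. (mb x $ i / rb x + \<nu> * (pd i rb x / rb x)) * pd i (\<lambda>y. m y $ j) x)
    - (\<Sum>i\<in>UNIV. (pd i (\<lambda>y. mb y $ i) x / rb x - mb x $ i * pd i rb x / (rb x)\<^sup>2) +
      \<nu> * (pd i (pd i rb) x / rb x - pd i rb x * pd i rb x / (rb x)\<^sup>2)) * m x $ j
    - (\<Sum>i\<in>UNIV. (pd j (\<lambda>y. mb y $ i) x / rb x - mb x $ i * pd j rb x / (rb x)\<^sup>2) * m x $ i)
    - \<nu> * (\<Sum>i\<in>UNIV. (pd j (pd i rb) x / rb x - pd i rb x * pd j rb x / (rb x)\<^sup>2) * m x $ i)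
    + r x * (\<Sum>i\<in>UNIV. (pd j (\<lambda>y. mb y $ i) x / rb x - mb x $ i * pd j rb x / (rb x)\<^sup>2) * (mb x $ i / rb x))
    - r x / rb x * ((2 * rb x * deriv U (rb x) + (rb x)\<^sup>2 * deriv (deriv U) (rb x)) * pd j rb x)
    + \<kappa> * r x * (\<Sum>i\<in>UNIV. pd j (pd i (pd i rb)) x)
    - \<nu> * r x / (rb x)\<^sup>2 * (\<Sum>i\<in>UNIV. pd i (\<lambda>y. mb y $ i) x) * pd j rb x
    + \<nu> * r x / rb x * (\<Sum>i\<in>UNIV. pd j (pd i (\<lambda>y. mb y $ i)) x)"
proof -
  have "momentum_drift \<kappa> \<nu> U mb rb m r x $ j =
    - (\<Sum>i\<in>UNIV. (velocity mb rb x + \<nu> *\<^sub>R grad (\<lambda>z. ln (rb z)) x) $ i * pd i (\<lambda>y. m y $ j) x)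
    - (\<Sum>i\<in>UNIV. pd i (\<lambda>y. (velocity mb rb y + \<nu> *\<^sub>R grad (\<lambda>z. ln (rb z)) y) $ i) x) * m x $ j
    - (\<Sum>i\<in>UNIV. pd j (\<lambda>y. velocity mb rb y $ i) x * m x $ i)
    - \<nu> * (\<Sum>i\<in>UNIV. pd j (\<lambda>y. grad (\<lambda>z. ln (rb z)) y $ i) x * m x $ i)
    + r x * (\<Sum>i\<in>UNIV. pd j (\<lambda>y. velocity mb rb y $ i) x * velocity mb rb x $ i)
    - r x / rb x * pd j (pressure U rb) x
    + \<kappa> * r x * pd j (lap rb) x
    - \<nu> * r x / (rb x)\<^sup>2 * dvg mb x * pd j rb x
    + \<nu> * r x / rb x * pd j (dvg mb) x"
    unfolding momentum_drift_def Let_def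
    by (simp add: nabla_def nablaT_def dvg_def[of "\<lambda>y. velocity mb rb y + \<nu> *\<^sub>R grad (\<lambda>z. ln (rb z)) y"])
      (simp add: grad_def)
  then show ?thesis
    unfolding pd_drift_velocity pd_velocity pd_grad_ln pd_pressure pd_lap_rb pd_dvg_mb
    by (simp add: velocity_nth grad_ln dvg_def)
qed

text \<open>At the mean density, \<rho> \<nabla> log \<rho> is \<nabla>\<rho>, so the divergence of
  the diffusive flux in the drift cancels the Laplacian produced by the noise.\<close>

lemma continuity_identity:
  "density_drift \<nu> mb rb rb x + \<nu> * lap rb x = - dvg (\<lambda>y. rb y *\<^sub>R velocity mb rb y) x"
proof -
  have "density_drift \<nu> mb rb rb x = - (\<Sum>i\<in>UNIV. pd i (\<lambda>y. mb y $ i) x + \<nu> * pd i (pd i rb) x)"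
    unfolding density_drift_eq[OF rb_diff(1)]
    by (intro arg_cong[where f=uminus] sum.cong refl) (simp add: field_simps power2_eq_square)
  moreover have "dvg (\<lambda>y. rb y *\<^sub>R velocity mb rb y) x = (\<Sum>i\<in>UNIV. pd i (\<lambda>y. mb y $ i) x)"
    by (simp add: dvg_def velocity_nth)
  ultimately show ?thesis by (simp add: lap_def sum.distrib sum_distrib_left)
qed

lemma dvg_stress: "dvg_tensor (stress \<nu> rb (velocity mb rb)) x $ j = (\<Sum>i\<in>UNIV. \<nu> * (
    pd i (pd i (\<lambda>y. mb y $ j)) x - (pd i (\<lambda>y. mb y $ j) x * pd i rb x + mb x $ j * pd i (pd i rb) x) / rb x
      + mb x $ j * pd i rb x * pd i rb x / (rb x)\<^sup>2
    + pd i (pd j (\<lambda>y. mb y $ i)) x - (pd i (\<lambda>y. mb y $ i) x * pd j rb x + mb x $ i * pd i (pd j rb) x) / rb x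
      + mb x $ i * pd j rb x * pd i rb x / (rb x)\<^sup>2))"
proof -
  \<comment> \<open>The density factor in the stress cancels one of the denominators in the
    derivative of \<open>mb / rb\<close>, leaving a single division to differentiate.\<close>
  have eq: "stress \<nu> rb (velocity mb rb) y $ i $ j = \<nu> * ((pd i (\<lambda>y. mb y $ j) y - mb y $ j * pd i rb y / rb y)
      + (pd j (\<lambda>y. mb y $ i) y - mb y $ i * pd j rb y / rb y))" for y i
    unfolding stress_def by (simp add: pd_velocity field_simps power2_eq_square)
  have q: "(\<lambda>y. mb y $ a * pd b rb y / rb y) differentiable (at x)"
    "pd i (\<lambda>y. mb y $ a * pd b rb y / rb y) x = (mb x $ a * pd i (pd b rb) x + pd i (\<lambda>y. mb y $ a) x * pd b rb x) / rb x
      - mb x $ a * pd b rb x * pd i rb x / (rb x)\<^sup>2" for a b i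
    using pd_divide(1)[OF differentiable_mult[OF mb_diff(1)[of a] rb_diff(2)[of b]] rb_diff(1) nz, where x=x and i=i]
      pd_divide(2)[OF differentiable_mult[OF mb_diff(1)[of a] rb_diff(2)[of b]] rb_diff(1) nz, where x=x]
      pd_mult[OF mb_diff(1)[of a] rb_diff(2)[of b], where x=x and i=i]
    by auto
  have "pd i (\<lambda>y. stress \<nu> rb (velocity mb rb) y $ i $ j) x = \<nu> * (
     (pd i (pd i (\<lambda>y. mb y $ j)) x - pd i (\<lambda>y. mb y $ j * pd i rb y / rb y) x) +
     (pd i (pd j (\<lambda>y. mb y $ i)) x - pd i (\<lambda>y. mb y $ i * pd j rb y / rb y) x))" for i
  proof -
    have d: "(\<lambda>y. pd a (\<lambda>y. mb y $ b) y - mb y $ b * pd a rb y / rb y) differentiable (at x)" for a b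
      using differentiable_diff[OF mb_diff(2)[of a b] q(1)[of b a]] .
    have "pd i (\<lambda>y. stress \<nu> rb (velocity mb rb) y $ i $ j) x =
        \<nu> * (pd i (\<lambda>y. pd i (\<lambda>y. mb y $ j) y - mb y $ j * pd i rb y / rb y) x +
          pd i (\<lambda>y. pd j (\<lambda>y. mb y $ i) y - mb y $ i * pd j rb y / rb y) x)"
      unfolding eq pd_cmult[OF differentiable_add[OF d d]] pd_add[OF d d] ..
    then show ?thesis by (simp only: pd_diff[OF mb_diff(2) q(1)])
  qed
  then show ?thesis
    unfolding dvg_tensor_def vec_lambda_beta
    by (intro sum.cong refl) (simp only: q(2), simp add: algebra_simps)
qed

text \<open>The divergence of the capillary tensor is \<kappa> \<rho> \<nabla>\<Delta>\<rho>. The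
  gradient of half the squared norm of \<nabla>\<rho> cancels the second derivatives contracted with
  \<nabla>\<rho>, and the two terms \<Delta>\<rho> \<nabla>\<rho> cancel each other.\<close>

lemma dvg_capillary: "dvg_tensor (capillary \<kappa> rb) x $ j = \<kappa> * rb x * (\<Sum>i\<in>UNIV. pd j (pd i (pd i rb)) x)"
proof -
  define E where "E = (\<lambda>y. rb y * lap rb y + 1 / 2 * (\<Sum>k\<in>UNIV. pd k rb y * pd k rb y))"
  have lap_diff: "lap rb differentiable (at x)"
    unfolding lap_def[abs_def] by (intro differentiable_sum' rb_diff)
  have sq_diff: "(\<lambda>y. \<Sum>k\<in>UNIV. pd k rb y * pd k rb y) differentiable (at x)"
    by (intro differentiable_sum' differentiable_mult rb_diff)
  have E_diff: "E differentiable (at x)"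
    unfolding E_def by (intro differentiable_add differentiable_mult rb_diff lap_diff differentiable_const sq_diff)
  have pdE: "pd i E x = rb x * pd i (lap rb) x + pd i rb x * lap rb x + (\<Sum>k\<in>UNIV. pd k rb x * pd i (pd k rb) x)" for i
  proof -
    have "pd i E x = (rb x * pd i (lap rb) x + pd i rb x * lap rb x) + 1 / 2 * pd i (\<lambda>y. \<Sum>k\<in>UNIV. pd k rb y * pd k rb y) x"
      unfolding E_def
      by (subst pd_add[OF differentiable_mult[OF rb_diff(1) lap_diff] differentiable_mult[OF differentiable_const sq_diff]])
        (simp only: pd_mult[OF rb_diff(1) lap_diff] pd_cmult[OF sq_diff])
    also have "pd i (\<lambda>y. \<Sum>k\<in>UNIV. pd k rb y * pd k rb y) x = (\<Sum>k\<in>UNIV. pd k rb x * pd i (pd k rb) x + pd i (pd k rb) x * pd k rb x)"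
      by (subst pd_sum[OF differentiable_mult[OF rb_diff(2) rb_diff(2)]])
        (simp only: pd_mult[OF rb_diff(2) rb_diff(2)])
    finally show ?thesis by (simp add: sum_distrib_left mult.commute)
  qed
  have eq: "capillary \<kappa> rb y $ i $ j = \<kappa> * ((if i = j then E y else 0) - pd i rb y * pd j rb y)" for y i
    by (simp add: capillary_def E_def grad_def inner_vec_def mat_def)
  have pdC: "pd i (\<lambda>y. capillary \<kappa> rb y $ i $ j) x =
      \<kappa> * ((if i = j then pd j E x else 0) - (pd i rb x * pd i (pd j rb) x + pd i (pd i rb) x * pd j rb x))" for i
  proof -
    have d: "(\<lambda>y. if i = j then E y else 0) differentiable (at x)" using E_diff by (cases "i = j") auto
    have p: "(\<lambda>y. pd i rb y * pd j rb y) differentiable (at x)" by (intro differentiable_mult rb_diff)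
    have "pd i (\<lambda>y. if i = j then E y else 0) x = (if i = j then pd j E x else 0)" by (cases "i = j") auto
    then show ?thesis
      unfolding eq pd_cmult[OF differentiable_diff[OF d p]] pd_diff[OF d p] pd_mult[OF rb_diff(2) rb_diff(2)] by simp
  qed
  have "dvg_tensor (capillary \<kappa> rb) x $ j = (\<Sum>i\<in>UNIV. \<kappa> * ((if i = j then pd j E x else 0) - (pd i rb x * pd i (pd j rb) x + pd i (pd i rb) x * pd j rb x)))"
    unfolding dvg_tensor_def vec_lambda_beta pdC ..
  also have "\<dots> = \<kappa> * (pd j E x - (\<Sum>i\<in>UNIV. pd i rb x * pd j (pd i rb) x) - lap rb x * pd j rb x)"
    by (simp add: sum_distrib_left[symmetric] sum_subtractf sum.distrib lap_def sum_distrib_right pd_commute_rb[of _ j] algebra_simps)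
  also have "\<dots> = \<kappa> * rb x * pd j (lap rb) x" by (simp add: pdE algebra_simps)
  finally show ?thesis by (simp add: pd_lap_rb)
qed

text \<open>The left side is the quotient rule for \<open>mb / rb\<close> with the mean equations
  inserted. Pressure and capillarity match directly; the remaining sums agree summand by summand
  once mixed derivatives are brought to the same order.\<close>

theorem momentum_identity:
  "(momentum_drift \<kappa> \<nu> U mb rb mb rb x $ j + \<nu> * lap (\<lambda>y. mb y $ j) x) / rb x
    - mb x $ j * (density_drift \<nu> mb rb rb x + \<nu> * lap rb x) / (rb x)\<^sup>2 =
  (- nabla (velocity mb rb) (velocity mb rb) x - (1 / rb x) *\<^sub>R grad (pressure U rb) x
    + (1 / rb x) *\<^sub>R (dvg_tensor (stress \<nu> rb (velocity mb rb)) x + dvg_tensor (capillary \<kappa> rb) x)) $ j"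
proof -
  let ?R = "rb x" and ?m = "\<lambda>i. mb x $ i" and ?R1 = "\<lambda>i. pd i rb x" and ?R2 = "\<lambda>i k. pd i (pd k rb) x"
  let ?M = "\<lambda>i k. pd i (\<lambda>y. mb y $ k) x" and ?M2 = "\<lambda>i k l. pd i (pd k (\<lambda>y. mb y $ l)) x"
  define Pj where "Pj = (2 * rb x * deriv U (rb x) + (rb x)\<^sup>2 * deriv (deriv U) (rb x)) * pd j rb x"
  define Kj where "Kj = (\<Sum>i\<in>UNIV. pd j (pd i (pd i rb)) x)"
  have dens: "density_drift \<nu> mb rb rb x + \<nu> * lap rb x = - (\<Sum>i\<in>UNIV. ?M i i)"
    unfolding continuity_identity by (simp add: dvg_def velocity_nth)
  have drift: "momentum_drift \<kappa> \<nu> U mb rb mb rb x $ j + \<nu> * lap (\<lambda>y. mb y $ j) x = \<kappa> * ?R * Kj - Pj +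
    (\<Sum>i\<in>UNIV. - (?m i / ?R + \<nu> * (?R1 i / ?R)) * ?M i j
      - ((?M i i / ?R - ?m i * ?R1 i / ?R\<^sup>2) + \<nu> * (?R2 i i / ?R - ?R1 i * ?R1 i / ?R\<^sup>2)) * ?m j
      - \<nu> * ((?R2 j i / ?R - ?R1 i * ?R1 j / ?R\<^sup>2) * ?m i)
      - \<nu> / ?R * ?M i i * ?R1 j + \<nu> * ?M2 j i i + \<nu> * ?M2 i i j)"
  proof -
    define v where "v = (\<lambda>i. ?m i / ?R + \<nu> * (?R1 i / ?R))"
    define dv where "dv = (\<lambda>i. (?M i i / ?R - ?m i * ?R1 i / ?R\<^sup>2) + \<nu> * (?R2 i i / ?R - ?R1 i * ?R1 i / ?R\<^sup>2))"
    define du where "du = (\<lambda>i. ?M j i / ?R - ?m i * ?R1 j / ?R\<^sup>2)"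
    define dg where "dg = (\<lambda>i. ?R2 j i / ?R - ?R1 i * ?R1 j / ?R\<^sup>2)"
    have "momentum_drift \<kappa> \<nu> U mb rb mb rb x $ j = - (\<Sum>i\<in>UNIV. v i * ?M i j) - (\<Sum>i\<in>UNIV. dv i) * ?m j
       - (\<Sum>i\<in>UNIV. du i * ?m i) - \<nu> * (\<Sum>i\<in>UNIV. dg i * ?m i) + ?R * (\<Sum>i\<in>UNIV. du i * (?m i / ?R))
       - ?R / ?R * Pj + \<kappa> * ?R * Kj - \<nu> * ?R / ?R\<^sup>2 * (\<Sum>i\<in>UNIV. ?M i i) * ?R1 j + \<nu> * ?R / ?R * (\<Sum>i\<in>UNIV. ?M2 j i i)"
      by (simp only: momentum_drift_eq v_def dv_def du_def dg_def Pj_def Kj_def)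
    moreover have "?R * (\<Sum>i\<in>UNIV. du i * (?m i / ?R)) = (\<Sum>i\<in>UNIV. du i * ?m i)"
      by (simp add: sum_distrib_left)
    moreover have "\<nu> * ?R / ?R\<^sup>2 = \<nu> / ?R" "?R / ?R * Pj = Pj" "\<nu> * ?R / ?R = \<nu>"
      by (simp_all add: power2_eq_square)
    ultimately have "momentum_drift \<kappa> \<nu> U mb rb mb rb x $ j = \<kappa> * ?R * Kj - Pj - (\<Sum>i\<in>UNIV. v i * ?M i j) - (\<Sum>i\<in>UNIV. dv i) * ?m j
       - \<nu> * (\<Sum>i\<in>UNIV. dg i * ?m i) - \<nu> / ?R * (\<Sum>i\<in>UNIV. ?M i i) * ?R1 j + \<nu> * (\<Sum>i\<in>UNIV. ?M2 j i i)"
      by simp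
    moreover have "(\<Sum>i\<in>UNIV. - v i * ?M i j - dv i * ?m j - \<nu> * (dg i * ?m i) - \<nu> / ?R * ?M i i * ?R1 j + \<nu> * ?M2 j i i + \<nu> * ?M2 i i j) =
       - (\<Sum>i\<in>UNIV. v i * ?M i j) - (\<Sum>i\<in>UNIV. dv i) * ?m j - \<nu> * (\<Sum>i\<in>UNIV. dg i * ?m i)
       - \<nu> / ?R * (\<Sum>i\<in>UNIV. ?M i i) * ?R1 j + \<nu> * (\<Sum>i\<in>UNIV. ?M2 j i i) + \<nu> * (\<Sum>i\<in>UNIV. ?M2 i i j)"
      by (simp add: sum.distrib sum_subtractf sum_negf sum_distrib_left sum_distrib_right)
    ultimately show ?thesis by (simp add: lap_def v_def dv_def dg_def)
  qed
  have stress: "dvg_tensor (stress \<nu> rb (velocity mb rb)) x $ j = (\<Sum>i\<in>UNIV. \<nu> * (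
    ?M2 i i j - (?M i j * ?R1 i + ?m j * ?R2 i i) / ?R + ?m j * ?R1 i * ?R1 i / ?R\<^sup>2
    + ?M2 j i i - (?M i i * ?R1 j + ?m i * ?R2 j i) / ?R + ?m i * ?R1 j * ?R1 i / ?R\<^sup>2))"
    unfolding dvg_stress pd_commute_mb[of _ j] pd_commute_rb[of _ j] ..
  have nab: "nabla (velocity mb rb) (velocity mb rb) x $ j =
      (\<Sum>i\<in>UNIV. ?m i / ?R * (?M i j / ?R - ?m j * ?R1 i / ?R\<^sup>2))"
    by (simp only: nabla_def vec_lambda_beta pd_velocity) (simp only: velocity_nth)
  have core: "(\<Sum>i\<in>UNIV. - (?m i / ?R + \<nu> * (?R1 i / ?R)) * ?M i j
      - ((?M i i / ?R - ?m i * ?R1 i / ?R\<^sup>2) + \<nu> * (?R2 i i / ?R - ?R1 i * ?R1 i / ?R\<^sup>2)) * ?m j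
      - \<nu> * ((?R2 j i / ?R - ?R1 i * ?R1 j / ?R\<^sup>2) * ?m i)
      - \<nu> / ?R * ?M i i * ?R1 j + \<nu> * ?M2 j i i + \<nu> * ?M2 i i j) / ?R + ?m j * (\<Sum>i\<in>UNIV. ?M i i) / ?R\<^sup>2 =
    - (\<Sum>i\<in>UNIV. ?m i / ?R * (?M i j / ?R - ?m j * ?R1 i / ?R\<^sup>2)) +
    (\<Sum>i\<in>UNIV. \<nu> * (
    ?M2 i i j - (?M i j * ?R1 i + ?m j * ?R2 i i) / ?R + ?m j * ?R1 i * ?R1 i / ?R\<^sup>2
    + ?M2 j i i - (?M i i * ?R1 j + ?m i * ?R2 j i) / ?R + ?m i * ?R1 j * ?R1 i / ?R\<^sup>2)) / ?R"
    unfolding sum_divide_distrib sum_distrib_left sum_negf[symmetric] sum.distrib[symmetric]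
    by (intro sum.cong refl) (simp add: field_simps power2_eq_square)
  have "(momentum_drift \<kappa> \<nu> U mb rb mb rb x $ j + \<nu> * lap (\<lambda>y. mb y $ j) x) / rb x
    - mb x $ j * (density_drift \<nu> mb rb rb x + \<nu> * lap rb x) / (rb x)\<^sup>2 = \<kappa> * Kj - Pj / ?R +
    (- nabla (velocity mb rb) (velocity mb rb) x $ j + dvg_tensor (stress \<nu> rb (velocity mb rb)) x $ j / ?R)"
    unfolding drift dens nab stress core[symmetric] by (simp add: add_divide_distrib diff_divide_distrib)
  also have "\<kappa> * Kj - Pj / ?R = (\<kappa> * ?R * Kj - grad (pressure U rb) x $ j) / ?R"
    by (simp add: grad_def pd_pressure Pj_def diff_divide_distrib)
  finally show ?thesis
    by (simp add: dvg_capillary Kj_def[symmetric] add_divide_distrib diff_divide_distrib)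
qed

end

section \<open>Processes with a given mean\<close>

lemma partition_of_mem: "partition_of t m p \<Longrightarrow> i \<le> m \<Longrightarrow> 0 \<le> p i \<and> p i \<le> t"
proof -
  assume p: "partition_of t m p" and i: "i \<le> m"
  have mono: "p i \<le> p j" if "i \<le> j" "j \<le> m" for i j
    using that
  proof (induction j)
    case (Suc j) then show ?case using p by (cases "i = Suc j") (auto simp: partition_of_def intro: order_trans)
  qed simp
  show ?thesis using mono[of 0 i] mono[of i m] p i by (auto simp: partition_of_def)
qed

lemma mesh_limit_in_prob_cong:
  assumes "mesh_limit_in_prob M t \<Phi> K"
    and "\<And>m p \<omega>. partition_of t m p \<Longrightarrow> \<omega> \<in> space M \<Longrightarrow> \<Phi> m p \<omega> = \<Psi> m p \<omega>"
  shows "mesh_limit_in_prob M t \<Psi> K"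
  unfolding mesh_limit_in_prob_def
proof (intro allI impI)
  fix e d :: real assume "e > 0" "d > 0"
  then obtain h where h: "h > 0" "\<And>m p. partition_of t m p \<Longrightarrow> (\<forall>i<m. p (Suc i) - p i < h) \<Longrightarrow>
      measure M {\<omega>\<in>space M. \<bar>\<Phi> m p \<omega> - K \<omega>\<bar> > e} < d"
    using assms(1) unfolding mesh_limit_in_prob_def by blast
  have "measure M {\<omega>\<in>space M. \<bar>\<Psi> m p \<omega> - K \<omega>\<bar> > e} < d" if "partition_of t m p" "\<forall>i<m. p (Suc i) - p i < h" for m p
  proof -
    have "{\<omega>\<in>space M. \<bar>\<Psi> m p \<omega> - K \<omega>\<bar> > e} = {\<omega>\<in>space M. \<bar>\<Phi> m p \<omega> - K \<omega>\<bar> > e}"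
      using assms(2)[OF that(1)] by auto
    then show ?thesis using h(2)[OF that] by simp
  qed
  then show "\<exists>h>0. \<forall>m p. partition_of t m p \<longrightarrow> (\<forall>i<m. p (Suc i) - p i < h) \<longrightarrow>
        measure M {\<omega>\<in>space M. \<bar>\<Psi> m p \<omega> - K \<omega>\<bar> > e} < d"
    using h(1) by blast
qed

section \<open>Replacing integrands that agree on the time interval\<close>

context brownian_setting
begin

lemma adapted_continuous_cong:
  assumes "adapted_continuous M F T Y" and eq: "\<And>t \<omega>. t \<in> {0..T} \<Longrightarrow> \<omega> \<in> space M \<Longrightarrow> Y t \<omega> = Y' t \<omega>"
  shows "adapted_continuous M F T Y'"
  unfolding adapted_continuous_def
proof (intro conjI ballI)
  fix t assume t: "t \<in> {0..T}"
  then have "Y t \<in> borel_measurable (F t)" using assms(1) by (simp add: adapted_continuous_def)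
  then show "Y' t \<in> borel_measurable (F t)" using eq[OF t] by (subst (asm) measurable_cong[where g="Y' t"]) auto
next
  fix \<omega> assume \<omega>: "\<omega> \<in> space M"
  then have "continuous_on {0..T} (\<lambda>t. Y t \<omega>)" using assms(1) by (simp add: adapted_continuous_def)
  then show "continuous_on {0..T} (\<lambda>t. Y' t \<omega>)" using eq \<omega> by (subst (asm) continuous_on_cong[OF refl]) auto
qed

lemma has_ito_integral_cong:
  assumes "has_ito_integral M F T Y V J" and eq: "\<And>t \<omega>. t \<in> {0..T} \<Longrightarrow> \<omega> \<in> space M \<Longrightarrow> Y t \<omega> = Y' t \<omega>"
  shows "has_ito_integral M F T Y' V J"
  unfolding has_ito_integral_def
proof (intro conjI ballI)
  show "adapted_continuous M F T Y'"
    using assms(1) by (intro adapted_continuous_cong[OF _ eq]) (auto simp: has_ito_integral_def)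
  show "adapted_continuous M F T J" using assms(1) by (simp add: has_ito_integral_def)
  fix t assume t: "t \<in> {0..T}"
  then have "mesh_limit_in_prob M t (\<lambda>m p \<omega>. \<Sum>i<m. Y (p i) \<omega> * (V (p (Suc i)) \<omega> - V (p i) \<omega>)) (J t)"
    using assms(1) by (simp add: has_ito_integral_def)
  then show "mesh_limit_in_prob M t (\<lambda>m p \<omega>. \<Sum>i<m. Y' (p i) \<omega> * (V (p (Suc i)) \<omega> - V (p i) \<omega>)) (J t)"
  proof (rule mesh_limit_in_prob_cong)
    fix m p \<omega> assume p: "partition_of t m p" and \<omega>: "\<omega> \<in> space M"
    have "Y (p i) \<omega> = Y' (p i) \<omega>" if "i < m" for i
      using partition_of_mem[OF p, of i] that t by (intro eq \<omega>) auto
    then show "(\<Sum>i<m. Y (p i) \<omega> * (V (p (Suc i)) \<omega> - V (p i) \<omega>)) = (\<Sum>i<m. Y' (p i) \<omega> * (V (p (Suc i)) \<omega> - V (p i) \<omega>))"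
      by (intro sum.cong) auto
  qed
qed

lemma has_covariation_cong:
  assumes "has_covariation M F T Y V J" and eq: "\<And>t \<omega>. t \<in> {0..T} \<Longrightarrow> \<omega> \<in> space M \<Longrightarrow> Y t \<omega> = Y' t \<omega>"
  shows "has_covariation M F T Y' V J"
  unfolding has_covariation_def
proof (intro conjI ballI)
  show "adapted_continuous M F T Y'"
    using assms(1) by (intro adapted_continuous_cong[OF _ eq]) (auto simp: has_covariation_def)
  show "adapted_continuous M F T J" using assms(1) by (simp add: has_covariation_def)
  show "finite_variation T (\<lambda>t. J t \<omega>)" if "\<omega> \<in> space M" for \<omega>
    using assms(1) that by (simp add: has_covariation_def)
  fix t assume t: "t \<in> {0..T}"
  then have "mesh_limit_in_prob M t (\<lambda>m p \<omega>. \<Sum>i<m. (Y (p (Suc i)) \<omega> - Y (p i) \<omega>) * (V (p (Suc i)) \<omega> - V (p i) \<omega>)) (J t)"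
    using assms(1) by (simp add: has_covariation_def)
  then show "mesh_limit_in_prob M t (\<lambda>m p \<omega>. \<Sum>i<m. (Y' (p (Suc i)) \<omega> - Y' (p i) \<omega>) * (V (p (Suc i)) \<omega> - V (p i) \<omega>)) (J t)"
  proof (rule mesh_limit_in_prob_cong)
    fix m p \<omega> assume p: "partition_of t m p" and \<omega>: "\<omega> \<in> space M"
    have "Y (p i) \<omega> = Y' (p i) \<omega>" if "i \<le> m" for i
      using partition_of_mem[OF p, of i] that t by (intro eq \<omega>) auto
    then show "(\<Sum>i<m. (Y (p (Suc i)) \<omega> - Y (p i) \<omega>) * (V (p (Suc i)) \<omega> - V (p i) \<omega>)) =
        (\<Sum>i<m. (Y' (p (Suc i)) \<omega> - Y' (p i) \<omega>) * (V (p (Suc i)) \<omega> - V (p i) \<omega>))"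
      by (intro sum.cong) auto
  qed
qed

context
  fixes T :: real and Y Y' :: "'i \<Rightarrow> real \<Rightarrow> 'a \<Rightarrow> real"
  assumes eq: "\<And>r t \<omega>. r \<in> I \<Longrightarrow> t \<in> {0..T} \<Longrightarrow> \<omega> \<in> space M \<Longrightarrow> Y r t \<omega> = Y' r t \<omega>"
begin

text \<open>The divergence form of the density noise agrees with its first order form where
  realisations are differentiable, which is known for times in the interval and outcomes in the
  space. All partition points lie in the interval, so integrals and covariations see no other
  values.\<close>

lemma has_stratonovich_series_cong:
  assumes "has_stratonovich_series M F T I Y W S"
  shows "has_stratonovich_series M F T I Y' W S"
proof -
  obtain J V Z A where 1: "\<And>r. r \<in> I \<Longrightarrow> has_ito_integral M F T (Y r) (W r) (J r)"
      "\<And>r. r \<in> I \<Longrightarrow> has_covariation M F T (Y r) (W r) (V r)"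
    and 2: "(\<forall>t\<in>{0..T}. sums_in_prob M I (\<lambda>r. J r t) (Z t) \<and> sums_in_prob M I (\<lambda>r. V r t) (A t)) \<and>
        adapted_continuous M F T Z \<and> adapted_continuous M F T A \<and>
        (\<forall>\<omega>\<in>space M. finite_variation T (\<lambda>t. A t \<omega>)) \<and>
        (\<forall>t\<in>{0..T}. \<forall>\<omega>\<in>space M. S t \<omega> = Z t \<omega> + A t \<omega> / 2)"
    using assms unfolding has_stratonovich_series_def by blast
  have "\<forall>r\<in>I. has_ito_integral M F T (Y' r) (W r) (J r) \<and> has_covariation M F T (Y' r) (W r) (V r)"
    using has_ito_integral_cong[OF 1(1) eq] has_covariation_cong[OF 1(2) eq] by blast
  then show ?thesis unfolding has_stratonovich_series_def using 2 by blast
qed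

lemma stratonovich_equation_cong:
  "stratonovich_equation M F T I W X b a Y \<Longrightarrow> stratonovich_equation M F T I W X b a Y'"
  unfolding stratonovich_equation_def using has_stratonovich_series_cong by blast

lemma ito_integrals_centred_cong:
  "ito_integrals_centred M F T I Y W \<Longrightarrow> ito_integrals_centred M F T I Y' W"
  unfolding ito_integrals_centred_def using has_ito_integral_cong eq by metis

lemma expectation_commutes_series_cong:
  assumes "expectation_commutes_series M F T I Y W"
  shows "expectation_commutes_series M F T I Y' W"
proof -
  have "has_stratonovich_integral M F T (Y r) (W r) S"
    if r: "r \<in> I" and S: "has_stratonovich_integral M F T (Y' r) (W r) S" for r S
  proof -
    obtain J V where JV: "has_ito_integral M F T (Y' r) (W r) J" "has_covariation M F T (Y' r) (W r) V"
        "\<forall>t\<in>{0..T}. \<forall>\<omega>\<in>space M. S t \<omega> = J t \<omega> + V t \<omega> / 2"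
      using S unfolding has_stratonovich_integral_def by blast
    show ?thesis
      unfolding has_stratonovich_integral_def
      using has_ito_integral_cong[OF JV(1) eq[OF r, symmetric]]
        has_covariation_cong[OF JV(2) eq[OF r, symmetric]] JV(3) by blast
  qed
  then show ?thesis using assms unfolding expectation_commutes_series_def by blast
qed

end
end

lemma ck_field_cong:
  assumes f: "ck_field T k f" and eq: "\<And>t. t \<in> {0..T} \<Longrightarrow> f t = g t"
  shows "ck_field T k g"
proof -
  have "continuous_on ({0..T} \<times> UNIV) (\<lambda>(t, x). pds is (g t) x)" if "length is \<le> k" for "is"
  proof -
    have "continuous_on ({0..T} \<times> UNIV) (\<lambda>(t, x). pds is (f t) x)" using f that by (simp add: ck_field_def)
    then show ?thesis by (rule continuous_on_eq) (auto simp: eq)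
  qed
  then show ?thesis using f eq by (auto simp: ck_field_def)
qed

context prob_space
begin

text \<open>The requirements on a drift for exchanging expectation and time integral, bundled
  because they are preserved by sums and by multiplication with deterministic continuous
  coefficients.\<close>

definition mean_process :: "real \<Rightarrow> (real \<Rightarrow> 'a \<Rightarrow> real) \<Rightarrow> (real \<Rightarrow> real) \<Rightarrow> bool" where
  "mean_process T b Eb \<longleftrightarrow>
     (\<forall>\<omega>\<in>space M. continuous_on {0..T} (\<lambda>\<tau>. b \<tau> \<omega>)) \<and>
     integrable (restrict_space lborel {0..T} \<Otimes>\<^sub>M M) (\<lambda>(\<tau>, \<omega>). b \<tau> \<omega>) \<and>
     continuous_on {0..T} Eb \<and> (\<forall>\<tau>\<in>{0..T}. integrable M (b \<tau>) \<and> expectation (b \<tau>) = Eb \<tau>)"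

lemma mean_process_add:
  "mean_process T b Eb \<Longrightarrow> mean_process T c Ec \<Longrightarrow>
    mean_process T (\<lambda>\<tau> \<omega>. b \<tau> \<omega> + c \<tau> \<omega>) (\<lambda>\<tau>. Eb \<tau> + Ec \<tau>)"
  unfolding mean_process_def case_prod_unfold by (auto intro!: continuous_intros)

lemma mean_process_sum:
  assumes "\<And>a. a \<in> A \<Longrightarrow> mean_process T (b a) (Eb a)"
  shows "mean_process T (\<lambda>\<tau> \<omega>. \<Sum>a\<in>A. b a \<tau> \<omega>) (\<lambda>\<tau>. \<Sum>a\<in>A. Eb a \<tau>)"
  using assms unfolding mean_process_def case_prod_unfold by (auto intro!: continuous_intros)

lemma mean_process_mult:
  assumes b: "mean_process T b Eb" and \<beta>: "continuous_on {0..T} \<beta>"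
  shows "mean_process T (\<lambda>\<tau> \<omega>. \<beta> \<tau> * b \<tau> \<omega>) (\<lambda>\<tau>. \<beta> \<tau> * Eb \<tau>)"
proof -
  let ?R = "restrict_space lborel {0..T} :: real measure"
  have "bounded (\<beta> ` {0..T})" using compact_continuous_image[OF \<beta>] compact_imp_bounded by blast
  then obtain C where C: "\<And>x. x \<in> {0..T} \<Longrightarrow> \<bar>\<beta> x\<bar> \<le> C" by (force simp: bounded_iff)
  have bi: "integrable (?R \<Otimes>\<^sub>M M) (\<lambda>z. b (fst z) (snd z))"
    using b by (simp add: mean_process_def case_prod_unfold)
  have sp: "space (?R \<Otimes>\<^sub>M M) = {0..T} \<times> space M" by (simp add: space_pair_measure space_restrict_space)
  have "\<beta> \<in> borel_measurable (restrict_space borel {0..T})" by (rule borel_measurable_continuous_on_restrict[OF \<beta>])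
  then have \<beta>m: "\<beta> \<in> borel_measurable ?R"
    using measurable_cong_sets[OF sets_restrict_space_cong[OF sets_lborel, of "{0..T}"] refl[of "sets borel"]] by blast
  have "integrable (?R \<Otimes>\<^sub>M M) (\<lambda>z. \<beta> (fst z) * b (fst z) (snd z))"
  proof (rule Bochner_Integration.integrable_bound)
    show "integrable (?R \<Otimes>\<^sub>M M) (\<lambda>z. C * b (fst z) (snd z))" using bi by simp
    show "(\<lambda>z. \<beta> (fst z) * b (fst z) (snd z)) \<in> borel_measurable (?R \<Otimes>\<^sub>M M)"
      using measurable_compose[OF measurable_fst \<beta>m] bi by (intro borel_measurable_times) auto
    show "AE z in ?R \<Otimes>\<^sub>M M. norm (\<beta> (fst z) * b (fst z) (snd z)) \<le> norm (C * b (fst z) (snd z))"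
    proof (rule AE_I2)
      fix z assume "z \<in> space (?R \<Otimes>\<^sub>M M)"
      then have "fst z \<in> {0..T}" unfolding sp by auto
      from C[OF this] have "\<bar>\<beta> (fst z)\<bar> \<le> \<bar>C\<bar>" by linarith
      then show "norm (\<beta> (fst z) * b (fst z) (snd z)) \<le> norm (C * b (fst z) (snd z))"
        by (simp add: abs_mult mult_right_mono)
    qed
  qed
  then show ?thesis
    using b \<beta> unfolding mean_process_def case_prod_unfold by (auto intro!: continuous_intros)
qed

lemma mean_process_cong:
  assumes b: "mean_process T b Eb" and eq: "\<And>\<tau> \<omega>. \<tau> \<in> {0..T} \<Longrightarrow> \<omega> \<in> space M \<Longrightarrow> b \<tau> \<omega> = c \<tau> \<omega>"
    and Eeq: "\<And>\<tau>. \<tau> \<in> {0..T} \<Longrightarrow> Eb \<tau> = Ec \<tau>"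
  shows "mean_process T c Ec"
  unfolding mean_process_def
proof (intro conjI ballI)
  fix \<omega> assume \<omega>: "\<omega> \<in> space M"
  have "continuous_on {0..T} (\<lambda>\<tau>. b \<tau> \<omega>)" using b \<omega> by (simp add: mean_process_def)
  then show "continuous_on {0..T} (\<lambda>\<tau>. c \<tau> \<omega>)" by (rule continuous_on_eq) (auto simp: eq \<omega>)
next
  have "integrable (restrict_space lborel {0..T} \<Otimes>\<^sub>M M) (\<lambda>(\<tau>, \<omega>). b \<tau> \<omega>)" using b by (simp add: mean_process_def)
  then show "integrable (restrict_space lborel {0..T} \<Otimes>\<^sub>M M) (\<lambda>(\<tau>, \<omega>). c \<tau> \<omega>)"
    by (rule Bochner_Integration.integrable_cong[OF refl, THEN iffD1, rotated])
      (auto simp: space_pair_measure space_restrict_space eq)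
next
  have "continuous_on {0..T} Eb" using b by (simp add: mean_process_def)
  then show "continuous_on {0..T} Ec" by (rule continuous_on_eq) (auto simp: Eeq)
next
  fix \<tau> assume \<tau>: "\<tau> \<in> {0..T}"
  have "integrable M (b \<tau>)" "expectation (b \<tau>) = Eb \<tau>" using b \<tau> by (auto simp: mean_process_def)
  moreover have "integrable M (c \<tau>) \<longleftrightarrow> integrable M (b \<tau>)" "expectation (c \<tau>) = expectation (b \<tau>)"
    using eq[OF \<tau>] by (auto intro!: Bochner_Integration.integrable_cong Bochner_Integration.integral_cong)
  ultimately show "integrable M (c \<tau>)" "expectation (c \<tau>) = Ec \<tau>" using Eeq[OF \<tau>] by auto
qed

lemma regular_field_mean_process:
  assumes X: "regular_field M F T X" and m: "ck_field T 2 (mean M X)" and l: "length is \<le> 2"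
  shows "mean_process T (\<lambda>\<tau> \<omega>. pds is (X \<tau> \<omega>) x) (\<lambda>\<tau>. pds is (mean M X \<tau>) x)"
  unfolding mean_process_def
  using ck_field_time[of T 2 _ "is" x] X m l unfolding regular_field_def by auto

end

section \<open>The drifts as linear functions of the realisations\<close>

definition advection_coeff :: "real \<Rightarrow> (real ^ 'n \<Rightarrow> real ^ 'n) \<Rightarrow> (real ^ 'n \<Rightarrow> real) \<Rightarrow> real ^ 'n \<Rightarrow> 'n \<Rightarrow> real" where
  "advection_coeff \<nu> mb rb x i = mb x $ i / rb x + \<nu> * (pd i rb x / rb x)"

definition divergence_coeff :: "real \<Rightarrow> (real ^ 'n \<Rightarrow> real ^ 'n) \<Rightarrow> (real ^ 'n \<Rightarrow> real) \<Rightarrow> real ^ 'n \<Rightarrow> real" where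
  "divergence_coeff \<nu> mb rb x =
    (\<Sum>i\<in>UNIV. (pd i (\<lambda>y. mb y $ i) x / rb x - mb x $ i * pd i rb x / (rb x)\<^sup>2) +
      \<nu> * (pd i (pd i rb) x / rb x - pd i rb x * pd i rb x / (rb x)\<^sup>2))"

text \<open>The derivative in direction \<open>j\<close> of component \<open>i\<close> of the drift
  velocity \<open>u + \<nu> \<nabla> log \<rho>\<close>; the two preceding definitions are the
  velocity itself and its divergence.\<close>

definition stretching_coeff :: "real \<Rightarrow> (real ^ 'n \<Rightarrow> real ^ 'n) \<Rightarrow> (real ^ 'n \<Rightarrow> real) \<Rightarrow> real ^ 'n \<Rightarrow> 'n \<Rightarrow> 'n \<Rightarrow> real" where
  "stretching_coeff \<nu> mb rb x j i =
    (pd j (\<lambda>y. mb y $ i) x / rb x - mb x $ i * pd j rb x / (rb x)\<^sup>2) +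
    \<nu> * (pd j (pd i rb) x / rb x - pd i rb x * pd j rb x / (rb x)\<^sup>2)"

text \<open>The force per unit of density: everything in the momentum drift that multiplies the
  realisation of the density.\<close>

definition forcing_coeff :: "real \<Rightarrow> real \<Rightarrow> (real \<Rightarrow> real) \<Rightarrow> (real ^ 'n \<Rightarrow> real ^ 'n) \<Rightarrow> (real ^ 'n \<Rightarrow> real) \<Rightarrow>
    real ^ 'n \<Rightarrow> 'n \<Rightarrow> real" where
  "forcing_coeff \<kappa> \<nu> U mb rb x j =
    (\<Sum>i\<in>UNIV. (pd j (\<lambda>y. mb y $ i) x / rb x - mb x $ i * pd j rb x / (rb x)\<^sup>2) * (mb x $ i / rb x))
    - 1 / rb x * ((2 * rb x * deriv U (rb x) + (rb x)\<^sup>2 * deriv (deriv U) (rb x)) * pd j rb x)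
    + \<kappa> * (\<Sum>i\<in>UNIV. pd j (pd i (pd i rb)) x)
    - \<nu> / (rb x)\<^sup>2 * (\<Sum>i\<in>UNIV. pd i (\<lambda>y. mb y $ i) x) * pd j rb x
    + \<nu> / rb x * (\<Sum>i\<in>UNIV. pd j (pd i (\<lambda>y. mb y $ i)) x)"

context flow_state
begin

text \<open>The mean field structure: the coefficients depend on the means alone and the
  realisations enter linearly. Hence the expected drift is the drift evaluated at the means, with no
  correlation terms.\<close>

lemma momentum_drift_linear:
  "momentum_drift \<kappa> \<nu> U mb rb m r x $ j =
    (\<Sum>i\<in>UNIV. (- advection_coeff \<nu> mb rb x i) * pd i (\<lambda>y. m y $ j) x) +
    ((- divergence_coeff \<nu> mb rb x) * m x $ j +
    ((\<Sum>i\<in>UNIV. (- stretching_coeff \<nu> mb rb x j i) * m x $ i) + forcing_coeff \<kappa> \<nu> U mb rb x j * r x))"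
proof -
  define du where "du = (\<lambda>i. pd j (\<lambda>y. mb y $ i) x / rb x - mb x $ i * pd j rb x / (rb x)\<^sup>2)"
  define dg where "dg = (\<lambda>i. pd j (pd i rb) x / rb x - pd i rb x * pd j rb x / (rb x)\<^sup>2)"
  define P where "P = (2 * rb x * deriv U (rb x) + (rb x)\<^sup>2 * deriv (deriv U) (rb x)) * pd j rb x"
  have f: "forcing_coeff \<kappa> \<nu> U mb rb x j = (\<Sum>i\<in>UNIV. du i * (mb x $ i / rb x)) - 1 / rb x * P
    + \<kappa> * (\<Sum>i\<in>UNIV. pd j (pd i (pd i rb)) x)
    - \<nu> / (rb x)\<^sup>2 * (\<Sum>i\<in>UNIV. pd i (\<lambda>y. mb y $ i) x) * pd j rb x
    + \<nu> / rb x * (\<Sum>i\<in>UNIV. pd j (pd i (\<lambda>y. mb y $ i)) x)"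
    by (simp only: forcing_coeff_def du_def P_def)
  have d: "momentum_drift \<kappa> \<nu> U mb rb m r x $ j =
    - (\<Sum>i\<in>UNIV. advection_coeff \<nu> mb rb x i * pd i (\<lambda>y. m y $ j) x) - divergence_coeff \<nu> mb rb x * m x $ j
    - (\<Sum>i\<in>UNIV. du i * m x $ i) - \<nu> * (\<Sum>i\<in>UNIV. dg i * m x $ i)
    + r x * (\<Sum>i\<in>UNIV. du i * (mb x $ i / rb x)) - r x / rb x * P
    + \<kappa> * r x * (\<Sum>i\<in>UNIV. pd j (pd i (pd i rb)) x)
    - \<nu> * r x / (rb x)\<^sup>2 * (\<Sum>i\<in>UNIV. pd i (\<lambda>y. mb y $ i) x) * pd j rb x
    + \<nu> * r x / rb x * (\<Sum>i\<in>UNIV. pd j (pd i (\<lambda>y. mb y $ i)) x)"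
    by (simp only: momentum_drift_eq advection_coeff_def divergence_coeff_def du_def dg_def P_def)
  have "momentum_drift \<kappa> \<nu> U mb rb m r x $ j =
    - (\<Sum>i\<in>UNIV. advection_coeff \<nu> mb rb x i * pd i (\<lambda>y. m y $ j) x) - divergence_coeff \<nu> mb rb x * m x $ j
    - (\<Sum>i\<in>UNIV. du i * m x $ i) - \<nu> * (\<Sum>i\<in>UNIV. dg i * m x $ i) + forcing_coeff \<kappa> \<nu> U mb rb x j * r x"
    unfolding d f by (simp add: algebra_simps)
  moreover have "(\<Sum>i\<in>UNIV. (- stretching_coeff \<nu> mb rb x j i) * m x $ i) =
      - (\<Sum>i\<in>UNIV. du i * m x $ i) - \<nu> * (\<Sum>i\<in>UNIV. dg i * m x $ i)"
  proof -
    have "stretching_coeff \<nu> mb rb x j i = du i + \<nu> * dg i" for i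
      by (simp only: stretching_coeff_def du_def dg_def)
    then show ?thesis
      by (simp add: left_diff_distrib sum_subtractf sum_negf sum_distrib_left mult.assoc)
  qed
  ultimately show ?thesis by (simp add: sum_negf)
qed

lemma density_drift_linear:
  assumes "r differentiable (at x)"
  shows "density_drift \<nu> mb rb r x =
    (- divergence_coeff \<nu> mb rb x) * r x + (\<Sum>i\<in>UNIV. (- advection_coeff \<nu> mb rb x i) * pd i r x)"
proof -
  define v dv where "v = advection_coeff \<nu> mb rb x" and "dv = (\<lambda>i.
    (pd i (\<lambda>y. mb y $ i) x / rb x - mb x $ i * pd i rb x / (rb x)\<^sup>2) +
      \<nu> * (pd i (pd i rb) x / rb x - pd i rb x * pd i rb x / (rb x)\<^sup>2))"
  have "density_drift \<nu> mb rb r x = - (\<Sum>i\<in>UNIV. r x * dv i + pd i r x * v i)"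
    unfolding density_drift_eq[OF assms] by (simp only: v_def dv_def advection_coeff_def)
  moreover have "divergence_coeff \<nu> mb rb x = sum dv UNIV"
    by (simp only: divergence_coeff_def dv_def)
  ultimately show ?thesis
    unfolding v_def[symmetric] by (simp add: sum.distrib sum_negf sum_distrib_left mult.commute)
qed

end

lemma coefficients_continuous:
  fixes mb :: "real \<Rightarrow> real ^ 'n \<Rightarrow> real ^ 'n"
  assumes m: "\<And>j. ck_field T 2 (\<lambda>t x. mb t x $ j)" and r: "ck_field T 3 rb"
    and pos: "\<And>t x. t \<in> {0..T} \<Longrightarrow> rb t x > 0"
    and U: "\<And>k r. r > 0 \<Longrightarrow> (deriv ^^ k) U field_differentiable (at r)"
  shows "continuous_on {0..T} (\<lambda>\<tau>. advection_coeff \<nu> (mb \<tau>) (rb \<tau>) x i)"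
    "continuous_on {0..T} (\<lambda>\<tau>. divergence_coeff \<nu> (mb \<tau>) (rb \<tau>) x)"
    "continuous_on {0..T} (\<lambda>\<tau>. stretching_coeff \<nu> (mb \<tau>) (rb \<tau>) x j i)"
    "continuous_on {0..T} (\<lambda>\<tau>. forcing_coeff \<kappa> \<nu> U (mb \<tau>) (rb \<tau>) x j)"
proof -
  note c = ck_field_2_time[OF m]
  have r0: "continuous_on {0..T} (\<lambda>\<tau>. rb \<tau> x)" and r1: "continuous_on {0..T} (\<lambda>\<tau>. pd i (rb \<tau>) x)"
    and r2: "continuous_on {0..T} (\<lambda>\<tau>. pd i (pd k (rb \<tau>)) x)"
    and r3: "continuous_on {0..T} (\<lambda>\<tau>. pd i (pd k (pd l (rb \<tau>))) x)" for i k l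
    using ck_field_time[OF r, of "[]" x] ck_field_time[OF r, of "[i]" x] ck_field_time[OF r, of "[i, k]" x]
      ck_field_time[OF r, of "[i, k, l]" x] by auto
  have nz: "\<forall>\<tau>\<in>{0..T}. rb \<tau> x \<noteq> 0" "\<forall>\<tau>\<in>{0..T}. (rb \<tau> x)\<^sup>2 \<noteq> 0" using pos[of _ x] by force+
  have "continuous_on {0<..} ((deriv ^^ k) U)" for k
    using U by (intro continuous_at_imp_continuous_on ballI field_differentiable_imp_continuous_at) auto
  moreover have "(\<lambda>\<tau>. rb \<tau> x) ` {0..T} \<subseteq> {0<..}" using pos by blast
  ultimately have u: "continuous_on {0..T} (\<lambda>\<tau>. (deriv ^^ k) U (rb \<tau> x))" for k
    using continuous_on_compose2[OF _ r0] by blast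
  have u': "continuous_on {0..T} (\<lambda>\<tau>. deriv U (rb \<tau> x))" "continuous_on {0..T} (\<lambda>\<tau>. deriv (deriv U) (rb \<tau> x))"
    using u[of 1] u[of 2] by (simp_all add: numeral_2_eq_2)
  note rules = continuous_on_add continuous_on_diff continuous_on_mult continuous_on_divide continuous_on_sum
    continuous_on_power continuous_on_const c r0 r1 r2 r3 u' nz
  show "continuous_on {0..T} (\<lambda>\<tau>. advection_coeff \<nu> (mb \<tau>) (rb \<tau>) x i)"
    unfolding advection_coeff_def by (intro rules)
  show "continuous_on {0..T} (\<lambda>\<tau>. divergence_coeff \<nu> (mb \<tau>) (rb \<tau>) x)"
    unfolding divergence_coeff_def by (intro rules)
  show "continuous_on {0..T} (\<lambda>\<tau>. stretching_coeff \<nu> (mb \<tau>) (rb \<tau>) x j i)"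
    unfolding stretching_coeff_def by (intro rules)
  show "continuous_on {0..T} (\<lambda>\<tau>. forcing_coeff \<kappa> \<nu> U (mb \<tau>) (rb \<tau>) x j)"
    unfolding forcing_coeff_def by (intro rules)
qed

section \<open>From the integrated mean equations to the differential system\<close>

lemma has_vector_derivative_vecI:
  fixes f :: "real \<Rightarrow> real ^ 'n"
  assumes "\<And>j. ((\<lambda>\<tau>. f \<tau> $ j) has_real_derivative D $ j) (at t within S)"
  shows "(f has_vector_derivative D) (at t within S)"
  unfolding has_vector_derivative_def
proof (subst has_derivative_componentwise_within, intro ballI)
  fix b :: "real ^ 'n" assume "b \<in> Basis"
  then obtain j where b: "b = axis j 1" by (auto simp: Basis_vec_def)
  show "((\<lambda>\<tau>. f \<tau> \<bullet> b) has_derivative (\<lambda>x. (x *\<^sub>R D) \<bullet> b)) (at t within S)"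
    using assms[of j] by (simp add: b inner_axis has_field_derivative_def mult.commute[of _ "D $ j"])
qed

lemma integral_equation_derivative:
  fixes f g :: "real \<Rightarrow> real"
  assumes g: "continuous_on {0..T} g" and t: "t \<in> {0..T}"
    and f: "\<And>t. t \<in> {0..T} \<Longrightarrow> f t = f 0 + integral {0..t} g"
  shows "(f has_real_derivative g t) (at t within {0..T})"
proof -
  have "((\<lambda>x. f 0 + integral {0..x} g) has_real_derivative 0 + g t) (at t within {0..T})"
    by (intro DERIV_add DERIV_const integral_has_real_derivative[OF g t])
  then have "((\<lambda>x. f 0 + integral {0..x} g) has_real_derivative g t) (at t within {0..T})" by simp
  then show ?thesis
  proof (rule has_field_derivative_transform_within[where d=1])
    show "f 0 + integral {0..x} g = f x" if "x \<in> {0..T}" for x using f[OF that] by (rule sym)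
  qed (rule zero_less_one, rule t)
qed

lemma adT_noise:
  fixes kp :: "(int, 'n::{finite,linorder}) vec \<Rightarrow> nat \<Rightarrow> (real, 'n) vec"
  assumes kp: "orthogonal_choice kp" and r: "r \<in> noise_indices"
  shows "adT (zeta s kp r) Y x $ j = first_order (\<lambda>i y. zeta s kp r y $ i)
    (\<lambda>c d. pd c (\<lambda>y. zeta s kp r y $ d)) (\<lambda>d y. Y y $ d) j x"
proof -
  have "dvg (zeta s kp r) x = 0"
    using zeta_identities(3)[OF kp r] by (simp add: dvg_def)
  then show ?thesis by (simp add: adT_def nabla_def nablaT_def first_order_def)
qed

text \<open>The density is a family with a single component, indexed by \<open>unit\<close>; the
  zeroth order term vanishes because the noise fields are divergence free.\<close>

lemma dvg_noise:
  fixes kp :: "(int, 'n::{finite,linorder}) vec \<Rightarrow> nat \<Rightarrow> (real, 'n) vec"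
  assumes kp: "orthogonal_choice kp" and r: "r \<in> noise_indices" and g: "g differentiable (at x)"
  shows "dvg (\<lambda>y. g y *\<^sub>R zeta s kp r y) x =
    first_order (\<lambda>i y. zeta s kp r y $ i) (\<lambda>_ _ _. 0) (\<lambda>_::unit. g) c x"
proof -
  have Z: "(\<lambda>y. zeta s kp r y $ i) differentiable (at x)" for i
    using Ck_differentiable zeta_identities(1)[OF kp r] by blast
  have "dvg (\<lambda>y. g y *\<^sub>R zeta s kp r y) x = (\<Sum>i\<in>UNIV. pd i (\<lambda>y. g y * zeta s kp r y $ i) x)"
    by (simp add: dvg_def)
  also have "\<dots> = (\<Sum>i\<in>UNIV. g x * pd i (\<lambda>y. zeta s kp r y $ i) x) + (\<Sum>i\<in>UNIV. pd i g x * zeta s kp r x $ i)"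
    by (simp add: pd_mult[OF g Z] sum.distrib)
  also have "(\<Sum>i\<in>UNIV. g x * pd i (\<lambda>y. zeta s kp r y $ i) x) = 0"
    using zeta_identities(3)[OF kp r] by (simp add: sum_distrib_left[symmetric])
  finally show ?thesis by (simp add: first_order_def mult.commute)
qed

text \<open>The common treatment of density and momentum. The equation is required at all points and
  for all components although the conclusion concerns one: the covariation must be known as a
  function of the point before it is differentiated, and \<open>B\<close> mixes components.\<close>

lemma noise_mean_derivative:
  fixes kp :: "(int, 'n::{finite,linorder}) vec \<Rightarrow> nat \<Rightarrow> (real, 'n) vec"
    and X :: "'c::finite \<Rightarrow> real \<Rightarrow> 'a \<Rightarrow> (real, 'n) vec \<Rightarrow> real"
    and B :: "'n noise_index \<Rightarrow> 'c \<Rightarrow> 'c \<Rightarrow> (real, 'n) vec \<Rightarrow> real" and s :: real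
  defines "L \<equiv> (\<lambda>r. first_order (\<lambda>i y. zeta s kp r y $ i) (B r))"
  assumes "brownian_setting M F noise_indices W"
    and kp: "orthogonal_choice kp" and s: "s > 1 + real CARD('n) / 2" and t: "t \<in> {0..T}"
    and reg: "\<And>c. regular_field M F T (X c)" and mreg: "\<And>c. ck_field T 2 (mean M (X c))"
    and cov: "\<And>c r. r \<in> noise_indices \<Longrightarrow> covariation_commutes_pd M F T (X c) (W r)"
    and B: "\<And>r c d. r \<in> noise_indices \<Longrightarrow> Ck 1 (B r c d)"
    and B2: "\<And>c d x. (\<lambda>r. (B r c d x)\<^sup>2) summable_on noise_indices"
    and B0: "\<And>r d. r \<in> noise_indices \<Longrightarrow> (\<Sum>i\<in>UNIV. zeta s kp r x $ i * pd i (B r c d) x) = 0"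
    and BB: "\<And>r e. r \<in> noise_indices \<Longrightarrow> (\<Sum>d\<in>UNIV. B r c d x * B r d e x) = 0"
    and AB: "\<And>i d. ((\<lambda>r. zeta s kp r x $ i * B r c d x) has_sum 0) noise_indices"
    and ito: "ito_integrals_centred M F T noise_indices (\<lambda>r t \<omega>. L r (\<lambda>d. X d t \<omega>) c x) W"
    and comm: "expectation_commutes_series M F T noise_indices (\<lambda>r t \<omega>. L r (\<lambda>d. X d t \<omega>) c x) W"
    and eq: "\<And>x c. stratonovich_equation M F T noise_indices W (\<lambda>t \<omega>. X c t \<omega> x) (b c x) a
        (\<lambda>r t \<omega>. L r (\<lambda>d. X d t \<omega>) c x)"
    and b: "\<And>c x. prob_space.mean_process M T (b c x) (Eb c x)"
  shows "((\<lambda>\<tau>. mean M (X c) \<tau> x) has_real_derivative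
    Eb c x t + a\<^sup>2 / 2 * noise_const TYPE('n) s * lap (mean M (X c) t) x) (at t within {0..T})"
proof (rule integral_equation_derivative[OF _ t])
  interpret brownian_setting M F noise_indices W by fact
  let ?k = "a\<^sup>2 / 2 * noise_const TYPE('n) s" and ?l = "\<lambda>\<tau>. lap (mean M (X c) \<tau>) x"
  have bc: "continuous_on {0..T} (Eb c x)"
    and b': "\<And>c x \<omega>. \<omega> \<in> space M \<Longrightarrow> continuous_on {0..T} (\<lambda>\<tau>. b c x \<tau> \<omega>)"
      "integrable (restrict_space lborel {0..T} \<Otimes>\<^sub>M M) (\<lambda>(\<tau>, \<omega>). b c x \<tau> \<omega>)"
      "\<And>\<tau>. \<tau> \<in> {0..T} \<Longrightarrow> expectation (b c x \<tau>) = Eb c x \<tau>"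
    using b by (simp_all add: mean_process_def)
  have lc: "continuous_on {0..T} ?l"
    unfolding lap_def by (intro continuous_on_sum ck_field_2_time(3)[OF mreg])
  show "continuous_on {0..T} (\<lambda>\<tau>. Eb c x \<tau> + ?k * ?l \<tau>)"
    by (intro continuous_on_add continuous_on_mult continuous_on_const bc lc)
  fix t assume "t \<in> {0..T}"
  then have t: "0 \<le> t" "t \<le> T" and st: "{0..t} \<subseteq> {0..T}" by auto
  have "(\<lambda>r. (zeta s kp r x $ i)\<^sup>2) summable_on noise_indices" for i x
    using zeta_product_has_sum[OF kp s, of x i i] unfolding summable_on_def power2_eq_square by blast
  note A2 = this
  have "mean M (X c) t x = mean M (X c) 0 x + integral {0..t} (Eb c x) +
      a\<^sup>2 / 2 * (noise_const TYPE('n) s * integral {0..t} ?l)"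
  proof (rule mean_field_equation[where A="\<lambda>r i y. zeta s kp r y $ i" and B=B and b=b])
    show "noise_indices \<noteq> ({} :: 'n noise_index set)" by (auto simp: noise_indices_def)
    show "((\<lambda>r. integral {0..t} (\<lambda>\<tau>. first_order (\<lambda>i y. zeta s kp r y $ i) (B r)
        (first_order (\<lambda>i y. zeta s kp r y $ i) (B r) (\<lambda>e. mean M (X e) \<tau>)) c x)) has_sum
        noise_const TYPE('n) s * integral {0..t} ?l) noise_indices"
      by (rule noise_second_order_has_sum[OF kp s mreg t B B0 BB AB])
    show "Ck 1 (\<lambda>y. zeta s kp r y $ i)" if "r \<in> noise_indices" for r i by (rule zeta_identities(1)[OF kp that])
    show "stratonovich_equation M F T noise_indices W (\<lambda>t \<omega>. X c t \<omega> x) (b c x) a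
        (\<lambda>r t \<omega>. first_order (\<lambda>i y. zeta s kp r y $ i) (B r) (\<lambda>d. X d t \<omega>) c x)" for c x
      using eq unfolding L_def .
    show "ito_integrals_centred M F T noise_indices
        (\<lambda>r t \<omega>. first_order (\<lambda>i y. zeta s kp r y $ i) (B r) (\<lambda>d. X d t \<omega>) c x) W"
      using ito unfolding L_def .
    show "expectation_commutes_series M F T noise_indices
        (\<lambda>r t \<omega>. first_order (\<lambda>i y. zeta s kp r y $ i) (B r) (\<lambda>d. X d t \<omega>) c x) W"
      using comm unfolding L_def .
    show "0 \<le> t" "t \<le> T" by (rule t)+
    show "regular_field M F T (X c)" "ck_field T 2 (mean M (X c))" for c by (rule reg mreg)+
    show "continuous_on {0..T} (\<lambda>\<tau>. b c x \<tau> \<omega>)" if "\<omega> \<in> space M" for c x \<omega> by (rule b'(1)[OF that])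
    show "continuous_on {0..T} (Eb c x)" by (rule bc)
  qed (auto simp: cov B A2 B2 b'(3) intro: b'(2) simp del: One_nat_def)
  moreover have "integral {0..t} (\<lambda>\<tau>. Eb c x \<tau> + ?k * ?l \<tau>) = integral {0..t} (Eb c x) + ?k * integral {0..t} ?l"
    by (subst integral_add)
      (auto intro!: integrable_continuous_interval continuous_on_mult_left continuous_on_subset[OF bc st] continuous_on_subset[OF lc st])
  ultimately show "mean M (X c) t x = mean M (X c) 0 x + integral {0..t} (\<lambda>\<tau>. Eb c x \<tau> + ?k * ?l \<tau>)"
    by simp
qed

text \<open>The mean of a vector field is a Bochner integral, while integrability is available
  componentwise.\<close>

lemma mean_component:
  fixes X :: "real \<Rightarrow> 'a \<Rightarrow> real ^ 'n \<Rightarrow> real ^ 'n"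
  assumes "\<And>j. integrable M (\<lambda>\<omega>. X t \<omega> x $ j)"
  shows "mean M X t x $ j = mean M (\<lambda>t \<omega> x. X t \<omega> x $ j) t x"
proof -
  have "X t \<omega> x = (\<Sum>j\<in>UNIV. X t \<omega> x $ j *\<^sub>R axis j 1)" for \<omega>
    by (simp add: vec_eq_iff axis_def if_distrib cong: if_cong)
  moreover have "integrable M (\<lambda>\<omega>. \<Sum>j\<in>UNIV. X t \<omega> x $ j *\<^sub>R (axis j 1 :: real ^ 'n))"
    using assms by (intro Bochner_Integration.integrable_sum integrable_scaleR_left) auto
  ultimately have "integrable M (\<lambda>\<omega>. X t \<omega> x)" by simp
  from integral_bounded_linear[OF bounded_linear_vec_nth[of j] this] show ?thesis by (simp add: mean_def)
qed

theorem theorem3p4: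
  fixes M :: "'a measure" and F :: "real \<Rightarrow> 'a measure" and T :: real
    and \<kappa> \<nu> \<epsilon> s :: real and U :: "real \<Rightarrow> real"
    and kp :: "(int, 'n::{finite,linorder}) vec \<Rightarrow> nat \<Rightarrow> (real, 'n) vec"
    and \<xi> :: "'n noise_index \<Rightarrow> (real, 'n) vec \<Rightarrow> (real, 'n) vec"
    and W :: "'n noise_index \<Rightarrow> real \<Rightarrow> 'a \<Rightarrow> real"
    and \<mu> :: "real \<Rightarrow> 'a \<Rightarrow> (real, 'n) vec \<Rightarrow> (real, 'n) vec"
    and \<rho> :: "real \<Rightarrow> 'a \<Rightarrow> (real, 'n) vec \<Rightarrow> real"
  defines "\<mu>b \<equiv> mean M \<mu>" and "\<rho>b \<equiv> mean M \<rho>"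
  assumes "prob_space M" and "usual_conditions M F" and "T > 0"
    and W: "brownian_family M F noise_indices W"
    and "\<kappa> \<ge> 0" and "\<nu> \<ge> 0" and "\<epsilon> \<ge> 0"
    and U: "\<And>k r. r > 0 \<Longrightarrow> (deriv ^^ k) U field_differentiable (at r)"
    and s: "s > 1 + real CARD('n) / 2"
    and kp: "orthogonal_choice kp"
    and \<xi>: "\<And>r. r \<in> noise_indices \<Longrightarrow> \<xi> r = zeta s kp r"
    and \<nu>: "noise_const TYPE('n) s * \<epsilon>\<^sup>2 / 2 = \<nu>"
    \<comment> \<open>conventions on solutions\<close>
    and \<rho>b_pos: "\<And>t x. t \<in> {0..T} \<Longrightarrow> \<rho>b t x > 0"
    and \<mu>b_reg: "\<And>j. ck_field T 2 (\<lambda>t x. \<mu>b t x $ j)"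
    and \<rho>b_reg: "ck_field T 3 \<rho>b"
    and \<mu>_reg: "\<And>j. regular_field M F T (\<lambda>t \<omega> x. \<mu> t \<omega> x $ j)"
    and \<rho>_reg: "regular_field M F T \<rho>"
    and \<mu>_cov: "\<And>r j. r \<in> noise_indices \<Longrightarrow>
          covariation_commutes_pd M F T (\<lambda>t \<omega> x. \<mu> t \<omega> x $ j) (W r)"
    and \<rho>_cov: "\<And>r. r \<in> noise_indices \<Longrightarrow> covariation_commutes_pd M F T \<rho> (W r)"
    and \<mu>_ito: "\<And>x j. ito_integrals_centred M F T noise_indices
          (\<lambda>r t \<omega>. adT (\<xi> r) (\<mu> t \<omega>) x $ j) W"
    and \<rho>_ito: "\<And>x. ito_integrals_centred M F T noise_indices
          (\<lambda>r t \<omega>. dvg (\<lambda>y. \<rho> t \<omega> y *\<^sub>R \<xi> r y) x) W"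
    and \<mu>_sum: "\<And>x j. expectation_commutes_series M F T noise_indices
          (\<lambda>r t \<omega>. adT (\<xi> r) (\<mu> t \<omega>) x $ j) W"
    and \<rho>_sum: "\<And>x. expectation_commutes_series M F T noise_indices
          (\<lambda>r t \<omega>. dvg (\<lambda>y. \<rho> t \<omega> y *\<^sub>R \<xi> r y) x) W"
    \<comment> \<open>the mean field system\<close>
    and \<mu>_eq: "\<And>x j. stratonovich_equation M F T noise_indices W
          (\<lambda>t \<omega>. \<mu> t \<omega> x $ j)
          (\<lambda>t \<omega>. momentum_drift \<kappa> \<nu> U (\<mu>b t) (\<rho>b t) (\<mu> t \<omega>) (\<rho> t \<omega>) x $ j)
          (- \<epsilon>) (\<lambda>r t \<omega>. adT (\<xi> r) (\<mu> t \<omega>) x $ j)"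
    and \<rho>_eq: "\<And>x. stratonovich_equation M F T noise_indices W
          (\<lambda>t \<omega>. \<rho> t \<omega> x)
          (\<lambda>t \<omega>. density_drift \<nu> (\<mu>b t) (\<rho>b t) (\<rho> t \<omega>) x)
          (- \<epsilon>) (\<lambda>r t \<omega>. dvg (\<lambda>y. \<rho> t \<omega> y *\<^sub>R \<xi> r y) x)"
  shows "compressible_navier_stokes T \<kappa> \<nu> U (\<lambda>t. velocity (\<mu>b t) (\<rho>b t)) \<rho>b"
proof -
  have bs: "brownian_setting M F noise_indices W"
    using \<open>prob_space M\<close> \<open>usual_conditions M F\<close> W
    by (simp add: brownian_setting_def brownian_setting_axioms_def)
  interpret brownian_setting M F noise_indices W by (rule bs)
  define \<mu>c where "\<mu>c = (\<lambda>j t \<omega> x. \<mu> t \<omega> x $ j)"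
  have \<mu>c_reg: "regular_field M F T (\<mu>c j)" for j using \<mu>_reg by (simp add: \<mu>c_def)
  \<comment> \<open>Restricted to the time interval: where some component is not integrable, the
    vector integral is 0 by convention and may differ from the integrals of the other
    components.\<close>
  have mean_nth: "mean M (\<mu>c j) t = (\<lambda>x. \<mu>b t x $ j)" if t: "t \<in> {0..T}" for j t
  proof
    fix x
    have "integrable M (\<lambda>\<omega>. \<mu> t \<omega> x $ j)" for j
      using \<mu>_reg[of j] t unfolding regular_field_def by (auto dest!: spec[of _ "[]"])
    then show "mean M (\<mu>c j) t x = \<mu>b t x $ j"
      unfolding \<mu>c_def \<mu>b_def by (rule mean_component[symmetric])
  qed
  have \<mu>c_mean: "ck_field T 2 (mean M (\<mu>c j))" for j
    by (rule ck_field_cong[OF \<mu>b_reg]) (rule mean_nth[symmetric])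
  have \<rho>b_2: "ck_field T 2 (mean M \<rho>)"
    using \<rho>b_reg Ck_mono[of 3 _ 2] unfolding ck_field_def \<rho>b_def by auto
  have flow: "flow_state (\<mu>b t) (\<rho>b t) U" if "t \<in> {0..T}" for t
    using that \<mu>b_reg \<rho>b_reg \<rho>b_pos U[of _ 0] U[of _ 1] by (simp add: flow_state_def ck_field_def)
  note coeff = coefficients_continuous[OF \<mu>b_reg \<rho>b_reg \<rho>b_pos U]
  have \<mu>_ck: "ck_field T 2 (\<lambda>t. \<mu>c j t \<omega>)" if "\<omega> \<in> space M" for j \<omega>
    using \<mu>c_reg that by (simp add: regular_field_def)
  have \<rho>_ck: "ck_field T 2 (\<lambda>t. \<rho> t \<omega>)" if "\<omega> \<in> space M" for \<omega>
    using \<rho>_reg that by (simp add: regular_field_def)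
  have mp: "mean_process T (\<lambda>\<tau> \<omega>. X \<tau> \<omega> x) (\<lambda>\<tau>. mean M X \<tau> x)"
      "mean_process T (\<lambda>\<tau> \<omega>. pd i (X \<tau> \<omega>) x) (\<lambda>\<tau>. pd i (mean M X \<tau>) x)"
    if "regular_field M F T X" "ck_field T 2 (mean M X)" for X :: "real \<Rightarrow> 'a \<Rightarrow> (real, 'n) vec \<Rightarrow> real" and i x
    using regular_field_mean_process[OF that, of "[]" x] regular_field_mean_process[OF that, of "[i]" x] by auto
  have \<rho>_drift: "mean_process T (\<lambda>t \<omega>. density_drift \<nu> (\<mu>b t) (\<rho>b t) (\<rho> t \<omega>) x)
      (\<lambda>t. density_drift \<nu> (\<mu>b t) (\<rho>b t) (\<rho>b t) x)" for x
  proof (rule mean_process_cong)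
    show "mean_process T
      (\<lambda>t \<omega>. (- divergence_coeff \<nu> (\<mu>b t) (\<rho>b t) x) * \<rho> t \<omega> x +
        (\<Sum>i\<in>UNIV. (- advection_coeff \<nu> (\<mu>b t) (\<rho>b t) x i) * pd i (\<rho> t \<omega>) x))
      (\<lambda>t. (- divergence_coeff \<nu> (\<mu>b t) (\<rho>b t) x) * mean M \<rho> t x +
        (\<Sum>i\<in>UNIV. (- advection_coeff \<nu> (\<mu>b t) (\<rho>b t) x i) * pd i (mean M \<rho> t) x))"
      by (intro mean_process_add mean_process_sum mean_process_mult mp \<rho>_reg \<rho>b_2 continuous_on_minus coeff)
  next
    fix t \<omega> assume t: "t \<in> {0..T}" and \<omega>: "\<omega> \<in> space M"
    show "(- divergence_coeff \<nu> (\<mu>b t) (\<rho>b t) x) * \<rho> t \<omega> x +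
        (\<Sum>i\<in>UNIV. (- advection_coeff \<nu> (\<mu>b t) (\<rho>b t) x i) * pd i (\<rho> t \<omega>) x) =
        density_drift \<nu> (\<mu>b t) (\<rho>b t) (\<rho> t \<omega>) x"
      by (rule flow_state.density_drift_linear[OF flow[OF t], symmetric]) (rule ck_field_2_differentiable(1)[OF \<rho>_ck[OF \<omega>] t])
  next
    fix t assume t: "t \<in> {0..T}"
    show "(- divergence_coeff \<nu> (\<mu>b t) (\<rho>b t) x) * mean M \<rho> t x +
        (\<Sum>i\<in>UNIV. (- advection_coeff \<nu> (\<mu>b t) (\<rho>b t) x i) * pd i (mean M \<rho> t) x) =
        density_drift \<nu> (\<mu>b t) (\<rho>b t) (\<rho>b t) x"
      unfolding \<rho>b_def[symmetric]
      by (rule flow_state.density_drift_linear[OF flow[OF t], symmetric])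
        (rule ck_field_2_differentiable(1)[OF \<rho>b_2[folded \<rho>b_def] t])
  qed
  have \<mu>_drift: "mean_process T (\<lambda>t \<omega>. momentum_drift \<kappa> \<nu> U (\<mu>b t) (\<rho>b t) (\<mu> t \<omega>) (\<rho> t \<omega>) x $ j)
      (\<lambda>t. momentum_drift \<kappa> \<nu> U (\<mu>b t) (\<rho>b t) (\<mu>b t) (\<rho>b t) x $ j)" for x j
  proof (rule mean_process_cong)
    show "mean_process T
      (\<lambda>t \<omega>. (\<Sum>i\<in>UNIV. (- advection_coeff \<nu> (\<mu>b t) (\<rho>b t) x i) * pd i (\<mu>c j t \<omega>) x) +
        ((- divergence_coeff \<nu> (\<mu>b t) (\<rho>b t) x) * \<mu>c j t \<omega> x +
        ((\<Sum>i\<in>UNIV. (- stretching_coeff \<nu> (\<mu>b t) (\<rho>b t) x j i) * \<mu>c i t \<omega> x) +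
         forcing_coeff \<kappa> \<nu> U (\<mu>b t) (\<rho>b t) x j * \<rho> t \<omega> x)))
      (\<lambda>t. (\<Sum>i\<in>UNIV. (- advection_coeff \<nu> (\<mu>b t) (\<rho>b t) x i) * pd i (mean M (\<mu>c j) t) x) +
        ((- divergence_coeff \<nu> (\<mu>b t) (\<rho>b t) x) * mean M (\<mu>c j) t x +
        ((\<Sum>i\<in>UNIV. (- stretching_coeff \<nu> (\<mu>b t) (\<rho>b t) x j i) * mean M (\<mu>c i) t x) +
         forcing_coeff \<kappa> \<nu> U (\<mu>b t) (\<rho>b t) x j * mean M \<rho> t x)))"
      by (intro mean_process_add mean_process_sum mean_process_mult mp \<rho>_reg \<rho>b_2 \<mu>c_reg \<mu>c_mean continuous_on_minus coeff)
  next
    fix t \<omega> assume t: "t \<in> {0..T}"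
    show "(\<Sum>i\<in>UNIV. (- advection_coeff \<nu> (\<mu>b t) (\<rho>b t) x i) * pd i (\<mu>c j t \<omega>) x) +
        ((- divergence_coeff \<nu> (\<mu>b t) (\<rho>b t) x) * \<mu>c j t \<omega> x +
        ((\<Sum>i\<in>UNIV. (- stretching_coeff \<nu> (\<mu>b t) (\<rho>b t) x j i) * \<mu>c i t \<omega> x) +
         forcing_coeff \<kappa> \<nu> U (\<mu>b t) (\<rho>b t) x j * \<rho> t \<omega> x)) =
      momentum_drift \<kappa> \<nu> U (\<mu>b t) (\<rho>b t) (\<mu> t \<omega>) (\<rho> t \<omega>) x $ j"
      unfolding \<mu>c_def by (rule flow_state.momentum_drift_linear[OF flow[OF t], symmetric])
    show "(\<Sum>i\<in>UNIV. (- advection_coeff \<nu> (\<mu>b t) (\<rho>b t) x i) * pd i (mean M (\<mu>c j) t) x) +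
        ((- divergence_coeff \<nu> (\<mu>b t) (\<rho>b t) x) * mean M (\<mu>c j) t x +
        ((\<Sum>i\<in>UNIV. (- stretching_coeff \<nu> (\<mu>b t) (\<rho>b t) x j i) * mean M (\<mu>c i) t x) +
         forcing_coeff \<kappa> \<nu> U (\<mu>b t) (\<rho>b t) x j * mean M \<rho> t x)) =
      momentum_drift \<kappa> \<nu> U (\<mu>b t) (\<rho>b t) (\<mu>b t) (\<rho>b t) x $ j"
      unfolding mean_nth[OF t] \<rho>b_def[symmetric]
      by (rule flow_state.momentum_drift_linear[OF flow[OF t], symmetric])
  qed
  \<comment> \<open>The noise amplitude enters only through its square, so the sign in the system
    disappears.\<close>
  have \<nu>': "(- \<epsilon>)\<^sup>2 / 2 * noise_const TYPE('n) s = \<nu>" using \<nu> by (simp add: mult.commute)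
  have \<rho>_L: "dvg (\<lambda>y. \<rho> t \<omega> y *\<^sub>R \<xi> r y) x =
      first_order (\<lambda>i y. zeta s kp r y $ i) (\<lambda>_ _ _. 0) (\<lambda>_::unit. \<rho> t \<omega>) () x"
    if "r \<in> noise_indices" "t \<in> {0..T}" "\<omega> \<in> space M" for r t \<omega> x
    using dvg_noise[OF kp that(1) ck_field_2_differentiable(1)[OF \<rho>_ck[OF that(3)] that(2)]] \<xi>[OF that(1)]
    by (simp add: fun_eq_iff)
  have \<mu>_L: "adT (\<xi> r) (\<mu> t \<omega>) x $ j = first_order (\<lambda>i y. zeta s kp r y $ i)
      (\<lambda>c d. pd c (\<lambda>y. zeta s kp r y $ d)) (\<lambda>d. \<mu>c d t \<omega>) j x"
    if "r \<in> noise_indices" for r t \<omega> x j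
    using adT_noise[OF kp that] \<xi>[OF that] by (simp add: \<mu>c_def)
  have \<rho>_time: "((\<lambda>\<tau>. \<rho>b \<tau> x) has_real_derivative
      density_drift \<nu> (\<mu>b t) (\<rho>b t) (\<rho>b t) x + \<nu> * lap (\<rho>b t) x) (at t within {0..T})"
    if t: "t \<in> {0..T}" for t x
  proof -
    have "((\<lambda>\<tau>. mean M \<rho> \<tau> x) has_real_derivative
      density_drift \<nu> (\<mu>b t) (\<rho>b t) (\<rho>b t) x + (- \<epsilon>)\<^sup>2 / 2 * noise_const TYPE('n) s * lap (mean M \<rho> t) x)
      (at t within {0..T})"
    proof (rule noise_mean_derivative[OF bs kp s t,
          where B="\<lambda>_ _ _ _. 0" and X="\<lambda>_. \<rho>" and c="()" and Eb="\<lambda>_ x t. density_drift \<nu> (\<mu>b t) (\<rho>b t) (\<rho>b t) x"])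
      show "ito_integrals_centred M F T noise_indices (\<lambda>r t \<omega>. first_order (\<lambda>i y. zeta s kp r y $ i) (\<lambda>_ _ _. 0) (\<lambda>_. \<rho> t \<omega>) () x) W"
        using ito_integrals_centred_cong[OF \<rho>_L \<rho>_ito] by simp
      show "expectation_commutes_series M F T noise_indices (\<lambda>r t \<omega>. first_order (\<lambda>i y. zeta s kp r y $ i) (\<lambda>_ _ _. 0) (\<lambda>_. \<rho> t \<omega>) () x) W"
        using expectation_commutes_series_cong[OF \<rho>_L \<rho>_sum] by simp
      show "stratonovich_equation M F T noise_indices W (\<lambda>t \<omega>. \<rho> t \<omega> x)
          (\<lambda>t \<omega>. density_drift \<nu> (\<mu>b t) (\<rho>b t) (\<rho> t \<omega>) x) (- \<epsilon>)
          (\<lambda>r t \<omega>. first_order (\<lambda>i y. zeta s kp r y $ i) (\<lambda>_ _ _. 0) (\<lambda>_. \<rho> t \<omega>) c x)" for x and c :: unit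
        using stratonovich_equation_cong[OF \<rho>_L \<rho>_eq] by simp
    qed (use \<rho>_reg \<rho>b_2 \<rho>_cov \<rho>_drift in \<open>auto simp: Ck_zero\<close>)
    then show ?thesis unfolding \<nu>' \<rho>b_def .
  qed
  have \<mu>_time: "((\<lambda>\<tau>. \<mu>b \<tau> x $ j) has_real_derivative
      momentum_drift \<kappa> \<nu> U (\<mu>b t) (\<rho>b t) (\<mu>b t) (\<rho>b t) x $ j + \<nu> * lap (\<lambda>y. \<mu>b t y $ j) x) (at t within {0..T})"
    if t: "t \<in> {0..T}" for t x j
  proof -
    have "((\<lambda>\<tau>. mean M (\<mu>c j) \<tau> x) has_real_derivative
      momentum_drift \<kappa> \<nu> U (\<mu>b t) (\<rho>b t) (\<mu>b t) (\<rho>b t) x $ j + (- \<epsilon>)\<^sup>2 / 2 * noise_const TYPE('n) s * lap (mean M (\<mu>c j) t) x)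
      (at t within {0..T})"
    proof (rule noise_mean_derivative[OF bs kp s t,
          where B="\<lambda>r c d. pd c (\<lambda>y. zeta s kp r y $ d)" and X="\<mu>c"
            and Eb="\<lambda>j x t. momentum_drift \<kappa> \<nu> U (\<mu>b t) (\<rho>b t) (\<mu>b t) (\<rho>b t) x $ j"])
      show "ito_integrals_centred M F T noise_indices (\<lambda>r t \<omega>. first_order (\<lambda>i y. zeta s kp r y $ i)
          (\<lambda>c d. pd c (\<lambda>y. zeta s kp r y $ d)) (\<lambda>d. \<mu>c d t \<omega>) j x) W"
        by (rule ito_integrals_centred_cong[OF \<mu>_L \<mu>_ito])
      show "expectation_commutes_series M F T noise_indices (\<lambda>r t \<omega>. first_order (\<lambda>i y. zeta s kp r y $ i)
          (\<lambda>c d. pd c (\<lambda>y. zeta s kp r y $ d)) (\<lambda>d. \<mu>c d t \<omega>) j x) W"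
        by (rule expectation_commutes_series_cong[OF \<mu>_L \<mu>_sum])
      show "stratonovich_equation M F T noise_indices W (\<lambda>t \<omega>. \<mu>c j t \<omega> x)
          (\<lambda>t \<omega>. momentum_drift \<kappa> \<nu> U (\<mu>b t) (\<rho>b t) (\<mu> t \<omega>) (\<rho> t \<omega>) x $ j) (- \<epsilon>)
          (\<lambda>r t \<omega>. first_order (\<lambda>i y. zeta s kp r y $ i)
          (\<lambda>c d. pd c (\<lambda>y. zeta s kp r y $ d)) (\<lambda>d. \<mu>c d t \<omega>) j x)" for x j
        using stratonovich_equation_cong[OF \<mu>_L \<mu>_eq] by (simp add: \<mu>c_def)
      show "covariation_commutes_pd M F T (\<mu>c j) (W r)" if "r \<in> noise_indices" for j r
        using \<mu>_cov[OF that] by (simp add: \<mu>c_def)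
      show "Ck 1 (pd c (\<lambda>y. zeta s kp r y $ d))" if "r \<in> noise_indices" for r c d by (rule zeta_identities(2)[OF kp that])
      show "(\<Sum>i\<in>UNIV. zeta s kp r x $ i * pd i (pd j (\<lambda>y. zeta s kp r y $ d)) x) = 0" if "r \<in> noise_indices" for r d
        by (rule zeta_identities(5)[OF kp that])
      show "(\<Sum>d\<in>UNIV. pd j (\<lambda>y. zeta s kp r y $ d) x * pd d (\<lambda>y. zeta s kp r y $ e) x) = 0" if "r \<in> noise_indices" for r e
        by (rule zeta_identities(6)[OF kp that])
      show "(\<lambda>r. (pd c (\<lambda>y. zeta s kp r y $ d) x)\<^sup>2) summable_on noise_indices" for c d x
        by (rule zeta_gradient_square_summable[OF kp s])
      show "((\<lambda>r. zeta s kp r x $ i * pd j (\<lambda>y. zeta s kp r y $ d) x) has_sum 0) noise_indices" for i d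
        by (rule zeta_cross_has_sum[OF kp s])
      show "mean_process T (\<lambda>t \<omega>. momentum_drift \<kappa> \<nu> U (\<mu>b t) (\<rho>b t) (\<mu> t \<omega>) (\<rho> t \<omega>) x $ j)
        (\<lambda>t. momentum_drift \<kappa> \<nu> U (\<mu>b t) (\<rho>b t) (\<mu>b t) (\<rho>b t) x $ j)" for j x by (rule \<mu>_drift)
    qed (rule \<mu>c_reg \<mu>c_mean)+
    then have "((\<lambda>\<tau>. mean M (\<mu>c j) \<tau> x) has_real_derivative
      momentum_drift \<kappa> \<nu> U (\<mu>b t) (\<rho>b t) (\<mu>b t) (\<rho>b t) x $ j + \<nu> * lap (\<lambda>y. \<mu>b t y $ j) x)
      (at t within {0..T})" unfolding \<nu>' mean_nth[OF t] .
    then show ?thesis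
      by (rule has_field_derivative_transform_within[where d=1]) (use t in \<open>auto simp: mean_nth\<close>)
  qed
  show ?thesis
    unfolding compressible_navier_stokes_def
  proof (intro ballI allI conjI)
    fix t x assume t: "t \<in> {0..T}"
    interpret flow_state "\<mu>b t" "\<rho>b t" U by (rule flow[OF t])
    show "((\<lambda>\<tau>. \<rho>b \<tau> x) has_real_derivative - dvg (\<lambda>y. \<rho>b t y *\<^sub>R velocity (\<mu>b t) (\<rho>b t) y) x) (at t within {0..T})"
      using \<rho>_time[OF t] unfolding continuity_identity .
    show "((\<lambda>\<tau>. velocity (\<mu>b \<tau>) (\<rho>b \<tau>) x) has_vector_derivative
      - nabla (velocity (\<mu>b t) (\<rho>b t)) (velocity (\<mu>b t) (\<rho>b t)) x - (1 / \<rho>b t x) *\<^sub>R grad (pressure U (\<rho>b t)) x +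
      (1 / \<rho>b t x) *\<^sub>R (dvg_tensor (stress \<nu> (\<rho>b t) (velocity (\<mu>b t) (\<rho>b t))) x + dvg_tensor (capillary \<kappa> (\<rho>b t)) x))
      (at t within {0..T})"
    proof (rule has_vector_derivative_vecI)
      fix j
      \<comment> \<open>The velocity is a quotient of means, so its time derivative needs both mean
        equations.\<close>
      note DERIV_divide[OF \<mu>_time[OF t, of x j] \<rho>_time[OF t, of x] nz]
      also have "((momentum_drift \<kappa> \<nu> U (\<mu>b t) (\<rho>b t) (\<mu>b t) (\<rho>b t) x $ j + \<nu> * lap (\<lambda>y. \<mu>b t y $ j) x) * \<rho>b t x -
        \<mu>b t x $ j * (density_drift \<nu> (\<mu>b t) (\<rho>b t) (\<rho>b t) x + \<nu> * lap (\<rho>b t) x)) / (\<rho>b t x * \<rho>b t x) =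
        (momentum_drift \<kappa> \<nu> U (\<mu>b t) (\<rho>b t) (\<mu>b t) (\<rho>b t) x $ j + \<nu> * lap (\<lambda>y. \<mu>b t y $ j) x) / \<rho>b t x
        - \<mu>b t x $ j * (density_drift \<nu> (\<mu>b t) (\<rho>b t) (\<rho>b t) x + \<nu> * lap (\<rho>b t) x) / (\<rho>b t x)\<^sup>2"
        by (simp add: diff_divide_distrib power2_eq_square)
      also note momentum_identity
      finally show "((\<lambda>\<tau>. velocity (\<mu>b \<tau>) (\<rho>b \<tau>) x $ j) has_real_derivative
        (- nabla (velocity (\<mu>b t) (\<rho>b t)) (velocity (\<mu>b t) (\<rho>b t)) x - (1 / \<rho>b t x) *\<^sub>R grad (pressure U (\<rho>b t)) x +
        (1 / \<rho>b t x) *\<^sub>R (dvg_tensor (stress \<nu> (\<rho>b t) (velocity (\<mu>b t) (\<rho>b t))) x + dvg_tensor (capillary \<kappa> (\<rho>b t)) x)) $ j)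
        (at t within {0..T})" by (simp only: velocity_def vector_scaleR_component real_scaleR_def times_divide_eq_left mult_1_left)
    qed
  qed
qed

end
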